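(* Let $p(h)=ah^\gamma$ with $a>0$ and $\gamma>1$, and let $(h_0,m_0)\in L^1(\mathbb T^d)\times L^1(\mathbb T^d;\mathbb R^d)$ satisfy $\mathcal E(h_0,m_0)<\infty$. Consider a tuple $(h,m,E)\in L^\infty(0,T;L^\gamma(\mathbb T^d))\times L^\infty(0,T;L^q(\mathbb T^d;\mathbb R^d))\times BV([0,T])$ with $q=2\gamma/(1+\gamma)$. Then $(h,m,E)$ is an energy-variational solution to the compressible Euler equations with initial data $(h_0,m_0)$ and with $\alpha=\gamma-1$ if and only if it is a dissipative weak solution with initial data $(h_0,m_0)$ and constant $c_{\mathfrak R}=\min\{\frac12,\frac1{d(\gamma-1)}\}$ (both notions as defined in the context).
   Context: $d\in\mathbb N$, $T\in(0,\infty)$, $\mathbb T^d=\mathbb R^d/\mathbb Z^d$ is the flat torus with Lebesgue measure. The compressible Euler equations (density $h\ge0$, momentum $m$) are $\partial_th+\operatorname{div}m=0$, $\partial_tm+\operatorname{div}\big(\frac{m\otimes m}{h}\big)+\nabla p(h)=0$ in $\mathbb T^d\times(0,T)$, $(h,m)(\cdot,0)=(h_0,m_0)$. With $P(h)=\frac{a}{\gamma-1}h^\gamma$, the entropy is $\eta(h,m)=\frac{|m|^2}{2h}+P(h)$ if $h>0$, $\eta(0,0)=0$, $\eta=\infty$ otherwise, and $\mathcal E(h,m)=\int_{\mathbb T^d}\eta(h(x),m(x))\,dx$. The term $\frac{m\otimes m}{h}$ is understood as $0$ where $h=0$. $A:B=\sum_{i,j}A_{ij}B_{ij}$, $(\nabla\varphi)_{ij}=\partial_{x_j}\varphi_i$,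 $I$ is the identity. $(A)_{\rm sym}=\frac12(A+A^T)$ and $(A)_{\rm sym,-}$ is the negative semi-definite part of $(A)_{\rm sym}$ in its spectral decomposition. $|A|_2$ is the spectral norm (square root of the largest eigenvalue of $A^TA$), $\|\Phi\|_{L^\infty(\mathbb T^d;\mathbb R^{d\times d})}=\operatorname{ess\,sup}_x|\Phi(x)|_2$. $BV([0,T])$ is the space of integrable functions of bounded variation on $[0,T]$; functions equal a.e. in time are identified, so they may be redefined on a null set of times. $\mathcal M(\mathbb T^d;\mathbb R^{d\times d}_{\rm sym,+})$ is the set of Radon measures $\mu$ with values in symmetric matrices such that $\xi\otimes\xi:\mu\ge0$ for all $\xi\in\mathbb R^d$; $L^\infty_{w^*}(0,T;X^* )$ is the space of weakly$^*$ measurable essentially bounded functions with values in the dual space $X^*$. Energy-variational solution (with parameter $\alpha>0$): a triple $(h,m,E)\in L^1_{\rm loc}(\mathbb T^d\times(0,T);[0,\infty))\times L^1_{\rm loc}(\mathbb T^d\times(0,T);\mathbb R^d)\times BV([0,T])$ with $\mathcal E(h(t),m(t))\le E(t)$ for a.e. $t\in(0,T)$ and $$\Big[E-\int_{\mathbb T^d}(h\rho+m\cdot\varphi)\,dx\Big]\Big|_s^t+\int_s^t\int_{\mathbb T^d}h\,\partial_t\rho+m\cdot\nabla\rho\,dx\,d\tau+\int_s^t\Big[\int_{\mathbb T^d}m\cdot\partial_t\varphi+\Big(\frac{m\otimes m}{h}+p(h)I\Big):\nabla\varphi\,dx+\mathcal K_\alpha(\varphi)[\mathcal E(h,m)-E]\Big]d\tau\le0$$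 for a.e. $s<t$ in $(0,T)$, including $s=0$ with $(h(0),m(0))=(h_0,m_0)$, and all $(\rho,\varphi)\in C^1(\mathbb T^d\times[0,T])\times C^1(\mathbb T^d\times[0,T];\mathbb R^d)$, where $\mathcal K_\alpha(\varphi)=\max\{2,\alpha d\}\,\|(\nabla\varphi)_{\rm sym,-}\|_{L^\infty(\mathbb T^d;\mathbb R^{d\times d})}$. $E(0)$ is understood as $E(0+)$. Dissipative weak solution (with constant $c_{\mathfrak R}\ge0$): a tuple $(h,m,E)\in L^\infty(0,T;L^\gamma(\mathbb T^d))\times L^\infty(0,T;L^q(\mathbb T^d;\mathbb R^d))\times BV([0,T])$ for which there is $\mathfrak R\in L^\infty_{w^*}(0,T;\mathcal M(\mathbb T^d;\mathbb R^{d\times d}_{\rm sym,+}))$ such that $$\int_{\mathbb T^d}h\rho\,dx\Big|_s^t=\int_s^t\int_{\mathbb T^d}h\,\partial_t\rho+m\cdot\nabla\rho\,dx\,d\tau,$$ $$\int_{\mathbb T^d}m\cdot\varphi\,dx\Big|_s^t=\int_s^t\int_{\mathbb T^d}m\cdot\partial_t\varphi+\frac{m\otimes m}{h}:(\nabla\varphi)_{\rm sym}+ah^\gamma\operatorname{div}\varphi\,dx\,d\tau+\int_s^t\int_{\mathbb T^d}\nabla\varphi:d\mathfrak R(\tau)\,d\tau$$ for all $\rho\in C^1(\mathbb T^d\times[0,T])$, $\varphi\in C^1(\mathbb T^d\times[0,T];\mathbb R^d)$ and a.a. $s,t\in(0,T)$, including $s=0$ with $(h(0),m(0))=(h_0,m_0)$;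 and $E$ is non-increasing, $E(0+)=\mathcal E(h_0,m_0)$, and $\mathcal E(h(t),m(t))+c_{\mathfrak R}\int_{\mathbb T^d}d\operatorname{tr}[\mathfrak R(t)]\le E(t)$ for a.a. $t\in(0,T)$.
   Formalization: The condition E(0+) = 𝓔(h_0,m_0) is added to "energy-variational solution"; without it the equivalence fails, e.g. h = h_0 = 1, m = m_0 = 0, E = P(1)+1 is energy-variational but not a dissipative weak solution. *)

theory Defs
  imports "HOL-Analysis.Analysis" "HOL-Probability.Essential_Supremum"
begin

section \<open>The flat torus\<close>

text \<open>
  Continuous functions on the torus are continuous functions on \<open>real ^ 'd\<close> with period 1 in each
  coordinate. Measurable functions and measures on the torus are given by their restriction to the
  half-open unit cell, which contains exactly one representative of each point; the quotient map is
  a measure-preserving Borel isomorphism from the cell to the torus. Values of \<open>h\<close>, \<open>m\<close> outside the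
  cell are therefore never used, and no periodicity is imposed on them.
\<close>

definition cell :: "(real ^ 'd) set" where
  "cell = {x. \<forall>i. 0 \<le> x $ i \<and> x $ i < 1}"

abbreviation torus :: "(real ^ 'd) measure" where
  "torus \<equiv> lebesgue_on cell"

definition periodic :: "(real ^ 'd \<Rightarrow> 'b) \<Rightarrow> bool" where
  "periodic f \<longleftrightarrow> (\<forall>x k. (\<forall>i. k $ i \<in> \<int>) \<longrightarrow> f (x + k) = f x)"

text \<open>
  \<open>C\<^sup>1\<close> on the product of the torus and the closed interval \<open>[0, T]\<close>: derivatives are one-sided in
  time at the endpoints and continuous up to them. Functions of space and time take the time
  argument first.
\<close>

definition C1_torus :: "real \<Rightarrow> (real \<Rightarrow> real ^ 'd \<Rightarrow> 'b::real_normed_vector) \<Rightarrow> bool" where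
  "C1_torus T f \<longleftrightarrow>
     (\<forall>t\<in>{0..T}. periodic (f t)) \<and>
     (\<exists>D :: real \<times> (real ^ 'd) \<Rightarrow> (real \<times> (real ^ 'd)) \<Rightarrow>\<^sub>L 'b.
        continuous_on ({0..T} \<times> UNIV) D \<and>
        (\<forall>z\<in>{0..T} \<times> UNIV.
           ((\<lambda>(t, x). f t x) has_derivative blinfun_apply (D z)) (at z within {0..T} \<times> UNIV)))"

definition dt :: "real \<Rightarrow> (real \<Rightarrow> real ^ 'd \<Rightarrow> 'b::real_normed_vector) \<Rightarrow> real \<Rightarrow> real ^ 'd \<Rightarrow> 'b" where
  "dt T f t x = vector_derivative (\<lambda>s. f s x) (at t within {0..T})"

definition grad :: "(real ^ 'd \<Rightarrow> real) \<Rightarrow> real ^ 'd \<Rightarrow> real ^ 'd" where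
  "grad f x = (\<chi> i. frechet_derivative f (at x) (axis i 1))"

text \<open>The matrix with entries \<open>\<partial>\<^sub>j f\<^sub>i\<close> in row \<open>i\<close> and column \<open>j\<close>.\<close>

definition nabla :: "(real ^ 'd \<Rightarrow> real ^ 'd) \<Rightarrow> real ^ 'd \<Rightarrow> real ^ 'd ^ 'd" where
  "nabla f x = jacobian f (at x)"

definition divergence :: "(real ^ 'd \<Rightarrow> real ^ 'd) \<Rightarrow> real ^ 'd \<Rightarrow> real" where
  "divergence f x = trace (nabla f x)"


section \<open>Matrices\<close>

text \<open>The product \<open>A : B\<close> is the library inner product on \<open>real ^ 'd ^ 'd\<close>.\<close>

definition outer :: "real ^ 'd \<Rightarrow> real ^ 'd \<Rightarrow> real ^ 'd ^ 'd" where
  "outer u v = (\<chi> i j. u $ i * v $ j)"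

definition sym_part :: "real ^ 'd ^ 'd \<Rightarrow> real ^ 'd ^ 'd" where
  "sym_part A = (1/2) *\<^sub>R (A + transpose A)"

definition diag :: "('d \<Rightarrow> real) \<Rightarrow> real ^ 'd ^ 'd" where
  "diag l = (\<chi> i j. if i = j then l i else 0)"

text \<open>
  Negative semi-definite part of a symmetric matrix: in a spectral decomposition every eigenvalue
  \<open>l i\<close> is replaced by \<open>min (l i) 0\<close>. The result does not depend on the chosen decomposition.
\<close>

definition neg_part :: "real ^ 'd ^ 'd \<Rightarrow> real ^ 'd ^ 'd" where
  "neg_part S = (THE N. \<exists>Q l. orthogonal_matrix Q \<and> S = Q ** diag l ** transpose Q \<and>
                              N = Q ** diag (\<lambda>i. min (l i) 0) ** transpose Q)"

definition spectral_norm :: "real ^ 'd ^ 'd \<Rightarrow> real" where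
  "spectral_norm A = sqrt (Max {l. \<exists>v. v \<noteq> 0 \<and> (transpose A ** A) *v v = l *\<^sub>R v})"

definition Linf_norm :: "(real ^ 'd \<Rightarrow> real ^ 'd ^ 'd) \<Rightarrow> real" where
  "Linf_norm F = real_of_ereal (esssup torus (\<lambda>x. ereal (spectral_norm (F x))))"


section \<open>Function spaces in time\<close>

definition Linf_Lp ::
    "real \<Rightarrow> real \<Rightarrow> (real \<Rightarrow> real ^ 'd \<Rightarrow> 'b::{real_normed_vector, second_countable_topology}) \<Rightarrow> bool" where
  "Linf_Lp T p f \<longleftrightarrow>
     (\<lambda>(t, x). f t x) \<in> borel_measurable (lebesgue_on ({0<..<T} \<times> cell)) \<and>
     (\<exists>C. AE t in lebesgue_on {0<..<T}.
        (\<integral>\<^sup>+ x. ennreal (norm (f t x) powr p) \<partial>torus) \<le> ennreal C)"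

definition L1_loc ::
    "real \<Rightarrow> (real \<Rightarrow> real ^ 'd \<Rightarrow> 'b::{banach, second_countable_topology}) \<Rightarrow> bool" where
  "L1_loc T f \<longleftrightarrow>
     (\<forall>s t. 0 < s \<and> s < t \<and> t < T \<longrightarrow>
        integrable (lebesgue_on ({s..t} \<times> cell)) (\<lambda>(t, x). f t x))"

definition bounded_variation_on :: "real \<Rightarrow> (real \<Rightarrow> real) \<Rightarrow> bool" where
  "bounded_variation_on T F \<longleftrightarrow>
     (\<exists>V. \<forall>n. \<forall>p :: nat \<Rightarrow> real.
        (\<forall>i\<le>n. p i \<in> {0..T}) \<and> (\<forall>i<n. p i \<le> p (Suc i)) \<longrightarrow>
        (\<Sum>i<n. \<bar>F (p (Suc i)) - F (p i)\<bar>) \<le> V)"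

text \<open>
  Elements of \<open>BV([0, T])\<close> are identified when they agree almost everywhere, so the following
  three notions only require a suitable representative.
\<close>

definition BV :: "real \<Rightarrow> (real \<Rightarrow> real) \<Rightarrow> bool" where
  "BV T E \<longleftrightarrow> (\<exists>F. bounded_variation_on T F \<and> (AE t in lebesgue_on {0<..<T}. E t = F t))"

definition nonincreasing :: "real \<Rightarrow> (real \<Rightarrow> real) \<Rightarrow> bool" where
  "nonincreasing T E \<longleftrightarrow>
     (\<exists>F. antimono_on {0<..<T} F \<and> (AE t in lebesgue_on {0<..<T}. E t = F t))"

text \<open>The right limit \<open>E(0+)\<close>; it exists and is unique for \<open>E\<close> in \<open>BV([0, T])\<close>.\<close>

definition initial_value :: "real \<Rightarrow> (real \<Rightarrow> real) \<Rightarrow> real" where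
  "initial_value T E =
     (THE l. \<exists>F. (F \<longlongrightarrow> l) (at_right 0) \<and> (AE t in lebesgue_on {0<..<T}. E t = F t))"


section \<open>Matrix-valued measures\<close>

text \<open>
  Countably additive set functions on the Borel sets of the torus with values in the symmetric
  positive semi-definite matrices. As the torus is a compact metric space, such finite Borel
  measures are automatically Radon.
\<close>

definition psd_measure :: "((real ^ 'd) set \<Rightarrow> real ^ 'd ^ 'd) \<Rightarrow> bool" where
  "psd_measure \<mu> \<longleftrightarrow>
     (\<forall>A\<in>sets (restrict_space borel cell).
        transpose (\<mu> A) = \<mu> A \<and> (\<forall>\<xi>. 0 \<le> outer \<xi> \<xi> \<bullet> \<mu> A)) \<and>
     (\<forall>A :: nat \<Rightarrow> (real ^ 'd) set.
        range A \<subseteq> sets (restrict_space borel cell) \<and> disjoint_family A \<longrightarrow>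
        (\<lambda>n. \<mu> (A n)) sums \<mu> (\<Union>n. A n))"

definition quad_measure :: "((real ^ 'd) set \<Rightarrow> real ^ 'd ^ 'd) \<Rightarrow> real ^ 'd \<Rightarrow> (real ^ 'd) measure" where
  "quad_measure \<mu> \<xi> =
     measure_of cell (sets (restrict_space borel cell)) (\<lambda>A. ennreal (outer \<xi> \<xi> \<bullet> \<mu> A))"

text \<open>
  Integration against the signed measure \<open>\<lambda>A. \<mu> A $ i $ j\<close>, which by symmetry of \<open>\<mu>\<close> and polarization
  is a combination of the finite positive measures \<open>quad_measure \<mu> \<xi>\<close>, with
  \<open>\<xi> = e\<^sub>i + e\<^sub>j, e\<^sub>i, e\<^sub>j\<close>.
\<close>

definition entry_integral ::
    "((real ^ 'd) set \<Rightarrow> real ^ 'd ^ 'd) \<Rightarrow> 'd \<Rightarrow> 'd \<Rightarrow> (real ^ 'd \<Rightarrow> real) \<Rightarrow> real" where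
  "entry_integral \<mu> i j f =
     (1/2) * ((\<integral>x. f x \<partial>quad_measure \<mu> (axis i 1 + axis j 1))
              - (\<integral>x. f x \<partial>quad_measure \<mu> (axis i 1))
              - (\<integral>x. f x \<partial>quad_measure \<mu> (axis j 1)))"

definition matrix_integral ::
    "((real ^ 'd) set \<Rightarrow> real ^ 'd ^ 'd) \<Rightarrow> (real ^ 'd \<Rightarrow> real ^ 'd ^ 'd) \<Rightarrow> real" where
  "matrix_integral \<mu> F = (\<Sum>i\<in>UNIV. \<Sum>j\<in>UNIV. entry_integral \<mu> i j (\<lambda>x. F x $ i $ j))"

definition C_sym :: "(real ^ 'd \<Rightarrow> real ^ 'd ^ 'd) \<Rightarrow> bool" where
  "C_sym F \<longleftrightarrow> continuous_on UNIV F \<and> periodic F \<and> (\<forall>x. transpose (F x) = F x)"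

text \<open>
  Essential boundedness refers to the norm dual to the supremum norm on the continuous
  symmetric-matrix-valued functions.
\<close>

definition Linf_weakstar_psd :: "real \<Rightarrow> (real \<Rightarrow> (real ^ 'd) set \<Rightarrow> real ^ 'd ^ 'd) \<Rightarrow> bool" where
  "Linf_weakstar_psd T R \<longleftrightarrow>
     (\<forall>t\<in>{0<..<T}. psd_measure (R t)) \<and>
     (\<forall>F. C_sym F \<longrightarrow> (\<lambda>t. matrix_integral (R t) F) \<in> borel_measurable (lebesgue_on {0<..<T})) \<and>
     (\<exists>C. AE t in lebesgue_on {0<..<T}. \<forall>F. C_sym F \<and> (\<forall>x. spectral_norm (F x) \<le> 1) \<longrightarrow>
        \<bar>matrix_integral (R t) F\<bar> \<le> C)"


section \<open>Compressible Euler equations\<close>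

definition pressure :: "real \<Rightarrow> real \<Rightarrow> real \<Rightarrow> real" where
  "pressure a \<gamma> h = a * h powr \<gamma>"

definition eta :: "real \<Rightarrow> real \<Rightarrow> real \<Rightarrow> real ^ 'd \<Rightarrow> ereal" where
  "eta a \<gamma> h m =
     (if h > 0 then ereal ((norm m)\<^sup>2 / (2 * h) + a / (\<gamma> - 1) * h powr \<gamma>)
      else if h = 0 \<and> m = 0 then 0
      else \<infinity>)"

text \<open>For \<open>a > 0\<close> and \<open>\<gamma> > 1\<close> the integrand is nonnegative, so \<open>e2ennreal\<close> loses nothing.\<close>

definition energy :: "real \<Rightarrow> real \<Rightarrow> (real ^ 'd \<Rightarrow> real) \<Rightarrow> (real ^ 'd \<Rightarrow> real ^ 'd) \<Rightarrow> ereal" where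
  "energy a \<gamma> h m = enn2ereal (\<integral>\<^sup>+ x. e2ennreal (eta a \<gamma> (h x) (m x)) \<partial>torus)"

text \<open>Division by zero is zero, in accordance with the convention for vanishing density.\<close>

definition convective :: "real \<Rightarrow> real ^ 'd \<Rightarrow> real ^ 'd ^ 'd" where
  "convective h m = (1 / h) *\<^sub>R outer m m"

definition K_weight :: "real \<Rightarrow> (real ^ 'd \<Rightarrow> real ^ 'd) \<Rightarrow> real" where
  "K_weight \<alpha> \<phi> =
     max 2 (\<alpha> * real CARD('d)) * Linf_norm (\<lambda>x. neg_part (sym_part (nabla \<phi> x)))"

text \<open>
  The left-hand side of the energy-variational inequality between the times \<open>s\<close> and \<open>t\<close>. The values
  \<open>es\<close>, \<open>hs\<close>, \<open>ms\<close> of the solution at time \<open>s\<close> are separate arguments, since at \<open>s = 0\<close> they are the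
  right limit of the energy and the initial data.
\<close>

definition ev_lhs ::
    "real \<Rightarrow> real \<Rightarrow> real \<Rightarrow> real \<Rightarrow>
     (real \<Rightarrow> real ^ 'd \<Rightarrow> real) \<Rightarrow> (real \<Rightarrow> real ^ 'd \<Rightarrow> real ^ 'd) \<Rightarrow> (real \<Rightarrow> real) \<Rightarrow>
     real \<Rightarrow> (real ^ 'd \<Rightarrow> real) \<Rightarrow> (real ^ 'd \<Rightarrow> real ^ 'd) \<Rightarrow> real \<Rightarrow> real \<Rightarrow>
     (real \<Rightarrow> real ^ 'd \<Rightarrow> real) \<Rightarrow> (real \<Rightarrow> real ^ 'd \<Rightarrow> real ^ 'd) \<Rightarrow> real" where
  "ev_lhs a \<gamma> \<alpha> T h m E es hs ms s t \<rho> \<phi> =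
     (E t - (\<integral>x. h t x * \<rho> t x + m t x \<bullet> \<phi> t x \<partial>torus))
     - (es - (\<integral>x. hs x * \<rho> s x + ms x \<bullet> \<phi> s x \<partial>torus))
     + (LINT \<tau>=s..t|lebesgue. \<integral>x. h \<tau> x * dt T \<rho> \<tau> x + m \<tau> x \<bullet> grad (\<rho> \<tau>) x \<partial>torus)
     + (LINT \<tau>=s..t|lebesgue.
          ((\<integral>x. m \<tau> x \<bullet> dt T \<phi> \<tau> x
               + (convective (h \<tau> x) (m \<tau> x) + pressure a \<gamma> (h \<tau> x) *\<^sub>R mat 1) \<bullet> nabla (\<phi> \<tau>) x
             \<partial>torus)
          + K_weight \<alpha> (\<phi> \<tau>) * (real_of_ereal (energy a \<gamma> (h \<tau>) (m \<tau>)) - E \<tau>)))"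

text \<open>
  This does not prescribe \<open>initial_value T E\<close>: adding a positive constant to \<open>E\<close> preserves all
  conditions below. In contrast, a dissipative weak solution has the initial energy
  \<open>energy a \<gamma> h0 m0\<close>.
\<close>

definition energy_variational_solution ::
    "real \<Rightarrow> real \<Rightarrow> real \<Rightarrow> real \<Rightarrow> (real ^ 'd \<Rightarrow> real) \<Rightarrow> (real ^ 'd \<Rightarrow> real ^ 'd) \<Rightarrow>
     (real \<Rightarrow> real ^ 'd \<Rightarrow> real) \<Rightarrow> (real \<Rightarrow> real ^ 'd \<Rightarrow> real ^ 'd) \<Rightarrow> (real \<Rightarrow> real) \<Rightarrow> bool" where
  "energy_variational_solution a \<gamma> \<alpha> T h0 m0 h m E \<longleftrightarrow>
     L1_loc T h \<and> (AE z in lebesgue_on ({0<..<T} \<times> cell). 0 \<le> h (fst z) (snd z)) \<and>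
     L1_loc T m \<and> BV T E \<and>
     (AE t in lebesgue_on {0<..<T}. energy a \<gamma> (h t) (m t) \<le> ereal (E t)) \<and>
     (AE s in lebesgue_on {0<..<T}. AE t in lebesgue_on {s<..<T}.
        \<forall>\<rho> \<phi>. C1_torus T \<rho> \<and> C1_torus T \<phi> \<longrightarrow>
          ev_lhs a \<gamma> \<alpha> T h m E (E s) (h s) (m s) s t \<rho> \<phi> \<le> 0) \<and>
     (AE t in lebesgue_on {0<..<T}.
        \<forall>\<rho> \<phi>. C1_torus T \<rho> \<and> C1_torus T \<phi> \<longrightarrow>
          ev_lhs a \<gamma> \<alpha> T h m E (initial_value T E) h0 m0 0 t \<rho> \<phi> \<le> 0)"

definition mass_balance ::
    "real \<Rightarrow> (real \<Rightarrow> real ^ 'd \<Rightarrow> real) \<Rightarrow> (real \<Rightarrow> real ^ 'd \<Rightarrow> real ^ 'd) \<Rightarrow>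
     (real ^ 'd \<Rightarrow> real) \<Rightarrow> real \<Rightarrow> real \<Rightarrow> (real \<Rightarrow> real ^ 'd \<Rightarrow> real) \<Rightarrow> bool" where
  "mass_balance T h m hs s t \<rho> \<longleftrightarrow>
     (\<integral>x. h t x * \<rho> t x \<partial>torus) - (\<integral>x. hs x * \<rho> s x \<partial>torus) =
     (LINT \<tau>=s..t|lebesgue. \<integral>x. h \<tau> x * dt T \<rho> \<tau> x + m \<tau> x \<bullet> grad (\<rho> \<tau>) x \<partial>torus)"

definition momentum_balance ::
    "real \<Rightarrow> real \<Rightarrow> real \<Rightarrow> (real \<Rightarrow> real ^ 'd \<Rightarrow> real) \<Rightarrow> (real \<Rightarrow> real ^ 'd \<Rightarrow> real ^ 'd) \<Rightarrow>
     (real \<Rightarrow> (real ^ 'd) set \<Rightarrow> real ^ 'd ^ 'd) \<Rightarrow>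
     (real ^ 'd \<Rightarrow> real ^ 'd) \<Rightarrow> real \<Rightarrow> real \<Rightarrow> (real \<Rightarrow> real ^ 'd \<Rightarrow> real ^ 'd) \<Rightarrow> bool" where
  "momentum_balance a \<gamma> T h m R ms s t \<phi> \<longleftrightarrow>
     (\<integral>x. m t x \<bullet> \<phi> t x \<partial>torus) - (\<integral>x. ms x \<bullet> \<phi> s x \<partial>torus) =
     (LINT \<tau>=s..t|lebesgue.
        \<integral>x. m \<tau> x \<bullet> dt T \<phi> \<tau> x + convective (h \<tau> x) (m \<tau> x) \<bullet> sym_part (nabla (\<phi> \<tau>) x)
            + pressure a \<gamma> (h \<tau> x) * divergence (\<phi> \<tau>) x \<partial>torus)
     + (LINT \<tau>=s..t|lebesgue. matrix_integral (R \<tau>) (nabla (\<phi> \<tau>)))"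

definition dissipative_weak_solution ::
    "real \<Rightarrow> real \<Rightarrow> real \<Rightarrow> real \<Rightarrow> (real ^ 'd \<Rightarrow> real) \<Rightarrow> (real ^ 'd \<Rightarrow> real ^ 'd) \<Rightarrow>
     (real \<Rightarrow> real ^ 'd \<Rightarrow> real) \<Rightarrow> (real \<Rightarrow> real ^ 'd \<Rightarrow> real ^ 'd) \<Rightarrow> (real \<Rightarrow> real) \<Rightarrow> bool" where
  "dissipative_weak_solution a \<gamma> c T h0 m0 h m E \<longleftrightarrow>
     Linf_Lp T \<gamma> h \<and> Linf_Lp T (2 * \<gamma> / (1 + \<gamma>)) m \<and> BV T E \<and>
     (\<exists>R. Linf_weakstar_psd T R \<and>
        (\<forall>\<rho>. C1_torus T \<rho> \<longrightarrow>
           (AE s in lebesgue_on {0<..<T}. AE t in lebesgue_on {0<..<T}.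
              mass_balance T h m (h s) s t \<rho>) \<and>
           (AE t in lebesgue_on {0<..<T}. mass_balance T h m h0 0 t \<rho>)) \<and>
        (\<forall>\<phi>. C1_torus T \<phi> \<longrightarrow>
           (AE s in lebesgue_on {0<..<T}. AE t in lebesgue_on {0<..<T}.
              momentum_balance a \<gamma> T h m R (m s) s t \<phi>) \<and>
           (AE t in lebesgue_on {0<..<T}. momentum_balance a \<gamma> T h m R m0 0 t \<phi>)) \<and>
        nonincreasing T E \<and>
        ereal (initial_value T E) = energy a \<gamma> h0 m0 \<and>
        (AE t in lebesgue_on {0<..<T}.
           energy a \<gamma> (h t) (m t) + ereal (c * trace (R t cell)) \<le> ereal (E t)))"

end

theory Submission
  imports Defs "HOL-Probability.Probability_Measure"
begin

text \<open>
  Write \<open>N(A)\<close> for the norm of the negative part of the symmetric part of \<open>A\<close>, so that \<open>N(A) \<le> r\<close> iff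
  \<open>v \<bullet> A v \<ge> - r |v|\<^sup>2\<close> for all \<open>v\<close>, and let \<open>\<kappa> = max 2 ((\<gamma> - 1) d) = 1 / c\<close>.

  For a positive semi-definite measure \<open>R\<close> one has \<open>\<integral> F : dR \<ge> - sup N(F) tr R\<close>. With
  \<open>tr R \<le> \<kappa> (E - \<E>)\<close> and the monotonicity of \<open>E\<close>, the balances of a dissipative solution sum up to the
  energy-variational inequality; a countable dense set of tests makes the null sets of times independent
  of the test.

  Conversely, the variational inequality is affine in \<open>\<rho>\<close> and positively homogeneous up to affine terms in
  \<open>\<phi>\<close>. Scaling gives the mass balance, the monotonicity of \<open>E\<close>, and for the momentum residual \<open>L\<close>
  the bound \<open>L(t, \<phi>) - L(s, \<phi>) \<ge> - \<kappa> \<integral>\<^sub>s\<^sup>t sup N(\<nabla>\<phi>) (E - \<E>) d\<tau>\<close>. Hence \<open>L(., \<phi>)\<close> is Lipschitz with a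
  density \<open>g(\<tau>, \<phi>)\<close>, and at almost every \<open>\<tau>\<close> the functional \<open>\<nabla>\<phi> \<mapsto> - g(\<tau>, \<phi>)\<close> is dominated by
  \<open>w sup N\<close>, where \<open>w = \<kappa> (E - \<E>)\<close>. A Hahn-Banach extension that is measurable in \<open>\<tau>\<close> defines the
  functional also on matrix-valued step functions on dyadic cells. Its values there form a finitely additive
  positive semi-definite content of trace at most \<open>w\<close>, which extends to the measure \<open>R(\<tau>)\<close> representing
  \<open>g(\<tau>, .)\<close>.
\<close>

section \<open>Negative parts of matrices\<close>

text \<open>The number \<open>\<kappa>\<close> compares the trace of the momentum flux with the
  entropy: \<open>|m|^2 / h + d a h^\<gamma>\<close> is twice the kinetic part plus
  \<open>(\<gamma> - 1) d\<close> times the internal part.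

  Two obstacles to measurability shape the harder direction. The domination of
  \<open>g(\<tau>, .)\<close> holds outside a null set that depends on the test, so it is used only
  for the countably many rational combinations of a dense sequence of tests. And a Hahn-Banach
  extension chosen separately at each time would give no measurable \<open>R\<close>; the functional
  is therefore extended generator by generator on coefficient sequences, each new value being an
  infimum of countably many measurable functions. The matrix units on dyadic cells are generators
  too, so that the measure can be read off from values of the extension, all measurable in time.

  Half-open cells are not compact, and a content on them may fail to be countably additive, since
  mass can sit on a missing upper face. The content is therefore extended on the space of nested
  sequences of cells and carried to the torus by taking limits.\<close>

lemma quadratic_nonneg_imp_linear_zero:
  fixes a c :: real
  assumes "\<And>t. 0 \<le> a * t + c * t\<^sup>2"
  shows "a = 0"
proof (rule ccontr)
  assume "a \<noteq> 0"
  \<comment> \<open>Any positive \<open>k\<close> above \<open>c\<close> works: at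
    \<open>- a / k\<close> the polynomial equals \<open>(a / k)^2 * (c - k)\<close>, which is
    negative.\<close>
  define k where "k = 1 + \<bar>c\<bar>"
  have k: "k > 0" "c < k" by (auto simp: k_def)
  have "a * (- a / k) + c * (- a / k)\<^sup>2 = (a\<^sup>2 / k\<^sup>2) * (c - k)"
    using k by (simp add: field_simps power2_eq_square)
  moreover have "\<dots> < 0"
    using k \<open>a \<noteq> 0\<close> by (intro mult_pos_neg) auto
  ultimately show False using assms[of "- a / k"] by linarith
qed

section \<open>Spectral theorem for real symmetric matrices\<close>

lemma symmetric_matrix_inner:
  fixes A :: "real ^ 'd ^ 'd"
  assumes "transpose A = A"
  shows "u \<bullet> (A *v v) = v \<bullet> (A *v u)"
  by (metis assms dot_lmul_matrix inner_commute transpose_matrix_vector)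

text \<open>Rayleigh's principle: a maximiser \<open>b\<close> of the quadratic form on the unit
  sphere of an invariant subspace is an eigenvector, since the first variation at \<open>b\<close>
  vanishes in every direction of \<open>S\<close>.\<close>

lemma symmetric_matrix_eigenvector:
  fixes A :: "real ^ 'd ^ 'd"
  assumes A: "transpose A = A" and S: "subspace S" "\<And>v. v \<in> S \<Longrightarrow> A *v v \<in> S" and d: "dim S > 0"
  obtains b c where "b \<in> S" "norm b = 1" "A *v b = c *\<^sub>R b"
proof -
  let ?g = "\<lambda>v. v \<bullet> (A *v v)"
  obtain x where x: "x \<in> S" "x \<noteq> 0"
    using d dim_eq_0[of S] by (metis less_irrefl singletonI subsetI)
  have ne: "S \<inter> sphere 0 1 \<noteq> {}"
  proof -
    have "(1 / norm x) *\<^sub>R x \<in> S \<inter> sphere 0 1"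
      using x S(1) by (auto simp: subspace_scale)
    then show ?thesis by blast
  qed
  have "compact (S \<inter> sphere 0 1)"
    using closed_subspace[OF S(1)] by (simp add: closed_Int_compact)
  moreover have "continuous_on (S \<inter> sphere 0 1) ?g"
    by (intro continuous_intros linear_continuous_on)
       (simp add: linear_linear matrix_vector_mul_linear)
  ultimately obtain b where b: "b \<in> S \<inter> sphere 0 1" "\<And>y. y \<in> S \<inter> sphere 0 1 \<Longrightarrow> ?g y \<le> ?g b"
    using continuous_attains_sup[OF _ ne] by blast
  define c where "c = ?g b"
  have bb: "b \<bullet> b = 1" using b(1) by (simp add: norm_eq_1)
  have ge: "?g v \<le> c * (v \<bullet> v)" if "v \<in> S" for v
  proof (cases "v = 0")
    case False
    have "(1 / norm v) *\<^sub>R v \<in> S \<inter> sphere 0 1"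
      using that False S(1) by (auto simp: subspace_scale)
    from b(2)[OF this] have "?g v / (norm v)\<^sup>2 \<le> c"
      by (simp add: c_def matrix_vector_mult_scaleR power2_eq_square)
    then show ?thesis using False by (simp add: field_simps power2_norm_eq_inner)
  qed simp
  have "A *v b = c *\<^sub>R b"
  proof -
    \<comment> \<open>The residual is itself an admissible direction because \<open>S\<close> is
      invariant; stationarity in this direction says \<open>u \<bullet> u = 0\<close>.\<close>
    define u where "u = c *\<^sub>R b - A *v b"
    have u: "u \<in> S" using b(1) S by (auto simp: u_def subspace_scale subspace_diff)
    have "2 * (c * (b \<bullet> u) - u \<bullet> (A *v b)) = 0"
    proof (rule quadratic_nonneg_imp_linear_zero[where c = "c * (u \<bullet> u) - ?g u"])
      fix t :: real
      have "b + t *\<^sub>R u \<in> S" using b(1) u S(1) by (auto simp: subspace_add subspace_scale)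
      from ge[OF this] show "0 \<le> 2 * (c * (b \<bullet> u) - u \<bullet> (A *v b)) * t + (c * (u \<bullet> u) - ?g u) * t\<^sup>2"
        using bb symmetric_matrix_inner[OF A, of b u]
        by (simp add: inner_simps matrix_vector_right_distrib matrix_vector_mult_scaleR c_def
              algebra_simps power2_eq_square inner_commute[of u b])
    qed
    then have "u \<bullet> (c *\<^sub>R b) - u \<bullet> (A *v b) = 0" by (simp add: inner_commute)
    then have "u \<bullet> u = 0" unfolding inner_diff_right[symmetric] u_def[symmetric] .
    then show ?thesis by (simp add: u_def)
  qed
  then show ?thesis using b(1) that by auto
qed

text \<open>Induction on the dimension: by symmetry the orthogonal complement of an eigenvector
  inside \<open>S\<close> is again invariant, so the induction hypothesis applies to it.\<close>

lemma symmetric_matrix_orthonormal_eigenvectors: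
  fixes A :: "real ^ 'd ^ 'd"
  assumes A: "transpose A = A"
  shows "subspace S \<Longrightarrow> (\<And>v. v \<in> S \<Longrightarrow> A *v v \<in> S) \<Longrightarrow>
    \<exists>B \<subseteq> S. finite B \<and> card B = dim S \<and> pairwise orthogonal B \<and>
      (\<forall>b\<in>B. norm b = 1 \<and> (\<exists>c. A *v b = c *\<^sub>R b))"
proof (induction "dim S" arbitrary: S)
  case 0
  then show ?case by (intro exI[of _ "{}"]) auto
next
  case (Suc n)
  obtain b c where b: "b \<in> S" "norm b = 1" "A *v b = c *\<^sub>R b"
    using symmetric_matrix_eigenvector[OF A Suc.prems] Suc.hyps(2) by auto
  have b0: "b \<noteq> 0" using b(2) by auto
  let ?S = "{y \<in> S. \<forall>x\<in>span {b}. orthogonal x y}"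
  have eq: "?S = {y \<in> S. b \<bullet> y = 0}"
    by (auto simp: span_singleton orthogonal_def)
  have "span {b} \<subseteq> S" using b Suc.prems(1) by (simp add: span_minimal)
  then have dim: "dim ?S + dim (span {b}) = dim S"
    using Suc.prems(1) by (intro dim_subspace_orthogonal_to_vectors) auto
  moreover have "dim (span {b}) = 1" using b0 by (simp add: dim_eq_card_independent)
  ultimately have n: "n = dim ?S" using Suc.hyps(2) by simp
  have sub: "subspace ?S"
    unfolding eq using Suc.prems(1) by (auto simp: subspace_def inner_simps)
  have inv: "A *v v \<in> ?S" if "v \<in> ?S" for v
    using that Suc.prems(2) symmetric_matrix_inner[OF A, of b v] b(3)
    unfolding eq by (auto simp: inner_commute)
  obtain B where B: "B \<subseteq> ?S" "finite B" "card B = dim ?S" "pairwise orthogonal B"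
      "\<forall>b\<in>B. norm b = 1 \<and> (\<exists>c. A *v b = c *\<^sub>R b)"
    using Suc.hyps(1)[OF n sub inv] by blast
  have "b \<notin> B" using B(1) b(2) unfolding eq by (auto simp: norm_eq_1)
  moreover have "pairwise orthogonal (insert b B)"
    using B(1,4) unfolding eq pairwise_insert by (auto simp: orthogonal_def inner_commute)
  ultimately show ?case
    using B b n Suc.hyps(2) unfolding eq by (intro exI[of _ "insert b B"]) auto
qed

lemma diag_mult_vec: "(diag l *v v) $ i = l i * v $ i"
  by (simp add: diag_def matrix_vector_mult_def if_distrib[of "\<lambda>x. x * _"] cong: if_cong)

lemma transpose_diag: "transpose (diag l) = diag l"
  by (auto simp: diag_def transpose_def vec_eq_iff)

theorem spectral_decomposition:
  fixes A :: "real ^ 'd ^ 'd"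
  assumes A: "transpose A = A"
  obtains Q l where "orthogonal_matrix Q" "A = Q ** diag l ** transpose Q"
proof -
  obtain B where B: "finite B" "card B = CARD('d)" "pairwise orthogonal B"
      "\<forall>b\<in>B. norm b = 1 \<and> (\<exists>c. A *v b = c *\<^sub>R b)"
    using symmetric_matrix_orthonormal_eigenvectors[OF A, of UNIV] by auto
  obtain q where q: "bij_betw q (UNIV :: 'd set) B"
    using B(1,2) finite_same_card_bij by (metis finite)
  have qB: "q i \<in> B" for i using q by (auto simp: bij_betw_def)
  have qi: "q i = q j \<longleftrightarrow> i = j" for i j using q by (auto simp: bij_betw_def inj_on_def)
  define l where "l = (\<lambda>i. SOME c. A *v q i = c *\<^sub>R q i)"
  have l: "A *v q i = l i *\<^sub>R q i" for i
    unfolding l_def by (rule someI_ex) (use B(4) qB in blast)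
  define Q :: "real ^ 'd ^ 'd" where "Q = (\<chi> i j. q j $ i)"
  have col: "column j Q = q j" for j by (simp add: Q_def column_def vec_eq_iff)
  have orth: "orthogonal_matrix Q"
    unfolding orthogonal_matrix_orthonormal_columns col
    using B(3,4) qB qi by (auto simp: pairwise_def)
  have "A ** Q = Q ** diag l"
  proof -
    have "(A ** Q) $ i $ j = (A *v q j) $ i" for i j
      by (simp add: matrix_matrix_mult_def matrix_vector_mult_def Q_def)
    moreover have "(Q ** diag l) $ i $ j = l j * q j $ i" for i j
      by (simp add: matrix_matrix_mult_def diag_def Q_def if_distrib cong: if_cong)
    ultimately show ?thesis by (simp add: vec_eq_iff l)
  qed
  then have "A = Q ** diag l ** transpose Q"
    using orth by (metis matrix_mul_assoc matrix_mul_rid orthogonal_matrix_def)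
  then show ?thesis using that orth by blast
qed

lemma conjugate_diag_mult_vec:
  "u \<bullet> ((Q ** diag l ** transpose Q) *v v) = (\<Sum>k\<in>UNIV. l k * (column k Q \<bullet> u) * (column k Q \<bullet> v))"
proof -
  have c: "(transpose Q *v w) $ k = column k Q \<bullet> w" for w k
    by (simp add: matrix_vector_mult_def transpose_def column_def inner_vec_def)
  have "u \<bullet> ((Q ** diag l ** transpose Q) *v v) = (transpose Q *v u) \<bullet> (diag l *v (transpose Q *v v))"
    by (metis dot_lmul_matrix matrix_vector_mul_assoc transpose_matrix_vector)
  also have "\<dots> = (\<Sum>k\<in>UNIV. l k * (column k Q \<bullet> u) * (column k Q \<bullet> v))"
    by (simp add: inner_vec_def diag_mult_vec c[unfolded inner_vec_def] mult_ac
        del: transpose_matrix_vector)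
  finally show ?thesis .
qed

lemma orthogonal_matrix_parseval:
  fixes Q :: "real ^ 'd ^ 'd"
  assumes "orthogonal_matrix Q"
  shows "v \<bullet> v = (\<Sum>k\<in>UNIV. (column k Q \<bullet> v)\<^sup>2)"
proof -
  have "diag (\<lambda>_. 1) = (mat 1 :: real ^ 'd ^ 'd)" by (simp add: diag_def mat_def)
  then have "Q ** diag (\<lambda>_. 1) ** transpose Q = mat 1"
    using assms by (simp add: orthogonal_matrix_def)
  then show ?thesis
    using conjugate_diag_mult_vec[of v Q "\<lambda>_. 1" v] by (simp add: power2_eq_square)
qed

lemma orthogonal_matrix_column_inner:
  fixes Q :: "real ^ 'd ^ 'd"
  assumes "orthogonal_matrix Q"
  shows "column i Q \<bullet> column j Q = (if i = j then 1 else (0::real))"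
proof -
  have "(transpose Q ** Q) $ i $ j = mat 1 $ i $ j"
    using assms by (simp add: orthogonal_matrix_def)
  then show ?thesis
    by (auto simp: matrix_matrix_mult_def transpose_def column_def inner_vec_def mat_def
        inner_real_def split: if_splits)
qed

lemma outer_inner: "outer u v \<bullet> A = u \<bullet> (A *v v)"
  by (simp add: outer_def inner_vec_def matrix_vector_mult_def sum_distrib_left mult_ac)

lemma inner_outer: "A \<bullet> outer u v = u \<bullet> (A *v v)"
  by (metis inner_commute outer_inner)

lemma conjugate_diag_eq_sum:
  "Q ** diag l ** transpose Q = (\<Sum>k\<in>UNIV. l k *\<^sub>R outer (column k Q) (column k Q))"
  by (simp add: vec_eq_iff matrix_matrix_mult_def diag_def transpose_def outer_def column_def
        if_distrib sum_component cong: if_cong) (simp add: mult_ac)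

lemma trace_outer: "trace (outer u v) = u \<bullet> v"
  by (simp add: trace_def outer_def inner_vec_def)

lemma trace_sum: "trace (\<Sum>k\<in>K. f k) = (\<Sum>k\<in>K. trace (f k))"
  by (simp add: trace_def sum_component) (rule sum.swap)

lemma trace_scaleR: "trace (c *\<^sub>R A) = c * trace (A :: real ^ 'd ^ 'd)"
  by (simp add: trace_def sum_distrib_left)

text \<open>In an eigenbasis \<open>R\<close> is a nonnegative combination of the projections onto
  the columns of \<open>Q\<close>, so \<open>F : R\<close> is the same combination of values of the
  quadratic form of \<open>F\<close> at unit vectors.\<close>

lemma psd_inner_lower:
  fixes F R :: "real ^ 'd ^ 'd"
  assumes R: "transpose R = R" "\<And>\<xi>. 0 \<le> outer \<xi> \<xi> \<bullet> R"
    and F: "\<And>v. - r * (v \<bullet> v) \<le> v \<bullet> (F *v v)"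
  shows "- r * trace R \<le> F \<bullet> R"
proof -
  obtain Q l where Q: "orthogonal_matrix Q" "R = Q ** diag l ** transpose Q"
    using spectral_decomposition[OF R(1)] by blast
  have l: "0 \<le> l k" for k
    using R(2)[of "column k Q"] unfolding outer_inner Q(2) conjugate_diag_mult_vec
    by (simp add: orthogonal_matrix_column_inner[OF Q(1)] if_distrib[of "\<lambda>x. _ * x"] cong: if_cong)
  have "- r * trace R = (\<Sum>k\<in>UNIV. l k * (- r * (column k Q \<bullet> column k Q)))"
    unfolding Q(2) conjugate_diag_eq_sum trace_sum trace_scaleR trace_outer
    by (simp add: sum_distrib_left mult_ac sum_negf)
  also have "\<dots> \<le> (\<Sum>k\<in>UNIV. l k * (column k Q \<bullet> (F *v column k Q)))"
    by (intro sum_mono mult_left_mono F l)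
  also have "\<dots> = F \<bullet> R"
    unfolding Q(2) conjugate_diag_eq_sum by (simp add: inner_sum_right inner_outer)
  finally show ?thesis .
qed

text \<open>\<open>neg_part\<close> is a definite description, so the point is uniqueness: two
  spectral decompositions of one matrix give the same truncated matrix, even when eigenvalues are
  repeated.\<close>

lemma neg_part_conjugate_diag:
  fixes Q :: "real ^ 'd ^ 'd"
  assumes Q: "orthogonal_matrix Q" and S: "S = Q ** diag l ** transpose Q"
  shows "neg_part S = Q ** diag (\<lambda>i. min (l i) 0) ** transpose Q"
  unfolding neg_part_def
proof (rule the_equality)
  show "\<exists>Q' l'. orthogonal_matrix Q' \<and> S = Q' ** diag l' ** transpose Q' \<and>
     Q ** diag (\<lambda>i. min (l i) 0) ** transpose Q = Q' ** diag (\<lambda>i. min (l' i) 0) ** transpose Q'"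
    using assms by blast
next
  fix N
  assume "\<exists>Q' l'. orthogonal_matrix Q' \<and> S = Q' ** diag l' ** transpose Q' \<and>
     N = Q' ** diag (\<lambda>i. min (l' i) 0) ** transpose Q'"
  then obtain Q' l' where Q': "orthogonal_matrix Q'" "S = Q' ** diag l' ** transpose Q'"
    "N = Q' ** diag (\<lambda>i. min (l' i) 0) ** transpose Q'" by blast
  \<comment> \<open>\<open>U\<close> intertwines the two diagonal matrices, so it can only link equal eigenvalues.\<close>
  define U where "U = transpose Q' ** Q"
  have QQ: "transpose Q ** Q = mat 1" "Q ** transpose Q = mat 1"
    and QQ': "transpose Q' ** Q' = mat 1" "Q' ** transpose Q' = mat 1"
    using Q Q'(1) by (auto simp: orthogonal_matrix_def)
  have eq: "U ** diag l = diag l' ** U"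
  proof -
    have "transpose Q' ** (Q ** diag l ** transpose Q) ** Q = transpose Q' ** (Q' ** diag l' ** transpose Q') ** Q"
      using S Q'(2) by simp
    then show ?thesis
      unfolding U_def by (metis QQ(1) QQ'(1) matrix_mul_assoc matrix_mul_lid matrix_mul_rid)
  qed
  have r: "(U ** diag f) $ i $ j = U $ i $ j * f j" for f i j
    by (simp add: matrix_matrix_mult_def diag_def if_distrib cong: if_cong)
  have le: "(diag f ** U) $ i $ j = f i * U $ i $ j" for f i j
    by (simp add: matrix_matrix_mult_def diag_def if_distrib[of "\<lambda>x. x * _"] cong: if_cong)
  have "U $ i $ j * l j = l' i * U $ i $ j" for i j
    using eq by (metis r le)
  then have "U $ i $ j * min (l j) 0 = min (l' i) 0 * U $ i $ j" for i j
    by (cases "U $ i $ j = 0") (simp_all, metis mult.commute mult_right_cancel)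
  then have "U ** diag (\<lambda>i. min (l i) 0) = diag (\<lambda>i. min (l' i) 0) ** U"
    by (simp add: vec_eq_iff r le)
  then have "Q' ** (U ** diag (\<lambda>i. min (l i) 0)) ** transpose Q
      = Q' ** (diag (\<lambda>i. min (l' i) 0) ** U) ** transpose Q" by simp
  then show "N = Q ** diag (\<lambda>i. min (l i) 0) ** transpose Q"
    unfolding Q'(3) U_def by (metis QQ(2) QQ'(2) matrix_mul_assoc matrix_mul_lid matrix_mul_rid)
qed

text \<open>The set under \<open>Max\<close> in \<open>spectral_norm\<close> turns out to be exactly
  the finite set of squares of the \<open>n i\<close>, so that \<open>Max\<close> is meaningful; the
  square root is monotone and can be taken inside.\<close>

lemma spectral_norm_conjugate_diag:
  fixes Q :: "real ^ 'd ^ 'd"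
  assumes Q: "orthogonal_matrix Q"
  shows "spectral_norm (Q ** diag n ** transpose Q) = Max (range (\<lambda>i. \<bar>n i\<bar>))"
proof -
  have QQ: "transpose Q ** Q = mat 1" "Q ** transpose Q = mat 1"
    using Q by (auto simp: orthogonal_matrix_def)
  let ?N = "Q ** diag n ** transpose Q"
  have tN: "transpose ?N = ?N"
    by (simp add: matrix_transpose_mul matrix_mul_assoc transpose_diag)
  have dd: "diag n ** diag n = diag (\<lambda>i. (n i)\<^sup>2)"
    by (auto simp: vec_eq_iff matrix_matrix_mult_def diag_def if_distrib[of "\<lambda>x. _ * x"] power2_eq_square
        cong: if_cong)
  have NN: "transpose ?N ** ?N = Q ** diag (\<lambda>i. (n i)\<^sup>2) ** transpose Q"
    unfolding tN dd[symmetric] by (metis QQ(1) matrix_mul_assoc matrix_mul_rid)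
  have "{l. \<exists>v. v \<noteq> 0 \<and> (transpose ?N ** ?N) *v v = l *\<^sub>R v} = range (\<lambda>i. (n i)\<^sup>2)" (is "?L = ?R")
  proof (intro equalityI subsetI)
    fix l assume "l \<in> ?L"
    then obtain v where v: "v \<noteq> 0" "(Q ** diag (\<lambda>i. (n i)\<^sup>2) ** transpose Q) *v v = l *\<^sub>R v"
      unfolding NN by blast
    define u where "u = transpose Q *v v"
    have "u \<noteq> 0"
      using v(1) QQ(2) by (metis u_def matrix_vector_mul_assoc matrix_vector_mul_lid matrix_vector_mult_0_right)
    \<comment> \<open>A nonzero coordinate of the eigenvector in the basis \<open>Q\<close>
      identifies its eigenvalue as \<open>(n i)^2\<close>.\<close>
    then obtain i where i: "u $ i \<noteq> 0" by (auto simp: vec_eq_iff)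
    have "diag (\<lambda>i. (n i)\<^sup>2) *v u = l *\<^sub>R u"
      using arg_cong[OF v(2), of "\<lambda>x. transpose Q *v x"] unfolding u_def
      by (metis QQ(1) matrix_mul_assoc matrix_mul_lid matrix_vector_mul_assoc matrix_vector_mult_scaleR)
    then have "(n i)\<^sup>2 * u $ i = l * u $ i"
      by (metis diag_mult_vec real_scaleR_def vector_scaleR_component)
    then show "l \<in> ?R" using i by auto
  next
    fix l assume "l \<in> ?R"
    then obtain i where l: "l = (n i)\<^sup>2" by blast
    have "diag (\<lambda>i. (n i)\<^sup>2) *v axis i 1 = l *\<^sub>R axis i 1"
      by (simp add: vec_eq_iff diag_mult_vec l) (simp add: axis_def)
    then have "(Q ** diag (\<lambda>i. (n i)\<^sup>2) ** transpose Q) *v (Q *v axis i 1) = l *\<^sub>R (Q *v axis i 1)"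
      by (metis QQ(1) matrix_mul_assoc matrix_mul_rid matrix_vector_mul_assoc matrix_vector_mult_scaleR)
    moreover have "Q *v axis i 1 \<noteq> 0"
      by (metis QQ(1) axis_eq_0_iff matrix_vector_mul_assoc matrix_vector_mul_lid matrix_vector_mult_0_right zero_neq_one)
    ultimately show "l \<in> ?L" unfolding NN by blast
  qed
  moreover have "sqrt (Max (range (\<lambda>i. (n i)\<^sup>2))) = Max (range (\<lambda>i. \<bar>n i\<bar>))"
    by (subst mono_Max_commute) (auto simp: mono_def image_image)
  ultimately show ?thesis unfolding spectral_norm_def by simp
qed

definition eneg :: "real ^ 'd ^ 'd \<Rightarrow> real" where
  "eneg A = spectral_norm (neg_part (sym_part A))"

lemma transpose_sym_part: "transpose (sym_part A) = sym_part A"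
  by (simp add: sym_part_def transpose_def vec_eq_iff add.commute)

lemma sym_part_quadratic: "v \<bullet> (sym_part A *v v) = v \<bullet> (A *v (v :: real ^ 'd))"
proof -
  have "v \<bullet> (transpose A *v v) = v \<bullet> (A *v v)"
    by (metis dot_lmul_matrix inner_commute transpose_matrix_vector)
  then show ?thesis
    by (simp add: sym_part_def matrix_vector_mult_add_rdistrib inner_simps scaleR_matrix_vector_assoc[symmetric])
qed

text \<open>For \<open>r \<ge> 0\<close> a truncated eigenvalue \<open>min (l i) 0\<close> has
  modulus at most \<open>r\<close> iff \<open>l i \<ge> - r\<close>, and in the eigenbasis this is
  the lower bound on the quadratic form. Sublinearity and continuity of \<open>eneg\<close> then
  follow from quadratic forms alone.\<close>

lemma eneg_decomposition:
  fixes A :: "real ^ 'd ^ 'd"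
  shows eneg_nonneg: "0 \<le> eneg A"
    and eneg_le_iff: "0 \<le> r \<Longrightarrow> eneg A \<le> r \<longleftrightarrow> (\<forall>v. - r * (v \<bullet> v) \<le> v \<bullet> (A *v v))"
proof -
  obtain Q l where Q: "orthogonal_matrix Q" "sym_part A = Q ** diag l ** transpose Q"
    using spectral_decomposition[OF transpose_sym_part] by blast
  have e: "eneg A = Max (range (\<lambda>i. \<bar>min (l i) 0\<bar>))"
    unfolding eneg_def neg_part_conjugate_diag[OF Q] spectral_norm_conjugate_diag[OF Q(1)] ..
  show "0 \<le> eneg A"
    unfolding e by (rule order_trans[OF abs_ge_zero[of "min (l undefined) 0"]], rule Max_ge) auto
  assume r: "0 \<le> r"
  have q: "v \<bullet> (A *v v) = (\<Sum>k\<in>UNIV. l k * (column k Q \<bullet> v)\<^sup>2)" for v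
    unfolding sym_part_quadratic[of v A, symmetric] Q(2) conjugate_diag_mult_vec
    by (simp add: power2_eq_square mult_ac)
  have "eneg A \<le> r \<longleftrightarrow> (\<forall>i. - r \<le> l i)"
  proof -
    have "\<bar>min (l i) 0\<bar> \<le> r \<longleftrightarrow> - r \<le> l i" for i using r by linarith
    then show ?thesis unfolding e by (subst Max_le_iff) auto
  qed
  also have "\<dots> \<longleftrightarrow> (\<forall>v. - r * (v \<bullet> v) \<le> v \<bullet> (A *v v))"
  proof (intro iffI allI)
    fix v assume "\<forall>i. - r \<le> l i"
    then show "- r * (v \<bullet> v) \<le> v \<bullet> (A *v v)"
      unfolding q orthogonal_matrix_parseval[OF Q(1), of v] sum_distrib_left
      by (intro sum_mono mult_right_mono) auto
  next
    fix i assume a: "\<forall>v. - r * (v \<bullet> v) \<le> v \<bullet> (A *v v)"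
    show "- r \<le> l i"
      using a[rule_format, of "column i Q"] unfolding q
      by (simp add: orthogonal_matrix_column_inner[OF Q(1)] if_distrib[of "\<lambda>x. x\<^sup>2"] if_distrib[of "\<lambda>x. _ * x"] cong: if_cong)
  qed
  finally show "eneg A \<le> r \<longleftrightarrow> (\<forall>v. - r * (v \<bullet> v) \<le> v \<bullet> (A *v v))" .
qed

lemma eneg_quadratic: "- eneg A * (v \<bullet> v) \<le> v \<bullet> (A *v (v :: real ^ 'd))"
  using eneg_le_iff[OF eneg_nonneg, of A A] by blast

text \<open>Cauchy-Schwarz for the Frobenius inner product, where \<open>outer v v\<close> has norm
  \<open>v \<bullet> v\<close>.\<close>

lemma abs_quadratic_le_norm:
  fixes A :: "real ^ 'd ^ 'd"
  shows "\<bar>v \<bullet> (A *v v)\<bar> \<le> norm A * (v \<bullet> v)"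
proof -
  have "\<bar>v \<bullet> (A *v v)\<bar> = \<bar>outer v v \<bullet> A\<bar>" by (simp add: outer_inner)
  also have "\<dots> \<le> norm (outer v v) * norm A" by (rule Cauchy_Schwarz_ineq2)
  also have "norm (outer v v) = v \<bullet> v"
  proof -
    have "outer v v \<bullet> outer v v = (v \<bullet> v)\<^sup>2"
      by (simp add: outer_inner) (simp add: outer_def matrix_vector_mult_def inner_vec_def
          sum_distrib_left sum_distrib_right power2_eq_square mult_ac)
    then show ?thesis by (simp add: norm_eq_sqrt_inner)
  qed
  finally show ?thesis by (simp add: mult.commute)
qed

lemma eneg_le_norm: "eneg A \<le> norm A"
  by (subst eneg_le_iff) (auto intro: abs_le_D2 order_trans simp: minus_le_iff
      abs_quadratic_le_norm[THEN abs_le_D2])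

lemma eneg_add_le: "eneg (A + B) \<le> eneg A + eneg B"
proof (subst eneg_le_iff)
  show "0 \<le> eneg A + eneg B" by (simp add: eneg_nonneg)
  show "\<forall>v. - (eneg A + eneg B) * (v \<bullet> v) \<le> v \<bullet> ((A + B) *v v)"
    using eneg_quadratic[of A] eneg_quadratic[of B]
    by (smt (verit) distrib_right inner_add_right matrix_vector_mult_add_rdistrib mult_minus_left)
qed

lemma eneg_scaleR: "0 \<le> c \<Longrightarrow> eneg (c *\<^sub>R A) = c * eneg A"
proof -
  have le: "eneg (c *\<^sub>R A) \<le> c * eneg A" if "0 \<le> c" for c :: real and A :: "real ^ 'd ^ 'd"
    using that mult_left_mono[OF eneg_quadratic that, of A]
    by (subst eneg_le_iff) (auto simp: eneg_nonneg scaleR_matrix_vector_assoc[symmetric] mult_ac)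
  assume c: "0 \<le> c"
  show ?thesis
  proof (cases "c = 0")
    case True
    then show ?thesis using eneg_nonneg[of "c *\<^sub>R A"] le[OF c, of A] by simp
  next
    case False
    \<comment> \<open>The reverse inequality is the one just proved, applied to
      \<open>c *\<^sub>R A\<close> with the factor \<open>1 / c\<close>.\<close>
    then have "c * eneg A \<le> c * (1 / c * eneg (c *\<^sub>R A))"
      using le[of "1 / c" "c *\<^sub>R A"] c by (intro mult_left_mono) auto
    then show ?thesis using le[OF c, of A] False c by auto
  qed
qed

lemma eneg_0 [simp]: "eneg 0 = 0"
  using eneg_scaleR[of 0 "0"] by simp

lemma eneg_dist: "\<bar>eneg A - eneg B\<bar> \<le> norm (A - B)"
  using eneg_add_le[of "A - B" B] eneg_add_le[of "B - A" A] eneg_le_norm[of "A - B"] eneg_le_norm[of "B - A"]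
  by (simp add: norm_minus_commute)

lemma continuous_on_eneg: "continuous_on X eneg"
  by (rule lipschitz_on_continuous_on[where L = 1], rule lipschitz_onI)
     (auto simp: dist_real_def dist_norm eneg_dist)

text \<open>Links the dual norm in \<open>Linf_weakstar_psd\<close> with the gauge
  \<open>eneg\<close>: for symmetric fields of spectral norm at most one, both signs of the field
  satisfy the hypothesis of \<open>matrix_integral_abs_le\<close>.\<close>

lemma eneg_uminus_sym_le_spectral_norm:
  fixes A :: "real ^ 'd ^ 'd"
  assumes "transpose A = A" "spectral_norm A \<le> 1"
  shows "eneg A \<le> 1" "eneg (- A) \<le> 1"
proof -
  obtain Q l where Q: "orthogonal_matrix Q" "A = Q ** diag l ** transpose Q"
    using spectral_decomposition[OF assms(1)] by blast
  have l: "\<bar>l i\<bar> \<le> 1" for i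
    using assms(2) unfolding Q(2) spectral_norm_conjugate_diag[OF Q(1)] by auto
  have q: "v \<bullet> (A *v v) = (\<Sum>k\<in>UNIV. l k * (column k Q \<bullet> v)\<^sup>2)" for v
    unfolding Q(2) conjugate_diag_mult_vec by (simp add: power2_eq_square mult_ac)
  have "\<bar>v \<bullet> (A *v v)\<bar> \<le> v \<bullet> v" for v
  proof -
    have "\<bar>v \<bullet> (A *v v)\<bar> \<le> (\<Sum>k\<in>UNIV. \<bar>l k * (column k Q \<bullet> v)\<^sup>2\<bar>)"
      unfolding q by (rule sum_abs)
    also have "\<dots> \<le> (\<Sum>k\<in>UNIV. (column k Q \<bullet> v)\<^sup>2)"
      using l by (intro sum_mono) (simp add: abs_mult mult_left_le_one_le)
    finally show ?thesis by (simp add: orthogonal_matrix_parseval[OF Q(1), of v])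
  qed
  then have "- (v \<bullet> v) \<le> v \<bullet> (A *v v)" "v \<bullet> (A *v v) \<le> v \<bullet> v" for v
    by (smt (verit))+
  then show "eneg A \<le> 1" "eneg (- A) \<le> 1"
    using scaleR_matrix_vector_assoc[of "-1" A, symmetric] by (auto simp: eneg_le_iff)
qed

section \<open>Differentiable functions on the torus\<close>

text \<open>Separability in the uniform norm. Each function is coded by a finite net on which its
  oscillation is small and by approximate values there from a countable dense set; one member of
  \<open>I\<close> is selected per code. Selecting inside \<open>I\<close> keeps the approximants
  differentiable when \<open>I\<close> indexes tests.\<close>

lemma countable_uniformly_dense:
  fixes u :: "'i \<Rightarrow> 'a::metric_space \<Rightarrow> 'c::{metric_space, second_countable_topology}"
  assumes K: "compact K" and cont: "\<And>i. i \<in> I \<Longrightarrow> continuous_on K (u i)"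
  obtains J where "countable J" "J \<subseteq> I"
    "\<And>i e. i \<in> I \<Longrightarrow> 0 < e \<Longrightarrow> \<exists>j\<in>J. \<forall>x\<in>K. dist (u i x) (u j x) < e"
proof -
  obtain D :: "'c set" where D: "countable D" "\<And>X. open X \<Longrightarrow> X \<noteq> {} \<Longrightarrow> \<exists>d\<in>D. d \<in> X"
    using countable_dense_exists[where 'a = 'c] by blast
  have "\<exists>k. finite k \<and> k \<subseteq> K \<and> K \<subseteq> (\<Union>x\<in>k. ball x (1 / real (Suc n)))" for n
    by (rule seq_compact_imp_totally_bounded[OF compact_imp_seq_compact[OF K], rule_format]) simp
  then obtain N where N: "\<And>n. finite (N n)" "\<And>n. N n \<subseteq> K"
    "\<And>n. K \<subseteq> (\<Union>x\<in>N n. ball x (1 / real (Suc n)))" by metis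
  define S where "S = (\<lambda>(n, m, c). {i \<in> I. (\<forall>p\<in>N n. dist (u i p) (c p) < 1 / real (Suc m)) \<and>
     (\<forall>x\<in>K. \<forall>p\<in>N n. dist p x < 1 / real (Suc n) \<longrightarrow> dist (u i x) (u i p) < 1 / real (Suc m))})"
  define Z where "Z = (SIGMA n:UNIV. SIGMA m:(UNIV::nat set). N n \<rightarrow>\<^sub>E D)"
  define J where "J = (\<lambda>z. SOME i. i \<in> S z) ` {z \<in> Z. S z \<noteq> {}}"
  have "countable Z"
    unfolding Z_def by (intro countable_SIGMA countable_PiE N D) auto
  then have "countable J" unfolding J_def by (intro countable_image) (auto intro: countable_subset[rotated])
  moreover have some: "(SOME i. i \<in> S z) \<in> S z" if "S z \<noteq> {}" for z
    using that by (simp add: some_in_eq)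
  then have "J \<subseteq> I" unfolding J_def S_def by (auto split: prod.splits)
  moreover have "\<exists>j\<in>J. \<forall>x\<in>K. dist (u i x) (u j x) < e" if i: "i \<in> I" and e: "0 < e" for i e
  proof -
    \<comment> \<open>Four distances are added at the end, two oscillations and two errors at the
      net point, hence \<open>e / 4\<close>.\<close>
    obtain m where m: "1 / real (Suc m) < e / 4" using e using nat_approx_posE[of "e / 4"] by auto
    have "uniformly_continuous_on K (u i)" using cont[OF i] K by (rule compact_uniformly_continuous)
    then have "\<exists>d>0. \<forall>x\<in>K. \<forall>p\<in>K. dist p x < d \<longrightarrow> dist (u i p) (u i x) < 1 / real (Suc m)"
      unfolding uniformly_continuous_on_def by simp
    then obtain d where d: "d > 0" "\<And>x p. x \<in> K \<Longrightarrow> p \<in> K \<Longrightarrow> dist p x < d \<Longrightarrow> dist (u i x) (u i p) < 1 / real (Suc m)"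
      by (metis dist_commute)
    obtain n where n: "1 / real (Suc n) < d" using d(1) nat_approx_posE by blast
    have "\<exists>q\<in>D. dist (u i p) q < 1 / real (Suc m)" for p
      using D(2)[of "ball (u i p) (1 / real (Suc m))"] by auto
    then obtain q where q: "\<And>p. q p \<in> D" "\<And>p. dist (u i p) (q p) < 1 / real (Suc m)" by metis
    define c where "c = restrict q (N n)"
    have z: "(n, m, c) \<in> Z" using q(1) by (auto simp: Z_def c_def)
    have iS: "i \<in> S (n, m, c)"
    proof -
      have "dist (u i x) (u i p) < 1 / real (Suc m)"
        if "x \<in> K" "p \<in> N n" "dist p x < 1 / real (Suc n)" for x p
        using d(2)[of x p] that N(2)[of n] n by auto
      then show ?thesis using i q(2) by (auto simp: S_def c_def)
    qed
    define j where "j = (SOME i. i \<in> S (n, m, c))"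
    have jJ: "j \<in> J" unfolding J_def j_def using z iS by blast
    have jS: "j \<in> S (n, m, c)" unfolding j_def using some iS by blast
    have "dist (u i x) (u j x) < e" if x: "x \<in> K" for x
    proof -
      obtain p where p: "p \<in> N n" "dist p x < 1 / real (Suc n)" using N(3) x by fastforce
      have "dist (u i x) (u i p) < 1 / real (Suc m)" "dist (u i p) (c p) < 1 / real (Suc m)"
        "dist (u j x) (u j p) < 1 / real (Suc m)" "dist (u j p) (c p) < 1 / real (Suc m)"
        using iS jS p x by (auto simp: S_def)
      moreover have "dist (u i x) (u j x) \<le> dist (u i x) (u i p) + dist (u i p) (c p) + dist (u j p) (c p) + dist (u j x) (u j p)"
        by metric
      ultimately show ?thesis using m by linarith
    qed
    then show ?thesis using jJ by blast
  qed
  ultimately show ?thesis using that by blast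
qed

lemma C1_torusE:
  assumes "C1_torus T f"
  obtains D where "continuous_on ({0..T} \<times> UNIV) D"
    "\<forall>t\<in>{0..T}. \<forall>x. ((\<lambda>(t, x). f t x) has_derivative blinfun_apply (D (t, x))) (at (t, x) within {0..T} \<times> UNIV)"
    "\<And>t x k. t \<in> {0..T} \<Longrightarrow> (\<And>i. k $ i \<in> \<int>) \<Longrightarrow> f t (x + k) = f t x"
proof -
  obtain D where "\<forall>t\<in>{0..T}. periodic (f t)" "continuous_on ({0..T} \<times> UNIV) D"
    "\<forall>z\<in>{0..T} \<times> UNIV. ((\<lambda>(t, x). f t x) has_derivative blinfun_apply (D z)) (at z within {0..T} \<times> UNIV)"
    using assms unfolding C1_torus_def by blast
  then show ?thesis by (intro that[of D]) (auto simp: periodic_def)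
qed

context
  fixes T :: real and f :: "real \<Rightarrow> real ^ 'd \<Rightarrow> 'b::real_normed_vector"
    and D :: "real \<times> (real ^ 'd) \<Rightarrow> (real \<times> (real ^ 'd)) \<Rightarrow>\<^sub>L 'b"
  assumes T: "0 < T"
    and D: "\<forall>t\<in>{0..T}. \<forall>x. ((\<lambda>(t, x). f t x) has_derivative blinfun_apply (D (t, x))) (at (t, x) within {0..T} \<times> UNIV)"
begin

lemma dt_eq_blinfun:
  assumes t: "t \<in> {0..T}"
  shows "dt T f t x = D (t, x) (1, 0)"
proof -
  have lin: "blinfun_apply (D (t, x)) (h, 0) = h *\<^sub>R D (t, x) (1, 0)" for h
    by (simp add: blinfun.scaleR_right[symmetric])
  have "((\<lambda>s. (s, x)) has_derivative (\<lambda>h. (h, 0))) (at t within {0..T})"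
    by (auto intro!: derivative_eq_intros)
  moreover have "((\<lambda>(t, x). f t x) has_derivative blinfun_apply (D (t, x))) (at (t, x) within (\<lambda>s. (s, x)) ` {0..T})"
    by (rule has_derivative_subset[OF D[rule_format, OF t]]) auto
  ultimately have "((\<lambda>s. (\<lambda>(t, x). f t x) (s, x)) has_derivative (\<lambda>h. D (t, x) (h, 0))) (at t within {0..T})"
    by (rule has_derivative_in_compose)
  then have "((\<lambda>s. f s x) has_vector_derivative D (t, x) (1, 0)) (at t within {0..T})"
    unfolding has_vector_derivative_def by (simp add: lin[symmetric])
  then show ?thesis
    unfolding dt_def using vector_derivative_within_cbox[of 0 T t] T t by (simp add: cbox_interval)
qed

lemma has_derivative_space:
  assumes t: "t \<in> {0..T}"
  shows "(f t has_derivative (\<lambda>v. D (t, x) (0, v))) (at x)"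
proof -
  have "((\<lambda>y. (t, y)) has_derivative (\<lambda>h. (0, h))) (at x)"
    by (auto intro!: derivative_eq_intros)
  moreover have "((\<lambda>(t, x). f t x) has_derivative blinfun_apply (D (t, x))) (at (t, x) within range (\<lambda>y. (t, y)))"
    by (rule has_derivative_subset[OF D[rule_format, OF t]]) (use t in auto)
  ultimately have "((\<lambda>y. (\<lambda>(t, x). f t x) (t, y)) has_derivative (\<lambda>h. D (t, x) (0, h))) (at x)"
    by (rule has_derivative_in_compose)
  then show ?thesis by simp
qed

lemma frechet_derivative_space:
  assumes "t \<in> {0..T}"
  shows "frechet_derivative (f t) (at x) = (\<lambda>v. D (t, x) (0, v))"
  using frechet_derivative_at[OF has_derivative_space[OF assms]] by simp

end

lemma continuous_on_pair_blinfun: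
  assumes "continuous_on S D"
  shows "continuous_on S (\<lambda>z. blinfun_apply (D z) v)"
  using assms by (intro continuous_intros)

lemma C1_torus_continuous:
  fixes f :: "real \<Rightarrow> real ^ 'd \<Rightarrow> 'b::real_normed_vector"
  assumes f: "C1_torus T f"
  shows "continuous_on ({0..T} \<times> UNIV) (\<lambda>(t, x). f t x)"
proof -
  obtain D where D: "\<forall>t\<in>{0..T}. \<forall>x. ((\<lambda>(t, x). f t x) has_derivative blinfun_apply (D (t, x))) (at (t, x) within {0..T} \<times> UNIV)"
    using C1_torusE[OF f] by metis
  show ?thesis
    by (rule has_derivative_continuous_on[where f' = "\<lambda>z. blinfun_apply (D z)"]) (use D in auto)
qed

lemma C1_torus_continuous_dt:
  fixes f :: "real \<Rightarrow> real ^ 'd \<Rightarrow> 'b::real_normed_vector"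
  assumes "0 < T" "C1_torus T f"
  shows "continuous_on ({0..T} \<times> UNIV) (\<lambda>(t, x). dt T f t x)"
proof -
  obtain D where D: "continuous_on ({0..T} \<times> UNIV) D"
    "\<forall>t\<in>{0..T}. \<forall>x. ((\<lambda>(t, x). f t x) has_derivative blinfun_apply (D (t, x))) (at (t, x) within {0..T} \<times> UNIV)"
    using C1_torusE[OF assms(2)] by metis
  show ?thesis
    using continuous_on_pair_blinfun[OF D(1), of "(1, 0)"]
    by (rule continuous_on_eq) (auto simp: dt_eq_blinfun[OF assms(1) D(2)])
qed

lemma C1_torus_continuous_grad:
  fixes \<rho> :: "real \<Rightarrow> real ^ 'd \<Rightarrow> real"
  assumes "0 < T" "C1_torus T \<rho>"
  shows "continuous_on ({0..T} \<times> UNIV) (\<lambda>(t, x). grad (\<rho> t) x)"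
proof -
  obtain D where D: "continuous_on ({0..T} \<times> UNIV) D"
    "\<forall>t\<in>{0..T}. \<forall>x. ((\<lambda>(t, x). \<rho> t x) has_derivative blinfun_apply (D (t, x))) (at (t, x) within {0..T} \<times> UNIV)"
    using C1_torusE[OF assms(2)] by metis
  have "continuous_on ({0..T} \<times> UNIV) (\<lambda>z. \<chi> i. blinfun_apply (D z) (0, axis i 1))"
    by (intro continuous_on_vec_lambda continuous_on_pair_blinfun D(1))
  then show ?thesis
    by (rule continuous_on_eq) (auto simp: grad_def frechet_derivative_space[OF assms(1) D(2)])
qed

lemma C1_torus_continuous_nabla:
  fixes \<phi> :: "real \<Rightarrow> real ^ 'd \<Rightarrow> real ^ 'd"
  assumes "0 < T" "C1_torus T \<phi>"
  shows "continuous_on ({0..T} \<times> UNIV) (\<lambda>(t, x). nabla (\<phi> t) x)"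
proof -
  obtain D where D: "continuous_on ({0..T} \<times> UNIV) D"
    "\<forall>t\<in>{0..T}. \<forall>x. ((\<lambda>(t, x). \<phi> t x) has_derivative blinfun_apply (D (t, x))) (at (t, x) within {0..T} \<times> UNIV)"
    using C1_torusE[OF assms(2)] by metis
  have "continuous_on ({0..T} \<times> UNIV) (\<lambda>z. \<chi> i j. blinfun_apply (D z) (0, axis j 1) $ i)"
    by (intro continuous_on_vec_lambda continuous_intros continuous_on_pair_blinfun D(1))
  then show ?thesis
    by (rule continuous_on_eq)
       (auto simp: nabla_def jacobian_def matrix_def frechet_derivative_space[OF assms(1) D(2)])
qed

lemma C1_torus_nabla_periodic:
  fixes \<phi> :: "real \<Rightarrow> real ^ 'd \<Rightarrow> real ^ 'd"
  assumes "0 < T" "C1_torus T \<phi>" "t \<in> {0..T}" "\<And>i. k $ i \<in> \<int>"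
  shows "nabla (\<phi> t) (x + k) = nabla (\<phi> t) x"
proof -
  obtain D where D:
    "\<forall>t\<in>{0..T}. \<forall>x. ((\<lambda>(t, x). \<phi> t x) has_derivative blinfun_apply (D (t, x))) (at (t, x) within {0..T} \<times> UNIV)"
    "\<And>t x k. t \<in> {0..T} \<Longrightarrow> (\<And>i. k $ i \<in> \<int>) \<Longrightarrow> \<phi> t (x + k) = \<phi> t x"
    using C1_torusE[OF assms(2)] by metis
  have "(\<phi> t has_derivative (\<lambda>v. D (t, x + k) (0, v))) (at (x + k))"
    by (rule has_derivative_space[OF assms(1) D(1) assms(3), of "x + k"])
  then have "((\<lambda>y. \<phi> t (y + k)) has_derivative (\<lambda>v. D (t, x + k) (0, v))) (at x)"
    by (intro has_derivative_compose[where f = "\<lambda>y. y + k" and g = "\<phi> t"])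
       (auto intro!: derivative_eq_intros)
  then have "(\<phi> t has_derivative (\<lambda>v. D (t, x + k) (0, v))) (at x)"
    using D(2)[OF assms(3,4)] by simp
  then show ?thesis
    unfolding nabla_def jacobian_def frechet_derivative_space[OF assms(1) D(1) assms(3)]
    using frechet_derivative_at frechet_derivative_space[OF assms(1) D(1) assms(3)] by metis
qed

lemma C1_torus_add_scaleR:
  fixes f g :: "real \<Rightarrow> real ^ 'd \<Rightarrow> 'b::real_normed_vector"
  assumes T: "0 < T" and f: "C1_torus T f" and g: "C1_torus T g"
  shows "C1_torus T (\<lambda>t x. f t x + c *\<^sub>R g t x)" (is ?C1)
    and "t \<in> {0..T} \<Longrightarrow> dt T (\<lambda>t x. f t x + c *\<^sub>R g t x) t x = dt T f t x + c *\<^sub>R dt T g t x"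
    and "t \<in> {0..T} \<Longrightarrow> frechet_derivative (\<lambda>x. f t x + c *\<^sub>R g t x) (at x) v
          = frechet_derivative (f t) (at x) v + c *\<^sub>R frechet_derivative (g t) (at x) v"
proof -
  obtain D where D: "continuous_on ({0..T} \<times> UNIV) D"
    "\<forall>t\<in>{0..T}. \<forall>x. ((\<lambda>(t, x). f t x) has_derivative blinfun_apply (D (t, x))) (at (t, x) within {0..T} \<times> UNIV)"
    "\<And>t x k. t \<in> {0..T} \<Longrightarrow> (\<And>i. k $ i \<in> \<int>) \<Longrightarrow> f t (x + k) = f t x"
    using C1_torusE[OF f] by metis
  obtain D' where D': "continuous_on ({0..T} \<times> UNIV) D'"
    "\<forall>t\<in>{0..T}. \<forall>x. ((\<lambda>(t, x). g t x) has_derivative blinfun_apply (D' (t, x))) (at (t, x) within {0..T} \<times> UNIV)"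
    "\<And>t x k. t \<in> {0..T} \<Longrightarrow> (\<And>i. k $ i \<in> \<int>) \<Longrightarrow> g t (x + k) = g t x"
    using C1_torusE[OF g] by metis
  define D'' where "D'' = (\<lambda>z. D z + c *\<^sub>R D' z)"
  have c: "continuous_on ({0..T} \<times> UNIV) D''"
    unfolding D''_def using D(1) D'(1) by (intro continuous_intros)
  have "((\<lambda>(t, x). f t x + c *\<^sub>R g t x) has_derivative blinfun_apply (D'' (t, x))) (at (t, x) within {0..T} \<times> UNIV)"
    if "t \<in> {0..T}" for t x
    using has_derivative_add[OF D(2)[rule_format, OF that, of x] has_derivative_scaleR_right[OF D'(2)[rule_format, OF that, of x], of c]]
    by (simp add: D''_def blinfun.add_left[abs_def] blinfun.scaleR_left[abs_def] case_prod_unfold)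
  then have d: "\<forall>t\<in>{0..T}. \<forall>x. ((\<lambda>(t, x). f t x + c *\<^sub>R g t x) has_derivative blinfun_apply (D'' (t, x))) (at (t, x) within {0..T} \<times> UNIV)"
    by blast
  show ?C1 unfolding C1_torus_def
    using c d D(3) D'(3) by (auto simp: periodic_def intro!: exI[of _ D''])
  assume t: "t \<in> {0..T}"
  show "dt T (\<lambda>t x. f t x + c *\<^sub>R g t x) t x = dt T f t x + c *\<^sub>R dt T g t x"
    unfolding dt_eq_blinfun[OF T D(2) t] dt_eq_blinfun[OF T D'(2) t] dt_eq_blinfun[OF T d t]
    by (simp add: D''_def blinfun.add_left blinfun.scaleR_left)
  show "frechet_derivative (\<lambda>x. f t x + c *\<^sub>R g t x) (at x) v
          = frechet_derivative (f t) (at x) v + c *\<^sub>R frechet_derivative (g t) (at x) v"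
    unfolding frechet_derivative_space[OF T D(2) t] frechet_derivative_space[OF T D'(2) t]
      frechet_derivative_space[OF T d t]
    by (simp add: D''_def blinfun.add_left blinfun.scaleR_left)
qed

lemma grad_add_scaleR:
  assumes "0 < T" "C1_torus T f" "C1_torus T g" "t \<in> {0..T}"
  shows "grad (\<lambda>x. f t x + c *\<^sub>R g t x) x = grad (f t) x + c *\<^sub>R grad (g t) x"
  by (simp add: grad_def C1_torus_add_scaleR(3)[OF assms(1-3,4), simplified] vec_eq_iff)

lemma nabla_add_scaleR:
  assumes "0 < T" "C1_torus T f" "C1_torus T g" "t \<in> {0..T}"
  shows "nabla (\<lambda>x. f t x + c *\<^sub>R g t x) x = nabla (f t) x + c *\<^sub>R nabla (g t) x"
  by (simp add: nabla_def jacobian_def matrix_def C1_torus_add_scaleR(3)[OF assms(1-3,4)] vec_eq_iff)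

lemma C1_torus_0: "C1_torus T (\<lambda>t x. 0)"
  unfolding C1_torus_def periodic_def
  by (auto intro!: exI[of _ "\<lambda>_. 0"] simp: zero_blinfun.rep_eq case_prod_unfold)

lemma dt_0: "0 < T \<Longrightarrow> t \<in> {0..T} \<Longrightarrow> dt T (\<lambda>t x. 0) t x = 0"
  unfolding dt_def using vector_derivative_within_cbox[of 0 T t "\<lambda>_. 0" 0] by (simp add: cbox_interval)

lemma grad_0: "grad (\<lambda>x. 0) x = 0"
  by (simp add: grad_def vec_eq_iff)

lemma nabla_0: "nabla (\<lambda>x. 0) x = 0"
  by (simp add: nabla_def jacobian_def matrix_def vec_eq_iff)

lemma C1_torus_scaleR:
  fixes f :: "real \<Rightarrow> real ^ 'd \<Rightarrow> 'b::real_normed_vector"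
  assumes "0 < T" "C1_torus T f"
  shows "C1_torus T (\<lambda>t x. c *\<^sub>R f t x)"
    and "t \<in> {0..T} \<Longrightarrow> dt T (\<lambda>t x. c *\<^sub>R f t x) t x = c *\<^sub>R dt T f t x"
  using C1_torus_add_scaleR(1,2)[OF assms(1) C1_torus_0 assms(2), where c = c] by (auto simp: dt_0[OF assms(1)])

lemma nabla_scaleR:
  assumes "0 < T" "C1_torus T f" "t \<in> {0..T}"
  shows "nabla (\<lambda>x. c *\<^sub>R f t x) x = c *\<^sub>R nabla (f t) x"
  using nabla_add_scaleR[OF assms(1) C1_torus_0 assms(2,3), of c x] by (simp add: nabla_0)

lemma C1_torus_sum:
  fixes f :: "'i \<Rightarrow> real \<Rightarrow> real ^ 'd \<Rightarrow> real ^ 'd"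
  assumes T: "0 < T" and K: "finite K" and f: "\<And>k. k \<in> K \<Longrightarrow> C1_torus T (f k)"
  shows "C1_torus T (\<lambda>t x. \<Sum>k\<in>K. c k *\<^sub>R f k t x) \<and>
    (\<forall>t\<in>{0..T}. \<forall>x. dt T (\<lambda>t x. \<Sum>k\<in>K. c k *\<^sub>R f k t x) t x = (\<Sum>k\<in>K. c k *\<^sub>R dt T (f k) t x) \<and>
       nabla (\<lambda>x. \<Sum>k\<in>K. c k *\<^sub>R f k t x) x = (\<Sum>k\<in>K. c k *\<^sub>R nabla (f k t) x))"
  using K f
proof (induction K)
  case empty
  then show ?case by (simp add: C1_torus_0 dt_0[OF T] nabla_0)
next
  case (insert k K)
  have IH: "C1_torus T (\<lambda>t x. \<Sum>k\<in>K. c k *\<^sub>R f k t x)" using insert by simp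
  note fk = insert.prems[of k, simplified]
  have eq: "(\<lambda>t x. \<Sum>k\<in>insert k K. c k *\<^sub>R f k t x) = (\<lambda>t x. (\<Sum>k\<in>K. c k *\<^sub>R f k t x) + c k *\<^sub>R f k t x)"
    using insert.hyps by (simp add: fun_eq_iff add.commute)
  show ?case
    unfolding eq using insert C1_torus_add_scaleR(1)[OF T IH fk, of "c k"]
      C1_torus_add_scaleR(2)[OF T IH fk, of _ "c k"] nabla_add_scaleR[OF T IH fk, of _ "c k"]
    by (simp add: fun_cong[OF fun_cong[OF eq]] add.commute)
qed

section \<open>The unit cell and suprema of continuous fields on it\<close>

lemma cell_subset_cbox: "cell \<subseteq> cbox (0 :: real ^ 'd) 1"
  by (auto simp: cell_def mem_box_cart) (metis less_imp_le)

lemma box_subset_cell: "box (0 :: real ^ 'd) 1 \<subseteq> cell"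
  by (auto simp: cell_def mem_box_cart less_imp_le)

lemma cell_borel [measurable]: "(cell :: (real ^ 'd) set) \<in> sets borel"
proof -
  have "(cell :: (real ^ 'd) set) = (\<Inter>i. {x. 0 \<le> x $ i} \<inter> {x. x $ i < 1})"
    by (auto simp: cell_def)
  moreover have "{x :: real ^ 'd. 0 \<le> x $ i} \<inter> {x. x $ i < 1} \<in> sets borel" for i
    by measurable
  then have "(\<Inter>i. {x :: real ^ 'd. 0 \<le> x $ i} \<inter> {x. x $ i < 1}) \<in> sets borel"
    by (intro sets.finite_INT) auto
  ultimately show ?thesis by simp
qed

lemma cell_lebesgue [simp]: "(cell :: (real ^ 'd) set) \<in> sets lebesgue"
  using cell_borel by (rule sets_completionI_sets[where M = lborel, simplified])

lemma closure_box_01: "closure (box (0 :: real ^ 'd) 1) = cbox 0 1"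
proof -
  have "box (0 :: real ^ 'd) 1 \<noteq> {}" by (simp add: interval_ne_empty_cart)
  then show ?thesis by (rule closure_box)
qed

text \<open>The part of the open box where the bound fails is open and negligible, hence empty; the
  remaining faces of the cell are reached by continuity from the closure of the box.\<close>

lemma AE_torus_continuous_le:
  fixes F :: "real ^ 'd \<Rightarrow> real"
  assumes F: "continuous_on UNIV F" and ae: "AE x in torus. F x \<le> r" and x: "x \<in> cell"
  shows "F x \<le> r"
proof -
  let ?U = "{x \<in> box 0 1. r < F x}"
  have "open ?U"
    using continuous_open_preimage[OF F, of "{r<..}"] open_box[of "0 :: real ^ 'd" 1]
    by (auto simp: Int_def intro!: open_Collect_conj open_Collect_less F)
  moreover have "AE x in lebesgue. x \<notin> ?U"
    using ae box_subset_cell by (auto simp: AE_restrict_space_iff elim!: eventually_mono)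
  then have "?U \<in> null_sets lebesgue"
    by (simp add: AE_iff_null_sets \<open>open ?U\<close> lborelD sets_completionI_sets borel_open)
  then have "negligible ?U" by (simp add: negligible_iff_null_sets)
  ultimately have "?U = {}" using open_not_negligible by blast
  then have "\<And>y. y \<in> box 0 1 \<Longrightarrow> F y \<le> r" by force
  moreover have "x \<in> closure (box 0 1)" unfolding closure_box_01 using x cell_subset_cbox by blast
  ultimately show ?thesis
    using continuous_le_on_closure[of "box 0 1" F x r] continuous_on_subset[OF F] by auto
qed

lemma emeasure_cell: "emeasure lebesgue (cell :: (real ^ 'd) set) = 1"
proof (rule antisym)
  have "emeasure lebesgue (cell :: (real ^ 'd) set) \<le> emeasure lebesgue (cbox (0 :: real ^ 'd) 1)"
    by (intro emeasure_mono cell_subset_cbox) auto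
  also have "\<dots> = 1" by (simp add: emeasure_lborel_cbox_eq Basis_vec_def inner_axis prod.neutral)
  finally show "emeasure lebesgue (cell :: (real ^ 'd) set) \<le> 1" .
  have "1 = emeasure lebesgue (box (0 :: real ^ 'd) 1)"
    by (simp add: emeasure_lborel_box_eq Basis_vec_def inner_axis prod.neutral)
  also have "\<dots> \<le> emeasure lebesgue (cell :: (real ^ 'd) set)"
    by (intro emeasure_mono box_subset_cell) auto
  finally show "1 \<le> emeasure lebesgue (cell :: (real ^ 'd) set)" .
qed

lemma space_torus [simp]: "space torus = cell"
  by (simp add: space_restrict_space)

lemma emeasure_torus: "emeasure torus cell = 1"
  by (subst emeasure_restrict_space) (auto simp: emeasure_cell)

lemma prob_space_torus: "prob_space (torus :: (real ^ 'd) measure)"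
  by (rule prob_spaceI) (simp add: emeasure_torus)

text \<open>For a continuous field the essential supremum bounds the values at every point of the
  cell. It is finite, between zero and the maximum on the closed cube, so
  \<open>real_of_ereal\<close> in \<open>Linf_norm\<close> loses nothing.\<close>

lemma Linf_norm_neg_part:
  fixes F :: "real ^ 'd \<Rightarrow> real ^ 'd ^ 'd"
  assumes F: "continuous_on UNIV F"
  shows Linf_norm_nonneg: "0 \<le> Linf_norm (\<lambda>x. neg_part (sym_part (F x)))" (is "0 \<le> ?n")
    and Linf_norm_ge: "x \<in> cell \<Longrightarrow> eneg (F x) \<le> Linf_norm (\<lambda>x. neg_part (sym_part (F x)))"
    and Linf_norm_le: "(\<And>x. x \<in> cell \<Longrightarrow> eneg (F x) \<le> r) \<Longrightarrow> Linf_norm (\<lambda>x. neg_part (sym_part (F x))) \<le> r"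
proof -
  define e where "e = (\<lambda>x. eneg (F x))"
  have ce: "continuous_on UNIV e"
    unfolding e_def by (rule continuous_on_compose2[OF continuous_on_eneg F]) auto
  have me: "(\<lambda>x. ereal (e x)) \<in> borel_measurable torus"
    by (intro borel_measurable_ereal measurable_restrict_space1 measurable_completion)
       (simp add: borel_measurable_continuous_onI[OF ce])
  define s where "s = esssup torus (\<lambda>x. ereal (e x))"
  have n: "?n = real_of_ereal s" by (simp add: Linf_norm_def s_def e_def eneg_def)
  have up: "s \<le> ereal r" if "\<And>x. x \<in> cell \<Longrightarrow> e x \<le> r" for r
    unfolding s_def by (rule esssup_I[OF me]) (auto intro!: AE_I2 that)
  have ae: "AE x in torus. ereal (e x) \<le> s" unfolding s_def by (rule esssup_AE)
  interpret prob_space "torus :: (real ^ 'd) measure" by (rule prob_space_torus)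
  \<comment> \<open>On a probability space an almost sure statement holds somewhere; at such a point
    \<open>s\<close> dominates a value of \<open>e\<close>, hence is nonnegative.\<close>
  have "\<exists>x. ereal (e x) \<le> s"
  proof (rule ccontr)
    assume "\<not> ?thesis"
    then have "AE x in (torus :: (real ^ 'd) measure). False" using ae by simp
    then show False by simp
  qed
  then have s0: "0 \<le> s" using eneg_nonneg order_trans unfolding e_def
    by (metis ereal_less_eq(5))
  have "compact (e ` cbox 0 1)"
    by (intro compact_continuous_image continuous_on_subset[OF ce] compact_cbox) auto
  then obtain B where "\<And>x. x \<in> cbox 0 1 \<Longrightarrow> e x \<le> B"
    by (metis bounded_imp_bdd_above bdd_above.E compact_imp_bounded imageI)
  then have "s \<le> ereal B" using cell_subset_cbox by (intro up) blast
  then have s: "s = ereal ?n" using s0 n by (cases s) auto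
  show "0 \<le> ?n" using s0 s by simp
  show "?n \<le> r" if "\<And>x. x \<in> cell \<Longrightarrow> eneg (F x) \<le> r"
    using up[of r] that s unfolding e_def by (metis ereal_less_eq(3))
  assume x: "x \<in> cell"
  show "eneg (F x) \<le> ?n"
  proof (rule AE_torus_continuous_le[OF ce[unfolded e_def] _ x])
    show "AE x in torus. eneg (F x) \<le> ?n"
      using ae unfolding s e_def by simp
  qed
qed

section \<open>Sections of measurable functions\<close>

lemma borel_measurable_lebesgue_on_AE_cong:
  fixes f g :: "'a::euclidean_space \<Rightarrow> 'b::euclidean_space"
  assumes A: "A \<in> sets lebesgue" and f: "f \<in> borel_measurable (lebesgue_on A)"
    and eq: "AE x in lebesgue_on A. f x = g x"
  shows "g \<in> borel_measurable (lebesgue_on A)"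
proof -
  have "(\<lambda>x. if x \<in> A then f x else 0) \<in> borel_measurable lebesgue"
    using f A by (simp add: borel_measurable_if)
  moreover have "AE x in lebesgue. (if x \<in> A then f x else 0) = (if x \<in> A then g x else 0)"
    using eq A by (auto simp: AE_restrict_space_iff elim!: eventually_mono)
  ultimately have "(\<lambda>x. if x \<in> A then g x else 0) \<in> borel_measurable lebesgue"
    by (rule borel_measurable_AE)
  then show ?thesis using A by (simp add: borel_measurable_if)
qed

lemma lebesgue_measurable_AE_cong_ennreal:
  fixes f g :: "'a::euclidean_space \<Rightarrow> ennreal"
  assumes f: "f \<in> borel_measurable lebesgue" and eq: "AE x in lebesgue. f x = g x"
  shows "g \<in> borel_measurable lebesgue"
proof (rule measurableI)
  fix S :: "ennreal set" assume S: "S \<in> sets borel"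
  have fS: "f -` S \<inter> space lebesgue \<in> sets lebesgue" using f S by (rule measurable_sets)
  show "g -` S \<inter> space lebesgue \<in> sets lebesgue"
    by (rule completion.in_sets_AE[OF _ fS]) (use eq in \<open>auto elim!: eventually_mono\<close>)
qed auto

context
  fixes f :: "'a::euclidean_space \<times> 'b::euclidean_space \<Rightarrow> ennreal"
  assumes f: "f \<in> borel_measurable lebesgue"
begin

text \<open>Lebesgue measure on a product is only the completion of the product measure, so sections
  of a Lebesgue measurable function are measurable for almost every parameter. A Borel version
  brings the Tonelli theorem for \<open>lborel\<close> into reach.\<close>

lemma lebesgue_section_borel:
  obtains g where "g \<in> borel_measurable (lborel \<Otimes>\<^sub>M lborel)"
    "AE t in lebesgue. AE x in lebesgue. f (t, x) = g (t, x)" "AE z in lebesgue. f z = g z"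
proof -
  obtain g where g: "g \<in> borel_measurable lborel" "AE z in lborel. f z = g z"
    using completion_ex_borel_measurable[OF f] by auto
  have "AE z in (lborel \<Otimes>\<^sub>M lborel :: ('a \<times> 'b) measure). f z = g z"
    using g(2) unfolding lborel_prod .
  from lborel_pair.AE_pair[OF this]
  have "AE t in lebesgue. AE x in lebesgue. f (t, x) = g (t, x)"
    by (simp add: AE_completion_iff)
  then show ?thesis using g by (intro that[of g]) (auto simp: lborel_prod AE_completion_iff)
qed

lemma AE_lebesgue_section_measurable: "AE t in lebesgue. (\<lambda>x. f (t, x)) \<in> borel_measurable lebesgue"
proof -
  obtain g where g: "g \<in> borel_measurable (lborel \<Otimes>\<^sub>M lborel)"
    "AE t in lebesgue. AE x in lebesgue. f (t, x) = g (t, x)" "AE z in lebesgue. f z = g z"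
    by (rule lebesgue_section_borel)
  have "(\<lambda>x. g (t, x)) \<in> borel_measurable lebesgue" for t
    using measurable_Pair2[OF g(1), of t] by (intro measurable_completion) simp
  then have "(\<lambda>x. f (t, x)) \<in> borel_measurable lebesgue" if "AE x in lebesgue. f (t, x) = g (t, x)" for t
  proof (rule lebesgue_measurable_AE_cong_ennreal)
    show "AE x in lebesgue. g (t, x) = f (t, x)"
      using that by (rule eventually_mono) simp
  qed
  with g(2) show ?thesis by (rule eventually_mono)
qed

lemma lebesgue_nn_integral_section_measurable:
    "(\<lambda>t. \<integral>\<^sup>+x. f (t, x) \<partial>lebesgue) \<in> borel_measurable lebesgue" (is ?m)
  and lebesgue_nn_integral_fst: "(\<integral>\<^sup>+z. f z \<partial>lebesgue) = (\<integral>\<^sup>+t. \<integral>\<^sup>+x. f (t, x) \<partial>lebesgue \<partial>lebesgue)" (is ?e)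
proof -
  obtain g where g: "g \<in> borel_measurable (lborel \<Otimes>\<^sub>M lborel)"
    "AE t in lebesgue. AE x in lebesgue. f (t, x) = g (t, x)" "AE z in lebesgue. f z = g z"
    by (rule lebesgue_section_borel)
  have eq: "AE t in lebesgue. (\<integral>\<^sup>+x. g (t, x) \<partial>lborel) = (\<integral>\<^sup>+x. f (t, x) \<partial>lebesgue)"
    using g(2)
  proof (rule eventually_mono)
    fix t assume "AE x in lebesgue. f (t, x) = g (t, x)"
    then have "(\<integral>\<^sup>+x. f (t, x) \<partial>lebesgue) = (\<integral>\<^sup>+x. g (t, x) \<partial>lebesgue)"
      by (rule nn_integral_cong_AE)
    then show "(\<integral>\<^sup>+x. g (t, x) \<partial>lborel) = (\<integral>\<^sup>+x. f (t, x) \<partial>lebesgue)"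
      by (simp add: nn_integral_completion)
  qed
  have m: "(\<lambda>t. \<integral>\<^sup>+x. g (t, x) \<partial>lborel) \<in> borel_measurable lborel"
    using g(1) by (rule lborel.borel_measurable_nn_integral_fst)
  show ?m
    by (rule lebesgue_measurable_AE_cong_ennreal[OF measurable_completion[OF m] eq])
  have "(\<integral>\<^sup>+z. f z \<partial>lebesgue) = (\<integral>\<^sup>+z. g z \<partial>lebesgue)"
    using g(3) by (rule nn_integral_cong_AE)
  also have "\<dots> = (\<integral>\<^sup>+z. g z \<partial>(lborel \<Otimes>\<^sub>M lborel))"
    by (simp add: nn_integral_completion lborel_prod)
  also have "\<dots> = (\<integral>\<^sup>+t. \<integral>\<^sup>+x. g (t, x) \<partial>lborel \<partial>lborel)"
    by (rule lborel.nn_integral_fst[OF g(1), symmetric])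
  also have "\<dots> = (\<integral>\<^sup>+t. \<integral>\<^sup>+x. g (t, x) \<partial>lborel \<partial>lebesgue)"
    by (simp add: nn_integral_completion)
  also have "\<dots> = (\<integral>\<^sup>+t. \<integral>\<^sup>+x. f (t, x) \<partial>lebesgue \<partial>lebesgue)"
    using eq by (rule nn_integral_cong_AE)
  finally show ?e .
qed

end

context
  fixes A :: "'a::euclidean_space set" and B :: "'b::euclidean_space set"
  assumes A [measurable]: "A \<in> sets borel" and B [measurable]: "B \<in> sets borel"
begin

lemma A_lebesgue: "A \<in> sets lebesgue" using A sets_completionI_sets[of A lborel] by simp
lemma B_lebesgue: "B \<in> sets lebesgue" using B sets_completionI_sets[of B lborel] by simp
lemma AB_lebesgue: "A \<times> B \<in> sets lebesgue"
  using sets_completionI_sets[of "A \<times> B" lborel] borel_Times[OF A B] by (metis sets_lborel)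

lemma indicator_Times_pair: "indicator (A \<times> B) (t, x) = (indicator A t * indicator B x :: ennreal)"
  by (auto simp: indicator_def)

context
  fixes f :: "'a \<times> 'b \<Rightarrow> ennreal"
  assumes f: "f \<in> borel_measurable (lebesgue_on (A \<times> B))"
begin

lemma AE_section_measurable_ennreal:
  "AE t in lebesgue_on A. (\<lambda>x. f (t, x)) \<in> borel_measurable (lebesgue_on B)"
proof -
  have "(\<lambda>z. f z * indicator (A \<times> B) z) \<in> borel_measurable lebesgue"
    using f AB_lebesgue by (simp add: borel_measurable_restrict_space_iff_ennreal)
  from AE_lebesgue_section_measurable[OF this]
  have "AE t in lebesgue. t \<in> A \<longrightarrow> (\<lambda>x. f (t, x)) \<in> borel_measurable (lebesgue_on B)"
  proof (rule eventually_mono, intro impI)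
    fix t assume "(\<lambda>x. f (t, x) * indicator (A \<times> B) (t, x)) \<in> borel_measurable lebesgue" "t \<in> A"
    then have "(\<lambda>x. f (t, x) * indicator B x) \<in> borel_measurable lebesgue"
      by (simp add: indicator_Times_pair)
    then show "(\<lambda>x. f (t, x)) \<in> borel_measurable (lebesgue_on B)"
      using B_lebesgue by (simp add: borel_measurable_restrict_space_iff_ennreal)
  qed
  then show ?thesis
    using A_lebesgue by (simp add: AE_restrict_space_iff)
qed

lemma nn_integral_section_measurable:
    "(\<lambda>t. \<integral>\<^sup>+x. f (t, x) \<partial>lebesgue_on B) \<in> borel_measurable (lebesgue_on A)" (is ?m)
  and nn_integral_lebesgue_on_fst:
    "(\<integral>\<^sup>+z. f z \<partial>lebesgue_on (A \<times> B)) = (\<integral>\<^sup>+t. \<integral>\<^sup>+x. f (t, x) \<partial>lebesgue_on B \<partial>lebesgue_on A)" (is ?e)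
proof -
  let ?g = "\<lambda>z. f z * indicator (A \<times> B) z"
  have g: "?g \<in> borel_measurable lebesgue"
    using f AB_lebesgue by (simp add: borel_measurable_restrict_space_iff_ennreal)
  have gA: "(\<integral>\<^sup>+x. ?g (t, x) \<partial>lebesgue) = (\<integral>\<^sup>+x. f (t, x) \<partial>lebesgue_on B) * indicator A t" for t
    using B_lebesgue by (simp add: indicator_Times_pair nn_integral_restrict_space indicator_def)
  show ?m
    using lebesgue_nn_integral_section_measurable[OF g] A_lebesgue
    unfolding gA by (simp add: borel_measurable_restrict_space_iff_ennreal)
  have "(\<integral>\<^sup>+z. f z \<partial>lebesgue_on (A \<times> B)) = (\<integral>\<^sup>+z. ?g z \<partial>lebesgue)"
    using AB_lebesgue by (simp add: nn_integral_restrict_space)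
  also have "\<dots> = (\<integral>\<^sup>+t. (\<integral>\<^sup>+x. f (t, x) \<partial>lebesgue_on B) * indicator A t \<partial>lebesgue)"
    unfolding lebesgue_nn_integral_fst[OF g] gA ..
  finally show ?e using A_lebesgue by (simp add: nn_integral_restrict_space)
qed

end

text \<open>Each coordinate is split into positive and negative part, to which the version for
  nonnegative functions applies.\<close>

lemma AE_section_measurable:
  fixes f :: "'a \<times> 'b \<Rightarrow> 'c::euclidean_space"
  assumes f: "f \<in> borel_measurable (lebesgue_on (A \<times> B))"
  shows "AE t in lebesgue_on A. (\<lambda>x. f (t, x)) \<in> borel_measurable (lebesgue_on B)"
proof -
  have "AE t in lebesgue_on A. (\<lambda>x. f (t, x) \<bullet> i) \<in> borel_measurable (lebesgue_on B)" for i
  proof -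
    have "(\<lambda>z. ennreal (f z \<bullet> i)) \<in> borel_measurable (lebesgue_on (A \<times> B))"
      "(\<lambda>z. ennreal (- (f z \<bullet> i))) \<in> borel_measurable (lebesgue_on (A \<times> B))"
      using f by measurable
    from this[THEN AE_section_measurable_ennreal] show ?thesis
    proof eventually_elim
      case (elim t)
      then have "(\<lambda>x. enn2real (ennreal (f (t, x) \<bullet> i)) - enn2real (ennreal (- (f (t, x) \<bullet> i))))
          \<in> borel_measurable (lebesgue_on B)"
        by measurable
      moreover have "enn2real (ennreal r) - enn2real (ennreal (- r)) = r" for r :: real
        by (cases "0 \<le> r") (auto simp: ennreal_neg)
      ultimately show ?case by simp
    qed
  qed
  then have "AE t in lebesgue_on A. \<forall>i\<in>Basis. (\<lambda>x. f (t, x) \<bullet> i) \<in> borel_measurable (lebesgue_on B)"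
    by (intro AE_ball_countable[THEN iffD2]) (auto simp: countable_finite)
  then show ?thesis
  proof (rule eventually_mono)
    fix t assume "\<forall>i\<in>Basis. (\<lambda>x. f (t, x) \<bullet> i) \<in> borel_measurable (lebesgue_on B)"
    then show "(\<lambda>x. f (t, x)) \<in> borel_measurable (lebesgue_on B)"
      by (subst borel_measurable_euclidean_space)
  qed
qed

lemma AE_pair_lebesgue_on:
  assumes P: "{z \<in> A \<times> B. \<not> P z} \<in> sets (lebesgue_on (A \<times> B))"
    and ae: "AE t in lebesgue_on A. AE x in lebesgue_on B. P (t, x)"
  shows "AE z in lebesgue_on (A \<times> B). P z"
proof -
  let ?N = "{z \<in> A \<times> B. \<not> P z}"
  have "(\<integral>\<^sup>+z. indicator ?N z \<partial>lebesgue_on (A \<times> B))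
      = (\<integral>\<^sup>+t. \<integral>\<^sup>+x. indicator ?N (t, x) \<partial>lebesgue_on B \<partial>lebesgue_on A)"
    using P by (intro nn_integral_lebesgue_on_fst) auto
  also have "\<dots> = (\<integral>\<^sup>+t. 0 \<partial>lebesgue_on A)"
  proof (rule nn_integral_cong_AE, use ae in eventually_elim)
    case (elim t)
    then have "(\<integral>\<^sup>+x. indicator ?N (t, x) \<partial>lebesgue_on B) = (\<integral>\<^sup>+x. 0 \<partial>lebesgue_on B)"
      by (intro nn_integral_cong_AE) (auto elim!: eventually_mono simp: indicator_def)
    then show ?case by simp
  qed
  finally have "emeasure (lebesgue_on (A \<times> B)) ?N = 0" using P by simp
  then show ?thesis using P AB_lebesgue by (intro AE_I[of _ _ ?N]) (auto simp: space_restrict_space)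
qed

lemma integrable_sections:
  fixes f :: "'a \<times> 'b \<Rightarrow> real"
  assumes f: "integrable (lebesgue_on (A \<times> B)) f"
  shows AE_section_integrable: "AE t in lebesgue_on A. integrable (lebesgue_on B) (\<lambda>x. f (t, x))" (is ?ae)
    and integrable_section_integral: "integrable (lebesgue_on A) (\<lambda>t. \<integral>x. f (t, x) \<partial>lebesgue_on B)" (is ?int)
proof -
  note fm = borel_measurable_integrable[OF f]
  have pm: "(\<lambda>z. ennreal (f z)) \<in> borel_measurable (lebesgue_on (A \<times> B))"
    "(\<lambda>z. ennreal (- f z)) \<in> borel_measurable (lebesgue_on (A \<times> B))"
    "(\<lambda>z. ennreal (norm (f z))) \<in> borel_measurable (lebesgue_on (A \<times> B))"
    using fm by measurable
  let ?N = "\<lambda>t. \<integral>\<^sup>+x. ennreal (norm (f (t, x))) \<partial>lebesgue_on B"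
  have fin: "(\<integral>\<^sup>+t. ?N t \<partial>lebesgue_on A) < \<infinity>"
    using f unfolding nn_integral_lebesgue_on_fst[OF pm(3), symmetric] by (simp add: integrable_iff_bounded)
  have "AE t in lebesgue_on A. ?N t \<noteq> \<infinity>"
    using fin by (intro nn_integral_PInf_AE nn_integral_section_measurable pm) auto
  with AE_section_measurable[OF fm] show ae: ?ae
    by eventually_elim (simp add: integrable_iff_bounded less_top)
  \<comment> \<open>The Bochner integral of a section agrees with this difference where the section
    is integrable, which is almost everywhere; completeness of Lebesgue measure transfers
    measurability.\<close>
  have m: "(\<lambda>t. enn2real (\<integral>\<^sup>+x. ennreal (f (t, x)) \<partial>lebesgue_on B) - enn2real (\<integral>\<^sup>+x. ennreal (- f (t, x)) \<partial>lebesgue_on B))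
      \<in> borel_measurable (lebesgue_on A)"
    using nn_integral_section_measurable[OF pm(1)] nn_integral_section_measurable[OF pm(2)] by measurable
  have "(\<lambda>t. \<integral>x. f (t, x) \<partial>lebesgue_on B) \<in> borel_measurable (lebesgue_on A)"
    by (rule borel_measurable_lebesgue_on_AE_cong[OF A_lebesgue m], use ae in eventually_elim)
       (simp add: real_lebesgue_integral_def)
  moreover have "(\<integral>\<^sup>+t. ennreal (norm (\<integral>x. f (t, x) \<partial>lebesgue_on B)) \<partial>lebesgue_on A) \<le> (\<integral>\<^sup>+t. ?N t \<partial>lebesgue_on A)"
    by (rule nn_integral_mono_AE, use ae in eventually_elim) (rule integral_norm_bound_ennreal)
  ultimately show ?int using fin by (intro integrableI_bounded) (auto intro: le_less_trans)
qed

end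

section \<open>Integrals over initial time intervals\<close>

text \<open>A primitive over one fixed measure space. Interval integrals between arbitrary times
  become differences of its values, and inequalities on subintervals become monotonicity
  statements.\<close>

definition tint :: "real \<Rightarrow> (real \<Rightarrow> real) \<Rightarrow> real \<Rightarrow> real" where
  "tint T f t = (\<integral>\<tau>. indicator {0<..<t} \<tau> * f \<tau> \<partial>lebesgue_on {0<..<T})"

lemma integrable_indicator_lebesgue_on:
  fixes f :: "real \<Rightarrow> real"
  assumes "integrable (lebesgue_on {0<..<T}) f"
  shows "integrable (lebesgue_on {0<..<T}) (\<lambda>\<tau>. indicator {s<..<t} \<tau> * f \<tau>)"
proof -
  have "{s<..<t} \<inter> {0<..<T} \<in> sets (lebesgue_on {0<..<T})"
    by (auto simp: sets_restrict_space)
  then have "integrable (lebesgue_on {0<..<T}) (\<lambda>\<tau>. indicator ({s<..<t} \<inter> {0<..<T}) \<tau> *\<^sub>R f \<tau>)"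
    using assms by (rule integrable_mult_indicator)
  then show ?thesis
    by (subst Bochner_Integration.integrable_cong[of _ _ _ "\<lambda>\<tau>. indicator ({s<..<t} \<inter> {0<..<T}) \<tau> *\<^sub>R f \<tau>"])
       (auto simp: indicator_def)
qed

lemma AE_lebesgue_neq: "AE x in (lebesgue :: real measure). x \<noteq> s"
  by (rule AE_completion) (rule AE_lborel_singleton)

lemma AE_lebesgue_on_neq: "AE x in lebesgue_on {0<..<T::real}. x \<noteq> s"
  using AE_lebesgue_neq[of s] by (auto simp: AE_restrict_space_iff elim: eventually_mono)

lemma tint_diff:
  assumes f: "integrable (lebesgue_on {0<..<T}) f" and st: "0 \<le> s" "s \<le> t"
  shows "tint T f t - tint T f s = (\<integral>\<tau>. indicator {s<..<t} \<tau> * f \<tau> \<partial>lebesgue_on {0<..<T})"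
proof -
  have "tint T f t - tint T f s
    = (\<integral>\<tau>. indicator {0<..<t} \<tau> * f \<tau> - indicator {0<..<s} \<tau> * f \<tau> \<partial>lebesgue_on {0<..<T})"
    unfolding tint_def by (intro Bochner_Integration.integral_diff[symmetric] integrable_indicator_lebesgue_on f)
  also have "\<dots> = (\<integral>\<tau>. indicator {s<..<t} \<tau> * f \<tau> \<partial>lebesgue_on {0<..<T})"
  proof (rule integral_cong_AE)
    show "AE \<tau> in lebesgue_on {0<..<T}. indicator {0<..<t} \<tau> * f \<tau> - indicator {0<..<s} \<tau> * f \<tau>
        = indicator {s<..<t} \<tau> * f \<tau>"
      using AE_lebesgue_on_neq[where s = s and T = T] AE_space
      by eventually_elim (use st in \<open>auto simp: indicator_def\<close>)
  qed (use integrable_indicator_lebesgue_on[OF f] in auto)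
  finally show ?thesis .
qed

text \<open>Both orders of the endpoints are covered, as the balances are required for almost all
  pairs of times.\<close>

lemma interval_integral_eq_tint:
  assumes f: "integrable (lebesgue_on {0<..<T}) f" and st: "s \<in> {0..T}" "t \<in> {0..T}"
  shows "(LINT \<tau>=s..t|lebesgue. f \<tau>) = tint T f t - tint T f s"
proof -
  have *: "(LINT \<tau>:{s<..<t}|lebesgue. f \<tau>) = tint T f t - tint T f s"
    if "s \<le> t" "s \<in> {0..T}" "t \<in> {0..T}" for s t
  proof -
    have "(LINT \<tau>:{s<..<t}|lebesgue. f \<tau>)
        = (\<integral>\<tau>. indicator {0<..<T} \<tau> *\<^sub>R (indicator {s<..<t} \<tau> * f \<tau>) \<partial>lebesgue)"
      unfolding set_lebesgue_integral_def
      by (rule Bochner_Integration.integral_cong) (use that in \<open>auto simp: indicator_def\<close>)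
    also have "\<dots> = (\<integral>\<tau>. indicator {s<..<t} \<tau> * f \<tau> \<partial>lebesgue_on {0<..<T})"
      by (subst integral_restrict_space) auto
    finally show ?thesis using tint_diff[OF f, of s t] that by simp
  qed
  show ?thesis
    unfolding interval_lebesgue_integral_def
    using *[of s t] *[of t s] st by (auto simp: einterval_eq_Icc)
qed

lemma tint_linear:
  assumes "integrable (lebesgue_on {0<..<T}) f" "integrable (lebesgue_on {0<..<T}) g"
  shows "tint T (\<lambda>\<tau>. f \<tau> + c * g \<tau>) t = tint T f t + c * tint T g t"
  unfolding tint_def
  using integrable_indicator_lebesgue_on[OF assms(1), of 0 t] integrable_indicator_lebesgue_on[OF assms(2), of 0 t]
  by (simp add: algebra_simps)

lemma tint_sum:
  assumes "\<And>k. k \<in> K \<Longrightarrow> integrable (lebesgue_on {0<..<T}) (f k)"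
  shows "tint T (\<lambda>\<tau>. \<Sum>k\<in>K. c k * f k \<tau>) t = (\<Sum>k\<in>K. c k * tint T (f k) t)"
proof -
  have "tint T (\<lambda>\<tau>. \<Sum>k\<in>K. c k * f k \<tau>) t
      = (\<integral>\<tau>. (\<Sum>k\<in>K. c k * (indicator {0<..<t} \<tau> * f k \<tau>)) \<partial>lebesgue_on {0<..<T})"
    unfolding tint_def by (simp add: sum_distrib_left mult_ac)
  also have "\<dots> = (\<Sum>k\<in>K. c k * tint T (f k) t)"
    unfolding tint_def using integrable_indicator_lebesgue_on[OF assms]
    by (subst Bochner_Integration.integral_sum) auto
  finally show ?thesis .
qed

lemma tint_mono_diff:
  assumes "integrable (lebesgue_on {0<..<T}) f" "integrable (lebesgue_on {0<..<T}) g"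
    and "AE \<tau> in lebesgue_on {0<..<T}. f \<tau> \<le> g \<tau>" and "0 \<le> s" "s \<le> t"
  shows "tint T f t - tint T f s \<le> tint T g t - tint T g s"
  unfolding tint_diff[OF assms(1,4,5)] tint_diff[OF assms(2,4,5)]
  by (intro integral_mono_AE integrable_indicator_lebesgue_on assms(1,2), use assms(3) in eventually_elim)
     (auto simp: indicator_def)

lemma tint_cong_AE:
  assumes "integrable (lebesgue_on {0<..<T}) f" "integrable (lebesgue_on {0<..<T}) g"
    and "AE \<tau> in lebesgue_on {0<..<T}. f \<tau> = g \<tau>"
  shows "tint T f t = tint T g t"
  unfolding tint_def
  by (intro integral_cong_AE, use assms integrable_indicator_lebesgue_on in auto)

lemma tint_0 [simp]: "tint T f 0 = 0"
  by (simp add: tint_def)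

lemma emeasure_lebesgue_on_Ioo:
  assumes "0 \<le> s" "s \<le> t" "t \<le> T"
  shows "emeasure (lebesgue_on {0<..<T::real}) {s<..<t} = ennreal (t - s)"
proof -
  have "{s<..<t} \<subseteq> {0<..<T}" using assms by auto
  then show ?thesis using assms by (simp add: emeasure_restrict_space)
qed

lemma finite_measure_lebesgue_on_Ioo: "finite_measure (lebesgue_on {0<..<T::real})"
  by (rule finite_measureI) (cases "0 \<le> T"; simp add: emeasure_restrict_space)

lemma tint_const:
  assumes "0 \<le> t" "t \<le> T"
  shows "tint T (\<lambda>_. c) t = c * t"
proof -
  have "measure (lebesgue_on {0<..<T}) {0<..<t} = t"
    using emeasure_lebesgue_on_Ioo[of 0 t T] assms by (simp add: measure_def)
  moreover have "space (lebesgue_on {0<..<T}) \<inter> {0<..<t} = {0<..<t}" using assms by auto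
  ultimately show ?thesis unfolding tint_def using assms by (simp add: Int_commute)
qed

lemma integrable_const_lebesgue_on: "integrable (lebesgue_on {0<..<T::real}) (\<lambda>_. c :: real)"
  using finite_measure.integrable_const[OF finite_measure_lebesgue_on_Ioo] .

lemma tint_diff_abs_le:
  assumes f: "integrable (lebesgue_on {0<..<T}) f" and B: "AE \<tau> in lebesgue_on {0<..<T}. \<bar>f \<tau>\<bar> \<le> B"
    and st: "0 \<le> s" "s \<le> t" "t \<le> T"
  shows "\<bar>tint T f t - tint T f s\<bar> \<le> B * (t - s)"
proof -
  have "tint T f t - tint T f s \<le> tint T (\<lambda>_. B) t - tint T (\<lambda>_. B) s"
    by (rule tint_mono_diff[OF f integrable_const_lebesgue_on]) (use B st in \<open>auto elim: eventually_mono\<close>)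
  moreover have "tint T (\<lambda>_. - B) t - tint T (\<lambda>_. - B) s \<le> tint T f t - tint T f s"
    by (rule tint_mono_diff[OF integrable_const_lebesgue_on f]) (use B st in \<open>auto elim: eventually_mono\<close>)
  ultimately show ?thesis using st by (simp add: tint_const algebra_simps)
qed

section \<open>Pointwise control of the state by the entropy\<close>

lemma convective_norm: "norm (convective h m) = (norm m)\<^sup>2 / \<bar>h\<bar>"
proof -
  have eq: "outer m m \<bullet> outer m m = (m \<bullet> m)\<^sup>2"
    by (simp add: outer_inner) (simp add: outer_def matrix_vector_mult_def inner_vec_def
        sum_distrib_left sum_distrib_right power2_eq_square mult_ac)
  have "norm (outer m m) = (norm m)\<^sup>2"
    unfolding norm_eq_sqrt_inner[of "outer m m"] eq by (simp add: power2_norm_eq_inner)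
  then show ?thesis by (simp add: convective_def)
qed

text \<open>Finite entropy leaves two cases, positive density or vacuum with zero momentum. In the
  first, the norm of the convective term is twice the kinetic part and the pressure is
  \<open>\<gamma> - 1\<close> times the internal part.\<close>

lemma eta_bounds:
  assumes "0 < a" "1 < \<gamma>" "eta a \<gamma> h m = ereal r"
  shows "0 \<le> h" "0 \<le> r" "norm (convective h m) \<le> 2 * r" "0 \<le> pressure a \<gamma> h" "pressure a \<gamma> h \<le> (\<gamma> - 1) * r"
proof -
  consider "h > 0" "r = (norm m)\<^sup>2 / (2 * h) + a / (\<gamma> - 1) * h powr \<gamma>" | "h = 0" "m = 0" "r = 0"
    using assms(3) by (auto simp: eta_def zero_ereal_def split: if_splits)
  then have "0 \<le> h \<and> 0 \<le> r \<and> norm (convective h m) \<le> 2 * r \<and> 0 \<le> pressure a \<gamma> h \<and> pressure a \<gamma> h \<le> (\<gamma> - 1) * r"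
  proof cases
    case 1
    have "norm (convective h m) = 2 * ((norm m)\<^sup>2 / (2 * h))"
      using 1 by (simp add: convective_norm)
    moreover have "pressure a \<gamma> h = (\<gamma> - 1) * (a / (\<gamma> - 1) * h powr \<gamma>)"
      using assms by (simp add: pressure_def)
    moreover have "0 \<le> (norm m)\<^sup>2 / (2 * h)" "0 \<le> a / (\<gamma> - 1) * h powr \<gamma>"
      using 1 assms by auto
    ultimately show ?thesis using 1 assms by (auto simp: distrib_left)
  next
    case 2
    then show ?thesis by (simp add: convective_norm pressure_def)
  qed
  then show "0 \<le> h" "0 \<le> r" "norm (convective h m) \<le> 2 * r" "0 \<le> pressure a \<gamma> h" "pressure a \<gamma> h \<le> (\<gamma> - 1) * r"
    by auto
qed

lemma measurable_eta [measurable]: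
  assumes [measurable]: "f \<in> borel_measurable M" "g \<in> borel_measurable M"
  shows "(\<lambda>x. eta a \<gamma> (f x) (g x :: real ^ 'd)) \<in> borel_measurable M"
  unfolding eta_def by measurable

lemma measurable_pressure [measurable]:
  assumes [measurable]: "f \<in> borel_measurable M"
  shows "(\<lambda>x. pressure a \<gamma> (f x)) \<in> borel_measurable M"
  unfolding pressure_def by measurable

lemma continuous_on_outer: "continuous_on UNIV (\<lambda>v :: real ^ 'd. outer v v)"
  unfolding outer_def by (intro continuous_on_vec_lambda continuous_intros)

lemma measurable_convective [measurable]:
  assumes [measurable]: "f \<in> borel_measurable M" "g \<in> borel_measurable M"
  shows "(\<lambda>x. convective (f x) (g x :: real ^ 'd)) \<in> borel_measurable M"
proof -
  have "(\<lambda>x. outer (g x) (g x)) \<in> borel_measurable M"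
    using measurable_compose[OF assms(2) borel_measurable_continuous_onI[OF continuous_on_outer]] .
  then show ?thesis unfolding convective_def by measurable
qed

lemma le_one_plus_powr:
  fixes x p :: real
  assumes "0 \<le> x" "1 \<le> p"
  shows "x \<le> 1 + x powr p"
proof (cases "x \<le> 1")
  case False
  then have "x powr 1 \<le> x powr p" using assms by (intro powr_mono) auto
  then show ?thesis using False by simp
qed (simp add: add_increasing2)

text \<open>\<open>outer m m\<close> pairs with \<open>A\<close> through the quadratic form of
  \<open>A\<close>. This reconciles \<open>nabla\<close> in the variational inequality with its
  symmetric part in the momentum balance.\<close>

lemma sym_inner_convective: "convective h m \<bullet> A = convective h m \<bullet> sym_part A"
  by (simp add: convective_def outer_inner sym_part_quadratic)

lemma mat_1_inner: "mat 1 \<bullet> A = trace A"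
  by (simp add: mat_def inner_vec_def trace_def if_distrib[of "\<lambda>x. x * _"] cong: if_cong)

section \<open>Fields of bounded energy\<close>

text \<open>The derivatives of a test are arranged as a field dual to the state \<open>U\<close>,
  which lists density, momentum, convective term and pressure. Mass and momentum fluxes become
  instances of one pairing.\<close>

definition mass_test :: "real \<Rightarrow> (real \<Rightarrow> real ^ 'd \<Rightarrow> real) \<Rightarrow> real \<Rightarrow> real ^ 'd \<Rightarrow> real \<times> (real ^ 'd) \<times> (real ^ 'd ^ 'd) \<times> real" where
  "mass_test T \<rho> t x = (dt T \<rho> t x, grad (\<rho> t) x, 0, 0)"

definition momentum_test :: "real \<Rightarrow> (real \<Rightarrow> real ^ 'd \<Rightarrow> real ^ 'd) \<Rightarrow> real \<Rightarrow> real ^ 'd \<Rightarrow> real \<times> (real ^ 'd) \<times> (real ^ 'd ^ 'd) \<times> real" where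
  "momentum_test T \<phi> t x = (0, dt T \<phi> t x, nabla (\<phi> t) x, trace (nabla (\<phi> t) x))"

text \<open>\<open>K_weight\<close> without its constant factor.\<close>

definition neg_norm :: "(real ^ 'd \<Rightarrow> real ^ 'd) \<Rightarrow> real" where
  "neg_norm \<phi> = Linf_norm (\<lambda>x. neg_part (sym_part (nabla \<phi> x)))"

lemma continuous_on_mass_test:
  assumes "0 < T" "C1_torus T \<rho>"
  shows "continuous_on ({0..T} \<times> UNIV) (\<lambda>(t, x). mass_test T \<rho> t x)"
  using C1_torus_continuous_dt[OF assms] C1_torus_continuous_grad[OF assms]
  unfolding mass_test_def case_prod_unfold by (intro continuous_intros)

lemma continuous_on_trace: "continuous_on X (trace :: real ^ 'd ^ 'd \<Rightarrow> real)"
  unfolding trace_def[abs_def] by (intro continuous_intros)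

lemma continuous_on_momentum_test:
  assumes "0 < T" "C1_torus T \<phi>"
  shows "continuous_on ({0..T} \<times> UNIV) (\<lambda>(t, x). momentum_test T \<phi> t x)"
  using C1_torus_continuous_dt[OF assms] C1_torus_continuous_nabla[OF assms]
    continuous_on_compose2[OF continuous_on_trace[of UNIV] C1_torus_continuous_nabla[OF assms]]
  unfolding momentum_test_def case_prod_unfold by (intro continuous_intros) auto

lemma continuous_on_section:
  assumes "continuous_on (S \<times> UNIV) (\<lambda>(t, x). k t x)" "t \<in> S"
  shows "continuous_on UNIV (k t)"
proof -
  have "continuous_on UNIV (\<lambda>x. (\<lambda>(t, x). k t x) (t, x))"
    by (rule continuous_on_compose2[OF assms(1)]) (use assms(2) in \<open>auto intro!: continuous_intros\<close>)
  then show ?thesis by simp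
qed

lemma continuous_bounded_cell:
  fixes k :: "real \<Rightarrow> real ^ 'd \<Rightarrow> 'b::real_normed_vector"
  assumes "continuous_on ({0..T} \<times> UNIV) (\<lambda>(t, x). k t x)"
  obtains B where "0 \<le> B" "\<And>t x. t \<in> {0..T} \<Longrightarrow> x \<in> cell \<Longrightarrow> norm (k t x) \<le> B"
proof -
  have "compact ((\<lambda>(t, x). k t x) ` ({0..T} \<times> cbox 0 1))" (is "compact ?K")
    by (intro compact_continuous_image continuous_on_subset[OF assms] compact_Times) auto
  then have "bounded ?K" by (rule compact_imp_bounded)
  then obtain B where B: "\<And>z. z \<in> ?K \<Longrightarrow> norm z \<le> B"
    unfolding bounded_iff by blast
  show ?thesis
  proof (rule that[of "max 0 B"])
    fix t x assume "t \<in> {0..T}" "x \<in> (cell :: (real ^ 'd) set)"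
    then have "k t x \<in> (\<lambda>(t, x). k t x) ` ({0..T} \<times> cbox 0 1)"
      using cell_subset_cbox by (intro image_eqI[of _ _ "(t, x)"]) auto
    then have "norm (k t x) \<le> B" by (rule B)
    then show "norm (k t x) \<le> max 0 B" by simp
  qed simp
qed

lemma measurable_continuous_cell:
  fixes k :: "real \<Rightarrow> real ^ 'd \<Rightarrow> 'b::real_normed_vector"
  assumes "continuous_on ({0..T} \<times> UNIV) (\<lambda>(t, x). k t x)"
  shows "(\<lambda>(t, x). k t x) \<in> borel_measurable (lebesgue_on ({0<..<T} \<times> cell))"
proof (rule continuous_imp_measurable_on_sets_lebesgue)
  show "continuous_on ({0<..<T} \<times> cell) (\<lambda>(t, x). k t x)"
    by (rule continuous_on_subset[OF assms]) auto
  show "{0<..<T} \<times> (cell :: (real ^ 'd) set) \<in> sets lebesgue"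
    by (rule AB_lebesgue) auto
qed

lemma measurable_continuous_torus:
  fixes k :: "real ^ 'd \<Rightarrow> 'b::real_normed_vector"
  assumes "continuous_on UNIV k"
  shows "k \<in> borel_measurable torus"
  by (intro measurable_restrict_space1 measurable_completion)
     (simp add: borel_measurable_continuous_onI[OF assms])

lemma neg_norm_facts:
  assumes "0 < T" "C1_torus T \<phi>" "t \<in> {0..T}"
  shows neg_norm_nonneg: "0 \<le> neg_norm (\<phi> t)"
    and neg_norm_ge: "x \<in> cell \<Longrightarrow> eneg (nabla (\<phi> t) x) \<le> neg_norm (\<phi> t)"
    and neg_norm_le: "(\<And>x. x \<in> cell \<Longrightarrow> eneg (nabla (\<phi> t) x) \<le> r) \<Longrightarrow> neg_norm (\<phi> t) \<le> r"
proof -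
  note c = continuous_on_section[OF C1_torus_continuous_nabla[OF assms(1,2)] assms(3)]
  show "0 \<le> neg_norm (\<phi> t)"
    unfolding neg_norm_def by (rule Linf_norm_nonneg[OF c])
  show "x \<in> cell \<Longrightarrow> eneg (nabla (\<phi> t) x) \<le> neg_norm (\<phi> t)"
    unfolding neg_norm_def by (rule Linf_norm_ge[OF c])
  show "(\<And>x. x \<in> cell \<Longrightarrow> eneg (nabla (\<phi> t) x) \<le> r) \<Longrightarrow> neg_norm (\<phi> t) \<le> r"
    unfolding neg_norm_def by (rule Linf_norm_le[OF c])
qed

lemma neg_norm_le_add:
  assumes T: "0 < T" and \<phi>: "C1_torus T \<phi>" "t \<in> {0..T}" and \<psi>: "C1_torus T \<psi>" "s \<in> {0..T}"
    and e: "\<And>x. x \<in> cell \<Longrightarrow> norm (nabla (\<phi> t) x - nabla (\<psi> s) x) \<le> e"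
  shows "neg_norm (\<phi> t) \<le> neg_norm (\<psi> s) + e"
proof (rule neg_norm_le[OF T \<phi>])
  fix x :: "real ^ 'a" assume x: "x \<in> cell"
  show "eneg (nabla (\<phi> t) x) \<le> neg_norm (\<psi> s) + e"
    using eneg_dist[of "nabla (\<phi> t) x" "nabla (\<psi> s) x"] e[OF x] neg_norm_ge[OF T \<psi> x] by linarith
qed

lemma neg_norm_dist:
  assumes T: "0 < T" and \<phi>: "C1_torus T \<phi>" "t \<in> {0..T}" and \<psi>: "C1_torus T \<psi>" "s \<in> {0..T}"
    and e: "\<And>x. x \<in> cell \<Longrightarrow> norm (nabla (\<phi> t) x - nabla (\<psi> s) x) \<le> e"
  shows "\<bar>neg_norm (\<phi> t) - neg_norm (\<psi> s)\<bar> \<le> e"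
  using neg_norm_le_add[OF T \<phi> \<psi> e] neg_norm_le_add[OF T \<psi> \<phi>, of e] e
  by (simp add: norm_minus_commute abs_le_iff)

text \<open>Uniform continuity of \<open>nabla\<close> on a compact cylinder combined with the
  Lipschitz bound for \<open>eneg\<close>. It makes the defect measurable in time.\<close>

lemma continuous_on_neg_norm:
  assumes T: "0 < T" and \<phi>: "C1_torus T \<phi>"
  shows "continuous_on {0..T} (\<lambda>t. neg_norm (\<phi> t))"
proof (rule continuous_onI)
  fix t e :: real assume t: "t \<in> {0..T}" and e: "0 < e"
  have "uniformly_continuous_on ({0..T} \<times> cbox 0 1) (\<lambda>(t, x). nabla (\<phi> t) x)"
    by (intro compact_uniformly_continuous continuous_on_subset[OF C1_torus_continuous_nabla[OF T \<phi>]]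
        compact_Times) auto
  then obtain d where d: "d > 0" "\<And>z z'. z \<in> {0..T} \<times> cbox 0 1 \<Longrightarrow> z' \<in> {0..T} \<times> cbox 0 1 \<Longrightarrow> dist z' z < d \<Longrightarrow>
      dist (case z' of (t, x) \<Rightarrow> nabla (\<phi> t) x) (case z of (t, x) \<Rightarrow> nabla (\<phi> t) x) < e"
    using e unfolding uniformly_continuous_on_def by blast
  show "\<exists>d>0. \<forall>s\<in>{0..T}. dist s t < d \<longrightarrow> dist (neg_norm (\<phi> s)) (neg_norm (\<phi> t)) \<le> e"
  proof (intro exI[of _ d] conjI ballI impI d(1))
    fix s assume s: "s \<in> {0..T}" "dist s t < d"
    have "norm (nabla (\<phi> s) x - nabla (\<phi> t) x) \<le> e" if "x \<in> cell" for x
    proof -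
      have "dist (s, x) (t, x) < d" using s(2) by (simp add: dist_Pair_Pair)
      then show ?thesis
        using d(2)[of "(t, x)" "(s, x)"] that s(1) t cell_subset_cbox by (force simp: dist_norm)
    qed
    then show "dist (neg_norm (\<phi> s)) (neg_norm (\<phi> t)) \<le> e"
      unfolding dist_real_def using neg_norm_dist[OF T \<phi> s(1) \<phi> t] by blast
  qed
qed

text \<open>Common ground of the two implications. In both, measurability of \<open>E\<close> will
  come from its monotonicity and the bound \<open>C\<close> from bounded variation.\<close>

locale euler_fields =
  fixes a \<gamma> T C :: real
    and h :: "real \<Rightarrow> real ^ 'd \<Rightarrow> real" and m :: "real \<Rightarrow> real ^ 'd \<Rightarrow> real ^ 'd"
    and E :: "real \<Rightarrow> real"
  assumes T: "0 < T" and a: "0 < a" and \<gamma>: "1 < \<gamma>"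
    and h: "Linf_Lp T \<gamma> h" and m: "Linf_Lp T (2 * \<gamma> / (1 + \<gamma>)) m"
    and E_meas: "E \<in> borel_measurable (lebesgue_on {0<..<T})"
    and E_bdd: "AE t in lebesgue_on {0<..<T}. \<bar>E t\<bar> \<le> C"
    and energy_le: "AE t in lebesgue_on {0<..<T}. energy a \<gamma> (h t) (m t) \<le> ereal (E t)"
begin

definition en :: "real \<Rightarrow> real" where
  "en t = real_of_ereal (energy a \<gamma> (h t) (m t))"

definition U :: "real \<Rightarrow> real ^ 'd \<Rightarrow> real \<times> (real ^ 'd) \<times> (real ^ 'd ^ 'd) \<times> real" where
  "U t x = (h t x, m t x, convective (h t x) (m t x), pressure a \<gamma> (h t x))"

definition flux :: "(real \<Rightarrow> real ^ 'd \<Rightarrow> real \<times> (real ^ 'd) \<times> (real ^ 'd ^ 'd) \<times> real) \<Rightarrow> real \<Rightarrow> real" where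
  "flux k t = (\<integral>x. U t x \<bullet> k t x \<partial>torus)"

abbreviation "I \<equiv> lebesgue_on {0<..<T}"
abbreviation "\<Omega> \<equiv> lebesgue_on ({0<..<T} \<times> (cell :: (real ^ 'd) set))"

lemma h_measurable [measurable]: "(\<lambda>z. h (fst z) (snd z)) \<in> borel_measurable \<Omega>"
  and m_measurable [measurable]: "(\<lambda>z. m (fst z) (snd z)) \<in> borel_measurable \<Omega>"
  using h m by (auto simp: Linf_Lp_def case_prod_unfold)

lemma U_measurable: "(\<lambda>z. U (fst z) (snd z)) \<in> borel_measurable \<Omega>"
  unfolding U_def by measurable

lemma eta_measurable: "(\<lambda>z. e2ennreal (eta a \<gamma> (h (fst z) (snd z)) (m (fst z) (snd z)))) \<in> borel_measurable \<Omega>"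
  by measurable

lemma AE_I_range: "AE t in I. t \<in> {0<..<T}"
  using AE_space[of I] by (simp add: space_restrict_space)

lemma AE_sections:
  "AE t in I. h t \<in> borel_measurable torus \<and> m t \<in> borel_measurable torus \<and> U t \<in> borel_measurable torus \<and>
     (\<lambda>x. e2ennreal (eta a \<gamma> (h t x) (m t x))) \<in> borel_measurable torus"
proof -
  have IB: "{0<..<T} \<in> sets borel" by simp
  show ?thesis
    using AE_section_measurable[OF IB cell_borel h_measurable] AE_section_measurable[OF IB cell_borel m_measurable]
      AE_section_measurable[OF IB cell_borel U_measurable] AE_section_measurable_ennreal[OF IB cell_borel eta_measurable]
    by eventually_elim (simp add: eta_contract_eq)
qed

lemma AE_en: "AE t in I. energy a \<gamma> (h t) (m t) = ereal (en t) \<and> 0 \<le> en t \<and> en t \<le> E t"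
  using energy_le
proof (rule eventually_mono)
  fix t assume le: "energy a \<gamma> (h t) (m t) \<le> ereal (E t)"
  have "0 \<le> energy a \<gamma> (h t) (m t)" by (simp add: energy_def)
  then show "energy a \<gamma> (h t) (m t) = ereal (en t) \<and> 0 \<le> en t \<and> en t \<le> E t"
    using le unfolding en_def by (cases "energy a \<gamma> (h t) (m t)") auto
qed

lemma en_measurable [measurable]: "en \<in> borel_measurable I"
proof -
  have "(\<lambda>t. \<integral>\<^sup>+ x. e2ennreal (eta a \<gamma> (h t x) (m t x)) \<partial>torus) \<in> borel_measurable I"
    using nn_integral_section_measurable[OF _ cell_borel eta_measurable] by simp
  then show ?thesis unfolding en_def[abs_def] energy_def by measurable
qed

lemma AE_nn_integral_eta_le:
  "AE t in I. (\<integral>\<^sup>+ x. e2ennreal (eta a \<gamma> (h t x) (m t x)) \<partial>torus) \<le> ennreal C"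
  using AE_en E_bdd
proof eventually_elim
  case (elim t)
  then have "energy a \<gamma> (h t) (m t) \<le> ereal C" by simp
  then have "e2ennreal (enn2ereal (\<integral>\<^sup>+ x. e2ennreal (eta a \<gamma> (h t x) (m t x)) \<partial>torus)) \<le> e2ennreal (ereal C)"
    unfolding energy_def by (rule e2ennreal_mono)
  then show ?case by (simp add: ennreal.abs_eq)
qed

text \<open>Where the entropy is infinite, so is the right-hand side. Elsewhere density and momentum
  are at most one plus their powers, and the factor \<open>\<gamma> + 1\<close> is \<open>2\<close>
  from the convective term plus \<open>\<gamma> - 1\<close> from the pressure.\<close>

lemma norm_U_le:
  "ennreal (norm (U t x)) \<le> (1 + ennreal (norm (h t x) powr \<gamma>)) + (1 + ennreal (norm (m t x) powr (2 * \<gamma> / (1 + \<gamma>))))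
     + ennreal (\<gamma> + 1) * e2ennreal (eta a \<gamma> (h t x) (m t x))"
proof (cases "eta a \<gamma> (h t x) (m t x) = \<infinity>")
  case True
  then show ?thesis using \<gamma> by (simp add: ennreal_mult_top)
next
  case False
  then obtain r where r: "eta a \<gamma> (h t x) (m t x) = ereal r"
    by (auto simp: eta_def zero_ereal_def split: if_splits)
  note b = eta_bounds[OF a \<gamma> r]
  have q: "1 \<le> 2 * \<gamma> / (1 + \<gamma>)" using \<gamma> by (simp add: field_simps)
  have "norm (U t x) \<le> norm (h t x) + (norm (m t x) + (norm (convective (h t x) (m t x)) + norm (pressure a \<gamma> (h t x))))"
    unfolding U_def by (intro order_trans[OF norm_Pair_le] add_left_mono order_refl)
  also have "\<dots> \<le> (1 + norm (h t x) powr \<gamma>) + ((1 + norm (m t x) powr (2 * \<gamma> / (1 + \<gamma>))) + (2 * r + (\<gamma> - 1) * r))"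
    using b q \<gamma> by (intro add_mono le_one_plus_powr) auto
  also have "\<dots> = (1 + norm (h t x) powr \<gamma>) + (1 + norm (m t x) powr (2 * \<gamma> / (1 + \<gamma>))) + (\<gamma> + 1) * r"
    by (simp add: algebra_simps)
  finally have "ennreal (norm (U t x)) \<le> ennreal (\<dots>)" by (rule ennreal_leI)
  also have "\<dots> = (1 + ennreal (norm (h t x) powr \<gamma>)) + (1 + ennreal (norm (m t x) powr (2 * \<gamma> / (1 + \<gamma>))))
     + ennreal (\<gamma> + 1) * ennreal r"
    using b \<gamma> by (simp add: ennreal_plus ennreal_mult)
  also have "ennreal r = e2ennreal (eta a \<gamma> (h t x) (m t x))" unfolding r by simp
  finally show ?thesis .
qed

lemma ex_CU: "\<exists>B\<ge>0. AE t in I. (\<integral>\<^sup>+ x. ennreal (norm (U t x)) \<partial>torus) \<le> ennreal B"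
proof -
  obtain C1 C2 where C1: "AE t in I. (\<integral>\<^sup>+ x. ennreal (norm (h t x) powr \<gamma>) \<partial>torus) \<le> ennreal C1"
    and C2: "AE t in I. (\<integral>\<^sup>+ x. ennreal (norm (m t x) powr (2 * \<gamma> / (1 + \<gamma>))) \<partial>torus) \<le> ennreal C2"
    using h m unfolding Linf_Lp_def by blast
  let ?B = "(1 + ennreal C1) + (1 + ennreal C2) + ennreal (\<gamma> + 1) * ennreal C"
  have "AE t in I. (\<integral>\<^sup>+ x. ennreal (norm (U t x)) \<partial>torus) \<le> ?B"
    using AE_sections C1 C2 AE_nn_integral_eta_le
  proof eventually_elim
    case (elim t)
    then have [measurable]: "h t \<in> borel_measurable torus" "m t \<in> borel_measurable torus"
      "(\<lambda>x. e2ennreal (eta a \<gamma> (h t x) (m t x))) \<in> borel_measurable torus" by auto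
    have "(\<integral>\<^sup>+ x. ennreal (norm (U t x)) \<partial>torus) \<le>
      (\<integral>\<^sup>+ x. (1 + ennreal (norm (h t x) powr \<gamma>)) + (1 + ennreal (norm (m t x) powr (2 * \<gamma> / (1 + \<gamma>))))
     + ennreal (\<gamma> + 1) * e2ennreal (eta a \<gamma> (h t x) (m t x)) \<partial>torus)"
      by (intro nn_integral_mono norm_U_le)
    also have "\<dots> = (1 + (\<integral>\<^sup>+ x. ennreal (norm (h t x) powr \<gamma>) \<partial>torus))
       + (1 + (\<integral>\<^sup>+ x. ennreal (norm (m t x) powr (2 * \<gamma> / (1 + \<gamma>))) \<partial>torus))
       + ennreal (\<gamma> + 1) * (\<integral>\<^sup>+ x. e2ennreal (eta a \<gamma> (h t x) (m t x)) \<partial>torus)"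
      by (simp add: nn_integral_add nn_integral_cmult emeasure_torus)
    also have "\<dots> \<le> ?B"
      using elim by (intro add_mono mult_left_mono order_refl) auto
    finally show ?case .
  qed
  moreover have "?B = ennreal (enn2real ?B)" by (simp add: ennreal_enn2real_if ennreal_mult_eq_top_iff)
  ultimately show ?thesis by (intro exI[of _ "enn2real ?B"]) auto
qed

definition CU :: real where
  "CU = (SOME B. 0 \<le> B \<and> (AE t in I. (\<integral>\<^sup>+ x. ennreal (norm (U t x)) \<partial>torus) \<le> ennreal B))"

lemma CU: "0 \<le> CU" "AE t in I. (\<integral>\<^sup>+ x. ennreal (norm (U t x)) \<partial>torus) \<le> ennreal CU"
  using someI_ex[OF ex_CU[unfolded Bex_def, simplified]] unfolding CU_def by auto

lemma AE_U: "AE t in I. integrable torus (U t) \<and> (\<integral>x. norm (U t x) \<partial>torus) \<le> CU"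
  using AE_sections CU(2)
proof eventually_elim
  case (elim t)
  then have i: "integrable torus (U t)"
    by (intro integrableI_bounded) (auto intro: le_less_trans)
  then have "ennreal (\<integral>x. norm (U t x) \<partial>torus) \<le> ennreal CU"
    using elim by (subst nn_integral_eq_integral[symmetric]) auto
  then show ?case using i CU(1) by simp
qed

lemma integrable_hm:
  assumes "integrable torus (U t)"
  shows "integrable torus (h t)" "integrable torus (m t)"
proof -
  show "integrable torus (h t)" using integrable_fst[OF assms] by (simp add: U_def)
  show "integrable torus (m t)" using integrable_fst[OF integrable_snd[OF assms]] by (simp add: U_def)
qed

text \<open>Negative density has infinite entropy, which finite energy excludes almost everywhere in
  space at almost every time.\<close>

lemma nonneg_h: "AE z in \<Omega>. 0 \<le> h (fst z) (snd z)"
proof (rule AE_pair_lebesgue_on)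
  have "{z \<in> space \<Omega>. \<not> 0 \<le> h (fst z) (snd z)} \<in> sets \<Omega>" by measurable
  then show "{z \<in> {0<..<T} \<times> cell. \<not> 0 \<le> h (fst z) (snd z)} \<in> sets \<Omega>" by (simp add: space_restrict_space)
  show "AE t in I. AE x in torus. 0 \<le> h (fst (t, x)) (snd (t, x))"
    using AE_sections AE_nn_integral_eta_le
  proof eventually_elim
    case (elim t)
    then have "(\<integral>\<^sup>+ x. e2ennreal (eta a \<gamma> (h t x) (m t x)) \<partial>torus) \<noteq> \<infinity>"
      using ennreal_less_top le_less_trans by (auto simp: top_unique)
    then have "AE x in torus. e2ennreal (eta a \<gamma> (h t x) (m t x)) \<noteq> \<infinity>"
      using elim by (intro nn_integral_PInf_AE) auto
    then show ?case
      by (rule eventually_mono) (auto simp: eta_def split: if_splits)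
  qed
qed auto

lemma integrable_U: "integrable \<Omega> (\<lambda>z. U (fst z) (snd z))"
proof (rule integrableI_bounded[OF U_measurable])
  have "(\<integral>\<^sup>+ z. ennreal (norm (U (fst z) (snd z))) \<partial>\<Omega>) = (\<integral>\<^sup>+ t. \<integral>\<^sup>+ x. ennreal (norm (U t x)) \<partial>torus \<partial>I)"
    using U_measurable by (subst nn_integral_lebesgue_on_fst) auto
  also have "\<dots> \<le> (\<integral>\<^sup>+ t. ennreal CU \<partial>I)"
    using CU(2) by (rule nn_integral_mono_AE)
  also have "\<dots> < \<infinity>" using T by (simp add: emeasure_restrict_space ennreal_mult_less_top)
  finally show "(\<integral>\<^sup>+ z. ennreal (norm (U (fst z) (snd z))) \<partial>\<Omega>) < \<infinity>" .
qed

context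
  fixes k :: "real \<Rightarrow> real ^ 'd \<Rightarrow> real \<times> (real ^ 'd) \<times> (real ^ 'd ^ 'd) \<times> real"
  assumes k: "continuous_on ({0..T} \<times> UNIV) (\<lambda>(t, x). k t x)"
begin

lemma integrable_U_inner: "integrable \<Omega> (\<lambda>z. U (fst z) (snd z) \<bullet> k (fst z) (snd z))"
proof -
  obtain B where B: "0 \<le> B" "\<And>t x. t \<in> {0..T} \<Longrightarrow> x \<in> cell \<Longrightarrow> norm (k t x) \<le> B"
    using continuous_bounded_cell[OF k] by metis
  have [measurable]: "(\<lambda>z. k (fst z) (snd z)) \<in> borel_measurable \<Omega>"
    using measurable_continuous_cell[OF k] by (simp add: case_prod_unfold)
  note U_measurable [measurable]
  show ?thesis
  proof (rule Bochner_Integration.integrable_bound)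
    show "integrable \<Omega> (\<lambda>z. B *\<^sub>R norm (U (fst z) (snd z)))"
      using integrable_U by (intro integrable_scaleR_right integrable_norm)
    show "AE z in \<Omega>. norm (U (fst z) (snd z) \<bullet> k (fst z) (snd z)) \<le> norm (B *\<^sub>R norm (U (fst z) (snd z)))"
    proof (rule AE_I2)
      fix z assume "z \<in> space \<Omega>"
      then have "norm (k (fst z) (snd z)) \<le> B" using B(2) by (auto simp: space_restrict_space)
      then show "norm (U (fst z) (snd z) \<bullet> k (fst z) (snd z)) \<le> norm (B *\<^sub>R norm (U (fst z) (snd z)))"
        using B(1) Cauchy_Schwarz_ineq2[of "U (fst z) (snd z)" "k (fst z) (snd z)"]
          mult_left_mono[of "norm (k (fst z) (snd z))" B "norm (U (fst z) (snd z))"]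
        by (simp add: mult.commute)
    qed
  qed measurable
qed

lemma AE_integrable_U_inner: "AE t in I. integrable torus (\<lambda>x. U t x \<bullet> k t x)"
  using AE_section_integrable[OF _ cell_borel integrable_U_inner] by simp

lemma integrable_flux: "integrable I (flux k)"
  using integrable_section_integral[OF _ cell_borel integrable_U_inner] by (simp add: flux_def[abs_def])

lemma AE_flux_le:
  assumes B: "\<And>t x. t \<in> {0..T} \<Longrightarrow> x \<in> cell \<Longrightarrow> norm (k t x) \<le> B"
  shows "AE t in I. \<bar>flux k t\<bar> \<le> B * CU"
  using AE_U AE_integrable_U_inner AE_I_range
proof eventually_elim
  case (elim t)
  then have t: "t \<in> {0..T}" by simp
  have "0 \<in> cell" by (simp add: cell_def)
  then have B0: "0 \<le> B" using B[OF t, of 0] norm_ge_zero order_trans by blast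
  have "\<bar>flux k t\<bar> \<le> (\<integral>x. \<bar>U t x \<bullet> k t x\<bar> \<partial>torus)"
    unfolding flux_def by (rule integral_abs_bound)
  also have "\<dots> \<le> (\<integral>x. B * norm (U t x) \<partial>torus)"
  proof (rule integral_mono)
    show "integrable torus (\<lambda>x. \<bar>U t x \<bullet> k t x\<bar>)" "integrable torus (\<lambda>x. B * norm (U t x))"
      using elim by auto
    fix x assume "x \<in> space (torus :: (real ^ 'd) measure)"
    then have "norm (k t x) \<le> B" using B t by simp
    then show "\<bar>U t x \<bullet> k t x\<bar> \<le> B * norm (U t x)"
      using Cauchy_Schwarz_ineq2[of "U t x" "k t x"] mult_left_mono[of "norm (k t x)" B "norm (U t x)"]
      by (simp add: mult.commute)
  qed
  also have "\<dots> \<le> B * CU" using elim B0 by (simp add: mult_left_mono)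
  finally show ?case .
qed

end

text \<open>At times where the pairings are not integrable the Bochner integral takes its default
  value zero and additivity may fail, hence the restriction to almost every time.\<close>

lemma AE_flux_add_scaleR:
  fixes k k' k'' :: "real \<Rightarrow> real ^ 'd \<Rightarrow> real \<times> (real ^ 'd) \<times> (real ^ 'd ^ 'd) \<times> real"
  assumes k: "continuous_on ({0..T} \<times> UNIV) (\<lambda>(t, x). k t x)" "continuous_on ({0..T} \<times> UNIV) (\<lambda>(t, x). k' t x)"
    and eq: "\<And>t x. t \<in> {0..T} \<Longrightarrow> k'' t x = k t x + c *\<^sub>R k' t x"
  shows "AE t in I. flux k'' t = flux k t + c * flux k' t"
  using AE_integrable_U_inner[OF k(1)] AE_integrable_U_inner[OF k(2)] AE_I_range
proof eventually_elim
  case (elim t)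
  then have "t \<in> {0..T}" by simp
  then show ?case using elim by (simp add: flux_def eq inner_add_right)
qed

end

section \<open>Countable dense families of tests\<close>

definition mass_close :: "real \<Rightarrow> real \<Rightarrow> (real \<Rightarrow> real ^ 'd \<Rightarrow> real) \<Rightarrow> (real \<Rightarrow> real ^ 'd \<Rightarrow> real) \<Rightarrow> bool" where
  "mass_close T e \<rho> \<sigma> \<longleftrightarrow> (\<forall>t\<in>{0..T}. \<forall>x\<in>cell. norm (\<rho> t x - \<sigma> t x) \<le> e \<and> norm (mass_test T \<rho> t x - mass_test T \<sigma> t x) \<le> e)"

definition momentum_close :: "real \<Rightarrow> real \<Rightarrow> (real \<Rightarrow> real ^ 'd \<Rightarrow> real ^ 'd) \<Rightarrow> (real \<Rightarrow> real ^ 'd \<Rightarrow> real ^ 'd) \<Rightarrow> bool" where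
  "momentum_close T e \<phi> \<psi> \<longleftrightarrow> (\<forall>t\<in>{0..T}. \<forall>x\<in>cell. norm (\<phi> t x - \<psi> t x) \<le> e \<and> norm (momentum_test T \<phi> t x - momentum_test T \<psi> t x) \<le> e)"

lemma momentum_close_nabla:
  assumes "momentum_close T e \<phi> \<psi>" "t \<in> {0..T}" "x \<in> cell"
  shows "norm (nabla (\<phi> t) x - nabla (\<psi> t) x) \<le> e"
proof -
  have "norm (nabla (\<phi> t) x - nabla (\<psi> t) x) \<le> norm (momentum_test T \<phi> t x - momentum_test T \<psi> t x)"
    unfolding momentum_test_def diff_Pair
    by (rule order_trans[OF norm_fst_le order_trans[OF norm_snd_le norm_snd_le]])
  then show ?thesis using assms unfolding momentum_close_def by fastforce
qed

lemma countable_dense_cell: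
  fixes w :: "'i \<Rightarrow> real \<Rightarrow> real ^ 'd \<Rightarrow> 'c::{metric_space, second_countable_topology}"
  assumes w: "\<And>f. f \<in> P \<Longrightarrow> continuous_on ({0..T} \<times> UNIV) (\<lambda>(t, x). w f t x)"
  shows "\<exists>J. countable J \<and> J \<subseteq> P \<and>
    (\<forall>f\<in>P. \<forall>e>0. \<exists>g\<in>J. \<forall>t\<in>{0..T}. \<forall>x\<in>cell. dist (w f t x) (w g t x) < e)"
proof -
  let ?K = "{0..T} \<times> cbox (0 :: real ^ 'd) 1"
  have c: "compact ?K" by (intro compact_Times) auto
  have cc: "continuous_on ?K (\<lambda>z. w f (fst z) (snd z))" if "f \<in> P" for f
    using continuous_on_subset[OF w[OF that], of ?K] by (auto simp: case_prod_unfold)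
  show ?thesis
  proof (rule countable_uniformly_dense[OF c cc])
    fix J assume J: "countable J" "J \<subseteq> P"
      "\<And>f e. f \<in> P \<Longrightarrow> 0 < e \<Longrightarrow> \<exists>g\<in>J. \<forall>z\<in>?K. dist (w f (fst z) (snd z)) (w g (fst z) (snd z)) < e"
    have "\<exists>g\<in>J. \<forall>t\<in>{0..T}. \<forall>x\<in>cell. dist (w f t x) (w g t x) < e" if f: "f \<in> P" and e: "0 < e" for f e
    proof -
      obtain g where g: "g \<in> J" "\<forall>z\<in>?K. dist (w f (fst z) (snd z)) (w g (fst z) (snd z)) < e"
        using J(3)[OF f e] by (rule bexE)
      have "dist (w f t x) (w g t x) < e" if "t \<in> {0..T}" "x \<in> cell" for t x
        using bspec[OF g(2), of "(t, x)"] that cell_subset_cbox by auto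
      then show ?thesis using g(1) by blast
    qed
    then show ?thesis using J(1,2) by (intro exI[of _ J]) simp
  qed
qed

text \<open>A test and its derivatives form one continuous map on a compact cylinder, so uniform
  density of these maps is density in the \<open>C1\<close> norm.\<close>

lemma countable_dense_mass_tests:
  assumes T: "0 < T"
  shows "\<exists>J :: (real \<Rightarrow> real ^ 'd \<Rightarrow> real) set. countable J \<and> (\<forall>\<rho>\<in>J. C1_torus T \<rho>) \<and>
    (\<forall>\<rho>. C1_torus T \<rho> \<longrightarrow> (\<forall>e>0. \<exists>\<sigma>\<in>J. mass_close T e \<rho> \<sigma>))"
proof -
  let ?w = "\<lambda>(\<rho> :: real \<Rightarrow> real ^ 'd \<Rightarrow> real) t x. (\<rho> t x, mass_test T \<rho> t x)"
  have c: "continuous_on ({0..T} \<times> UNIV) (\<lambda>(t, x). ?w \<rho> t x)" if "\<rho> \<in> {\<rho>. C1_torus T \<rho>}" for \<rho>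
    using continuous_on_Pair[OF C1_torus_continuous continuous_on_mass_test[OF T], of \<rho> \<rho>] that
    by (simp add: case_prod_unfold)
  obtain J where J: "countable J \<and> J \<subseteq> {\<rho>. C1_torus T \<rho>} \<and>
    (\<forall>\<rho>\<in>{\<rho>. C1_torus T \<rho>}. \<forall>e>0. \<exists>\<sigma>\<in>J. \<forall>t\<in>{0..T}. \<forall>x\<in>cell. dist (?w \<rho> t x) (?w \<sigma> t x) < e)"
    using countable_dense_cell[where w = ?w, OF c] by (rule exE)
  have "\<exists>\<sigma>\<in>J. mass_close T e \<rho> \<sigma>" if r: "C1_torus T \<rho>" "0 < e" for \<rho> e
  proof -
    obtain \<sigma> where \<sigma>: "\<sigma> \<in> J" "\<forall>t\<in>{0..T}. \<forall>x\<in>cell. dist (?w \<rho> t x) (?w \<sigma> t x) < e"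
      using J[THEN conjunct2, THEN conjunct2, rule_format, of _ e] r by blast
    have "norm (\<rho> t x - \<sigma> t x) \<le> e \<and> norm (mass_test T \<rho> t x - mass_test T \<sigma> t x) \<le> e"
      if "t \<in> {0..T}" "x \<in> cell" for t x
      using \<sigma>(2)[rule_format, OF that] dist_fst_le[of "?w \<rho> t x" "?w \<sigma> t x"]
        dist_snd_le[of "?w \<rho> t x" "?w \<sigma> t x"]
      unfolding fst_conv snd_conv dist_norm[symmetric] by linarith
    then show ?thesis using \<sigma>(1) unfolding mass_close_def by blast
  qed
  then show ?thesis using J by (intro exI[of _ J]) blast
qed

lemma countable_dense_momentum_tests:
  assumes T: "0 < T"
  shows "\<exists>J :: (real \<Rightarrow> real ^ 'd \<Rightarrow> real ^ 'd) set. countable J \<and> (\<forall>\<phi>\<in>J. C1_torus T \<phi>) \<and>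
    (\<forall>\<phi>. C1_torus T \<phi> \<longrightarrow> (\<forall>e>0. \<exists>\<psi>\<in>J. momentum_close T e \<phi> \<psi>))"
proof -
  let ?w = "\<lambda>(\<phi> :: real \<Rightarrow> real ^ 'd \<Rightarrow> real ^ 'd) t x. (\<phi> t x, momentum_test T \<phi> t x)"
  have c: "continuous_on ({0..T} \<times> UNIV) (\<lambda>(t, x). ?w \<phi> t x)" if "\<phi> \<in> {\<phi>. C1_torus T \<phi>}" for \<phi>
    using continuous_on_Pair[OF C1_torus_continuous continuous_on_momentum_test[OF T], of \<phi> \<phi>] that
    by (simp add: case_prod_unfold)
  obtain J where J: "countable J \<and> J \<subseteq> {\<phi>. C1_torus T \<phi>} \<and>
    (\<forall>\<phi>\<in>{\<phi>. C1_torus T \<phi>}. \<forall>e>0. \<exists>\<psi>\<in>J. \<forall>t\<in>{0..T}. \<forall>x\<in>cell. dist (?w \<phi> t x) (?w \<psi> t x) < e)"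
    using countable_dense_cell[where w = ?w, OF c] by (rule exE)
  have "\<exists>\<psi>\<in>J. momentum_close T e \<phi> \<psi>" if r: "C1_torus T \<phi>" "0 < e" for \<phi> e
  proof -
    obtain \<psi> where \<psi>: "\<psi> \<in> J" "\<forall>t\<in>{0..T}. \<forall>x\<in>cell. dist (?w \<phi> t x) (?w \<psi> t x) < e"
      using J[THEN conjunct2, THEN conjunct2, rule_format, of _ e] r by blast
    have "norm (\<phi> t x - \<psi> t x) \<le> e \<and> norm (momentum_test T \<phi> t x - momentum_test T \<psi> t x) \<le> e"
      if "t \<in> {0..T}" "x \<in> cell" for t x
      using \<psi>(2)[rule_format, OF that] dist_fst_le[of "?w \<phi> t x" "?w \<psi> t x"]
        dist_snd_le[of "?w \<phi> t x" "?w \<psi> t x"]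
      unfolding fst_conv snd_conv dist_norm[symmetric] by linarith
    then show ?thesis using \<psi>(1) unfolding momentum_close_def by blast
  qed
  then show ?thesis using J by (intro exI[of _ J]) blast
qed

lemma mass_test_add_scaleR:
  assumes "0 < T" "C1_torus T \<rho>" "C1_torus T \<sigma>" "t \<in> {0..T}"
  shows "mass_test T (\<lambda>t x. \<rho> t x + c *\<^sub>R \<sigma> t x) t x = mass_test T \<rho> t x + c *\<^sub>R mass_test T \<sigma> t x"
  unfolding mass_test_def C1_torus_add_scaleR(2)[OF assms] grad_add_scaleR[OF assms] by simp

lemma momentum_test_add_scaleR:
  assumes "0 < T" "C1_torus T \<rho>" "C1_torus T \<sigma>" "t \<in> {0..T}"
  shows "momentum_test T (\<lambda>t x. \<rho> t x + c *\<^sub>R \<sigma> t x) t x = momentum_test T \<rho> t x + c *\<^sub>R momentum_test T \<sigma> t x"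
  unfolding momentum_test_def C1_torus_add_scaleR(2)[OF assms] nabla_add_scaleR[OF assms]
  by (simp add: trace_add trace_scaleR)

lemma integrable_inner_continuous:
  fixes f k :: "real ^ 'd \<Rightarrow> 'b::euclidean_space"
  assumes f: "integrable torus f" and k: "continuous_on UNIV k"
  shows "integrable torus (\<lambda>x. f x \<bullet> k x)"
proof -
  have "compact (k ` cbox 0 1)" by (intro compact_continuous_image continuous_on_subset[OF k]) auto
  then have "bounded (k ` cbox 0 1)" by (rule compact_imp_bounded)
  then obtain B where B: "\<And>x. x \<in> cbox 0 1 \<Longrightarrow> norm (k x) \<le> B"
    unfolding bounded_iff by blast
  have [measurable]: "k \<in> borel_measurable torus" by (rule measurable_continuous_torus[OF k])
  note [measurable] = borel_measurable_integrable[OF f]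
  show ?thesis
  proof (rule Bochner_Integration.integrable_bound)
    show "integrable torus (\<lambda>x. B *\<^sub>R norm (f x))" using f by auto
    show "AE x in torus. norm (f x \<bullet> k x) \<le> norm (B *\<^sub>R norm (f x))"
    proof (rule AE_I2)
      fix x assume "x \<in> space (torus :: (real ^ 'd) measure)"
      then have "norm (k x) \<le> B" using B cell_subset_cbox by auto
      then show "norm (f x \<bullet> k x) \<le> norm (B *\<^sub>R norm (f x))"
        using order_trans[OF Cauchy_Schwarz_ineq2[of "f x" "k x"] mult_left_mono[of "norm (k x)" "\<bar>B\<bar>" "norm (f x)"]]
        by (simp add: abs_mult mult.commute)
    qed
  qed measurable
qed

lemma integral_inner_diff_le:
  fixes f k l :: "real ^ 'd \<Rightarrow> 'b::euclidean_space"
  assumes f: "integrable torus f" and k: "continuous_on UNIV k" "continuous_on UNIV l"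
    and e: "\<And>x. x \<in> cell \<Longrightarrow> norm (k x - l x) \<le> e"
  shows "\<bar>(\<integral>x. f x \<bullet> k x \<partial>torus) - (\<integral>x. f x \<bullet> l x \<partial>torus)\<bar> \<le> (\<integral>x. norm (f x) \<partial>torus) * e"
proof -
  note i = integrable_inner_continuous[OF f k(1)] integrable_inner_continuous[OF f k(2)]
  have "\<bar>(\<integral>x. f x \<bullet> k x \<partial>torus) - (\<integral>x. f x \<bullet> l x \<partial>torus)\<bar> = \<bar>\<integral>x. f x \<bullet> k x - f x \<bullet> l x \<partial>torus\<bar>"
    using i by simp
  also have "\<dots> \<le> (\<integral>x. \<bar>f x \<bullet> k x - f x \<bullet> l x\<bar> \<partial>torus)" by (rule integral_abs_bound)
  also have "\<dots> \<le> (\<integral>x. norm (f x) * e \<partial>torus)"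
  proof (rule integral_mono)
    fix x assume "x \<in> space (torus :: (real ^ 'd) measure)"
    then have "norm (k x - l x) \<le> e" using e by simp
    then show "\<bar>f x \<bullet> k x - f x \<bullet> l x\<bar> \<le> norm (f x) * e"
      using Cauchy_Schwarz_ineq2[of "f x" "k x - l x"] mult_left_mono[of "norm (k x - l x)" e "norm (f x)"]
      by (simp add: inner_diff_right)
  qed (use i f in auto)
  finally show ?thesis by simp
qed

section \<open>Balances and variational inequality in terms of potentials\<close>

context euler_fields
begin

text \<open>Pairing minus accumulated flux. The mass balance says that this number does not change
  in time; for the analogous \<open>momentum_pot\<close> the change is the contribution of the
  measure \<open>R\<close>.\<close>

definition mass_pot :: "real \<Rightarrow> (real \<Rightarrow> real ^ 'd \<Rightarrow> real) \<Rightarrow> real" where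
  "mass_pot t \<rho> = (\<integral>x. h t x * \<rho> t x \<partial>torus) - tint T (flux (mass_test T \<rho>)) t"

definition momentum_pot :: "real \<Rightarrow> (real \<Rightarrow> real ^ 'd \<Rightarrow> real ^ 'd) \<Rightarrow> real" where
  "momentum_pot t \<phi> = (\<integral>x. m t x \<bullet> \<phi> t x \<partial>torus) - tint T (flux (momentum_test T \<phi>)) t"

text \<open>The last term of the variational inequality, with its sign reversed and its constant
  factor removed; it is nonnegative at almost every time because the energy lies below
  \<open>E\<close>.\<close>

definition defect :: "(real \<Rightarrow> real ^ 'd \<Rightarrow> real ^ 'd) \<Rightarrow> real \<Rightarrow> real" where
  "defect \<phi> \<tau> = neg_norm (\<phi> \<tau>) * (E \<tau> - en \<tau>)"

lemma integrable_bounded_I: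
  assumes "f \<in> borel_measurable I" "AE t in I. \<bar>f t\<bar> \<le> B"
  shows "integrable I (f :: real \<Rightarrow> real)"
  using assms by (intro finite_measure.integrable_const_bound[OF finite_measure_lebesgue_on_Ioo, of f B]) auto

lemma AE_gap: "AE \<tau> in I. 0 \<le> E \<tau> - en \<tau> \<and> E \<tau> - en \<tau> \<le> C"
  using AE_en E_bdd by eventually_elim auto

lemma C_nonneg: "0 \<le> C"
proof -
  have "\<exists>t. \<bar>E t\<bar> \<le> C"
  proof (rule ccontr)
    assume "\<not> ?thesis"
    then have "AE t in I. False" using E_bdd by simp
    then obtain N where N: "{x \<in> space I. \<not> False} \<subseteq> N" "emeasure I N = 0" "N \<in> sets I" by (rule AE_E)
    then have "space I \<subseteq> N" by auto
    then have "emeasure I (space I) \<le> 0" using emeasure_mono[of "space I" N I] N(2,3) by simp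
    then show False using T by (simp add: emeasure_restrict_space space_restrict_space)
  qed
  then show ?thesis by auto
qed

lemma gap_measurable: "(\<lambda>\<tau>. E \<tau> - en \<tau>) \<in> borel_measurable I"
  using E_meas en_measurable by measurable

lemma defect_facts:
  assumes \<phi>: "C1_torus T \<phi>"
  shows defect_integrable: "integrable I (defect \<phi>)"
    and AE_defect_le: "(\<And>t. t \<in> {0..T} \<Longrightarrow> neg_norm (\<phi> t) \<le> B) \<Longrightarrow> AE \<tau> in I. \<bar>defect \<phi> \<tau>\<bar> \<le> B * C"
proof -
  show le: "AE \<tau> in I. \<bar>defect \<phi> \<tau>\<bar> \<le> B * C" if "\<And>t. t \<in> {0..T} \<Longrightarrow> neg_norm (\<phi> t) \<le> B" for B
    using AE_gap AE_I_range
  proof eventually_elim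
    case (elim t)
    then have t: "t \<in> {0..T}" by simp
    show ?case
      unfolding defect_def abs_mult using elim that[OF t] neg_norm_nonneg[OF T \<phi> t] C_nonneg
      by (intro mult_mono) auto
  qed
  have "(\<lambda>t. neg_norm (\<phi> t)) \<in> borel_measurable I"
    by (rule continuous_imp_measurable_on_sets_lebesgue[OF continuous_on_subset[OF continuous_on_neg_norm[OF T \<phi>]]]) auto
  then have "defect \<phi> \<in> borel_measurable I"
    unfolding defect_def[abs_def] using gap_measurable by measurable
  moreover have "compact ((\<lambda>t. neg_norm (\<phi> t)) ` {0..T})"
    by (intro compact_continuous_image continuous_on_neg_norm[OF T \<phi>]) auto
  then obtain B where "\<And>t. t \<in> {0..T} \<Longrightarrow> neg_norm (\<phi> t) \<le> B"
    by (metis bdd_above.E bounded_imp_bdd_above compact_imp_bounded imageI)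
  then have "AE \<tau> in I. \<bar>defect \<phi> \<tau>\<bar> \<le> B * C" by (rule le)
  ultimately show "integrable I (defect \<phi>)" by (rule integrable_bounded_I)
qed

lemma mass_integrand:
  "(\<integral>x. h \<tau> x * dt T \<rho> \<tau> x + m \<tau> x \<bullet> grad (\<rho> \<tau>) x \<partial>torus) = flux (mass_test T \<rho>) \<tau>"
  by (simp add: flux_def U_def mass_test_def)

lemma momentum_integrand:
  "(\<integral>x. m \<tau> x \<bullet> dt T \<phi> \<tau> x + (convective (h \<tau> x) (m \<tau> x) + pressure a \<gamma> (h \<tau> x) *\<^sub>R mat 1) \<bullet> nabla (\<phi> \<tau>) x \<partial>torus)
    = flux (momentum_test T \<phi>) \<tau>"
  by (simp add: flux_def U_def momentum_test_def inner_add_left mat_1_inner add.assoc)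

lemma momentum_integrand':
  "(\<integral>x. m \<tau> x \<bullet> dt T \<phi> \<tau> x + convective (h \<tau> x) (m \<tau> x) \<bullet> sym_part (nabla (\<phi> \<tau>) x)
            + pressure a \<gamma> (h \<tau> x) * divergence (\<phi> \<tau>) x \<partial>torus) = flux (momentum_test T \<phi>) \<tau>"
  by (simp add: flux_def U_def momentum_test_def divergence_def sym_inner_convective[symmetric] add.assoc)

lemma mass_balance_iff:
  assumes \<rho>: "C1_torus T \<rho>" and st: "s \<in> {0..T}" "t \<in> {0..T}"
  shows "mass_balance T h m hs s t \<rho> \<longleftrightarrow>
    mass_pot t \<rho> = (\<integral>x. hs x * \<rho> s x \<partial>torus) - tint T (flux (mass_test T \<rho>)) s"
  unfolding mass_balance_def mass_integrand mass_pot_def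
    interval_integral_eq_tint[OF integrable_flux[OF continuous_on_mass_test[OF T \<rho>]] st]
  by auto

lemma momentum_balance_iff:
  assumes \<phi>: "C1_torus T \<phi>" and st: "s \<in> {0..T}" "t \<in> {0..T}"
  shows "momentum_balance a \<gamma> T h m R ms s t \<phi> \<longleftrightarrow>
    momentum_pot t \<phi> = (\<integral>x. ms x \<bullet> \<phi> s x \<partial>torus) - tint T (flux (momentum_test T \<phi>)) s
      + (LINT \<tau>=s..t|lebesgue. matrix_integral (R \<tau>) (nabla (\<phi> \<tau>)))"
  unfolding momentum_balance_def momentum_integrand' momentum_pot_def
    interval_integral_eq_tint[OF integrable_flux[OF continuous_on_momentum_test[OF T \<phi>]] st]
  by auto

text \<open>Normal form for both implications: increments of the energy, of the two potentials and
  of the accumulated defect. The values at \<open>s\<close> stay explicit because at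
  \<open>s = 0\<close> they are initial data rather than values of \<open>h\<close> and
  \<open>m\<close>.\<close>

lemma ev_lhs_eq:
  assumes \<rho>: "C1_torus T \<rho>" and \<phi>: "C1_torus T \<phi>" and st: "s \<in> {0..T}" "t \<in> {0..T}"
    and Ut: "integrable torus (U t)" and hs: "integrable torus hs" and ms: "integrable torus ms"
  shows "ev_lhs a \<gamma> \<alpha> T h m E es hs ms s t \<rho> \<phi> = E t - es
    - (mass_pot t \<rho> - ((\<integral>x. hs x * \<rho> s x \<partial>torus) - tint T (flux (mass_test T \<rho>)) s))
    - (momentum_pot t \<phi> - ((\<integral>x. ms x \<bullet> \<phi> s x \<partial>torus) - tint T (flux (momentum_test T \<phi>)) s))
    - max 2 (\<alpha> * real CARD('d)) * (tint T (defect \<phi>) t - tint T (defect \<phi>) s)"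
proof -
  let ?k = "max 2 (\<alpha> * real CARD('d))"
  note c = continuous_on_section[OF C1_torus_continuous[OF \<rho>]] continuous_on_section[OF C1_torus_continuous[OF \<phi>]]
  have 1: "(\<integral>x. h t x * \<rho> t x + m t x \<bullet> \<phi> t x \<partial>torus) = (\<integral>x. h t x * \<rho> t x \<partial>torus) + (\<integral>x. m t x \<bullet> \<phi> t x \<partial>torus)"
    using integrable_inner_continuous[OF integrable_hm(1)[OF Ut] c(1)[OF st(2)]]
      integrable_inner_continuous[OF integrable_hm(2)[OF Ut] c(2)[OF st(2)]] by simp
  have 2: "(\<integral>x. hs x * \<rho> s x + ms x \<bullet> \<phi> s x \<partial>torus) = (\<integral>x. hs x * \<rho> s x \<partial>torus) + (\<integral>x. ms x \<bullet> \<phi> s x \<partial>torus)"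
    using integrable_inner_continuous[OF hs c(1)[OF st(1)]]
      integrable_inner_continuous[OF ms c(2)[OF st(1)]] by simp
  note iR = integrable_flux[OF continuous_on_mass_test[OF T \<rho>]]
  note iP = integrable_flux[OF continuous_on_momentum_test[OF T \<phi>]]
  note iD = defect_integrable[OF \<phi>]
  have K: "K_weight \<alpha> (\<phi> \<tau>) * (real_of_ereal (energy a \<gamma> (h \<tau>) (m \<tau>)) - E \<tau>) = (- ?k) * defect \<phi> \<tau>" for \<tau>
    by (simp add: K_weight_def neg_norm_def[symmetric] defect_def en_def algebra_simps)
  have i: "integrable I (\<lambda>\<tau>. flux (momentum_test T \<phi>) \<tau> + (- ?k) * defect \<phi> \<tau>)"
    using iP iD by auto
  show ?thesis
    unfolding ev_lhs_def 1 2 mass_integrand momentum_integrand K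
      interval_integral_eq_tint[OF iR st] interval_integral_eq_tint[OF i st] tint_linear[OF iP iD]
      mass_pot_def momentum_pot_def
    by (simp add: algebra_simps)
qed

lemma flux_diff_le:
  assumes k: "continuous_on ({0..T} \<times> UNIV) (\<lambda>(t, x). k t x)" "continuous_on ({0..T} \<times> UNIV) (\<lambda>(t, x). l t x)"
    and e: "\<And>t x. t \<in> {0..T} \<Longrightarrow> x \<in> cell \<Longrightarrow> norm (k t x - l t x) \<le> e" and t: "t \<in> {0..T}"
  shows "\<bar>tint T (flux k) t - tint T (flux l) t\<bar> \<le> CU * T * e"
proof -
  define d where "d = (\<lambda>t x. k t x + (-1) *\<^sub>R l t x)"
  have d: "continuous_on ({0..T} \<times> UNIV) (\<lambda>(t, x). d t x)"
    using k unfolding d_def case_prod_unfold by (intro continuous_intros)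
  have "tint T (flux d) t = tint T (\<lambda>\<tau>. flux k \<tau> + (-1) * flux l \<tau>) t"
    using integrable_flux[OF k(1)] integrable_flux[OF k(2)] integrable_flux[OF d]
    by (intro tint_cong_AE AE_flux_add_scaleR[OF k]) (auto simp: d_def)
  also have "\<dots> = tint T (flux k) t + (-1) * tint T (flux l) t"
    by (rule tint_linear) (rule integrable_flux k)+
  finally have eq: "tint T (flux k) t - tint T (flux l) t = tint T (flux d) t - tint T (flux d) 0" by simp
  have "\<bar>tint T (flux d) t - tint T (flux d) 0\<bar> \<le> (e * CU) * (t - 0)"
    by (rule tint_diff_abs_le[OF integrable_flux[OF d] AE_flux_le[OF d]]) (use e t in \<open>auto simp: d_def\<close>)
  also have "\<dots> \<le> (e * CU) * T"
  proof -
    have "0 \<in> cell" by (simp add: cell_def)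
    then have "0 \<le> e" using e[OF t, of 0] norm_ge_zero order_trans by blast
    then show ?thesis using t CU(1) by (intro mult_left_mono) auto
  qed
  finally show ?thesis unfolding eq by (simp add: mult_ac)
qed

lemma tint_defect_close:
  assumes \<phi>: "C1_torus T \<phi>" and \<psi>: "C1_torus T \<psi>" and e: "momentum_close T e \<phi> \<psi>" and t: "t \<in> {0..T}"
  shows "\<bar>tint T (defect \<phi>) t - tint T (defect \<psi>) t\<bar> \<le> C * T * e"
proof -
  have i: "integrable I (\<lambda>\<tau>. defect \<phi> \<tau> + (-1) * defect \<psi> \<tau>)"
    using defect_integrable[OF \<phi>] defect_integrable[OF \<psi>] by auto
  have "\<bar>tint T (\<lambda>\<tau>. defect \<phi> \<tau> + (-1) * defect \<psi> \<tau>) t - tint T (\<lambda>\<tau>. defect \<phi> \<tau> + (-1) * defect \<psi> \<tau>) 0\<bar> \<le> (e * C) * (t - 0)"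
  proof (rule tint_diff_abs_le[OF i])
    show "AE \<tau> in I. \<bar>defect \<phi> \<tau> + (-1) * defect \<psi> \<tau>\<bar> \<le> e * C"
      using AE_gap AE_I_range
    proof eventually_elim
      case (elim \<tau>)
      then have \<tau>: "\<tau> \<in> {0..T}" by simp
      have "\<bar>neg_norm (\<phi> \<tau>) - neg_norm (\<psi> \<tau>)\<bar> \<le> e"
        by (rule neg_norm_dist[OF T \<phi> \<tau> \<psi> \<tau> momentum_close_nabla[OF e \<tau>]])
      then have "\<bar>neg_norm (\<phi> \<tau>) - neg_norm (\<psi> \<tau>)\<bar> * \<bar>E \<tau> - en \<tau>\<bar> \<le> e * C"
        using elim by (intro mult_mono) auto
      then show ?case by (simp add: defect_def abs_mult[symmetric] algebra_simps)
    qed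
  qed (use t in auto)
  also have "\<dots> \<le> (e * C) * T"
  proof -
    have "0 \<in> cell" by (simp add: cell_def)
    then have "0 \<le> e" using momentum_close_nabla[OF e t, of 0] norm_ge_zero order_trans by blast
    then show ?thesis using t C_nonneg by (intro mult_left_mono) auto
  qed
  finally show ?thesis
    using tint_linear[OF defect_integrable[OF \<phi>] defect_integrable[OF \<psi>], of "-1"] by (simp add: mult_ac)
qed

lemma mass_pot_close:
  assumes "C1_torus T \<rho>" "C1_torus T \<sigma>" "mass_close T e \<rho> \<sigma>" "t \<in> {0..T}" and hs: "integrable torus hs"
  shows "\<bar>((\<integral>x. hs x * \<rho> t x \<partial>torus) - tint T (flux (mass_test T \<rho>)) t)
    - ((\<integral>x. hs x * \<sigma> t x \<partial>torus) - tint T (flux (mass_test T \<sigma>)) t)\<bar> \<le> ((\<integral>x. norm (hs x) \<partial>torus) + CU * T) * e"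
  using integral_inner_diff_le[OF hs continuous_on_section[OF C1_torus_continuous[OF assms(1)] assms(4)]
      continuous_on_section[OF C1_torus_continuous[OF assms(2)] assms(4)], of e]
    flux_diff_le[OF continuous_on_mass_test[OF T assms(1)] continuous_on_mass_test[OF T assms(2)] _ assms(4), of e]
    assms(3,4) unfolding mass_close_def by (simp add: algebra_simps)

lemma momentum_pot_close:
  assumes "C1_torus T \<phi>" "C1_torus T \<psi>" "momentum_close T e \<phi> \<psi>" "t \<in> {0..T}" and ms: "integrable torus ms"
  shows "\<bar>((\<integral>x. ms x \<bullet> \<phi> t x \<partial>torus) - tint T (flux (momentum_test T \<phi>)) t)
    - ((\<integral>x. ms x \<bullet> \<psi> t x \<partial>torus) - tint T (flux (momentum_test T \<psi>)) t)\<bar> \<le> ((\<integral>x. norm (ms x) \<partial>torus) + CU * T) * e"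
  using integral_inner_diff_le[OF ms continuous_on_section[OF C1_torus_continuous[OF assms(1)] assms(4)]
      continuous_on_section[OF C1_torus_continuous[OF assms(2)] assms(4)], of e]
    flux_diff_le[OF continuous_on_momentum_test[OF T assms(1)] continuous_on_momentum_test[OF T assms(2)] _ assms(4), of e]
    assms(3,4) unfolding momentum_close_def by (simp add: algebra_simps)

end

section \<open>Integrals against matrix-valued measures\<close>

text \<open>Lower corner of the half-open dyadic cube of side \<open>1 / 2 ^ n\<close> that contains
  \<open>x\<close>; cubes are represented by these corners.\<close>

definition dyadic :: "nat \<Rightarrow> real ^ 'd \<Rightarrow> real ^ 'd" where
  "dyadic n x = (\<chi> i. of_int \<lfloor>2 ^ n * x $ i\<rfloor> / 2 ^ n)"

lemma dyadic_le: "dyadic n x $ i \<le> x $ i" and dyadic_ge: "x $ i - 1 / 2 ^ n < dyadic n x $ i"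
proof -
  have "of_int \<lfloor>2 ^ n * x $ i\<rfloor> / 2 ^ n \<le> (2 ^ n * x $ i) / 2 ^ n"
    by (intro divide_right_mono) auto
  moreover have "(2 ^ n * x $ i - 1) / 2 ^ n < of_int \<lfloor>2 ^ n * x $ i\<rfloor> / 2 ^ n"
    by (intro divide_strict_right_mono) (linarith, simp)
  ultimately show "dyadic n x $ i \<le> x $ i" "x $ i - 1 / 2 ^ n < dyadic n x $ i"
    by (simp_all add: dyadic_def diff_divide_distrib)
qed

lemma dyadic_cell:
  assumes "x \<in> cell"
  shows "dyadic n x \<in> cell"
proof -
  have "0 \<le> dyadic n x $ i \<and> dyadic n x $ i < 1" for i
  proof
    show "0 \<le> dyadic n x $ i" using assms by (simp add: cell_def dyadic_def)
    show "dyadic n x $ i < 1" using assms le_less_trans[OF dyadic_le[of n x i]] by (simp add: cell_def)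
  qed
  then show ?thesis by (simp add: cell_def)
qed

lemma dyadic_tendsto: "(\<lambda>n. dyadic n x) \<longlonglongrightarrow> x"
proof (rule vec_tendstoI)
  fix i
  show "(\<lambda>n. dyadic n x $ i) \<longlonglongrightarrow> x $ i"
  proof (rule tendsto_sandwich[of "\<lambda>n. x $ i - 1 / 2 ^ n" _ _ "\<lambda>_. x $ i"])
    show "(\<lambda>n. x $ i - 1 / 2 ^ n) \<longlonglongrightarrow> x $ i"
      using tendsto_diff[OF tendsto_const[of "x $ i"] LIMSEQ_divide_realpow_zero[of 2 1]] by simp
  qed (auto intro!: eventuallyI dyadic_le less_imp_le[OF dyadic_ge])
qed

lemma dyadic_dyadic:
  assumes "m \<le> n"
  shows "dyadic m (dyadic n x) = dyadic m x"
proof -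
  obtain k where n: "n = m + k" using assms le_Suc_ex by blast
  have "\<lfloor>2 ^ m * (real_of_int \<lfloor>2 ^ n * y\<rfloor> / 2 ^ n)\<rfloor> = \<lfloor>2 ^ m * y\<rfloor>" for y :: real
  proof -
    have "2 ^ m * (of_int \<lfloor>2 ^ n * y\<rfloor> / 2 ^ n) = of_int \<lfloor>2 ^ n * y\<rfloor> / real_of_int (2 ^ k)"
      by (simp add: n power_add)
    then have "\<lfloor>2 ^ m * (real_of_int \<lfloor>2 ^ n * y\<rfloor> / 2 ^ n)\<rfloor> = \<lfloor>2 ^ n * y\<rfloor> div 2 ^ k"
      by (metis floor_divide_of_int_eq)
    also have "\<dots> = \<lfloor>2 ^ n * y / real_of_int (2 ^ k)\<rfloor>"
      by (subst floor_divide_real_eq_div) auto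
    also have "2 ^ n * y / real_of_int (2 ^ k) = 2 ^ m * y" by (simp add: n power_add)
    finally show ?thesis .
  qed
  then show ?thesis by (simp add: dyadic_def vec_eq_iff)
qed

lemma finite_dyadic_cell: "finite (dyadic n ` (cell :: (real ^ 'd) set))"
proof (rule finite_subset)
  show "finite ((\<lambda>f. \<chi> i. real_of_int (f i) / 2 ^ n) ` (UNIV \<rightarrow>\<^sub>E {0..<2 ^ n :: int}) :: (real ^ 'd) set)"
    by (intro finite_imageI finite_PiE) auto
  show "dyadic n ` cell \<subseteq> ((\<lambda>f. \<chi> i. real_of_int (f i) / 2 ^ n) ` (UNIV \<rightarrow>\<^sub>E {0..<2 ^ n :: int}) :: (real ^ 'd) set)"
  proof
    fix y :: "real ^ 'd" assume "y \<in> dyadic n ` cell"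
    then obtain x where x: "x \<in> cell" "y = dyadic n x" by blast
    have "\<lfloor>2 ^ n * x $ i\<rfloor> \<in> {0..<2 ^ n}" for i
      using x(1) by (auto simp: cell_def floor_less_iff)
    then show "y \<in> (\<lambda>f. \<chi> i. real_of_int (f i) / 2 ^ n) ` (UNIV \<rightarrow>\<^sub>E {0..<2 ^ n :: int})"
      unfolding x(2) dyadic_def by (intro image_eqI[of _ _ "\<lambda>i. \<lfloor>2 ^ n * x $ i\<rfloor>"]) (auto simp: PiE_UNIV_domain)
  qed
qed

lemma measurable_dyadic [measurable]: "dyadic n \<in> borel_measurable (borel :: (real ^ 'd) measure)"
proof (subst borel_measurable_euclidean_space, intro ballI)
  fix b :: "real ^ 'd" assume "b \<in> Basis"
  then obtain i where b: "b = axis i 1" by (auto simp: Basis_vec_def)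
  have "(\<lambda>x :: real ^ 'd. real_of_int \<lfloor>2 ^ n * x $ i\<rfloor> / 2 ^ n) \<in> borel_measurable borel" by measurable
  then show "(\<lambda>x. dyadic n x \<bullet> b) \<in> borel_measurable borel"
    by (simp add: b inner_axis dyadic_def)
qed

abbreviation cellB :: "(real ^ 'd) measure" where "cellB \<equiv> restrict_space borel cell"

lemma sets_cellB: "sets cellB = {A. A \<in> sets borel \<and> A \<subseteq> cell}"
proof -
  have "A \<in> (\<inter>) cell ` sets borel" if "A \<in> sets borel" "A \<subseteq> cell" for A :: "(real ^ 'd) set"
    using that by (intro image_eqI[of _ _ A]) auto
  then show ?thesis by (auto simp: sets_restrict_space)
qed

lemma polarization:
  fixes A :: "real ^ 'd ^ 'd"
  assumes "transpose A = A"
  shows "A $ i $ j = (1/2) * (outer (axis i 1 + axis j 1) (axis i 1 + axis j 1) \<bullet> A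
     - outer (axis i 1) (axis i 1) \<bullet> A - outer (axis j 1) (axis j 1) \<bullet> A)"
proof -
  have c: "axis k 1 \<bullet> (A *v axis l 1) = A $ k $ l" for k l
    by (simp add: inner_axis' matrix_vector_mult_basis column_def)
  have "A $ j $ i = A $ i $ j" using assms by (metis transpose_def vec_lambda_beta)
  then show ?thesis
    by (simp add: outer_inner inner_simps matrix_vector_right_distrib c)
qed

lemma trace_eq_outer: "trace A = (\<Sum>i\<in>UNIV. outer (axis i 1) (axis i 1) \<bullet> (A :: real ^ 'd ^ 'd))"
  by (simp add: trace_def outer_inner inner_axis' matrix_vector_mult_basis column_def)

locale psd_matrix_measure =
  fixes \<mu> :: "(real ^ 'd) set \<Rightarrow> real ^ 'd ^ 'd"
  assumes psd: "psd_measure \<mu>"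
begin

lemma sym: "A \<in> sets cellB \<Longrightarrow> transpose (\<mu> A) = \<mu> A"
  and pos: "A \<in> sets cellB \<Longrightarrow> 0 \<le> outer \<xi> \<xi> \<bullet> \<mu> A"
  using psd by (auto simp: psd_measure_def)

lemma empty: "\<mu> {} = 0"
proof -
  have "(\<lambda>n::nat. \<mu> {}) sums \<mu> (\<Union>n::nat. {})"
    using psd unfolding psd_measure_def by (elim conjE allE[of _ "\<lambda>_. {}"]) (auto simp: disjoint_family_on_def)
  then have "(\<lambda>n::nat. \<mu> {}) \<longlonglongrightarrow> 0" using sums_summable summable_LIMSEQ_zero by blast
  then show ?thesis by (simp add: LIMSEQ_const_iff)
qed

lemma sets_quad [simp]: "sets (quad_measure \<mu> \<xi>) = sets cellB"
  and space_quad [simp]: "space (quad_measure \<mu> \<xi>) = cell"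
proof -
  have "sets cellB \<subseteq> Pow cell" by (auto simp: sets_cellB)
  then show "space (quad_measure \<mu> \<xi>) = cell"
    unfolding quad_measure_def by (rule space_measure_of)
  have "sets (quad_measure \<mu> \<xi>) = sigma_sets (space cellB) (sets cellB)"
    unfolding quad_measure_def using sets_measure_of[OF \<open>sets cellB \<subseteq> Pow cell\<close>]
    by (simp only: space_restrict_space space_borel Int_UNIV_right)
  then show "sets (quad_measure \<mu> \<xi>) = sets cellB"
    unfolding sets.sigma_sets_eq .
qed

lemma emeasure_quad:
  assumes "A \<in> sets cellB"
  shows "emeasure (quad_measure \<mu> \<xi>) A = ennreal (outer \<xi> \<xi> \<bullet> \<mu> A)"
proof (rule emeasure_measure_of[OF quad_measure_def])
  show "sets cellB \<subseteq> Pow cell" by (auto simp: sets_cellB)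
  show "A \<in> sets (quad_measure \<mu> \<xi>)" using assms by simp
  show "positive (sets (quad_measure \<mu> \<xi>)) (\<lambda>A. ennreal (outer \<xi> \<xi> \<bullet> \<mu> A))"
    by (simp add: positive_def empty)
  show "countably_additive (sets (quad_measure \<mu> \<xi>)) (\<lambda>A. ennreal (outer \<xi> \<xi> \<bullet> \<mu> A))"
  proof (rule countably_additiveI)
    fix B :: "nat \<Rightarrow> (real ^ 'd) set"
    assume B: "range B \<subseteq> sets (quad_measure \<mu> \<xi>)" "disjoint_family B"
    have "(\<lambda>n. \<mu> (B n)) sums \<mu> (\<Union>n. B n)"
      using psd B unfolding psd_measure_def by auto
    then have "(\<lambda>n. outer \<xi> \<xi> \<bullet> \<mu> (B n)) sums (outer \<xi> \<xi> \<bullet> \<mu> (\<Union>n. B n))"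
      by (rule bounded_linear.sums[OF bounded_linear_inner_right])
    then show "(\<Sum>n. ennreal (outer \<xi> \<xi> \<bullet> \<mu> (B n))) = ennreal (outer \<xi> \<xi> \<bullet> \<mu> (\<Union>n. B n))"
      using B pos by (intro suminf_ennreal_eq) auto
  qed
qed

lemma measure_quad: "A \<in> sets cellB \<Longrightarrow> measure (quad_measure \<mu> \<xi>) A = outer \<xi> \<xi> \<bullet> \<mu> A"
  by (simp add: measure_def emeasure_quad pos)

lemma cell_sets: "cell \<in> sets cellB"
  by (simp add: sets_cellB)

lemma finite_quad: "finite_measure (quad_measure \<mu> \<xi>)"
  by (rule finite_measureI) (simp add: emeasure_quad cell_sets)

definition Q :: "nat \<Rightarrow> real ^ 'd \<Rightarrow> (real ^ 'd) set" where
  "Q n q = {x \<in> cell. dyadic n x = q}"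

lemma Q_sets: "Q n q \<in> sets cellB"
proof -
  have "{x \<in> space borel. dyadic n x = q} \<in> sets borel" by measurable
  then show ?thesis by (auto simp: Q_def sets_cellB Int_def[symmetric] Collect_conj_eq)
qed

lemma integral_dyadic:
  "(\<integral>x. f (dyadic n x) \<partial>quad_measure \<mu> \<xi>) = (\<Sum>q\<in>dyadic n ` cell. f q * (outer \<xi> \<xi> \<bullet> \<mu> (Q n q)))"
proof -
  interpret finite_measure "quad_measure \<mu> \<xi>" by (rule finite_quad)
  have "(\<integral>x. f (dyadic n x) \<partial>quad_measure \<mu> \<xi>)
    = (\<integral>x. (\<Sum>q\<in>dyadic n ` cell. f q * indicator (Q n q) x) \<partial>quad_measure \<mu> \<xi>)"
  proof (rule Bochner_Integration.integral_cong)
    fix x assume "x \<in> space (quad_measure \<mu> \<xi>)"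
    then have x: "x \<in> cell" by simp
    have "(\<Sum>q\<in>dyadic n ` cell. f q * indicator (Q n q) x) = (\<Sum>q\<in>dyadic n ` cell. if q = dyadic n x then f q else 0)"
      using x by (intro sum.cong) (auto simp: Q_def indicator_def)
    then show "f (dyadic n x) = (\<Sum>q\<in>dyadic n ` cell. f q * indicator (Q n q) x)"
      using x by (simp add: sum.delta' finite_dyadic_cell)
  qed simp
  also have "\<dots> = (\<Sum>q\<in>dyadic n ` cell. f q * measure (quad_measure \<mu> \<xi>) (Q n q))"
  proof -
    have "integrable (quad_measure \<mu> \<xi>) (indicator (Q n q) :: _ \<Rightarrow> real)" for q
    proof (rule integrable_real_indicator)
      show "Q n q \<in> sets (quad_measure \<mu> \<xi>)" using Q_sets by simp
      show "emeasure (quad_measure \<mu> \<xi>) (Q n q) < \<infinity>" by (simp add: emeasure_finite less_top[symmetric])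
    qed
    moreover have "Q n q \<inter> cell = Q n q" for q by (auto simp: Q_def)
    ultimately show ?thesis by (subst Bochner_Integration.integral_sum) auto
  qed
  finally show ?thesis by (simp add: measure_quad Q_sets)
qed

text \<open>The three quadratic measures in \<open>entry_integral\<close> recombine on each cube, by
  polarization, to the matrix entry of \<open>\<mu>\<close>.\<close>

lemma matrix_integral_dyadic:
  "matrix_integral \<mu> (\<lambda>x. F (dyadic n x)) = (\<Sum>q\<in>dyadic n ` cell. F q \<bullet> \<mu> (Q n q))"
proof -
  have "entry_integral \<mu> i j (\<lambda>x. F (dyadic n x) $ i $ j) = (\<Sum>q\<in>dyadic n ` cell. F q $ i $ j * \<mu> (Q n q) $ i $ j)" for i j
    unfolding entry_integral_def integral_dyadic[where f = "\<lambda>q. F q $ i $ j"] polarization[OF sym[OF Q_sets], of _ _ i j]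
    by (simp add: sum_subtractf[symmetric] sum_distrib_left algebra_simps)
  then have "matrix_integral \<mu> (\<lambda>x. F (dyadic n x)) = (\<Sum>i\<in>UNIV. \<Sum>j\<in>UNIV. \<Sum>q\<in>dyadic n ` cell. F q $ i $ j * \<mu> (Q n q) $ i $ j)"
    by (simp add: matrix_integral_def)
  also have "\<dots> = (\<Sum>i\<in>UNIV. \<Sum>q\<in>dyadic n ` cell. \<Sum>j\<in>UNIV. F q $ i $ j * \<mu> (Q n q) $ i $ j)"
    by (subst sum.swap) simp
  also have "\<dots> = (\<Sum>q\<in>dyadic n ` cell. \<Sum>i\<in>UNIV. \<Sum>j\<in>UNIV. F q $ i $ j * \<mu> (Q n q) $ i $ j)"
    by (rule sum.swap)
  finally show ?thesis by (simp add: inner_vec_def)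
qed

lemma sum_trace_Q: "(\<Sum>q\<in>dyadic n ` cell. trace (\<mu> (Q n q))) = trace (\<mu> cell)"
proof -
  have "(\<Sum>q\<in>dyadic n ` cell. outer \<xi> \<xi> \<bullet> \<mu> (Q n q)) = outer \<xi> \<xi> \<bullet> \<mu> cell" for \<xi>
    using integral_dyadic[where f = "\<lambda>_. 1" and n = n and \<xi> = \<xi>] measure_quad[OF cell_sets, of \<xi>] by simp
  then show ?thesis
    unfolding trace_eq_outer by (subst sum.swap) simp
qed

text \<open>Dominated convergence in each quadratic measure. Linearity and bounds of the matrix
  integral will be inherited from the finite sums on the left.\<close>

lemma matrix_integral_dyadic_tendsto:
  fixes F :: "real ^ 'd \<Rightarrow> real ^ 'd ^ 'd"
  assumes F: "continuous_on UNIV F"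
  shows "(\<lambda>n. matrix_integral \<mu> (\<lambda>x. F (dyadic n x))) \<longlonglongrightarrow> matrix_integral \<mu> F"
proof -
  have "compact (F ` cbox 0 1)" by (intro compact_continuous_image continuous_on_subset[OF F]) auto
  then have "bounded (F ` cbox 0 1)" by (rule compact_imp_bounded)
  then obtain B where B: "\<And>x. x \<in> cbox 0 1 \<Longrightarrow> norm (F x) \<le> B"
    unfolding bounded_iff by blast
  have lim: "(\<lambda>n. \<integral>x. F (dyadic n x) $ i $ j \<partial>quad_measure \<mu> \<xi>) \<longlonglongrightarrow> (\<integral>x. F x $ i $ j \<partial>quad_measure \<mu> \<xi>)" for i j \<xi>
  proof (rule integral_dominated_convergence[where w = "\<lambda>_. B"])
    interpret finite_measure "quad_measure \<mu> \<xi>" by (rule finite_quad)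
    have "continuous_on UNIV (\<lambda>x. F x $ i $ j)" using F by (intro continuous_intros)
    then have Fm: "(\<lambda>x. F x $ i $ j) \<in> borel_measurable borel" by (rule borel_measurable_continuous_onI)
    have m: "g \<in> borel_measurable (quad_measure \<mu> \<xi>)" if "g \<in> borel_measurable borel" for g :: "real ^ 'd \<Rightarrow> real"
      using measurable_restrict_space1[OF that, of cell] by (simp add: measurable_def)
    show "(\<lambda>x. F x $ i $ j) \<in> borel_measurable (quad_measure \<mu> \<xi>)"
      "(\<lambda>x. F (dyadic n x) $ i $ j) \<in> borel_measurable (quad_measure \<mu> \<xi>)" for n
      using m[OF Fm] m[OF measurable_compose[OF measurable_dyadic Fm]] by auto
    show "integrable (quad_measure \<mu> \<xi>) (\<lambda>_. B)" by simp
    show "AE x in quad_measure \<mu> \<xi>. (\<lambda>n. F (dyadic n x) $ i $ j) \<longlonglongrightarrow> F x $ i $ j"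
    proof (rule AE_I2)
      fix x :: "real ^ 'd"
      have "(\<lambda>n. F (dyadic n x)) \<longlonglongrightarrow> F x"
        using F by (intro isCont_tendsto_compose[OF _ dyadic_tendsto]) (simp add: continuous_on_eq_continuous_at)
      then show "(\<lambda>n. F (dyadic n x) $ i $ j) \<longlonglongrightarrow> F x $ i $ j" by (intro tendsto_vec_nth)
    qed
    show "AE x in quad_measure \<mu> \<xi>. norm (F (dyadic n x) $ i $ j) \<le> B" for n
    proof (rule AE_I2)
      fix x assume "x \<in> space (quad_measure \<mu> \<xi>)"
      then have "dyadic n x \<in> cbox 0 1" using dyadic_cell cell_subset_cbox by auto
      then have "norm (F (dyadic n x)) \<le> B" by (rule B)
      then show "norm (F (dyadic n x) $ i $ j) \<le> B"
        using Finite_Cartesian_Product.norm_nth_le[of "F (dyadic n x)" i] Finite_Cartesian_Product.norm_nth_le[of "F (dyadic n x) $ i" j] by linarith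
    qed
  qed
  show ?thesis
    unfolding matrix_integral_def entry_integral_def by (intro tendsto_intros lim)
qed

text \<open>For dyadic step functions this is \<open>psd_inner_lower\<close> on each cube, and the
  traces over the cubes add up to the total trace; the bound survives the limit.\<close>

lemma matrix_integral_lower:
  fixes F :: "real ^ 'd \<Rightarrow> real ^ 'd ^ 'd"
  assumes F: "continuous_on UNIV F" and r: "\<And>x. x \<in> cell \<Longrightarrow> eneg (F x) \<le> r"
  shows "- r * trace (\<mu> cell) \<le> matrix_integral \<mu> F"
proof (rule LIMSEQ_le_const[OF matrix_integral_dyadic_tendsto[OF F]], intro exI allI impI)
  fix n
  have "(\<Sum>q\<in>dyadic n ` cell. - r * trace (\<mu> (Q n q))) \<le> (\<Sum>q\<in>dyadic n ` cell. F q \<bullet> \<mu> (Q n q))"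
  proof (rule sum_mono)
    fix q :: "real ^ 'd" assume "q \<in> dyadic n ` cell"
    then have q: "q \<in> cell" using dyadic_cell by auto
    have "0 \<le> r" using r[OF q] eneg_nonneg order_trans by blast
    then have "- r * (v \<bullet> v) \<le> v \<bullet> (F q *v v)" for v using r[OF q] by (simp add: eneg_le_iff)
    then show "- r * trace (\<mu> (Q n q)) \<le> F q \<bullet> \<mu> (Q n q)"
      by (intro psd_inner_lower sym pos Q_sets)
  qed
  then show "- r * trace (\<mu> cell) \<le> matrix_integral \<mu> (\<lambda>x. F (dyadic n x))"
    unfolding matrix_integral_dyadic sum_distrib_left[symmetric] sum_trace_Q .
qed

end

section \<open>Dissipative solutions are energy-variational\<close>

lemma AE_ex_between:
  assumes "0 \<le> s" "s < t" "t \<le> T" and P: "AE x in lebesgue_on {0<..<T::real}. P x"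
  shows "\<exists>x\<in>{s<..<t}. P x"
proof (rule ccontr)
  assume "\<not> ?thesis"
  then have *: "\<And>x. x \<in> {s<..<t} \<Longrightarrow> \<not> P x" by blast
  obtain N where N: "{x \<in> space (lebesgue_on {0<..<T}). \<not> P x} \<subseteq> N" "emeasure (lebesgue_on {0<..<T}) N = 0"
    "N \<in> sets (lebesgue_on {0<..<T})" using P by (rule AE_E)
  have "{s<..<t} \<subseteq> N" using * N(1) assms by (auto simp: space_restrict_space)
  then have "emeasure (lebesgue_on {0<..<T}) {s<..<t} \<le> 0"
    using emeasure_mono[of "{s<..<t}" N] N(2,3) by metis
  then show False using emeasure_lebesgue_on_Ioo[of s t T] assms by simp
qed

lemma bounded_variation_on_bounded:
  assumes T: "0 < T" and F: "bounded_variation_on T F"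
  obtains C where "\<And>t. t \<in> {0..T} \<Longrightarrow> \<bar>F t\<bar> \<le> C"
proof -
  obtain V where V: "\<And>n p. (\<forall>i\<le>n. p i \<in> {0..T}) \<and> (\<forall>i<n. p i \<le> p (Suc i)) \<Longrightarrow>
        (\<Sum>i<n. \<bar>F (p (Suc i)) - F (p i)\<bar>) \<le> V"
    using F unfolding bounded_variation_on_def by auto
  show ?thesis
  proof (rule that[of "\<bar>F 0\<bar> + V"])
    fix t assume t: "t \<in> {0..T}"
    have "(\<Sum>i<1. \<bar>F ((\<lambda>i::nat. if i = 0 then 0 else t) (Suc i)) - F ((\<lambda>i. if i = 0 then 0 else t) i)\<bar>) \<le> V"
      by (rule V) (use t T in auto)
    then show "\<bar>F t\<bar> \<le> \<bar>F 0\<bar> + V" by simp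
  qed
qed

lemma BV_bounded:
  assumes "0 < T" "BV T E"
  obtains C where "AE t in lebesgue_on {0<..<T}. \<bar>E t\<bar> \<le> C"
proof -
  obtain F where F: "bounded_variation_on T F" "AE t in lebesgue_on {0<..<T}. E t = F t"
    using assms(2) unfolding BV_def by blast
  obtain C where C: "\<And>t. t \<in> {0..T} \<Longrightarrow> \<bar>F t\<bar> \<le> C"
    by (rule bounded_variation_on_bounded[OF assms(1) F(1)]) blast
  have "AE t in lebesgue_on {0<..<T}. \<bar>E t\<bar> \<le> C"
    using F(2) AE_space by eventually_elim (use C in \<open>auto simp: space_restrict_space\<close>)
  then show ?thesis by (rule that)
qed

lemma nonincreasing_measurable:
  assumes "nonincreasing T E"
  shows "E \<in> borel_measurable (lebesgue_on {0<..<T})"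
proof -
  obtain F where F: "antimono_on {0<..<T} F" "AE t in lebesgue_on {0<..<T}. E t = F t"
    using assms unfolding nonincreasing_def by blast
  have "mono_on {0<..<T} (\<lambda>t. - F t)" using F(1) by (auto simp: monotone_on_def)
  then have "(\<lambda>t. - F t) \<in> borel_measurable (restrict_space borel {0<..<T})"
    by (intro borel_measurable_mono_on_fnc) auto
  then have "(\<lambda>t. - (- F t)) \<in> borel_measurable (restrict_space borel {0<..<T})" by (rule borel_measurable_uminus)
  then have "(\<lambda>t. indicator {0<..<T} t *\<^sub>R F t) \<in> borel_measurable borel"
    by (simp add: borel_measurable_restrict_space_iff)
  then have "(\<lambda>t. indicator {0<..<T} t *\<^sub>R F t) \<in> borel_measurable lebesgue"
    by (intro measurable_completion) simp
  then have m: "F \<in> borel_measurable (lebesgue_on {0<..<T})"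
    by (simp add: borel_measurable_restrict_space_iff)
  show ?thesis
    by (rule borel_measurable_lebesgue_on_AE_cong[OF _ m]) (use F(2) in \<open>auto elim: eventually_mono\<close>)
qed

text \<open>The initial value is the supremum of the monotone representative. The definite
  description is unambiguous because two representatives agree at times arbitrarily close to
  zero.\<close>

lemma initial_value_nonincreasing:
  assumes T: "0 < T" and E: "nonincreasing T E" and C: "AE t in lebesgue_on {0<..<T}. \<bar>E t\<bar> \<le> C"
  shows "AE t in lebesgue_on {0<..<T}. E t \<le> initial_value T E"
proof -
  obtain F where F: "antimono_on {0<..<T} F" "AE t in lebesgue_on {0<..<T}. E t = F t"
    using E unfolding nonincreasing_def by blast
  have FC: "AE t in lebesgue_on {0<..<T}. \<bar>F t\<bar> \<le> C" using F(2) C by eventually_elim simp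
  have bdd: "F t \<le> C" if t: "t \<in> {0<..<T}" for t
  proof -
    obtain s where "s \<in> {0<..<t}" "\<bar>F s\<bar> \<le> C"
      using AE_ex_between[OF _ _ _ FC, of 0 t] t by auto
    then show ?thesis using monotone_onD[OF F(1), of s t] t by auto
  qed
  define l where "l = (SUP t\<in>{0<..<T}. F t)"
  have bd: "bdd_above (F ` {0<..<T})" by (intro bdd_aboveI2[of _ _ C] bdd)
  have le: "F t \<le> l" if "t \<in> {0<..<T}" for t
    unfolding l_def by (rule cSUP_upper[OF that bd])
  have lim: "(F \<longlongrightarrow> l) (at_right 0)"
  proof (rule order_tendstoI)
    fix b assume "b < l"
    moreover have "{0<..<T} \<noteq> {}" using T by simp
    ultimately have "\<exists>t\<in>{0<..<T}. b < F t" unfolding l_def using less_cSUP_iff[OF _ bd] by blast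
    then obtain t where t: "t \<in> {0<..<T}" "b < F t" by blast
    have "b < F s" if "0 < s" "s < t" for s
      using monotone_onD[OF F(1), of s t] that t by auto
    then show "\<forall>\<^sub>F s in at_right 0. b < F s"
      unfolding eventually_at_right_field using t(1) by auto
  next
    fix b assume "l < b"
    then show "\<forall>\<^sub>F s in at_right 0. F s < b"
      unfolding eventually_at_right_field
    proof (intro exI conjI allI impI)
      fix s assume "0 < s" "s < T"
      then show "F s < b" using le[of s] \<open>l < b\<close> by simp
    qed (rule T)
  qed
  have iv: "initial_value T E = l"
    unfolding initial_value_def
  proof (rule the_equality)
    show "\<exists>F. (F \<longlongrightarrow> l) (at_right 0) \<and> (AE t in lebesgue_on {0<..<T}. E t = F t)"
      using lim F(2) by blast
  next
    fix l' assume "\<exists>F. (F \<longlongrightarrow> l') (at_right 0) \<and> (AE t in lebesgue_on {0<..<T}. E t = F t)"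
    then obtain G where G: "(G \<longlongrightarrow> l') (at_right 0)" "AE t in lebesgue_on {0<..<T}. E t = G t" by blast
    have FG: "AE t in lebesgue_on {0<..<T}. F t = G t" using F(2) G(2) by eventually_elim simp
    show "l' = l"
    proof (rule ccontr)
      assume "l' \<noteq> l"
      have lim': "((\<lambda>t. F t - G t) \<longlongrightarrow> l - l') (at_right 0)" by (intro tendsto_intros lim G)
      have "\<forall>\<^sub>F t in at_right 0. F t - G t \<noteq> 0"
        by (rule tendsto_imp_eventually_ne[OF lim']) (use \<open>l' \<noteq> l\<close> in auto)
      then obtain b where b: "0 < b" "\<And>t. 0 < t \<Longrightarrow> t < b \<Longrightarrow> F t \<noteq> G t"
        unfolding eventually_at_right_field by auto
      obtain t where "t \<in> {0<..<min b T}" "F t = G t"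
        using AE_ex_between[OF _ _ _ FG, of 0 "min b T"] b(1) T by auto
      then show False using b(2)[of t] by auto
    qed
  qed
  show ?thesis
    unfolding iv using F(2) AE_space by eventually_elim (use le in \<open>auto simp: space_restrict_space\<close>)
qed

lemma AE_lebesgue_on_Ioo_subset:
  assumes "AE t in lebesgue_on {0<..<T::real}. P t" "0 \<le> s"
  shows "AE t in lebesgue_on {s<..<T}. P t"
  using assms(1) by (simp add: AE_restrict_space_iff) (use assms(2) in \<open>auto elim: eventually_mono\<close>)

lemma nonincreasing_AE_AE:
  assumes "nonincreasing T E"
  shows "AE s in lebesgue_on {0<..<T}. AE t in lebesgue_on {s<..<T}. E t \<le> E s"
proof -
  obtain F where F: "antimono_on {0<..<T} F" "AE t in lebesgue_on {0<..<T}. E t = F t"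
    using assms unfolding nonincreasing_def by blast
  show ?thesis
    using F(2) AE_space
  proof eventually_elim
    case (elim s)
    then have s: "s \<in> {0<..<T}" by (simp add: space_restrict_space)
    have "AE t in lebesgue_on {s<..<T}. E t = F t"
      using AE_lebesgue_on_Ioo_subset[OF F(2)] s by simp
    then show ?case using AE_space
    proof eventually_elim
      case (elim t)
      then show ?case using monotone_onD[OF F(1), of s t] s \<open>E s = F s\<close> by (auto simp: space_restrict_space)
    qed
  qed
qed

section \<open>From the balances to the variational inequality\<close>

context euler_fields
begin

definition kap :: real where "kap = max 2 ((\<gamma> - 1) * real CARD('d))"

lemma kap_pos: "0 < kap" by (simp add: kap_def)

lemma AE_defect_nonneg: "C1_torus T \<phi> \<Longrightarrow> AE \<tau> in I. 0 \<le> defect \<phi> \<tau>"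
  using AE_gap AE_I_range
  by eventually_elim (auto simp: defect_def intro!: mult_nonneg_nonneg neg_norm_nonneg[OF T])

text \<open>Integrability in time of the measure term is not among the hypotheses: weak-star
  measurability concerns fixed symmetric fields, whereas \<open>nabla (\<phi> \<tau>)\<close>
  depends on time and is in general not symmetric. The proof therefore distinguishes two
  cases.\<close>

lemma matrix_integral_time_lower:
  assumes R: "\<And>t. t \<in> {0<..<T} \<Longrightarrow> psd_measure (R t)"
    and tr: "AE t in I. trace (R t cell) \<le> kap * (E t - en t)"
    and \<phi>: "C1_torus T \<phi>" and st: "0 \<le> s" "s \<le> t" "t \<le> T"
  shows "- kap * (tint T (defect \<phi>) t - tint T (defect \<phi>) s)
    \<le> (LINT \<tau>=s..t|lebesgue. matrix_integral (R \<tau>) (nabla (\<phi> \<tau>)))"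
proof -
  let ?f = "\<lambda>\<tau>. matrix_integral (R \<tau>) (nabla (\<phi> \<tau>))"
  have low: "AE \<tau> in I. - kap * defect \<phi> \<tau> \<le> ?f \<tau>"
    using tr AE_I_range
  proof eventually_elim
    case (elim \<tau>)
    then have \<tau>: "\<tau> \<in> {0..T}" by auto
    interpret psd_matrix_measure "R \<tau>" by unfold_locales (rule R[OF elim(2)])
    have "neg_norm (\<phi> \<tau>) * trace (R \<tau> cell) \<le> neg_norm (\<phi> \<tau>) * (kap * (E \<tau> - en \<tau>))"
      using elim by (intro mult_left_mono neg_norm_nonneg[OF T \<phi> \<tau>])
    moreover have "- neg_norm (\<phi> \<tau>) * trace (R \<tau> cell) \<le> ?f \<tau>"
      by (rule matrix_integral_lower[OF continuous_on_section[OF C1_torus_continuous_nabla[OF T \<phi>] \<tau>]])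
         (rule neg_norm_ge[OF T \<phi> \<tau>])
    ultimately show ?case by (simp add: defect_def mult_ac)
  qed
  have eq: "(LINT \<tau>=s..t|lebesgue. g \<tau>) = (\<integral>\<tau>. indicator {s<..<t} \<tau> *\<^sub>R g \<tau> \<partial>lebesgue)" for g :: "real \<Rightarrow> real"
    using st by (simp add: interval_lebesgue_integral_def set_lebesgue_integral_def einterval_eq_Icc)
  have i: "integrable I (\<lambda>\<tau>. - kap * defect \<phi> \<tau>)" using defect_integrable[OF \<phi>] by (intro integrable_mult_right)
  have dl: "tint T (defect \<phi>) t - tint T (defect \<phi>) s \<ge> 0"
  proof -
    have "tint T (\<lambda>_. 0) t - tint T (\<lambda>_. 0) s \<le> tint T (defect \<phi>) t - tint T (defect \<phi>) s"
      by (rule tint_mono_diff) (use AE_defect_nonneg[OF \<phi>] defect_integrable[OF \<phi>] st in auto)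
    then show ?thesis by (simp add: tint_def)
  qed
  show ?thesis
  proof (cases "integrable lebesgue (\<lambda>\<tau>. indicator {s<..<t} \<tau> *\<^sub>R ?f \<tau>)")
    case True
    have "integrable I (\<lambda>\<tau>. indicator {s<..<t} \<tau> * (- kap * defect \<phi> \<tau>))"
      by (rule integrable_indicator_lebesgue_on[OF i])
    then have "integrable lebesgue (\<lambda>\<tau>. indicator {0<..<T} \<tau> *\<^sub>R (indicator {s<..<t} \<tau> * (- kap * defect \<phi> \<tau>)))"
      by (subst (asm) integrable_restrict_space) auto
    then have i': "integrable lebesgue (\<lambda>\<tau>. indicator {s<..<t} \<tau> *\<^sub>R (- kap * defect \<phi> \<tau>))"
      by (rule Bochner_Integration.integrable_cong[THEN iffD1, rotated -1]) (use st in \<open>auto simp: indicator_def\<close>)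
    have "(\<integral>\<tau>. indicator {s<..<t} \<tau> *\<^sub>R (- kap * defect \<phi> \<tau>) \<partial>lebesgue) \<le> (\<integral>\<tau>. indicator {s<..<t} \<tau> *\<^sub>R ?f \<tau> \<partial>lebesgue)"
    proof (rule integral_mono_AE[OF i' True])
      have "AE \<tau> in lebesgue. \<tau> \<in> {0<..<T} \<longrightarrow> - kap * defect \<phi> \<tau> \<le> ?f \<tau>"
        using low by (subst (asm) AE_restrict_space_iff) auto
      then show "AE \<tau> in lebesgue. indicator {s<..<t} \<tau> *\<^sub>R (- kap * defect \<phi> \<tau>) \<le> indicator {s<..<t} \<tau> *\<^sub>R ?f \<tau>"
        by eventually_elim (use st in \<open>auto simp: indicator_def\<close>)
    qed
    then show ?thesis
      unfolding eq[symmetric] using interval_integral_eq_tint[OF i, of s t] st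
        tint_linear[OF integrable_const_lebesgue_on[of T 0] defect_integrable[OF \<phi>], where c = "- kap" and t = s]
        tint_linear[OF integrable_const_lebesgue_on[of T 0] defect_integrable[OF \<phi>], where c = "- kap" and t = t]
      by (simp add: tint_const algebra_simps)
  next
    case False
    \<comment> \<open>The integral has the default value zero here, and the asserted lower bound is
      nonpositive by \<open>dl\<close>.\<close>
    then have "(LINT \<tau>=s..t|lebesgue. ?f \<tau>) = 0" unfolding eq by (rule not_integrable_integral_eq)
    then show ?thesis using dl mult_nonneg_nonneg[OF less_imp_le[OF kap_pos] dl] by simp
  qed
qed

text \<open>At fixed times the left-hand side is Lipschitz in the tests for the \<open>C1\<close>
  distance. The constant \<open>K\<close> collects the integrals of the fields at both times, the
  flux bound \<open>CU\<close> and the bound \<open>C\<close> on the energy gap.\<close>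

lemma ev_lhs_le_0_dense:
  assumes Jm: "\<forall>\<rho>\<in>Jm. C1_torus T \<rho>" "\<forall>\<rho>. C1_torus T \<rho> \<longrightarrow> (\<forall>e>0. \<exists>\<sigma>\<in>Jm. mass_close T e \<rho> \<sigma>)"
    and Jp: "\<forall>\<phi>\<in>Jp. C1_torus T \<phi>" "\<forall>\<phi>. C1_torus T \<phi> \<longrightarrow> (\<forall>e>0. \<exists>\<psi>\<in>Jp. momentum_close T e \<phi> \<psi>)"
    and st: "s \<in> {0..T}" "t \<in> {0..T}"
    and Ut: "integrable torus (U t)" and hs: "integrable torus hs" and ms: "integrable torus ms"
    and le: "\<And>\<rho> \<phi>. \<rho> \<in> Jm \<Longrightarrow> \<phi> \<in> Jp \<Longrightarrow> ev_lhs a \<gamma> (\<gamma> - 1) T h m E es hs ms s t \<rho> \<phi> \<le> 0"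
    and \<rho>: "C1_torus T \<rho>" and \<phi>: "C1_torus T \<phi>"
  shows "ev_lhs a \<gamma> (\<gamma> - 1) T h m E es hs ms s t \<rho> \<phi> \<le> 0"
proof -
  let ?n = "\<lambda>f. (\<integral>x. norm (f x) \<partial>torus) + CU * T"
  define K where "K = ?n (h t) + ?n hs + ((\<integral>x. norm (m t x) \<partial>torus) + CU * T) + ((\<integral>x. norm (ms x) \<partial>torus) + CU * T) + kap * (C * T + C * T)"
  have main: "ev_lhs a \<gamma> (\<gamma> - 1) T h m E es hs ms s t \<rho> \<phi> \<le> K * e" if e: "0 < e" for e
  proof -
    obtain \<sigma> where \<sigma>: "\<sigma> \<in> Jm" "mass_close T e \<rho> \<sigma>" using Jm(2) \<rho> e by blast
    obtain \<psi> where \<psi>: "\<psi> \<in> Jp" "momentum_close T e \<phi> \<psi>" using Jp(2) \<phi> e by blast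
    have \<sigma>1: "C1_torus T \<sigma>" and \<psi>1: "C1_torus T \<psi>" using Jm(1) Jp(1) \<sigma> \<psi> by auto
    note 1 = mass_pot_close[OF \<rho> \<sigma>1 \<sigma>(2) st(2) integrable_hm(1)[OF Ut], folded mass_pot_def]
    note 2 = mass_pot_close[OF \<rho> \<sigma>1 \<sigma>(2) st(1) hs]
    note 3 = momentum_pot_close[OF \<phi> \<psi>1 \<psi>(2) st(2) integrable_hm(2)[OF Ut], folded momentum_pot_def]
    note 4 = momentum_pot_close[OF \<phi> \<psi>1 \<psi>(2) st(1) ms]
    note 5 = tint_defect_close[OF \<phi> \<psi>1 \<psi>(2) st(2)] tint_defect_close[OF \<phi> \<psi>1 \<psi>(2) st(1)]
    note kap_nonneg = less_imp_le[OF kap_pos]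
    have 6: "kap * ((tint T (defect \<psi>) t - tint T (defect \<psi>) s) - (tint T (defect \<phi>) t - tint T (defect \<phi>) s)) \<le> kap * ((C * T + C * T) * e)"
      using 5 by (intro mult_left_mono kap_nonneg) (auto simp: algebra_simps)
    have "ev_lhs a \<gamma> (\<gamma> - 1) T h m E es hs ms s t \<rho> \<phi> \<le> ev_lhs a \<gamma> (\<gamma> - 1) T h m E es hs ms s t \<sigma> \<psi> + K * e"
      unfolding ev_lhs_eq[OF \<rho> \<phi> st Ut hs ms] ev_lhs_eq[OF \<sigma>1 \<psi>1 st Ut hs ms] K_def kap_def[symmetric]
      using 1 2 3 4 6 unfolding distrib_right right_diff_distrib mult.assoc by linarith
    then show ?thesis using le[OF \<sigma>(1) \<psi>(1)] by linarith
  qed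
  show ?thesis
  proof (rule field_le_epsilon)
    fix e :: real assume e: "0 < e"
    have "K * (e / (\<bar>K\<bar> + 1)) \<le> e"
    proof -
      have "K * e \<le> \<bar>K\<bar> * e" using e by (intro mult_right_mono) auto
      moreover have "e * (\<bar>K\<bar> + 1) = \<bar>K\<bar> * e + e" by (simp add: algebra_simps)
      ultimately have "K * e \<le> e * (\<bar>K\<bar> + 1)" using e by linarith
      then show ?thesis by (simp add: pos_divide_le_eq add_nonneg_pos)
    qed
    moreover have "0 < e / (\<bar>K\<bar> + 1)" using e by (intro divide_pos_pos) auto
    ultimately show "ev_lhs a \<gamma> (\<gamma> - 1) T h m E es hs ms s t \<rho> \<phi> \<le> 0 + e"
      using main[of "e / (\<bar>K\<bar> + 1)"] by linarith
  qed
qed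

lemma balances_imp_ev_lhs_le_0:
  assumes R: "\<And>t. t \<in> {0<..<T} \<Longrightarrow> psd_measure (R t)"
    and tr: "AE t in I. trace (R t cell) \<le> kap * (E t - en t)"
    and \<rho>: "C1_torus T \<rho>" and \<phi>: "C1_torus T \<phi>" and st: "0 \<le> s" "s \<le> t" "t \<le> T"
    and Ut: "integrable torus (U t)" and hs: "integrable torus hs" and ms: "integrable torus ms"
    and mass: "mass_balance T h m hs s t \<rho>" and mom: "momentum_balance a \<gamma> T h m R ms s t \<phi>"
    and E: "E t \<le> es"
  shows "ev_lhs a \<gamma> (\<gamma> - 1) T h m E es hs ms s t \<rho> \<phi> \<le> 0"
proof -
  have st': "s \<in> {0..T}" "t \<in> {0..T}" using st by auto
  show ?thesis
    unfolding ev_lhs_eq[OF \<rho> \<phi> st' Ut hs ms] kap_def[symmetric]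
    using mass[unfolded mass_balance_iff[OF \<rho> st']] mom[unfolded momentum_balance_iff[OF \<phi> st']] E
      matrix_integral_time_lower[OF R tr \<phi> st] by simp
qed

end

lemma (in psd_matrix_measure) trace_nonneg: "0 \<le> trace (\<mu> cell)"
  unfolding trace_eq_outer by (intro sum_nonneg pos cell_sets)

lemma min_eq_inverse_max:
  fixes d \<gamma> :: real
  assumes "0 < d" "1 < \<gamma>"
  shows "min (1/2) (1 / (d * (\<gamma> - 1))) = 1 / max 2 ((\<gamma> - 1) * d)"
proof -
  define x where "x = (\<gamma> - 1) * d"
  have "0 < x" using assms by (simp add: x_def)
  then have "min (1/2) (1 / x) = 1 / max 2 x"
    by (cases "x \<le> 2") (auto simp: min_def max_def field_simps)
  then show ?thesis by (simp add: x_def mult.commute)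
qed

context euler_fields
begin

lemma integrable_on_subcylinder:
  fixes f :: "real \<Rightarrow> real ^ 'd \<Rightarrow> 'b::{banach, second_countable_topology}"
  assumes f: "integrable \<Omega> (\<lambda>z. f (fst z) (snd z))" and st: "0 < s" "t < T"
  shows "integrable (lebesgue_on ({s..t} \<times> cell)) (\<lambda>(t, x). f t x)"
proof -
  have \<Omega>: "{0<..<T} \<times> (cell :: (real ^ 'd) set) \<in> sets lebesgue" and S: "{s..t} \<times> (cell :: (real ^ 'd) set) \<in> sets lebesgue"
    by (rule AB_lebesgue; simp)+
  have "set_integrable lebesgue ({0<..<T} \<times> cell) (\<lambda>z. f (fst z) (snd z))"
    using f \<Omega> by (simp add: integrable_restrict_space set_integrable_def)
  then have "set_integrable lebesgue ({s..t} \<times> cell) (\<lambda>z. f (fst z) (snd z))"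
    by (rule set_integrable_subset[OF _ S]) (use st in auto)
  then show ?thesis
    using S by (simp add: integrable_restrict_space set_integrable_def case_prod_unfold)
qed

lemma L1_loc_fields: "L1_loc T h" "L1_loc T m"
proof -
  have "integrable \<Omega> (\<lambda>z. h (fst z) (snd z))" using integrable_fst[OF integrable_U] by (simp add: U_def)
  then show "L1_loc T h" unfolding L1_loc_def by (auto intro!: integrable_on_subcylinder[unfolded case_prod_unfold] simp: case_prod_unfold)
  have "integrable \<Omega> (\<lambda>z. m (fst z) (snd z))" using integrable_fst[OF integrable_snd[OF integrable_U]] by (simp add: U_def)
  then show "L1_loc T m" unfolding L1_loc_def by (auto intro!: integrable_on_subcylinder[unfolded case_prod_unfold] simp: case_prod_unfold)
qed

end

lemma AE_ball_swap:
  assumes J: "countable J" and P: "\<And>j. j \<in> J \<Longrightarrow> AE s in M. AE t in N. P j s t"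
  shows "AE s in M. AE t in N. \<forall>j\<in>J. P j s t"
proof -
  have "AE s in M. \<forall>j\<in>J. AE t in N. P j s t"
    using P by (intro AE_ball_countable[OF J, THEN iffD2]) blast
  then show ?thesis
    by (rule eventually_mono) (intro AE_ball_countable[OF J, THEN iffD2])
qed

theorem dissipative_imp_energy_variational:
  fixes h0 :: "real ^ 'd \<Rightarrow> real" and m0 :: "real ^ 'd \<Rightarrow> real ^ 'd"
  assumes T: "0 < T" and a: "0 < a" and \<gamma>: "1 < \<gamma>"
    and h0: "integrable torus h0" and m0: "integrable torus m0"
    and D: "dissipative_weak_solution a \<gamma> (min (1/2) (1 / (real CARD('d) * (\<gamma> - 1)))) T h0 m0 h m E"
  shows "energy_variational_solution a \<gamma> (\<gamma> - 1) T h0 m0 h m E"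
    and "ereal (initial_value T E) = energy a \<gamma> h0 m0"
proof -
  let ?c = "min (1/2) (1 / (real CARD('d) * (\<gamma> - 1)))"
  let ?I = "lebesgue_on {0<..<T}"
  obtain R where hL: "Linf_Lp T \<gamma> h" and mL: "Linf_Lp T (2 * \<gamma> / (1 + \<gamma>)) m" and BV: "BV T E"
    and R: "\<And>t. t \<in> {0<..<T} \<Longrightarrow> psd_measure (R t)"
    and mass: "\<And>\<rho>. C1_torus T \<rho> \<Longrightarrow> AE s in ?I. AE t in ?I. mass_balance T h m (h s) s t \<rho>"
      "\<And>\<rho>. C1_torus T \<rho> \<Longrightarrow> AE t in ?I. mass_balance T h m h0 0 t \<rho>"
    and mom: "\<And>\<phi>. C1_torus T \<phi> \<Longrightarrow> AE s in ?I. AE t in ?I. momentum_balance a \<gamma> T h m R (m s) s t \<phi>"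
      "\<And>\<phi>. C1_torus T \<phi> \<Longrightarrow> AE t in ?I. momentum_balance a \<gamma> T h m R m0 0 t \<phi>"
    and noninc: "nonincreasing T E" and iv: "ereal (initial_value T E) = energy a \<gamma> h0 m0"
    and ene: "AE t in ?I. energy a \<gamma> (h t) (m t) + ereal (?c * trace (R t cell)) \<le> ereal (E t)"
    using D unfolding dissipative_weak_solution_def Linf_weakstar_psd_def by blast
  show "ereal (initial_value T E) = energy a \<gamma> h0 m0" by (rule iv)
  obtain C where C: "AE t in ?I. \<bar>E t\<bar> \<le> C" using BV_bounded[OF T BV] by blast
  have c: "?c = 1 / max 2 ((\<gamma> - 1) * real CARD('d))" by (rule min_eq_inverse_max) (use \<gamma> in auto)
  have c0: "0 < ?c" unfolding c by simp
  have trnn: "0 \<le> trace (R t cell)" if "t \<in> {0<..<T}" for t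
    using psd_matrix_measure.trace_nonneg[OF psd_matrix_measure.intro[OF R[OF that]]] .
  have range: "AE t in ?I. t \<in> {0<..<T}" using AE_space[of ?I] by (simp add: space_restrict_space)
  have le: "AE t in ?I. energy a \<gamma> (h t) (m t) \<le> ereal (E t)"
    using ene range
  proof eventually_elim
    case (elim t)
    have "0 \<le> ?c * trace (R t cell)" using trnn[OF elim(2)] c0 by simp
    then have "energy a \<gamma> (h t) (m t) + 0 \<le> energy a \<gamma> (h t) (m t) + ereal (?c * trace (R t cell))"
      by (intro add_left_mono) simp
    then show ?case using elim(1) by simp
  qed
  interpret euler_fields a \<gamma> T C h m E
    by unfold_locales (fact T a \<gamma> hL mL nonincreasing_measurable[OF noninc] C le)+
  have tr: "AE t in I. trace (R t cell) \<le> kap * (E t - en t)"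
    using ene AE_en
  proof eventually_elim
    case (elim t)
    then have "en t + ?c * trace (R t cell) \<le> E t" by simp
    then have "trace (R t cell) / kap \<le> E t - en t" unfolding c kap_def by simp
    then show ?case using kap_pos by (simp add: field_simps)
  qed
  obtain Jm :: "(real \<Rightarrow> real ^ 'd \<Rightarrow> real) set" where Jm: "countable Jm" "\<forall>\<rho>\<in>Jm. C1_torus T \<rho>"
    "\<forall>\<rho>. C1_torus T \<rho> \<longrightarrow> (\<forall>e>0. \<exists>\<sigma>\<in>Jm. mass_close T e \<rho> \<sigma>)"
    using countable_dense_mass_tests[OF T] by blast
  obtain Jp :: "(real \<Rightarrow> real ^ 'd \<Rightarrow> real ^ 'd) set" where Jp: "countable Jp" "\<forall>\<rho>\<in>Jp. C1_torus T \<rho>"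
    "\<forall>\<rho>. C1_torus T \<rho> \<longrightarrow> (\<forall>e>0. \<exists>\<sigma>\<in>Jp. momentum_close T e \<rho> \<sigma>)"
    using countable_dense_momentum_tests[OF T] by blast
  have ev: "AE s in I. AE t in lebesgue_on {s<..<T}. \<forall>\<rho> \<phi>. C1_torus T \<rho> \<and> C1_torus T \<phi> \<longrightarrow>
          ev_lhs a \<gamma> (\<gamma> - 1) T h m E (E s) (h s) (m s) s t \<rho> \<phi> \<le> 0"
  proof -
    have "AE s in I. AE t in I. \<forall>\<rho>\<in>Jm. mass_balance T h m (h s) s t \<rho>"
      using mass(1) Jm(2) by (intro AE_ball_swap[OF Jm(1)]) blast
    moreover have "AE s in I. AE t in I. \<forall>\<phi>\<in>Jp. momentum_balance a \<gamma> T h m R (m s) s t \<phi>"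
      using mom(1) Jp(2) by (intro AE_ball_swap[OF Jp(1)]) blast
    ultimately show ?thesis
      using nonincreasing_AE_AE[OF noninc] AE_U AE_I_range
    proof eventually_elim
      case (elim s)
      then have s: "0 \<le> s" "s \<in> {0..T}" by auto
      have U: "integrable torus (U s)" using elim by simp
      show ?case
        using AE_lebesgue_on_Ioo_subset[OF elim(1) s(1)] AE_lebesgue_on_Ioo_subset[OF elim(2) s(1)]
          elim(3) AE_lebesgue_on_Ioo_subset[OF AE_U s(1)] AE_space[of "lebesgue_on {s<..<T}"]
      proof eventually_elim
        case (elim t)
        then have t: "s \<le> t" "t \<le> T" "t \<in> {0..T}" using s by (auto simp: space_restrict_space)
        show ?case
        proof (intro allI impI, elim conjE)
          fix \<rho> :: "real \<Rightarrow> real ^ 'd \<Rightarrow> real" and \<phi> :: "real \<Rightarrow> real ^ 'd \<Rightarrow> real ^ 'd"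
          assume \<rho>\<phi>: "C1_torus T \<rho>" "C1_torus T \<phi>"
          have Ut: "integrable torus (U t)" using elim by simp
          have le: "ev_lhs a \<gamma> (\<gamma> - 1) T h m E (E s) (h s) (m s) s t \<rho> \<phi> \<le> 0"
            if "\<rho> \<in> Jm" "\<phi> \<in> Jp" for \<rho> \<phi>
            by (rule balances_imp_ev_lhs_le_0[OF R tr _ _ s(1) t(1,2) Ut integrable_hm[OF U]])
               (use that elim Jm(2) Jp(2) in simp_all)
          show "ev_lhs a \<gamma> (\<gamma> - 1) T h m E (E s) (h s) (m s) s t \<rho> \<phi> \<le> 0"
            by (rule ev_lhs_le_0_dense[OF Jm(2,3) Jp(2,3) s(2) t(3) Ut integrable_hm[OF U] le \<rho>\<phi>])
        qed
      qed
    qed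
  qed
  have ev0: "AE t in I. \<forall>\<rho> \<phi>. C1_torus T \<rho> \<and> C1_torus T \<phi> \<longrightarrow>
          ev_lhs a \<gamma> (\<gamma> - 1) T h m E (initial_value T E) h0 m0 0 t \<rho> \<phi> \<le> 0"
  proof -
    have "AE t in I. \<forall>\<rho>\<in>Jm. mass_balance T h m h0 0 t \<rho>"
      using mass(2) Jm(2) by (intro AE_ball_countable[OF Jm(1), THEN iffD2]) blast
    moreover have "AE t in I. \<forall>\<phi>\<in>Jp. momentum_balance a \<gamma> T h m R m0 0 t \<phi>"
      using mom(2) Jp(2) by (intro AE_ball_countable[OF Jp(1), THEN iffD2]) blast
    ultimately show ?thesis
      using initial_value_nonincreasing[OF T noninc C] AE_U AE_I_range
    proof eventually_elim
      case (elim t)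
      then have t: "0 \<le> t" "t \<le> T" "t \<in> {0..T}" "0 \<in> {0..T}" by auto
      show ?case
      proof (intro allI impI, elim conjE)
        fix \<rho> :: "real \<Rightarrow> real ^ 'd \<Rightarrow> real" and \<phi> :: "real \<Rightarrow> real ^ 'd \<Rightarrow> real ^ 'd"
        assume \<rho>\<phi>: "C1_torus T \<rho>" "C1_torus T \<phi>"
        have Ut: "integrable torus (U t)" using elim by simp
        have le: "ev_lhs a \<gamma> (\<gamma> - 1) T h m E (initial_value T E) h0 m0 0 t \<rho> \<phi> \<le> 0"
          if "\<rho> \<in> Jm" "\<phi> \<in> Jp" for \<rho> \<phi>
          by (rule balances_imp_ev_lhs_le_0[OF R tr _ _ order_refl t(1,2) Ut h0 m0])
             (use that elim Jm(2) Jp(2) in simp_all)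
        show "ev_lhs a \<gamma> (\<gamma> - 1) T h m E (initial_value T E) h0 m0 0 t \<rho> \<phi> \<le> 0"
          by (rule ev_lhs_le_0_dense[OF Jm(2,3) Jp(2,3) t(4,3) Ut h0 m0 le \<rho>\<phi>])
      qed
    qed
  qed
  show "energy_variational_solution a \<gamma> (\<gamma> - 1) T h0 m0 h m E"
    unfolding energy_variational_solution_def
    using L1_loc_fields nonneg_h BV energy_le ev ev0 by simp
qed

section \<open>Lipschitz functions as integrals\<close>

text \<open>\<open>H\<close> is a bi-Lipschitz bijection of the line. Its Stieltjes measure is the
  image of Lebesgue measure under the inverse, and it is absolutely continuous because Lipschitz
  maps preserve null sets. The Radon-Nikodym density acts as the derivative of \<open>H\<close>,
  without an appeal to differentiability almost everywhere.\<close>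

lemma Lipschitz_strictly_increasing_density:
  fixes H :: "real \<Rightarrow> real"
  assumes eps: "0 < \<epsilon>" and low: "\<And>x y. x \<le> y \<Longrightarrow> \<epsilon> * (y - x) \<le> H y - H x"
    and up: "\<And>x y. x \<le> y \<Longrightarrow> H y - H x \<le> K * (y - x)"
  shows "\<exists>n\<in>borel_measurable borel. \<forall>s t. s \<le> t \<longrightarrow> (\<integral>\<^sup>+x. n x * indicator {s<..<t} x \<partial>lborel) = ennreal (H t - H s)"
proof -
  have K: "0 < K" using low[of 0 1] up[of 0 1] eps by simp
  have Lip: "\<bar>H y - H x\<bar> \<le> K * \<bar>y - x\<bar>" for x y
  proof -
    have "\<bar>H y - H x\<bar> \<le> K * \<bar>y - x\<bar>" if "x \<le> y" for x y
    proof -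
      have "0 \<le> \<epsilon> * (y - x)" using that eps by simp
      then show ?thesis using low[OF that] up[OF that] that by simp
    qed
    from this[of x y] this[of y x] show ?thesis by (cases "x \<le> y") (auto simp: abs_minus_commute)
  qed
  have strict: "x < y \<Longrightarrow> H x < H y" for x y
    using low[of x y] mult_pos_pos[OF eps, of "y - x"] by simp
  then have iff: "H x \<le> H y \<longleftrightarrow> x \<le> y" for x y
  proof (cases "x \<le> y")
    case True
    then show ?thesis using strict[of x y] by (cases "x = y") auto
  next
    case False
    then show ?thesis using strict[of y x] by auto
  qed
  have inj: "inj H" by (rule injI, rule order_antisym) (simp_all add: iff[symmetric])
  have cont: "continuous_on UNIV H"
    by (rule lipschitz_on_continuous_on[of K], rule lipschitz_onI) (use Lip K in \<open>auto simp: dist_real_def abs_minus_commute\<close>)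
  have surj: "surj H"
    unfolding surj_def
  proof
    fix y
    \<comment> \<open>The growth rate \<open>\<epsilon>\<close> forces
      \<open>H (- b) \<le> y \<le> H b\<close> for this \<open>b\<close>.\<close>
    define b where "b = (\<bar>y\<bar> + \<bar>H 0\<bar>) / \<epsilon>"
    have b: "0 \<le> b" "\<epsilon> * b = \<bar>y\<bar> + \<bar>H 0\<bar>" using eps by (auto simp: b_def)
    have "H (- b) \<le> y" "y \<le> H b" using low[of "-b" 0] low[of 0 b] b by auto
    moreover have "continuous_on {-b..b} H" using cont by (rule continuous_on_subset) simp
    ultimately have "\<exists>x\<ge>-b. x \<le> b \<and> H x = y" using b(1) by (intro IVT') auto
    then show "\<exists>x. y = H x" by blast
  qed
  define J where "J = inv H"
  have HJ: "H (J y) = y" and JH: "J (H x) = x" for x y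
    using surj inj by (auto simp: J_def surj_f_inv_f)
  have "mono J" by (rule monoI) (metis HJ iff)
  then have J [measurable]: "J \<in> borel_measurable borel" by (rule borel_measurable_mono)
  \<comment> \<open>\<open>\<nu>\<close> measures a Borel set by the Lebesgue measure of its image
    under \<open>H\<close>.\<close>
  define \<nu> where "\<nu> = distr lborel borel J"
  have pre: "J -` A = H ` A" for A
  proof (intro equalityI subsetI)
    fix x assume "x \<in> J -` A"
    then show "x \<in> H ` A" using HJ by (intro image_eqI[of _ _ "J x"]) auto
  qed (use JH in auto)
  have em: "emeasure \<nu> A = emeasure lborel (H ` A)" if "A \<in> sets borel" for A
    unfolding \<nu>_def using that by (subst emeasure_distr) (auto simp: pre)
  have img: "H ` {s<..<t} = {H s<..<H t}" for s t
  proof (intro equalityI subsetI)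
    fix y assume "y \<in> {H s<..<H t}"
    then have "s < J y" "J y < t" using iff[of "J y" s] iff[of t "J y"] HJ[of y] by auto
    then show "y \<in> H ` {s<..<t}" using HJ by (intro image_eqI[of _ _ "J y"]) auto
  qed (use strict in auto)
  have "absolutely_continuous lborel \<nu>"
    unfolding absolutely_continuous_def
  proof
    fix N :: "real set" assume N: "N \<in> null_sets lborel"
    then have neg: "negligible N" by (simp add: negligible_iff_null_sets null_sets_completionI)
    have "negligible (H ` N)"
    proof (rule negligible_locally_Lipschitz_image[OF _ neg])
      show "\<exists>T B. open T \<and> x \<in> T \<and> (\<forall>y\<in>N \<inter> T. norm (H y - H x) \<le> B * norm (y - x))" if "x \<in> N" for x
        using Lip by (intro exI[of _ UNIV] exI[of _ K]) auto
    qed simp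
    have HN: "H ` N \<in> sets borel"
      using measurable_sets[OF J, of N] N by (simp add: pre null_sets_def)
    have "emeasure lebesgue (H ` N) = 0"
      using \<open>negligible (H ` N)\<close> unfolding negligible_iff_null_sets by (rule null_setsD1)
    then have "emeasure lborel (H ` N) = 0" using HN by simp
    then show "N \<in> null_sets \<nu>" using N em[of N] by (auto simp: null_sets_def \<nu>_def)
  qed
  then obtain n where n: "n \<in> borel_measurable lborel" "density lborel n = \<nu>"
    using sigma_finite_measure.Radon_Nikodym[OF sigma_finite_lborel, of \<nu>] by (auto simp: \<nu>_def)
  show ?thesis
  proof (intro bexI[of _ n] allI impI)
    show "n \<in> borel_measurable borel" using n(1) by simp
    fix s t :: real assume "s \<le> t"
    then have "H s \<le> H t" by (simp add: iff)
    have "(\<integral>\<^sup>+x. n x * indicator {s<..<t} x \<partial>lborel) = emeasure \<nu> {s<..<t}"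
      unfolding n(2)[symmetric] by (subst emeasure_density[OF n(1)]) auto
    also have "\<dots> = ennreal (H t - H s)" using em[of "{s<..<t}"] \<open>H s \<le> H t\<close> by (simp add: img)
    finally show "(\<integral>\<^sup>+x. n x * indicator {s<..<t} x \<partial>lborel) = ennreal (H t - H s)" .
  qed
qed

text \<open>Positive and negative part of the zero extension of \<open>f\<close> define finite
  measures with equal values on all half-lines, hence equal measures. By uniqueness of densities the
  two parts agree almost everywhere, so both vanish.\<close>

lemma tint_eq_0_imp_AE:
  assumes f: "integrable (lebesgue_on {0<..<T}) f" and z: "\<And>t. t \<in> {0..T} \<Longrightarrow> tint T f t = 0" and T: "0 < T"
  shows "AE \<tau> in lebesgue_on {0<..<T}. f \<tau> = 0"
proof -
  have int: "integrable lebesgue (\<lambda>\<tau>. indicator {0<..<T} \<tau> *\<^sub>R f \<tau>)"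
    using f by (subst (asm) integrable_restrict_space) auto
  \<comment> \<open>A Borel version is taken because uniqueness of densities is applied over
    \<open>lborel\<close>.\<close>
  obtain f' where f': "f' \<in> borel_measurable lborel" "AE \<tau> in lborel. indicator {0<..<T} \<tau> *\<^sub>R f \<tau> = f' \<tau>"
    using completion_ex_borel_measurable_real[OF borel_measurable_integrable[OF int]] by auto
  have ae: "AE \<tau> in lebesgue. indicator {0<..<T} \<tau> *\<^sub>R f \<tau> = f' \<tau>"
    using f'(2) by (rule AE_completion)
  have f'm: "f' \<in> borel_measurable lebesgue" using f'(1) by (rule measurable_completion)
  have "integrable lebesgue f'"
    by (rule integrable_cong_AE_imp[OF int f'm]) (use ae in \<open>auto elim: eventually_mono\<close>)
  then have f'i: "integrable lborel f'" using f'(1) by (simp add: integrable_completion)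
  have z': "(\<integral>\<tau>. f' \<tau> * indicator {s<..} \<tau> \<partial>lborel) = 0" for s
  proof -
    have "(\<integral>\<tau>. f' \<tau> * indicator {s<..} \<tau> \<partial>lborel) = (\<integral>\<tau>. f' \<tau> * indicator {s<..} \<tau> \<partial>lebesgue)"
      using f'(1) by (subst integral_completion) auto
    also have "\<dots> = (\<integral>\<tau>. indicator {0<..<T} \<tau> *\<^sub>R (indicator {max 0 s<..<max 0 T} \<tau> * f \<tau>) \<partial>lebesgue)"
    proof (rule integral_cong_AE)
      show "AE \<tau> in lebesgue. f' \<tau> * indicator {s<..} \<tau> = indicator {0<..<T} \<tau> *\<^sub>R (indicator {max 0 s<..<max 0 T} \<tau> * f \<tau>)"
        using ae by eventually_elim (auto simp: indicator_def split: if_splits)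
      have "(\<lambda>\<tau>. indicator {max 0 s<..<max 0 T} \<tau> * (indicator {0<..<T} \<tau> *\<^sub>R f \<tau>)) \<in> borel_measurable lebesgue"
        by (intro borel_measurable_times borel_measurable_integrable[OF int] borel_measurable_indicator) simp
      then show "(\<lambda>\<tau>. indicator {0<..<T} \<tau> *\<^sub>R (indicator {max 0 s<..<max 0 T} \<tau> * f \<tau>)) \<in> borel_measurable lebesgue"
        by (simp add: mult_ac)
      show "(\<lambda>\<tau>. f' \<tau> * indicator {s<..} \<tau>) \<in> borel_measurable lebesgue"
        by (intro borel_measurable_times f'm borel_measurable_indicator) simp
    qed
    also have "\<dots> = (\<integral>\<tau>. indicator {max 0 s<..<max 0 T} \<tau> * f \<tau> \<partial>lebesgue_on {0<..<T})"
      by (subst integral_restrict_space) auto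
    also have "\<dots> = 0"
    proof (cases "max 0 s \<le> T")
      case True
      then show ?thesis using tint_diff[OF f, of "max 0 s" T] z[of T] z[of "max 0 s"] T by (simp add: max_def)
    next
      case False
      then have "{max 0 s<..<max 0 T} = {}" using T by auto
      then show ?thesis by simp
    qed
    finally show ?thesis .
  qed
  have fin: "(\<integral>\<^sup>+\<tau>. ennreal (f' \<tau>) * indicator {s<..} \<tau> \<partial>lborel) < \<infinity> \<and>
      (\<integral>\<^sup>+\<tau>. ennreal (f' \<tau>) * indicator {s<..} \<tau> \<partial>lborel) = (\<integral>\<^sup>+\<tau>. ennreal (- f' \<tau>) * indicator {s<..} \<tau> \<partial>lborel)" for s
  proof -
    have i: "integrable lborel (\<lambda>\<tau>. f' \<tau> * indicator {s<..} \<tau>)"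
      using integrable_real_mult_indicator[OF _ f'i, of "{s<..}"] by simp
    have e: "(\<integral>\<^sup>+\<tau>. ennreal (f' \<tau> * indicator {s<..} \<tau>) \<partial>lborel) = (\<integral>\<^sup>+\<tau>. ennreal (f' \<tau>) * indicator {s<..} \<tau> \<partial>lborel)"
      "(\<integral>\<^sup>+\<tau>. ennreal (- (f' \<tau> * indicator {s<..} \<tau>)) \<partial>lborel) = (\<integral>\<^sup>+\<tau>. ennreal (- f' \<tau>) * indicator {s<..} \<tau> \<partial>lborel)"
      by (auto intro!: nn_integral_cong split: split_indicator)
    have "enn2real (\<integral>\<^sup>+\<tau>. ennreal (f' \<tau>) * indicator {s<..} \<tau> \<partial>lborel) = enn2real (\<integral>\<^sup>+\<tau>. ennreal (- f' \<tau>) * indicator {s<..} \<tau> \<partial>lborel)"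
      using z'[of s] i unfolding real_lebesgue_integral_def[OF i] e by simp
    moreover have "(\<integral>\<^sup>+\<tau>. ennreal (f' \<tau>) * indicator {s<..} \<tau> \<partial>lborel) \<noteq> \<infinity>" "(\<integral>\<^sup>+\<tau>. ennreal (- f' \<tau>) * indicator {s<..} \<tau> \<partial>lborel) \<noteq> \<infinity>"
      using i unfolding real_integrable_def e by auto
    ultimately show ?thesis by (metis ennreal_enn2real_if infinity_ennreal_def less_top)
  qed
  have "density lborel (\<lambda>\<tau>. ennreal (f' \<tau>)) = density lborel (\<lambda>\<tau>. ennreal (- f' \<tau>))"
  proof (rule measure_eqI_lessThan)
    fix s
    show "emeasure (density lborel (\<lambda>\<tau>. ennreal (f' \<tau>))) {s<..} < \<infinity>"
      using fin[of s, THEN conjunct1] f'(1) by (simp add: emeasure_density)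
    show "emeasure (density lborel (\<lambda>\<tau>. ennreal (f' \<tau>))) {s<..} = emeasure (density lborel (\<lambda>\<tau>. ennreal (- f' \<tau>))) {s<..}"
      using fin[of s, THEN conjunct2] f'(1) by (simp add: emeasure_density)
  qed auto
  then have "AE \<tau> in lborel. ennreal (f' \<tau>) = ennreal (- f' \<tau>)"
    using f'(1) by (intro sigma_finite_measure.density_unique[OF sigma_finite_lborel]) auto
  then have "AE \<tau> in lborel. f' \<tau> = 0"
    by eventually_elim (metis ennreal_neg ennreal_eq_0_iff le_cases neg_le_0_iff_le order_antisym)
  then have "AE \<tau> in lebesgue. f' \<tau> = 0" by (rule AE_completion)
  then have "AE \<tau> in lebesgue. \<tau> \<in> {0<..<T} \<longrightarrow> f \<tau> = 0"
    using ae by eventually_elim auto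
  then show ?thesis by (subst AE_restrict_space_iff) auto
qed

text \<open>Moves the density to \<open>(0, T)\<close> and makes it real-valued; it is finite almost
  everywhere because its integral is \<open>H T - H 0\<close>.\<close>

lemma tint_density:
  fixes H :: "real \<Rightarrow> real"
  assumes eps: "0 < \<epsilon>" and low: "\<And>x y. x \<le> y \<Longrightarrow> \<epsilon> * (y - x) \<le> H y - H x"
    and up: "\<And>x y. x \<le> y \<Longrightarrow> H y - H x \<le> K * (y - x)" and T: "0 < T"
  shows "\<exists>n. integrable (lebesgue_on {0<..<T}) n \<and> (\<forall>\<tau>. 0 \<le> n \<tau>) \<and> (\<forall>t\<in>{0..T}. tint T n t = H t - H 0)"
proof -
  have "\<exists>n\<in>borel_measurable borel. \<forall>s t. s \<le> t \<longrightarrow> (\<integral>\<^sup>+x. n x * indicator {s<..<t} x \<partial>lborel) = ennreal (H t - H s)"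
    by (rule Lipschitz_strictly_increasing_density[where K = K]) (fact eps low up)+
  then obtain n where n: "n \<in> borel_measurable borel"
    "\<forall>s t. s \<le> t \<longrightarrow> (\<integral>\<^sup>+x. n x * indicator {s<..<t} x \<partial>lborel) = ennreal (H t - H s)"
    by blast
  let ?I = "lebesgue_on {0<..<T}"
  have nm [measurable]: "n \<in> borel_measurable ?I"
    using n(1) by (intro measurable_restrict_space1 measurable_completion) simp
  have nn: "(\<integral>\<^sup>+\<tau>. n \<tau> * indicator {0<..<t} \<tau> \<partial>?I) = ennreal (H t - H 0)" if "t \<in> {0..T}" for t
  proof -
    have "(\<integral>\<^sup>+\<tau>. n \<tau> * indicator {0<..<t} \<tau> \<partial>?I) = (\<integral>\<^sup>+\<tau>. (n \<tau> * indicator {0<..<t} \<tau>) * indicator {0<..<T} \<tau> \<partial>lebesgue)"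
      by (rule nn_integral_restrict_space) simp
    also have "\<dots> = (\<integral>\<^sup>+\<tau>. n \<tau> * indicator {0<..<t} \<tau> \<partial>lborel)"
      unfolding nn_integral_completion by (rule nn_integral_cong) (use that in \<open>auto split: split_indicator\<close>)
    finally show ?thesis using n(2) that by simp
  qed
  have "(\<integral>\<^sup>+\<tau>. n \<tau> \<partial>?I) = (\<integral>\<^sup>+\<tau>. n \<tau> * indicator {0<..<T} \<tau> \<partial>?I)"
    by (rule nn_integral_cong) (auto simp: space_restrict_space)
  then have fin: "(\<integral>\<^sup>+\<tau>. n \<tau> \<partial>?I) < \<infinity>" using nn[of T] T by simp
  then have ae: "AE \<tau> in ?I. n \<tau> \<noteq> \<infinity>" by (intro nn_integral_PInf_AE) auto
  have ae': "AE \<tau> in ?I. ennreal (enn2real (n \<tau>)) = n \<tau>" using ae by eventually_elim (simp add: less_top)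
  show ?thesis
  proof (intro exI[of _ "\<lambda>\<tau>. enn2real (n \<tau>)"] conjI ballI allI)
    have "(\<integral>\<^sup>+\<tau>. ennreal (norm (enn2real (n \<tau>))) \<partial>?I) = (\<integral>\<^sup>+\<tau>. n \<tau> \<partial>?I)"
      by (rule nn_integral_cong_AE) (use ae' in auto)
    then show "integrable ?I (\<lambda>\<tau>. enn2real (n \<tau>))"
      using fin by (intro integrableI_bounded) auto
    fix t assume t: "t \<in> {0..T}"
    have "tint T (\<lambda>\<tau>. enn2real (n \<tau>)) t = enn2real (\<integral>\<^sup>+\<tau>. ennreal (indicator {0<..<t} \<tau> * enn2real (n \<tau>)) \<partial>?I)"
      unfolding tint_def
    proof (rule integral_eq_nn_integral)
      have "{0<..<t} \<in> sets ?I" using t by (auto simp: sets_restrict_space)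
      then show "(\<lambda>\<tau>. indicator {0<..<t} \<tau> * enn2real (n \<tau>)) \<in> borel_measurable ?I" by measurable
    qed auto
    also have "(\<integral>\<^sup>+\<tau>. ennreal (indicator {0<..<t} \<tau> * enn2real (n \<tau>)) \<partial>?I) = (\<integral>\<^sup>+\<tau>. n \<tau> * indicator {0<..<t} \<tau> \<partial>?I)"
      by (rule nn_integral_cong_AE, use ae' in eventually_elim) (auto split: split_indicator)
    also have "enn2real \<dots> = H t - H 0"
    proof -
      have "0 \<le> \<epsilon> * (t - 0)" using eps t by simp
      then have "0 \<le> H t - H 0" using low[of 0 t] t by simp
      then show ?thesis using nn[OF t] by simp
    qed
    finally show "tint T (\<lambda>\<tau>. enn2real (n \<tau>)) t = H t - H 0" .
  qed auto
qed

text \<open>After adding \<open>\<epsilon> * x\<close> the primitive grows at a positive rate, so it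
  has a nonnegative density \<open>n\<close>, and uniqueness identifies \<open>n\<close> with
  \<open>f + \<epsilon>\<close>. The values \<open>\<epsilon> = 1 / Suc k\<close> give the
  claim.\<close>

lemma tint_increasing_imp_AE_nonneg:
  assumes T: "0 < T" and f: "integrable (lebesgue_on {0<..<T}) f"
    and K: "\<And>s t. 0 \<le> s \<Longrightarrow> s \<le> t \<Longrightarrow> t \<le> T \<Longrightarrow> tint T f t - tint T f s \<le> K * (t - s)"
    and mono: "\<And>s t. 0 \<le> s \<Longrightarrow> s \<le> t \<Longrightarrow> t \<le> T \<Longrightarrow> tint T f s \<le> tint T f t"
  shows "AE \<tau> in lebesgue_on {0<..<T}. 0 \<le> f \<tau>"
proof -
  let ?I = "lebesgue_on {0<..<T}"
  have ge: "AE \<tau> in ?I. - \<epsilon> \<le> f \<tau>" if \<epsilon>: "0 < \<epsilon>" for \<epsilon>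
  proof -
    \<comment> \<open>Clamping to \<open>[0, T]\<close> makes the hypotheses, which concern that
      interval, available at all real points, as \<open>tint_density\<close> requires.\<close>
    define p where "p = (\<lambda>x. min T (max 0 x))"
    define H where "H = (\<lambda>x. tint T f (p x) + \<epsilon> * x)"
    have p: "0 \<le> p x" "p x \<le> T" for x using T by (auto simp: p_def)
    have pm: "p x \<le> p y" "p y - p x \<le> y - x" if "x \<le> y" for x y using that T by (auto simp: p_def min_def max_def)
    have low: "\<epsilon> * (y - x) \<le> H y - H x" if "x \<le> y" for x y
      using mono[OF p(1) pm(1)[OF that] p(2)] by (simp add: H_def algebra_simps)
    have up: "H y - H x \<le> (\<bar>K\<bar> + \<epsilon>) * (y - x)" if "x \<le> y" for x y
    proof -
      have "tint T f (p y) - tint T f (p x) \<le> K * (p y - p x)"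
        by (rule K[OF p(1) pm(1)[OF that] p(2)])
      also have "\<dots> \<le> \<bar>K\<bar> * (p y - p x)" using pm(1)[OF that] by (intro mult_right_mono) auto
      also have "\<dots> \<le> \<bar>K\<bar> * (y - x)" using pm[OF that] by (intro mult_left_mono) auto
      finally show ?thesis by (simp add: H_def algebra_simps)
    qed
    have "\<exists>n. integrable (lebesgue_on {0<..<T}) n \<and> (\<forall>\<tau>. 0 \<le> n \<tau>) \<and> (\<forall>t\<in>{0..T}. tint T n t = H t - H 0)"
      by (rule tint_density[where K = "\<bar>K\<bar> + \<epsilon>"]) (fact \<epsilon> low up T)+
    then obtain n where n: "integrable ?I n" "\<And>\<tau>. 0 \<le> n \<tau>" "\<And>t. t \<in> {0..T} \<Longrightarrow> tint T n t = H t - H 0"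
      by blast
    have i1: "integrable ?I (\<lambda>\<tau>. f \<tau> + (-1) * n \<tau>)" and i2: "integrable ?I (\<lambda>\<tau>. (f \<tau> + (-1) * n \<tau>) + \<epsilon> * 1)"
      using f n(1) integrable_const_lebesgue_on[of T \<epsilon>] by auto
    have "AE \<tau> in ?I. (f \<tau> + (-1) * n \<tau>) + \<epsilon> * 1 = 0"
    proof (rule tint_eq_0_imp_AE[OF i2 _ T])
      fix t assume t: "t \<in> {0..T}"
      have "tint T (\<lambda>\<tau>. (f \<tau> + (-1) * n \<tau>) + \<epsilon> * 1) t = tint T f t + (-1) * tint T n t + \<epsilon> * t"
        using tint_linear[OF i1 integrable_const_lebesgue_on[of T 1], of \<epsilon> t] tint_linear[OF f n(1), of "-1" t] t
        by (simp add: tint_const)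
      then show "tint T (\<lambda>\<tau>. (f \<tau> + (-1) * n \<tau>) + \<epsilon> * 1) t = 0"
        using n(3)[OF t] t T by (simp add: H_def p_def)
    qed
    then show ?thesis by eventually_elim (use n(2) in \<open>smt (verit)\<close>)
  qed
  have "AE \<tau> in ?I. \<forall>k::nat. - (1 / real (Suc k)) \<le> f \<tau>"
    unfolding AE_all_countable by (intro allI ge) simp
  then show ?thesis
  proof eventually_elim
    case (elim \<tau>)
    show ?case
    proof (rule ccontr)
      assume "\<not> 0 \<le> f \<tau>"
      then obtain k where "1 / real (Suc k) < - f \<tau>" using nat_approx_posE[of "- f \<tau>"] by auto
      then show False using elim[rule_format, of k] by linarith
    qed
  qed
qed

text \<open>McShane's extension turns the Lipschitz function on \<open>G\<close> into one on the real line.\<close>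

lemma Lipschitz_on_good_times_density:
  assumes T: "0 < T" and G: "G \<subseteq> {0..T}" and K: "0 \<le> K"
    and L: "\<And>s t. s \<in> G \<Longrightarrow> t \<in> G \<Longrightarrow> \<bar>L s - L t\<bar> \<le> K * \<bar>s - t\<bar>" and G0: "0 \<in> G" "L 0 = 0"
  shows "\<exists>g. integrable (lebesgue_on {0<..<T}) g \<and> (\<forall>t\<in>G. tint T g t = L t) \<and>
    (\<forall>s\<in>{0..T}. \<forall>t\<in>{0..T}. \<bar>tint T g t - tint T g s\<bar> \<le> K * \<bar>t - s\<bar>)"
proof -
  define F where "F = (\<lambda>x. INF s\<in>G. L s + K * \<bar>x - s\<bar>)"
  have bdd: "bdd_below ((\<lambda>s. L s + K * \<bar>x - s\<bar>) ` G)" for x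
  proof (rule bdd_belowI2)
    fix s assume s: "s \<in> G"
    have "\<bar>L s\<bar> \<le> K * \<bar>s\<bar>" using L[OF s G0(1)] G0(2) by simp
    moreover have "K * \<bar>s\<bar> \<le> K * \<bar>x - s\<bar> + K * \<bar>x\<bar>"
      unfolding distrib_left[symmetric] using K by (intro mult_left_mono) auto
    ultimately show "- (K * \<bar>x\<bar>) \<le> L s + K * \<bar>x - s\<bar>" by linarith
  qed
  have FL: "F t = L t" if t: "t \<in> G" for t
  proof (rule antisym)
    show "F t \<le> L t" unfolding F_def using cINF_lower[OF bdd t, of t] by simp
    show "L t \<le> F t" unfolding F_def
    proof (rule cINF_greatest)
      show "G \<noteq> {}" using G0 by auto
      fix s assume "s \<in> G"
      then show "L t \<le> L s + K * \<bar>t - s\<bar>" using L[OF t, of s] by simp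
    qed
  qed
  have FLip: "F x \<le> F y + K * \<bar>x - y\<bar>" for x y
  proof -
    have "F x - K * \<bar>x - y\<bar> \<le> F y"     proof (subst (2) F_def, rule cINF_greatest)
      show "G \<noteq> {}" using G0 by auto
      fix s assume s: "s \<in> G"
      have "F x \<le> L s + K * \<bar>x - s\<bar>" unfolding F_def by (rule cINF_lower[OF bdd s])
      also have "K * \<bar>x - s\<bar> \<le> K * \<bar>x - y\<bar> + K * \<bar>y - s\<bar>"
        unfolding distrib_left[symmetric] using K by (intro mult_left_mono) auto
      finally show "F x - K * \<bar>x - y\<bar> \<le> L s + K * \<bar>y - s\<bar>" by simp
    qed
    then show ?thesis by simp
  qed
  \<comment> \<open>The difference quotients of \<open>F\<close> lie between \<open>- K\<close> and
    \<open>K\<close>; adding \<open>K + 1\<close> raises them to at least \<open>1\<close>, as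
    needed for \<open>tint_density\<close>, and the constant is subtracted from the density
    afterwards.\<close>
  define H where "H = (\<lambda>x. F x + (K + 1) * x)"
  have low: "1 * (y - x) \<le> H y - H x" if "x \<le> y" for x y
    using FLip[of x y] that by (simp add: H_def algebra_simps)
  have up: "H y - H x \<le> (2 * K + 1) * (y - x)" if "x \<le> y" for x y
    using FLip[of y x] that by (simp add: H_def algebra_simps)
  have "\<exists>n. integrable (lebesgue_on {0<..<T}) n \<and> (\<forall>\<tau>. 0 \<le> n \<tau>) \<and> (\<forall>t\<in>{0..T}. tint T n t = H t - H 0)"
    by (rule tint_density[where K = "2 * K + 1"]) (fact zero_less_one low up T)+
  then obtain n where n: "integrable (lebesgue_on {0<..<T}) n" "\<And>\<tau>. 0 \<le> n \<tau>" "\<And>t. t \<in> {0..T} \<Longrightarrow> tint T n t = H t - H 0"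
    by blast
  show ?thesis
  proof (intro exI[of _ "\<lambda>\<tau>. n \<tau> + (- (K + 1)) * 1"] conjI ballI)
    show "integrable (lebesgue_on {0<..<T}) (\<lambda>\<tau>. n \<tau> + (- (K + 1)) * 1)"
      using n(1) integrable_const_lebesgue_on[of T "- (K + 1)"] by auto
    have eq: "tint T (\<lambda>\<tau>. n \<tau> + (- (K + 1)) * 1) t = F t" if t': "t \<in> {0..T}" for t
    proof -
      have "tint T (\<lambda>\<tau>. n \<tau> + (- (K + 1)) * 1) t = tint T n t - (K + 1) * t"
        using tint_linear[OF n(1) integrable_const_lebesgue_on[of T 1], of "- (K + 1)" t] t' by (simp add: tint_const algebra_simps)
      then show ?thesis using n(3)[OF t'] FL[OF G0(1)] G0(2) by (simp add: H_def)
    qed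
    show "tint T (\<lambda>\<tau>. n \<tau> + (- (K + 1)) * 1) t = L t" if "t \<in> G" for t
      using eq[of t] FL[OF that] G that by auto
    fix s t assume st: "s \<in> {0..T}" "t \<in> {0..T}"
    show "\<bar>tint T (\<lambda>\<tau>. n \<tau> + (- (K + 1)) * 1) t - tint T (\<lambda>\<tau>. n \<tau> + (- (K + 1)) * 1) s\<bar> \<le> K * \<bar>t - s\<bar>"
      unfolding eq[OF st(1)] eq[OF st(2)] using FLip[of s t] FLip[of t s] by (simp add: abs_minus_commute abs_le_iff)
  qed
qed

text \<open>The endpoints are moved inwards to nearby times in \<open>G\<close>, and the Lipschitz
  bound controls the two errors.\<close>

lemma tint_increasing_from_dense:
  assumes T: "0 < T" and G: "AE t in lebesgue_on {0<..<T}. t \<in> G"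
    and K: "\<And>s t. s \<in> {0..T} \<Longrightarrow> t \<in> {0..T} \<Longrightarrow> \<bar>F t - F s\<bar> \<le> K * \<bar>t - s\<bar>"
    and mono: "\<And>s t. s \<in> G \<Longrightarrow> t \<in> G \<Longrightarrow> s < t \<Longrightarrow> t < T \<Longrightarrow> 0 < s \<Longrightarrow> F s \<le> F t"
    and st: "0 \<le> s" "s \<le> t" "t \<le> T"
  shows "F s \<le> (F t :: real)"
proof (cases "s = t")
  case False
  then have lt: "s < t" using st by simp
  show ?thesis
  proof (rule field_le_epsilon)
    fix e :: real assume e: "0 < e"
    \<comment> \<open>The first bound keeps the moved endpoints in order, the second makes the two
      errors add up to at most \<open>e\<close>.\<close>
    define d where "d = min ((t - s) / 2) (e / (2 * (\<bar>K\<bar> + 1)))"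
    have "0 < e / (2 * (\<bar>K\<bar> + 1))" using e by (intro divide_pos_pos) auto
    then have d: "0 < d" "d \<le> (t - s) / 2" "d \<le> e / (2 * (\<bar>K\<bar> + 1))"
      using lt unfolding d_def by (simp, intro min.cobounded1, intro min.cobounded2)
    have Kd: "2 * (\<bar>K\<bar> * d) \<le> e"
    proof -
      have "d * (2 * (\<bar>K\<bar> + 1)) \<le> e" using d(3) by (subst (asm) pos_le_divide_eq) auto
      then show ?thesis using d(1) by (simp add: algebra_simps)
    qed
    obtain s' where s': "s' \<in> {s<..<s + d}" "s' \<in> G"
      using AE_ex_between[OF st(1) _ _ G, of "s + d"] d st by force
    obtain t' where t': "t' \<in> {t - d<..<t}" "t' \<in> G"
      using AE_ex_between[OF _ _ st(3) G, of "t - d"] d st lt by force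
    have "s' < t'" using s'(1) t'(1) d(2) by (auto simp: field_simps)
    have "F s' \<le> F t'" using \<open>s' < t'\<close> s' t' st by (intro mono) auto
    moreover have "\<bar>F s' - F s\<bar> \<le> \<bar>K\<bar> * d" "\<bar>F t - F t'\<bar> \<le> \<bar>K\<bar> * d"
    proof -
      have "\<bar>F s' - F s\<bar> \<le> K * \<bar>s' - s\<bar>" using s' t' \<open>s' < t'\<close> st by (intro K) auto
      also have "\<dots> \<le> \<bar>K\<bar> * d" using s'(1) by (intro mult_mono) auto
      finally show "\<bar>F s' - F s\<bar> \<le> \<bar>K\<bar> * d" .
      have "\<bar>F t - F t'\<bar> \<le> K * \<bar>t - t'\<bar>" using s' t' \<open>s' < t'\<close> st by (intro K) auto
      also have "\<dots> \<le> \<bar>K\<bar> * d" using t'(1) by (intro mult_mono) auto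
      finally show "\<bar>F t - F t'\<bar> \<le> \<bar>K\<bar> * d" .
    qed
    ultimately show "F s \<le> F t + e" using Kd by linarith
  qed
qed simp

section \<open>Measurable extension of dominated functionals\<close>

definition finsupp :: "nat set \<Rightarrow> (nat \<Rightarrow> real) set" where
  "finsupp A = {c. finite {k. c k \<noteq> 0} \<and> {k. c k \<noteq> 0} \<subseteq> A}"

text \<open>Rational coefficients make the set countable: infima over it stay measurable, and the
  exceptional null sets of all its members can be discarded together.\<close>

definition ratsupp :: "nat set \<Rightarrow> (nat \<Rightarrow> real) set" where
  "ratsupp A = {c \<in> finsupp A. \<forall>k. c k \<in> \<rat>}"

definition pairing :: "(nat \<Rightarrow> real) \<Rightarrow> (nat \<Rightarrow> real) \<Rightarrow> real" where
  "pairing c b = (\<Sum>k | c k \<noteq> 0. c k * b k)"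

lemma pairing_superset:
  assumes "finite S" "{k. c k \<noteq> 0} \<subseteq> S"
  shows "pairing c b = (\<Sum>k\<in>S. c k * b k)"
  unfolding pairing_def using assms by (intro sum.mono_neutral_left) auto

lemma finsupp_add_scale:
  assumes "c \<in> finsupp A" "d \<in> finsupp A"
  shows "(\<lambda>k. c k + r * d k) \<in> finsupp A"
proof -
  have "{k. c k + r * d k \<noteq> 0} \<subseteq> {k. c k \<noteq> 0} \<union> {k. d k \<noteq> 0}" by auto
  then show ?thesis using assms unfolding finsupp_def by (auto intro: finite_subset)
qed

lemma pairing_add_scale:
  assumes "c \<in> finsupp A" "d \<in> finsupp A"
  shows "pairing (\<lambda>k. c k + r * d k) b = pairing c b + r * pairing d b"
proof -
  define S where "S = {k. c k \<noteq> 0} \<union> {k. d k \<noteq> 0}"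
  have S: "finite S" "{k. c k \<noteq> 0} \<subseteq> S" "{k. d k \<noteq> 0} \<subseteq> S" "{k. c k + r * d k \<noteq> 0} \<subseteq> S"
    using assms by (auto simp: finsupp_def S_def)
  show ?thesis
    unfolding pairing_superset[OF S(1,2)] pairing_superset[OF S(1,3)] pairing_superset[OF S(1,4)]
    by (simp add: algebra_simps sum.distrib sum_distrib_left)
qed

lemma finsupp_single: "n \<in> A \<Longrightarrow> (\<lambda>k. if k = n then r else 0) \<in> finsupp A"
  by (auto simp: finsupp_def)

lemma pairing_single: "pairing (\<lambda>k. if k = n then r else 0) b = r * b n"
  by (subst pairing_superset[of "{n}"]) auto

lemma countable_ratsupp: "countable (ratsupp A)"
proof (rule countable_subset)
  let ?f = "\<lambda>(xs :: rat list) k. if k < length xs then of_rat (xs ! k) else (0 :: real)"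
  show "ratsupp A \<subseteq> range ?f"
  proof
    fix c assume c: "c \<in> ratsupp A"
    then obtain N where N: "\<And>k. c k \<noteq> 0 \<Longrightarrow> k < N"
      unfolding ratsupp_def finsupp_def by (auto simp: finite_nat_set_iff_bounded)
    have "\<forall>k. \<exists>q. c k = of_rat q" using c by (auto simp: ratsupp_def Rats_def)
    then obtain q where q: "\<And>k. c k = of_rat (q k)" by metis
    have "c = ?f (map q [0..<N])" using N q by (force simp: fun_eq_iff)
    then show "c \<in> range ?f" by blast
  qed
qed simp

lemma ratsupp_add_scale:
  assumes "c \<in> ratsupp A" "d \<in> ratsupp A" "r \<in> \<rat>"
  shows "(\<lambda>k. c k + r * d k) \<in> ratsupp A"
  using assms finsupp_add_scale by (auto simp: ratsupp_def)

lemma ratsupp_0: "(\<lambda>k. 0) \<in> ratsupp A"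
  by (auto simp: ratsupp_def finsupp_def)

text \<open>The gauge lives on coefficient sequences, not on the fields that they represent. In the
  application \<open>p t\<close> depends only on the represented field; it vanishes on a linear
  relation between generators and on its negative, so a dominated functional respects such relations
  automatically.\<close>

locale sublinear_family =
  fixes M :: "'t measure" and p :: "'t \<Rightarrow> (nat \<Rightarrow> real) \<Rightarrow> real"
  assumes p_add: "\<And>t c d. t \<in> space M \<Longrightarrow> c \<in> finsupp UNIV \<Longrightarrow> d \<in> finsupp UNIV \<Longrightarrow> p t (\<lambda>k. c k + d k) \<le> p t c + p t d"
    and p_scale: "\<And>t c r. t \<in> space M \<Longrightarrow> c \<in> finsupp UNIV \<Longrightarrow> 0 \<le> r \<Longrightarrow> p t (\<lambda>k. r * c k) = r * p t c"
    and p_nonneg: "\<And>t c. t \<in> space M \<Longrightarrow> c \<in> finsupp UNIV \<Longrightarrow> 0 \<le> p t c"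
    and p_meas: "\<And>c. c \<in> ratsupp UNIV \<Longrightarrow> (\<lambda>t. p t c) \<in> borel_measurable M"
begin

definition dominated :: "nat set \<Rightarrow> (nat \<Rightarrow> 't \<Rightarrow> real) \<Rightarrow> bool" where
  "dominated A b \<longleftrightarrow> (\<forall>k\<in>A. b k \<in> borel_measurable M) \<and>
     (\<forall>t\<in>space M. \<forall>c\<in>ratsupp A. pairing c (\<lambda>k. b k t) \<le> p t c)"

lemma pairing_cong: "c \<in> finsupp A \<Longrightarrow> (\<And>k. k \<in> A \<Longrightarrow> b k = b' k) \<Longrightarrow> pairing c b = pairing c b'"
  unfolding pairing_def finsupp_def by (intro sum.cong) auto

lemma pairing_measurable:
  assumes "c \<in> finsupp A" "\<And>k. k \<in> A \<Longrightarrow> b k \<in> borel_measurable M"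
  shows "(\<lambda>t. pairing c (\<lambda>k. b k t)) \<in> borel_measurable M"
  unfolding pairing_def using assms
  by (intro borel_measurable_sum borel_measurable_times borel_measurable_const) (auto simp: finsupp_def)

text \<open>
  The classical one-dimensional extension step. The infimum runs over rational combinations only,
  which keeps the new value measurable in the parameter.
\<close>

lemma dominated_extend:
  assumes b: "dominated A b" and n: "n \<notin> A"
  shows "\<exists>b'. dominated (insert n A) b' \<and> (\<forall>k\<in>A. b' k = b k)"
proof -
  let ?\<delta> = "\<lambda>k. if k = n then 1 else 0 :: real"
  let ?P = "\<lambda>c t. pairing c (\<lambda>k. b k t)"
  have rs: "ratsupp A \<subseteq> finsupp UNIV" by (auto simp: ratsupp_def finsupp_def)
  have fs: "c \<in> finsupp UNIV" if "c \<in> ratsupp A" for c using rs that by blast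
  have \<delta>: "?\<delta> \<in> ratsupp UNIV" by (auto simp: ratsupp_def intro: finsupp_single)
  have \<delta>f: "?\<delta> \<in> finsupp UNIV" by (rule finsupp_single) simp
  have ru: "c \<in> ratsupp UNIV" if "c \<in> ratsupp A" for c using that by (auto simp: ratsupp_def finsupp_def)
  define F where "F = (\<lambda>c t. p t (\<lambda>k. c k + 1 * ?\<delta> k) - ?P c t)"
  define v where "v = (\<lambda>t. INF c\<in>ratsupp A. F c t)"
  \<comment> \<open>Every lower bound for the new value lies below every upper bound: the new unit
    vector cancels between the two arguments of \<open>p\<close>.\<close>
  have key: "?P d t - p t (\<lambda>k. d k + (-1) * ?\<delta> k) \<le> F c t" if t: "t \<in> space M" and cd: "c \<in> ratsupp A" "d \<in> ratsupp A" for c d t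
  proof -
    have "?P c t + 1 * ?P d t = pairing (\<lambda>k. c k + 1 * d k) (\<lambda>k. b k t)"
      by (rule pairing_add_scale[symmetric, OF fs[OF cd(1)] fs[OF cd(2)]])
    also have "\<dots> \<le> p t (\<lambda>k. c k + 1 * d k)"
      using b t ratsupp_add_scale[OF cd Rats_1] unfolding dominated_def by blast
    also have "(\<lambda>k. c k + 1 * d k) = (\<lambda>k. (c k + 1 * ?\<delta> k) + (d k + (-1) * ?\<delta> k))" by auto
    also have "p t \<dots> \<le> p t (\<lambda>k. c k + 1 * ?\<delta> k) + p t (\<lambda>k. d k + (-1) * ?\<delta> k)"
      by (intro p_add t finsupp_add_scale fs cd \<delta>f)
    finally show ?thesis by (simp add: F_def)
  qed
  have ne: "ratsupp A \<noteq> {}" using ratsupp_0 by blast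
  have bdd: "bdd_below ((\<lambda>c. F c t) ` ratsupp A)" if "t \<in> space M" for t
    using key[OF that _ ratsupp_0] by (intro bdd_belowI2)
  have v1: "v t \<le> F c t" if "t \<in> space M" "c \<in> ratsupp A" for c t
    unfolding v_def by (rule cINF_lower[OF bdd[OF that(1)] that(2)])
  have v2: "?P d t - p t (\<lambda>k. d k + (-1) * ?\<delta> k) \<le> v t" if "t \<in> space M" "d \<in> ratsupp A" for d t
    unfolding v_def by (rule cINF_greatest[OF ne]) (rule key[OF that(1) _ that(2)])
  have vm: "v \<in> borel_measurable M"
    unfolding v_def
  proof (rule borel_measurable_cINF[OF countable_ratsupp _ bdd])
    fix c assume c: "c \<in> ratsupp A"
    have "c \<in> finsupp A" using c by (simp add: ratsupp_def)
    then show "F c \<in> borel_measurable M"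
      unfolding F_def using b
      by (intro borel_measurable_diff p_meas ratsupp_add_scale ru c \<delta> pairing_measurable) (auto simp: dominated_def)
  qed
  define b' where "b' = b(n := v)"
  have "pairing e (\<lambda>k. b' k t) \<le> p t e" if t: "t \<in> space M" and e: "e \<in> ratsupp (insert n A)" for e t
  proof -
    define c where "c = (\<lambda>k. if k = n then 0 else e k)"
    have sub: "{k. c k \<noteq> 0} \<subseteq> {k. e k \<noteq> 0} - {n}" by (auto simp: c_def)
    have "finite {k. c k \<noteq> 0}"
      by (rule finite_subset[of _ "{k. e k \<noteq> 0}"]) (use sub e in \<open>auto simp: ratsupp_def finsupp_def\<close>)
    moreover have "{k. c k \<noteq> 0} \<subseteq> A" using sub e by (auto simp: ratsupp_def finsupp_def)
    moreover have "\<forall>k. c k \<in> \<rat>" using e by (simp add: c_def ratsupp_def)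
    ultimately have cA: "c \<in> ratsupp A" by (simp add: ratsupp_def finsupp_def)
    \<comment> \<open>The new coordinate is split off; after division by its modulus the claim is
      one of the two bounds \<open>v1\<close> and \<open>v2\<close>, according to its sign.\<close>
    have ec: "e = (\<lambda>k. c k + e n * ?\<delta> k)" by (auto simp: c_def)
    have "pairing e (\<lambda>k. b' k t) = pairing c (\<lambda>k. b' k t) + e n * v t"
      by (subst ec, subst pairing_add_scale[OF fs[OF cA] \<delta>f]) (simp add: pairing_single b'_def)
    also have "pairing c (\<lambda>k. b' k t) = ?P c t"
      using n cA by (intro pairing_cong[of _ A]) (auto simp: ratsupp_def b'_def)
    finally have pe: "pairing e (\<lambda>k. b' k t) = ?P c t + e n * v t" .
    have enq: "e n \<in> \<rat>" using e by (auto simp: ratsupp_def)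
    consider "e n = 0" | "0 < e n" | "e n < 0" by linarith
    then show ?thesis
    proof cases
      case 1
      then have "e = c" using ec by auto
      then show ?thesis using pe 1 b t cA unfolding dominated_def by auto
    next
      case 2
      define d where "d = (\<lambda>k. 0 + (1 / e n) * c k)"
      have d: "d \<in> ratsupp A" unfolding d_def by (intro ratsupp_add_scale ratsupp_0 cA Rats_divide enq Rats_1)
      have "v t \<le> p t (\<lambda>k. d k + 1 * ?\<delta> k) - ?P d t" using v1[OF t d] by (simp add: F_def)
      moreover have "?P d t = (1 / e n) * ?P c t"
        unfolding d_def by (subst pairing_add_scale[OF _ fs[OF cA]]) (auto simp: finsupp_def pairing_def)
      moreover have "p t e = e n * p t (\<lambda>k. d k + 1 * ?\<delta> k)"
      proof -
        have "e = (\<lambda>k. e n * (d k + 1 * ?\<delta> k))" using 2 by (subst ec) (auto simp: d_def fun_eq_iff field_simps)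
        then show ?thesis using 2 p_scale[OF t finsupp_add_scale[OF fs[OF d] \<delta>f], of "e n" 1] by simp
      qed
      ultimately have "e n * v t \<le> p t e - ?P c t"
        using 2 mult_left_mono[of "v t" "p t (\<lambda>k. d k + 1 * ?\<delta> k) - ?P d t" "e n"] by (simp add: right_diff_distrib)
      then show ?thesis using pe by simp
    next
      case 3
      define d where "d = (\<lambda>k. 0 + (1 / - e n) * c k)"
      have d: "d \<in> ratsupp A" unfolding d_def by (intro ratsupp_add_scale ratsupp_0 cA Rats_divide Rats_1) (simp add: enq)
      have "?P d t - p t (\<lambda>k. d k + (-1) * ?\<delta> k) \<le> v t" by (rule v2[OF t d])
      moreover have "?P d t = (1 / - e n) * ?P c t"
        unfolding d_def by (subst pairing_add_scale[OF _ fs[OF cA]]) (auto simp: finsupp_def pairing_def)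
      moreover have "p t e = (- e n) * p t (\<lambda>k. d k + (-1) * ?\<delta> k)"
      proof -
        have "e = (\<lambda>k. (- e n) * (d k + (-1) * ?\<delta> k))" using 3 by (subst ec) (auto simp: d_def fun_eq_iff field_simps)
        then show ?thesis using 3 p_scale[OF t finsupp_add_scale[OF fs[OF d] \<delta>f], of "- e n" "-1"] by simp
      qed
      ultimately have "?P c t - p t e \<le> (- e n) * v t"
        using 3 mult_left_mono[of "?P d t - p t (\<lambda>k. d k + (-1) * ?\<delta> k)" "v t" "- e n"] by (simp add: right_diff_distrib)
      then show ?thesis using pe by simp
    qed
  qed
  then have "dominated (insert n A) b'"
    using b vm n unfolding dominated_def b'_def by auto
  then show ?thesis using n by (intro exI[of _ b']) (auto simp: b'_def)
qed

text \<open>A crude bound by the values on signed unit vectors. It gives the continuity of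
  \<open>p t\<close> along finitely many coordinates that the passage from rational to real
  coefficients needs.\<close>

lemma p_le_sum:
  assumes t: "t \<in> space M" and S: "finite S"
  shows "p t (\<lambda>k. if k \<in> S then d k else 0) \<le> (\<Sum>k\<in>S. \<bar>d k\<bar> * (p t (\<lambda>j. if j = k then 1 else 0) + p t (\<lambda>j. if j = k then -1 else 0)))"
  using S
proof (induction S)
  case empty
  show ?case using p_scale[OF t, of "\<lambda>_. 0" 0] by (simp add: finsupp_def)
next
  case (insert n S)
  let ?e = "\<lambda>r j. if j = n then r else 0 :: real"
  let ?c = "\<lambda>k. if k \<in> S then d k else 0"
  have fin: "?c \<in> finsupp UNIV" using insert.hyps(1) by (auto simp: finsupp_def)
  have e: "?e r \<in> finsupp UNIV" for r by (rule finsupp_single) simp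
  have "(\<lambda>k. if k \<in> insert n S then d k else 0) = (\<lambda>k. ?c k + ?e (d n) k)"
    using insert.hyps by auto
  then have "p t (\<lambda>k. if k \<in> insert n S then d k else 0) \<le> p t ?c + p t (?e (d n))"
    using p_add[OF t fin e] by simp
  moreover have "p t (?e (d n)) \<le> \<bar>d n\<bar> * (p t (?e 1) + p t (?e (-1)))"
  proof (cases "0 \<le> d n")
    case True
    have "p t (?e (d n)) = d n * p t (?e 1)"
      using p_scale[OF t e, of "d n" 1] True by (simp add: if_distrib cong: if_cong)
    then show ?thesis using True p_nonneg[OF t e, of "-1"] by (simp add: distrib_left)
  next
    case False
    have "p t (?e (d n)) = (- d n) * p t (?e (-1))"
      using p_scale[OF t e, of "- d n" "-1"] False by (simp add: if_distrib cong: if_cong)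
    then show ?thesis using False p_nonneg[OF t e, of "1"] by (simp add: distrib_left mult_nonpos_nonneg)
  qed
  ultimately show ?case using insert by simp
qed

text \<open>The coefficients are perturbed to rational ones without enlarging the support; the
  resulting errors are at most a fixed multiple \<open>K\<close> of the perturbation.\<close>

lemma dominated_real:
  assumes b: "dominated UNIV b" and t: "t \<in> space M" and c: "c \<in> finsupp UNIV"
  shows "pairing c (\<lambda>k. b k t) \<le> p t c"
proof -
  define S where "S = {k. c k \<noteq> 0}"
  have S: "finite S" using c by (simp add: finsupp_def S_def)
  define D where "D = (\<lambda>k. p t (\<lambda>j. if j = k then 1 else 0) + p t (\<lambda>j. if j = k then -1 else 0))"
  have D: "0 \<le> D k" for k unfolding D_def by (intro add_nonneg_nonneg p_nonneg t finsupp_single) auto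
  define K where "K = (\<Sum>k\<in>S. \<bar>b k t\<bar> + D k)"
  have K: "0 \<le> K" unfolding K_def by (intro sum_nonneg add_nonneg_nonneg D) auto
  have main: "pairing c (\<lambda>k. b k t) \<le> p t c + \<epsilon> * K" if \<epsilon>: "0 < \<epsilon>" for \<epsilon>
  proof -
    have "\<exists>r\<in>\<rat>. \<bar>r - x\<bar> < \<epsilon>" for x :: real
      using Rats_dense_in_real[of "x - \<epsilon>" "x + \<epsilon>"] \<epsilon> by (auto simp: abs_less_iff) (metis add.commute diff_less_eq less_diff_eq minus_diff_eq)
    then obtain r where r: "\<And>x. r x \<in> \<rat>" "\<And>x. \<bar>r x - x\<bar> < \<epsilon>" by metis
    define c' where "c' = (\<lambda>k. if k \<in> S then r (c k) else 0)"
    have c': "c' \<in> ratsupp UNIV" using S r(1) by (auto simp: c'_def ratsupp_def finsupp_def)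
    have c'f: "c' \<in> finsupp UNIV" using c' by (simp add: ratsupp_def)
    define d where "d = (\<lambda>k. if k \<in> S then r (c k) - c k else 0)"
    have df: "d \<in> finsupp UNIV" using S by (auto simp: d_def finsupp_def)
    have cd: "c' = (\<lambda>k. c k + d k)" by (auto simp: c'_def d_def S_def)
    have "pairing c' (\<lambda>k. b k t) \<le> p t c'" using b t c' unfolding dominated_def by blast
    also have "\<dots> \<le> p t c + p t d" unfolding cd by (rule p_add[OF t c df])
    finally have 1: "pairing c' (\<lambda>k. b k t) \<le> p t c + p t d" .
    have 2: "pairing c' (\<lambda>k. b k t) = pairing c (\<lambda>k. b k t) + 1 * pairing d (\<lambda>k. b k t)"
      using pairing_add_scale[OF c df, of 1] by (simp add: cd)
    have "p t d \<le> (\<Sum>k\<in>S. \<bar>r (c k) - c k\<bar> * D k)"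
      using p_le_sum[OF t S, of "\<lambda>k. r (c k) - c k"] by (simp add: d_def D_def)
    also have "\<dots> \<le> (\<Sum>k\<in>S. \<epsilon> * D k)" using r(2) D by (intro sum_mono mult_right_mono) (auto intro: less_imp_le)
    finally have 3: "p t d \<le> (\<Sum>k\<in>S. \<epsilon> * D k)" .
    have "pairing d (\<lambda>k. b k t) = (\<Sum>k\<in>S. d k * b k t)" by (rule pairing_superset[OF S]) (auto simp: d_def)
    also have "- \<dots> \<le> (\<Sum>k\<in>S. \<epsilon> * \<bar>b k t\<bar>)"
      unfolding sum_negf[symmetric]
    proof (rule sum_mono)
      fix k assume "k \<in> S"
      have "- (d k * b k t) \<le> \<bar>d k\<bar> * \<bar>b k t\<bar>" by (simp add: abs_mult[symmetric] abs_ge_minus_self)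
      also have "\<dots> \<le> \<epsilon> * \<bar>b k t\<bar>" using r(2)[of "c k"] \<epsilon> by (intro mult_right_mono) (auto simp: d_def)
      finally show "- (d k * b k t) \<le> \<epsilon> * \<bar>b k t\<bar>" .
    qed
    finally have 4: "- pairing d (\<lambda>k. b k t) \<le> (\<Sum>k\<in>S. \<epsilon> * \<bar>b k t\<bar>)" .
    have "\<epsilon> * K = (\<Sum>k\<in>S. \<epsilon> * \<bar>b k t\<bar>) + (\<Sum>k\<in>S. \<epsilon> * D k)"
      by (simp add: K_def sum.distrib sum_distrib_left distrib_left)
    then show ?thesis using 1 2 3 4 by linarith
  qed
  show ?thesis
  proof (rule field_le_epsilon)
    fix e :: real assume e: "0 < e"
    have "e / (K + 1) * K \<le> e" using e K by (simp add: field_simps)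
    then show "pairing c (\<lambda>k. b k t) \<le> p t c + e"
      using main[of "e / (K + 1)"] e K by auto
  qed
qed

text \<open>Generators are added in the order of their index, and a value once assigned never
  changes. Each finitely supported sequence is therefore tested at a finite stage.\<close>

theorem measurable_Hahn_Banach:
  assumes a: "dominated A a"
  shows "\<exists>b. (\<forall>k. b k \<in> borel_measurable M) \<and> (\<forall>k\<in>A. b k = a k) \<and>
    (\<forall>t\<in>space M. \<forall>c\<in>finsupp UNIV. pairing c (\<lambda>k. b k t) \<le> p t c)"
proof -
  define B where "B = (\<lambda>n. A \<union> {..<n})"
  have "\<exists>f. \<forall>n. dominated (B n) (f n) \<and> (\<forall>k\<in>B n. f (Suc n) k = f n k) \<and> (\<forall>k\<in>A. f n k = a k)"
  proof -
    have "\<exists>f. \<forall>n. (dominated (B n) (f n) \<and> (\<forall>k\<in>A. f n k = a k)) \<and> (\<forall>k\<in>B n. f (Suc n) k = f n k)"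
    proof (rule dependent_nat_choice)
      show "\<exists>x. dominated (B 0) x \<and> (\<forall>k\<in>A. x k = a k)" using a by (intro exI[of _ a]) (simp add: B_def)
      fix x n assume x: "dominated (B n) x \<and> (\<forall>k\<in>A. x k = a k)"
      have BS: "B (Suc n) = insert n (B n)" by (auto simp: B_def lessThan_Suc)
      show "\<exists>y. (dominated (B (Suc n)) y \<and> (\<forall>k\<in>A. y k = a k)) \<and> (\<forall>k\<in>B n. y k = x k)"
      proof (cases "n \<in> B n")
        case True
        then show ?thesis using x by (intro exI[of _ x]) (simp add: BS insert_absorb)
      next
        case False
        obtain y where y: "dominated (insert n (B n)) y" "\<forall>k\<in>B n. y k = x k"
          using dominated_extend[OF conjunct1[OF x] False] by blast
        moreover have "\<forall>k\<in>A. y k = a k" using x y(2) by (simp add: B_def)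
        ultimately show ?thesis by (intro exI[of _ y]) (simp add: BS)
      qed
    qed
    then show ?thesis by blast
  qed
  then obtain f where f: "\<And>n. dominated (B n) (f n)" "\<And>n k. k \<in> B n \<Longrightarrow> f (Suc n) k = f n k" "\<And>n k. k \<in> A \<Longrightarrow> f n k = a k"
    by blast
  \<comment> \<open>The value at index \<open>k\<close> is settled from stage \<open>Suc k\<close>
    on.\<close>
  define b where "b = (\<lambda>k. f (Suc k) k)"
  have "f (Suc k + i) k = f (Suc k) k" for k i
  proof (induction i)
    case (Suc i)
    have "k \<in> B (Suc k + i)" by (simp add: B_def)
    then show ?case using f(2) Suc by simp
  qed simp
  then have bf: "b k = f n k" if "k < n" for k n
    using that by (metis add_Suc b_def less_imp_Suc_add)
  have bm: "b k \<in> borel_measurable M" for k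
    using f(1)[of "Suc k"] unfolding dominated_def b_def by (simp add: B_def)
  have "pairing c (\<lambda>k. b k t) \<le> p t c" if t: "t \<in> space M" and c: "c \<in> ratsupp UNIV" for c t
  proof -
    obtain N where N: "\<And>k. c k \<noteq> 0 \<Longrightarrow> k < N"
      using c unfolding ratsupp_def finsupp_def by (auto simp: finite_nat_set_iff_bounded)
    have cB: "c \<in> ratsupp (B N)" using c N by (auto simp: ratsupp_def finsupp_def B_def)
    have cN: "c \<in> finsupp {..<N}" using c N by (auto simp: ratsupp_def finsupp_def)
    have "pairing c (\<lambda>k. b k t) = pairing c (\<lambda>k. f N k t)"
      using bf by (intro pairing_cong[OF cN]) simp
    then show ?thesis using f(1)[of N] t cB unfolding dominated_def by simp
  qed
  then have "dominated UNIV b" unfolding dominated_def using bm by blast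
  then have "\<forall>t\<in>space M. \<forall>c\<in>finsupp UNIV. pairing c (\<lambda>k. b k t) \<le> p t c"
    using dominated_real by blast
  moreover have "\<forall>k\<in>A. b k = a k" using f(3) by (simp add: b_def)
  ultimately show ?thesis using bm by blast
qed

end

section \<open>Measures from contents on dyadic cells\<close>

definition dgrid :: "nat \<Rightarrow> (real ^ 'd) set" where
  "dgrid n = dyadic n ` cell"

lemma finite_dgrid: "finite (dgrid n)"
  unfolding dgrid_def by (rule finite_dyadic_cell)

lemma dgrid_cell: "q \<in> dgrid n \<Longrightarrow> q \<in> cell"
  unfolding dgrid_def using dyadic_cell by auto

lemma dyadic_in_dgrid: "x \<in> cell \<Longrightarrow> dyadic n x \<in> dgrid n"
  by (simp add: dgrid_def)

text \<open>A corner of level \<open>n\<close> is the corner of its own cell on every finer level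
  too. The cells containing \<open>q\<close> thus form a branch that is eventually constant in its
  corners.\<close>

lemma dyadic_dgrid: "q \<in> dgrid n \<Longrightarrow> n \<le> m \<Longrightarrow> dyadic m q = q"
proof -
  assume "q \<in> dgrid n" "n \<le> m"
  then obtain x where x: "q = dyadic n x" by (auto simp: dgrid_def)
  obtain i where m: "m = n + i" using \<open>n \<le> m\<close> le_Suc_ex by blast
  have "2 ^ m * (of_int k / 2 ^ n :: real) = of_int (2 ^ i * k)" for k
    by (simp add: m power_add)
  then have "\<lfloor>2 ^ m * (of_int k / 2 ^ n :: real)\<rfloor> = 2 ^ i * k" for k by (metis floor_of_int)
  then show "dyadic m q = q"
    unfolding x by (simp add: dyadic_def vec_eq_iff m power_add)
qed

text \<open>
  Nested sequences of dyadic cells. Unlike on the torus itself, cells are here both open and closed,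
  so that every finitely additive content on them extends to a measure.
\<close>

definition branches :: "(nat \<Rightarrow> real ^ 'd) set" where
  "branches = {\<omega>. \<forall>n. \<omega> n \<in> dgrid n \<and> dyadic n (\<omega> (Suc n)) = \<omega> n}"

definition cyl :: "nat \<Rightarrow> (real ^ 'd) set \<Rightarrow> (nat \<Rightarrow> real ^ 'd) set" where
  "cyl n S = {\<omega> \<in> branches. \<omega> n \<in> S}"

definition cylinders :: "(nat \<Rightarrow> real ^ 'd) set set" where
  "cylinders = {cyl n S | n S. S \<subseteq> dgrid n}"

lemma branches_dyadic:
  assumes "\<omega> \<in> branches" "n \<le> m"
  shows "dyadic n (\<omega> m) = \<omega> n"
  using assms(2)
proof (induction m)
  case 0
  then show ?case using assms(1) dyadic_dgrid[of "\<omega> 0" 0 0] by (simp add: branches_def)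
next
  case (Suc m)
  show ?case
  proof (cases "n = Suc m")
    case True
    then show ?thesis using assms(1) dyadic_dgrid[of "\<omega> n" n n] by (auto simp: branches_def)
  next
    case False
    then have "dyadic n (\<omega> (Suc m)) = dyadic n (dyadic m (\<omega> (Suc m)))"
      using Suc.prems by (simp add: dyadic_dyadic)
    then show ?thesis using Suc False assms(1) by (simp add: branches_def)
  qed
qed

lemma branch_through:
  assumes "q \<in> dgrid n"
  shows "\<exists>\<omega>\<in>branches. \<omega> n = q"
proof
  show "(\<lambda>k. dyadic k q) \<in> branches"
    using dgrid_cell[OF assms] by (auto simp: branches_def dyadic_in_dgrid dyadic_dyadic)
qed (use dyadic_dgrid[OF assms order_refl] in simp)

lemma branches_image_cyl: "S \<subseteq> dgrid n \<Longrightarrow> (\<lambda>\<omega>. \<omega> n) ` cyl n S = S"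
proof (intro equalityI subsetI)
  fix q assume S: "S \<subseteq> dgrid n" and "q \<in> S"
  then obtain \<omega> where "\<omega> \<in> branches" "\<omega> n = q" using branch_through[of q n] by blast
  then show "q \<in> (\<lambda>\<omega>. \<omega> n) ` cyl n S" using \<open>q \<in> S\<close> by (intro image_eqI[of _ _ \<omega>]) (simp_all add: cyl_def)
qed (auto simp: cyl_def)

lemma cyl_lift:
  fixes S :: "(real ^ 'd) set"
  assumes "n \<le> m"
  shows "cyl n S = cyl m {q \<in> dgrid m. dyadic n q \<in> S}"
proof (intro equalityI subsetI)
  fix \<omega> assume "\<omega> \<in> cyl n S"
  then have \<omega>: "\<omega> \<in> branches" "\<omega> n \<in> S" by (simp_all add: cyl_def)
  then have "\<omega> m \<in> dgrid m" by (simp add: branches_def)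
  then show "\<omega> \<in> cyl m {q \<in> dgrid m. dyadic n q \<in> S}"
    using \<omega> branches_dyadic[OF \<omega>(1) assms] by (simp add: cyl_def)
next
  fix \<omega> assume "\<omega> \<in> cyl m {q \<in> dgrid m. dyadic n q \<in> S}"
  then have \<omega>: "\<omega> \<in> branches" "dyadic n (\<omega> m) \<in> S" by (simp_all add: cyl_def)
  then show "\<omega> \<in> cyl n S"
    using branches_dyadic[OF \<omega>(1) assms] by (simp add: cyl_def)
qed

lemma cylinders_common:
  assumes "A \<in> cylinders" "B \<in> cylinders"
  obtains n S S' where "S \<subseteq> dgrid n" "S' \<subseteq> dgrid n" "A = cyl n S" "B = cyl n S'"
proof -
  obtain n S where A: "S \<subseteq> dgrid n" "A = cyl n S" using assms(1) by (auto simp: cylinders_def)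
  obtain m S' where B: "S' \<subseteq> dgrid m" "B = cyl m S'" using assms(2) by (auto simp: cylinders_def)
  show ?thesis
    using that[of "{q \<in> dgrid (max n m). dyadic n q \<in> S}" "max n m" "{q \<in> dgrid (max n m). dyadic m q \<in> S'}"]
      cyl_lift[of n "max n m" S] cyl_lift[of m "max n m" S'] A(2) B(2) by auto
qed

lemma cyl_Un: "cyl n S \<union> cyl n S' = cyl n (S \<union> S')"
  and cyl_Int: "cyl n S \<inter> cyl n S' = cyl n (S \<inter> S')"
  and cyl_Diff: "cyl n S - cyl n S' = cyl n (S - S')"
  by (auto simp: cyl_def)

lemma ring_cylinders: "ring_of_sets branches cylinders"
proof (rule ring_of_setsI)
  show "cylinders \<subseteq> Pow branches" by (auto simp: cylinders_def cyl_def)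
  show "{} \<in> cylinders" by (auto simp: cylinders_def cyl_def intro!: exI[of _ "{}"])
next
  fix a b :: "(nat \<Rightarrow> real ^ 'a) set" assume "a \<in> cylinders" "b \<in> cylinders"
  then obtain n S S' where "S \<subseteq> dgrid n" "S' \<subseteq> dgrid n" "a = cyl n S" "b = cyl n S'"
    by (rule cylinders_common)
  then show "a \<union> b \<in> cylinders" "a - b \<in> cylinders"
    by (auto simp: cyl_Un cyl_Diff cylinders_def intro!: exI)
qed

lemma Int_stable_cylinders: "Int_stable cylinders"
proof (rule Int_stableI)
  fix a b :: "(nat \<Rightarrow> real ^ 'a) set" assume "a \<in> cylinders" "b \<in> cylinders"
  then obtain n S S' where "S \<subseteq> dgrid n" "S' \<subseteq> dgrid n" "a = cyl n S" "b = cyl n S'"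
    by (rule cylinders_common)
  then show "a \<inter> b \<in> cylinders" by (auto simp: cyl_Int cylinders_def intro!: exI)
qed

lemma branches_cyl: "branches = cyl n (dgrid n)"
  by (auto simp: cyl_def branches_def)

text \<open>Compactness of the space of branches, in the form of Koenig's lemma: each level has
  finitely many cells, so one can be chosen that all the \<open>A i\<close> still meet, compatibly
  with the previous choice.\<close>

lemma decreasing_cylinders_nonempty:
  fixes A :: "nat \<Rightarrow> (nat \<Rightarrow> real ^ 'd) set"
  assumes A: "range A \<subseteq> cylinders" "decseq A" and ne: "\<And>i. A i \<noteq> {}"
  shows "(\<Inter>i. A i) \<noteq> {}"
proof -
  define P where "P = (\<lambda>n q. q \<in> dgrid n \<and> (\<forall>i. \<exists>\<omega>\<in>A i. \<omega> n = q))"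
  have sub: "A i \<subseteq> branches" for i using A(1) by (auto simp: cylinders_def cyl_def)
  \<comment> \<open>If each of the finitely many cells were missed by some \<open>A (k q)\<close>,
    the set with the largest such index would miss all of them. The predicate \<open>Z\<close>
    carries the choice made one level earlier.\<close>
  have pigeon: "\<exists>q\<in>dgrid n. (\<forall>i. \<exists>\<omega>\<in>A i. \<omega> n = q \<and> Z \<omega>)" if Z: "\<And>i. \<exists>\<omega>\<in>A i. Z \<omega>" for n Z
  proof (rule ccontr)
    assume "\<not> ?thesis"
    then have "\<forall>q. \<exists>i. q \<in> dgrid n \<longrightarrow> \<not> (\<exists>\<omega>\<in>A i. \<omega> n = q \<and> Z \<omega>)" by blast
    then obtain k where k: "\<And>q. q \<in> dgrid n \<Longrightarrow> \<not> (\<exists>\<omega>\<in>A (k q). \<omega> n = q \<and> Z \<omega>)" by metis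
    obtain \<omega> where \<omega>: "\<omega> \<in> A (Max (k ` dgrid n))" "Z \<omega>" using Z by blast
    have q: "\<omega> n \<in> dgrid n" using \<omega>(1) sub by (auto simp: branches_def)
    then have "k (\<omega> n) \<le> Max (k ` dgrid n)" using finite_dgrid by (intro Max_ge) auto
    then have "\<omega> \<in> A (k (\<omega> n))" using \<omega>(1) A(2) by (auto simp: decseq_def)
    then show False using k[OF q] \<omega>(2) by blast
  qed
  have "\<exists>f. \<forall>n. P n (f n) \<and> dyadic n (f (Suc n)) = f n"
  proof (rule dependent_nat_choice)
    have "\<exists>\<omega>\<in>A i. True" for i using ne by blast
    from pigeon[OF this, of 0] show "\<exists>x. P 0 x" by (auto simp: P_def)
    fix x n assume "P n x"
    then have "\<exists>\<omega>\<in>A i. \<omega> n = x" for i by (simp add: P_def)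
    from pigeon[OF this, of "Suc n"] obtain q where q: "q \<in> dgrid (Suc n)" "\<forall>i. \<exists>\<omega>\<in>A i. \<omega> (Suc n) = q \<and> \<omega> n = x" by blast
    obtain \<omega> where "\<omega> \<in> A 0" "\<omega> (Suc n) = q" "\<omega> n = x" using q(2) by blast
    then have "dyadic n q = x" using sub[of 0] by (auto simp: branches_def)
    moreover have "P (Suc n) q" using q unfolding P_def by blast
    ultimately show "\<exists>y. P (Suc n) y \<and> dyadic n y = x" by blast
  qed
  then obtain f where f: "\<And>n. P n (f n)" "\<And>n. dyadic n (f (Suc n)) = f n" by blast
  have fb: "f \<in> branches" using f by (auto simp: branches_def P_def)
  have "f \<in> A i" for i
  proof -
    have "A i \<in> cylinders" using A(1) by blast
    then obtain n S where n: "A i = cyl n S" unfolding cylinders_def by blast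
    obtain \<omega> where "\<omega> \<in> A i" "\<omega> n = f n" using f(1)[of n] unfolding P_def by blast
    then show ?thesis using n fb by (simp add: cyl_def)
  qed
  then show ?thesis by blast
qed

locale dyadic_content =
  fixes r :: "nat \<Rightarrow> real ^ 'd \<Rightarrow> real"
  assumes r_nonneg: "\<And>n q. q \<in> dgrid n \<Longrightarrow> 0 \<le> r n q"
    and r_add: "\<And>n q. q \<in> dgrid n \<Longrightarrow> r n q = (\<Sum>q' | q' \<in> dgrid (Suc n) \<and> dyadic n q' = q. r (Suc n) q')"
begin

lemma r_lift_Suc:
  assumes "S \<subseteq> dgrid n"
  shows "(\<Sum>q\<in>S. r n q) = (\<Sum>q | q \<in> dgrid (Suc n) \<and> dyadic n q \<in> S. r (Suc n) q)"
proof -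
  have "(\<Sum>q\<in>S. r n q) = (\<Sum>q\<in>S. \<Sum>q' | q' \<in> {q \<in> dgrid (Suc n). dyadic n q \<in> S} \<and> dyadic n q' = q. r (Suc n) q')"
  proof (rule sum.cong)
    fix q assume "q \<in> S"
    then show "r n q = (\<Sum>q' | q' \<in> {q \<in> dgrid (Suc n). dyadic n q \<in> S} \<and> dyadic n q' = q. r (Suc n) q')"
      using assms r_add[of q n] by (auto intro!: sum.cong)
  qed simp
  also have "\<dots> = (\<Sum>q | q \<in> dgrid (Suc n) \<and> dyadic n q \<in> S. r (Suc n) q)"
    using finite_dgrid assms by (subst sum.group) (auto intro: finite_subset)
  finally show ?thesis .
qed

text \<open>A cylinder can be presented on many levels. The least one makes the value definite, and
  \<open>content_level\<close> shows that finer levels give the same sum.\<close>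

definition content :: "(nat \<Rightarrow> real ^ 'd) set \<Rightarrow> real" where
  "content A = (let n = (LEAST n. \<exists>S\<subseteq>dgrid n. A = cyl n S) in \<Sum>q\<in>(\<lambda>\<omega>. \<omega> n) ` A. r n q)"

lemma content_level:
  assumes "S \<subseteq> dgrid n" "n \<le> m"
  shows "(\<Sum>q\<in>(\<lambda>\<omega>. \<omega> m) ` cyl n S. r m q) = (\<Sum>q\<in>S. r n q)"
  using assms(2)
proof (induction m)
  case 0
  then show ?case using branches_image_cyl[OF assms(1)] by simp
next
  case (Suc m)
  show ?case
  proof (cases "n = Suc m")
    case True
    then show ?thesis using branches_image_cyl[OF assms(1)] by simp
  next
    case False
    then have nm: "n \<le> m" using Suc.prems by simp
    let ?S = "{q \<in> dgrid m. dyadic n q \<in> S}"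
    have im: "(\<lambda>\<omega>. \<omega> m) ` cyl n S = ?S" unfolding cyl_lift[OF nm, of S] by (rule branches_image_cyl) auto
    have "{q \<in> dgrid (Suc m). dyadic n q \<in> S} = {q \<in> dgrid (Suc m). dyadic m q \<in> ?S}"
      using nm by (auto simp: dyadic_dyadic dyadic_in_dgrid dgrid_cell)
    then have im': "(\<lambda>\<omega>. \<omega> (Suc m)) ` cyl n S = {q \<in> dgrid (Suc m). dyadic m q \<in> ?S}"
      unfolding cyl_lift[OF Suc.prems, of S] by (subst branches_image_cyl) auto
    show ?thesis unfolding im' using r_lift_Suc[of ?S m] Suc.IH[OF nm] unfolding im by auto
  qed
qed

lemma content_cyl:
  assumes "S \<subseteq> dgrid n"
  shows "content (cyl n S) = (\<Sum>q\<in>S. r n q)"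
proof -
  define k where "k = (LEAST k. \<exists>S'\<subseteq>dgrid k. cyl n S = cyl k S')"
  have ex: "\<exists>S'\<subseteq>dgrid n. cyl n S = cyl n S'" using assms by blast
  have "\<exists>S'\<subseteq>dgrid k. cyl n S = cyl k S'" unfolding k_def using ex by (rule LeastI)
  then obtain S' where S': "S' \<subseteq> dgrid k" "cyl n S = cyl k S'" by blast
  have "k \<le> n" unfolding k_def using ex by (rule Least_le)
  have "content (cyl n S) = (\<Sum>q\<in>(\<lambda>\<omega>. \<omega> k) ` cyl k S'. r k q)"
    unfolding content_def k_def[symmetric] S'(2)[symmetric] by (simp add: Let_def)
  also have "\<dots> = (\<Sum>q\<in>S'. r k q)" by (simp add: branches_image_cyl[OF S'(1)])
  also have "\<dots> = (\<Sum>q\<in>(\<lambda>\<omega>. \<omega> n) ` cyl k S'. r n q)" by (rule content_level[OF S'(1) \<open>k \<le> n\<close>, symmetric])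
  also have "\<dots> = (\<Sum>q\<in>S. r n q)" unfolding S'(2)[symmetric] branches_image_cyl[OF assms] ..
  finally show ?thesis .
qed

text \<open>Caratheodory's theorem on the ring of cylinders. Continuity at the empty set is
  immediate, since a decreasing sequence of cylinders with empty intersection is eventually
  empty.\<close>

lemma ex_content_measure:
  "\<exists>\<nu>. space \<nu> = branches \<and> sets \<nu> = sigma_sets branches cylinders \<and>
     (\<forall>n S. S \<subseteq> dgrid n \<longrightarrow> emeasure \<nu> (cyl n S) = ennreal (\<Sum>q\<in>S. r n q))"
proof -
  interpret ring_of_sets branches "cylinders :: (nat \<Rightarrow> real ^ 'd) set set" by (rule ring_cylinders)
  have nn: "0 \<le> (\<Sum>q\<in>S. r n q)" if "S \<subseteq> dgrid n" for n S
    using that r_nonneg by (intro sum_nonneg) auto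
  have "\<exists>\<mu>. (\<forall>s\<in>cylinders. \<mu> s = ennreal (content s)) \<and> measure_space branches (sigma_sets branches cylinders) \<mu>"
  proof (rule caratheodory_empty_continuous)
    have "content {} = 0" using content_cyl[of "{}" 0] by (simp add: cyl_def)
    then show "positive cylinders (\<lambda>A. ennreal (content A))" by (simp add: positive_def)
    show "additive cylinders (\<lambda>A. ennreal (content A))"
      unfolding additive_def
    proof (intro ballI impI)
      fix A B :: "(nat \<Rightarrow> real ^ 'd) set" assume AB: "A \<in> cylinders" "B \<in> cylinders" "A \<inter> B = {}"
      obtain n S S' where S: "S \<subseteq> dgrid n" "S' \<subseteq> dgrid n" "A = cyl n S" "B = cyl n S'"
        using AB(1,2) by (rule cylinders_common)
      have "S \<inter> S' = {}" using AB(3) branches_image_cyl[of "S \<inter> S'" n] S by (auto simp: cyl_Int)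
      then have "content (A \<union> B) = content A + content B"
        unfolding S(3,4) cyl_Un using S(1,2) finite_subset[OF S(1) finite_dgrid] finite_subset[OF S(2) finite_dgrid]
        by (simp add: content_cyl sum.union_disjoint)
      moreover have "0 \<le> content A" "0 \<le> content B" unfolding S(3,4) using nn S(1,2) by (simp_all add: content_cyl)
      ultimately show "ennreal (content (A \<union> B)) = ennreal (content A) + ennreal (content B)" by simp
    qed
    show "ennreal (content A) \<noteq> \<infinity>" for A by simp
    fix A :: "nat \<Rightarrow> (nat \<Rightarrow> real ^ 'd) set"
    assume A: "range A \<subseteq> cylinders" "decseq A" "(\<Inter>i. A i) = {}"
    then obtain i where i: "A i = {}" using decreasing_cylinders_nonempty[OF A(1,2)] by blast
    have "\<forall>\<^sub>F j in sequentially. ennreal (content (A j)) = 0"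
    proof (rule eventually_sequentiallyI[of i])
      fix j assume "i \<le> j"
      then have "A j = {}" using A(2) i by (auto simp: decseq_def)
      then show "ennreal (content (A j)) = 0" using \<open>content {} = 0\<close> by simp
    qed
    then show "(\<lambda>i. ennreal (content (A i))) \<longlonglongrightarrow> 0" by (rule tendsto_eventually)
  qed
  then obtain \<mu> where \<mu>: "\<forall>s\<in>cylinders. \<mu> s = ennreal (content s)" "measure_space branches (sigma_sets branches cylinders) \<mu>"
    by blast
  have sub: "cylinders \<subseteq> Pow (branches :: (nat \<Rightarrow> real ^ 'd) set)" by (rule space_closed)
  define \<nu> where "\<nu> = measure_of branches (cylinders :: (nat \<Rightarrow> real ^ 'd) set set) \<mu>"
  show ?thesis
  proof (intro exI[of _ \<nu>] conjI allI impI)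
    show "space \<nu> = branches" "sets \<nu> = sigma_sets branches cylinders"
      unfolding \<nu>_def using sub by (auto simp: space_measure_of sets_measure_of)
    fix n and S :: "(real ^ 'd) set" assume S: "S \<subseteq> dgrid n"
    then have c: "cyl n S \<in> cylinders" by (auto simp: cylinders_def)
    have "emeasure \<nu> (cyl n S) = \<mu> (cyl n S)"
    proof (rule emeasure_measure_of[OF \<nu>_def sub])
      have s: "sets \<nu> = sigma_sets branches cylinders" unfolding \<nu>_def using sub by (rule sets_measure_of)
      show "positive (sets \<nu>) \<mu>" "countably_additive (sets \<nu>) \<mu>" "cyl n S \<in> sets \<nu>"
        using \<mu>(2) c unfolding s measure_space_def by auto
    qed
    then show "emeasure \<nu> (cyl n S) = ennreal (\<Sum>q\<in>S. r n q)" using \<mu>(1) c content_cyl[OF S] by simp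
  qed
qed

end

definition branch_limit :: "(nat \<Rightarrow> real ^ 'd) \<Rightarrow> real ^ 'd" where
  "branch_limit \<omega> = lim \<omega>"

text \<open>The limit of a branch may lie on a face \<open>x $ i = 1\<close>, outside the half-open
  cell. Reduction modulo the lattice moves it to the representative in the cell, which periodic
  fields do not notice.\<close>

definition wrap :: "real ^ 'd \<Rightarrow> real ^ 'd" where
  "wrap x = (\<chi> i. frac (x $ i))"

text \<open>Along a branch the corners are nondecreasing in every coordinate and stay in the unit
  cube.\<close>

lemma branch_limit:
  assumes \<omega>: "\<omega> \<in> branches"
  shows "\<omega> \<longlonglongrightarrow> branch_limit \<omega>"
proof -
  have le: "\<omega> n $ i \<le> \<omega> m $ i" if "n \<le> m" for n m i
    using dyadic_le[of n "\<omega> m" i] by (simp add: branches_dyadic[OF \<omega> that])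
  have "\<omega> n \<in> cell" for n using \<omega> dgrid_cell by (auto simp: branches_def)
  then have b: "0 \<le> \<omega> n $ i" "\<omega> n $ i \<le> 1" for n i by (auto simp: cell_def intro: less_imp_le)
  have "\<exists>l. (\<lambda>n. \<omega> n $ i) \<longlonglongrightarrow> l" for i
    by (rule Bseq_mono_convergent[unfolded convergent_def])
       (use le b in \<open>auto intro!: BseqI'[of _ 1] simp: monoseq_def\<close>)
  then obtain l where l: "\<And>i. (\<lambda>n. \<omega> n $ i) \<longlonglongrightarrow> l i" by metis
  have "\<omega> \<longlonglongrightarrow> (\<chi> i. l i)" by (rule vec_tendstoI) (simp add: l)
  then have "convergent \<omega>" by (rule convergentI)
  then show ?thesis unfolding branch_limit_def by (simp add: convergent_LIMSEQ_iff)
qed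

lemma wrap_cell: "wrap x \<in> cell"
  by (simp add: wrap_def cell_def frac_lt_1)

lemma wrap_periodic:
  assumes "\<And>x k. (\<And>i. k $ i \<in> \<int>) \<Longrightarrow> F (x + k) = F x"
  shows "F (wrap x) = F x"
proof -
  have "x = wrap x + (\<chi> i. of_int \<lfloor>x $ i\<rfloor>)" by (simp add: wrap_def vec_eq_iff frac_def)
  then show ?thesis using assms[of "\<chi> i. of_int \<lfloor>x $ i\<rfloor>" "wrap x"] by simp
qed

lemma measurable_wrap: "wrap \<in> borel_measurable (borel :: (real ^ 'd) measure)"
proof (subst borel_measurable_euclidean_space, intro ballI)
  fix b :: "real ^ 'd" assume "b \<in> Basis"
  then obtain i where b: "b = axis i 1" by (auto simp: Basis_vec_def)
  have "(\<lambda>x :: real ^ 'd. x $ i - real_of_int \<lfloor>x $ i\<rfloor>) \<in> borel_measurable borel" by measurable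
  then show "(\<lambda>x. wrap x \<bullet> b) \<in> borel_measurable borel"
    by (simp add: b inner_axis wrap_def frac_def)
qed

definition branchM :: "(nat \<Rightarrow> real ^ 'd) measure" where
  "branchM = sigma branches cylinders"

lemma space_branchM: "space branchM = (branches :: (nat \<Rightarrow> real ^ 'd) set)"
  and sets_branchM: "sets branchM = sigma_sets branches (cylinders :: (nat \<Rightarrow> real ^ 'd) set set)"
proof -
  have sub: "cylinders \<subseteq> Pow (branches :: (nat \<Rightarrow> real ^ 'd) set)" by (auto simp: cylinders_def cyl_def)
  show "space branchM = (branches :: (nat \<Rightarrow> real ^ 'd) set)"
    unfolding branchM_def using sub by (rule space_measure_of)
  show "sets branchM = sigma_sets branches (cylinders :: (nat \<Rightarrow> real ^ 'd) set set)"
    unfolding branchM_def using sub by (rule sets_measure_of)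
qed

lemma measurable_coordinate: "(\<lambda>\<omega>. \<omega> n) \<in> borel_measurable (branchM :: (nat \<Rightarrow> real ^ 'd) measure)"
proof (rule measurableI)
  fix A :: "(real ^ 'd) set"
  have "(\<lambda>\<omega>. \<omega> n) -` A \<inter> space branchM = cyl n (A \<inter> dgrid n)"
    by (auto simp: space_branchM cyl_def branches_def)
  then show "(\<lambda>\<omega>. \<omega> n) -` A \<inter> space branchM \<in> sets branchM"
    unfolding sets_branchM cylinders_def by (auto intro!: sigma_sets.Basic)
qed auto

lemma measurable_branch_limit: "branch_limit \<in> borel_measurable (branchM :: (nat \<Rightarrow> real ^ 'd) measure)"
  by (rule borel_measurable_LIMSEQ_metric[where f = "\<lambda>n \<omega>. \<omega> n", OF measurable_coordinate]) (simp add: branch_limit space_branchM)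

definition proj :: "(nat \<Rightarrow> real ^ 'd) \<Rightarrow> real ^ 'd" where
  "proj \<omega> = wrap (branch_limit \<omega>)"

lemma measurable_proj: "proj \<in> branchM \<rightarrow>\<^sub>M (cellB :: (real ^ 'd) measure)"
proof (rule measurable_restrict_space2)
  show "proj \<in> branchM \<rightarrow>\<^sub>M borel"
    unfolding proj_def[abs_def] using measurable_compose[OF measurable_branch_limit measurable_wrap] by simp
qed (simp add: proj_def wrap_cell)

section \<open>Matrix-valued contents on dyadic cells\<close>

locale psd_content =
  fixes B :: "nat \<Rightarrow> real ^ 'd \<Rightarrow> real ^ 'd ^ 'd"
  assumes B_sym: "\<And>n q. q \<in> dgrid n \<Longrightarrow> transpose (B n q) = B n q"
    and B_pos: "\<And>n q \<xi>. q \<in> dgrid n \<Longrightarrow> 0 \<le> outer \<xi> \<xi> \<bullet> B n q"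
    and B_add: "\<And>n q. q \<in> dgrid n \<Longrightarrow> B n q = (\<Sum>q' | q' \<in> dgrid (Suc n) \<and> dyadic n q' = q. B (Suc n) q')"
begin

lemma dyadic_content: "dyadic_content (\<lambda>n q. outer \<xi> \<xi> \<bullet> B n q)"
proof
  fix n and q :: "real ^ 'd" assume q: "q \<in> dgrid n"
  show "0 \<le> outer \<xi> \<xi> \<bullet> B n q" by (rule B_pos[OF q])
  show "outer \<xi> \<xi> \<bullet> B n q = (\<Sum>q' | q' \<in> dgrid (Suc n) \<and> dyadic n q' = q. outer \<xi> \<xi> \<bullet> B (Suc n) q')"
    unfolding B_add[OF q] by (rule inner_sum_right)
qed

definition \<nu> :: "real ^ 'd \<Rightarrow> (nat \<Rightarrow> real ^ 'd) measure" where
  "\<nu> \<xi> = (SOME \<nu>. space \<nu> = branches \<and> sets \<nu> = sigma_sets branches cylinders \<and>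
     (\<forall>n S. S \<subseteq> dgrid n \<longrightarrow> emeasure \<nu> (cyl n S) = ennreal (\<Sum>q\<in>S. outer \<xi> \<xi> \<bullet> B n q)))"

lemma \<nu>: "space (\<nu> \<xi>) = branches" "sets (\<nu> \<xi>) = sets branchM"
  "\<And>n S. S \<subseteq> dgrid n \<Longrightarrow> emeasure (\<nu> \<xi>) (cyl n S) = ennreal (\<Sum>q\<in>S. outer \<xi> \<xi> \<bullet> B n q)"
proof -
  have *: "space (\<nu> \<xi>) = branches \<and> sets (\<nu> \<xi>) = sigma_sets branches cylinders \<and>
     (\<forall>n S. S \<subseteq> dgrid n \<longrightarrow> emeasure (\<nu> \<xi>) (cyl n S) = ennreal (\<Sum>q\<in>S. outer \<xi> \<xi> \<bullet> B n q))"
    unfolding \<nu>_def by (rule someI_ex, rule dyadic_content.ex_content_measure[OF dyadic_content])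
  show "space (\<nu> \<xi>) = branches" "sets (\<nu> \<xi>) = sets branchM"
    "\<And>n S. S \<subseteq> dgrid n \<Longrightarrow> emeasure (\<nu> \<xi>) (cyl n S) = ennreal (\<Sum>q\<in>S. outer \<xi> \<xi> \<bullet> B n q)"
    using * by (auto simp: sets_branchM)
qed

lemma measure_cyl:
  assumes "S \<subseteq> dgrid n"
  shows "measure (\<nu> \<xi>) (cyl n S) = outer \<xi> \<xi> \<bullet> (\<Sum>q\<in>S. B n q)"
proof -
  have "0 \<le> (\<Sum>q\<in>S. outer \<xi> \<xi> \<bullet> B n q)" using assms B_pos by (intro sum_nonneg) auto
  then show ?thesis using \<nu>(3)[OF assms] by (simp add: measure_def inner_sum_right)
qed

lemma finite_\<nu>: "finite_measure (\<nu> \<xi>)"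
proof (rule finite_measureI)
  show "emeasure (\<nu> \<xi>) (space (\<nu> \<xi>)) \<noteq> \<infinity>"
    unfolding \<nu>(1) branches_cyl[of 0] \<nu>(3)[OF order_refl] by simp
qed

text \<open>The matrix is recovered by polarization from finitely many scalar measures, in the same
  way as in \<open>entry_integral\<close>.\<close>

definition N :: "(nat \<Rightarrow> real ^ 'd) set \<Rightarrow> real ^ 'd ^ 'd" where
  "N X = (\<chi> i j. (1/2) * (measure (\<nu> (axis i 1 + axis j 1)) X - measure (\<nu> (axis i 1)) X - measure (\<nu> (axis j 1)) X))"

lemma N_cyl:
  assumes S: "S \<subseteq> dgrid n"
  shows "N (cyl n S) = (\<Sum>q\<in>S. B n q)"
proof -
  have "B n q $ i $ j = B n q $ j $ i" if "q \<in> S" for q i j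
  proof -
    have "transpose (B n q) = B n q" using S that by (intro B_sym) auto
    from arg_cong[OF this, of "\<lambda>A. A $ j $ i"] show ?thesis by (simp add: transpose_def)
  qed
  then have sym: "transpose (\<Sum>q\<in>S. B n q) = (\<Sum>q\<in>S. B n q)"
    by (auto simp: vec_eq_iff transpose_def sum_component intro!: sum.cong)
  show ?thesis
    unfolding N_def measure_cyl[OF S] polarization[OF sym, symmetric] by (simp add: vec_eq_iff)
qed

lemma N_sums:
  assumes A: "range A \<subseteq> sets branchM" "disjoint_family A"
  shows "(\<lambda>n. N (A n)) sums N (\<Union>n. A n)"
proof -
  have s: "(\<lambda>n. measure (\<nu> \<xi>) (A n)) sums measure (\<nu> \<xi>) (\<Union>n. A n)" for \<xi>
  proof -
    interpret finite_measure "\<nu> \<xi>" by (rule finite_\<nu>)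
    show ?thesis using A by (intro finite_measure_UNION) (auto simp: \<nu>(2))
  qed
  have "(\<lambda>n. N (A n) $ i $ j) sums (N (\<Union>n. A n) $ i $ j)" for i j
    unfolding N_def vec_lambda_beta by (intro sums_mult sums_diff s)
  then show ?thesis
    unfolding sums_def by (intro vec_tendstoI) (simp add: sum_component)
qed

text \<open>Polarization uses only special vectors, so general \<open>\<xi>\<close> needs an
  argument: the identity holds on cylinders, where both sides come from \<open>B\<close>, and
  extends to the generated sigma-algebra by Dynkin's theorem. Positivity of \<open>R\<close> rests
  on it.\<close>

lemma measure_\<nu>_eq_N:
  assumes "X \<in> sets branchM"
  shows "measure (\<nu> \<xi>) X = outer \<xi> \<xi> \<bullet> N X"
proof -
  interpret finite_measure "\<nu> \<zeta>" for \<zeta> by (rule finite_\<nu>)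
  have top: "measure (\<nu> \<xi>) branches = outer \<xi> \<xi> \<bullet> N branches"
    using measure_cyl[of "dgrid 0" 0 \<xi>] N_cyl[of "dgrid 0" 0] by (simp add: branches_cyl[of 0, symmetric])
  have X: "X \<in> sigma_sets branches cylinders" using assms by (simp add: sets_branchM)
  have sub: "cylinders \<subseteq> Pow (branches :: (nat \<Rightarrow> real ^ 'd) set)" by (auto simp: cylinders_def cyl_def)
  show ?thesis
  proof (rule sigma_sets_induct_disjoint[where P = "\<lambda>X. measure (\<nu> \<xi>) X = outer \<xi> \<xi> \<bullet> N X", OF Int_stable_cylinders sub X])
    fix A :: "(nat \<Rightarrow> real ^ 'd) set" assume "A \<in> cylinders"
    then show "measure (\<nu> \<xi>) A = outer \<xi> \<xi> \<bullet> N A" by (auto simp: cylinders_def measure_cyl N_cyl)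
  next
    show "measure (\<nu> \<xi>) {} = outer \<xi> \<xi> \<bullet> N {}" using N_cyl[of "{}" 0] by (simp add: cyl_def)
  next
    fix A :: "(nat \<Rightarrow> real ^ 'd) set" assume A: "A \<in> sigma_sets branches cylinders" "measure (\<nu> \<xi>) A = outer \<xi> \<xi> \<bullet> N A"
    have c: "measure (\<nu> \<zeta>) (branches - A) = measure (\<nu> \<zeta>) branches - measure (\<nu> \<zeta>) A" for \<zeta>
      using finite_measure_compl[of A \<zeta>] A(1) by (simp add: \<nu> sets_branchM)
    have "N (branches - A) = N branches - N A"
      by (simp add: N_def vec_eq_iff c field_simps)
    then show "measure (\<nu> \<xi>) (branches - A) = outer \<xi> \<xi> \<bullet> N (branches - A)"
      using A(2) top by (simp add: c inner_diff_right)
  next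
    fix A :: "nat \<Rightarrow> (nat \<Rightarrow> real ^ 'd) set"
    assume A: "disjoint_family A" "range A \<subseteq> sigma_sets branches cylinders" "\<And>i. measure (\<nu> \<xi>) (A i) = outer \<xi> \<xi> \<bullet> N (A i)"
    have "(\<lambda>n. measure (\<nu> \<xi>) (A n)) sums measure (\<nu> \<xi>) (\<Union>n. A n)"
      using A(1,2) by (intro finite_measure_UNION) (auto simp: \<nu>(2) sets_branchM)
    moreover have "(\<lambda>n. outer \<xi> \<xi> \<bullet> N (A n)) sums (outer \<xi> \<xi> \<bullet> N (\<Union>n. A n))"
      using A(1,2) by (intro bounded_linear.sums[OF bounded_linear_inner_right] N_sums) (auto simp: sets_branchM)
    ultimately show "measure (\<nu> \<xi>) (\<Union>(range A)) = outer \<xi> \<xi> \<bullet> N (\<Union>(range A))"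
      using A(3) by (simp add: sums_unique2)
  qed
qed

definition R :: "(real ^ 'd) set \<Rightarrow> real ^ 'd ^ 'd" where
  "R A = N (proj -` A \<inter> branches)"

lemma proj_sets: "A \<in> sets cellB \<Longrightarrow> proj -` A \<inter> branches \<in> sets branchM"
  using measurable_sets[OF measurable_proj, of A] by (simp add: space_branchM)

lemma psd_measure_R: "psd_measure R"
  unfolding psd_measure_def
proof (intro conjI ballI allI impI)
  fix A :: "(real ^ 'd) set" assume A: "A \<in> sets cellB"
  show "transpose (R A) = R A" by (simp add: R_def N_def transpose_def vec_eq_iff add.commute)
  show "0 \<le> outer \<xi> \<xi> \<bullet> R A" for \<xi>
    unfolding R_def measure_\<nu>_eq_N[OF proj_sets[OF A], symmetric] by simp
next
  fix A :: "nat \<Rightarrow> (real ^ 'd) set" assume A: "range A \<subseteq> sets cellB \<and> disjoint_family A"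
  have "(\<lambda>n. N (proj -` A n \<inter> branches)) sums N (\<Union>n. proj -` A n \<inter> branches)"
    using A by (intro N_sums) (auto intro!: proj_sets simp: disjoint_family_on_def)
  then show "(\<lambda>n. R (A n)) sums R (\<Union>n. A n)"
    by (simp add: R_def vimage_UN Int_UN_distrib2)
qed

lemma quad_measure_R: "quad_measure R \<xi> = distr (\<nu> \<xi>) cellB proj"
proof (rule measure_eqI)
  interpret psd_matrix_measure R by unfold_locales (rule psd_measure_R)
  interpret finite_measure "\<nu> \<xi>" by (rule finite_\<nu>)
  show "sets (quad_measure R \<xi>) = sets (distr (\<nu> \<xi>) cellB proj)" by simp
  fix A assume "A \<in> sets (quad_measure R \<xi>)"
  then have A: "A \<in> sets cellB" by simp
  have m: "proj \<in> \<nu> \<xi> \<rightarrow>\<^sub>M cellB" using measurable_proj by (simp cong: measurable_cong_sets add: \<nu>(2))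
  show "emeasure (quad_measure R \<xi>) A = emeasure (distr (\<nu> \<xi>) cellB proj) A"
    unfolding emeasure_quad[OF A] emeasure_distr[OF m A]
    by (simp add: R_def measure_\<nu>_eq_N[OF proj_sets[OF A], symmetric] \<nu>(1) emeasure_eq_measure)
qed

lemma trace_R: "trace (R cell) = (\<Sum>q\<in>dgrid n. trace (B n q))"
proof -
  have eq: "proj -` cell \<inter> branches = cyl n (dgrid n)" by (auto simp: proj_def wrap_cell branches_cyl[of n])
  show ?thesis unfolding R_def eq N_cyl[OF order_refl] by (rule trace_sum)
qed

lemma integral_coordinate: "(\<integral>\<omega>. f (\<omega> n) \<partial>\<nu> \<xi>) = (\<Sum>q\<in>dgrid n. f q * (outer \<xi> \<xi> \<bullet> B n q))"
proof -
  interpret finite_measure "\<nu> \<xi>" by (rule finite_\<nu>)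
  have "(\<integral>\<omega>. f (\<omega> n) \<partial>\<nu> \<xi>) = (\<integral>\<omega>. (\<Sum>q\<in>dgrid n. f q * indicator (cyl n {q}) \<omega>) \<partial>\<nu> \<xi>)"
  proof (rule Bochner_Integration.integral_cong)
    fix \<omega> assume "\<omega> \<in> space (\<nu> \<xi>)"
    then have \<omega>: "\<omega> \<in> branches" "\<omega> n \<in> dgrid n" by (auto simp: \<nu>(1) branches_def)
    have "(\<Sum>q\<in>dgrid n. f q * indicator (cyl n {q}) \<omega>) = (\<Sum>q\<in>dgrid n. if q = \<omega> n then f q else 0)"
      using \<omega> by (intro sum.cong) (auto simp: cyl_def indicator_def)
    then show "f (\<omega> n) = (\<Sum>q\<in>dgrid n. f q * indicator (cyl n {q}) \<omega>)"
      using \<omega> by (simp add: sum.delta' finite_dgrid)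
  qed simp
  also have "\<dots> = (\<Sum>q\<in>dgrid n. f q * measure (\<nu> \<xi>) (cyl n {q}))"
  proof -
    have c: "cyl n {q} \<in> sets (\<nu> \<xi>)" if "q \<in> dgrid n" for q
      using that by (auto simp: \<nu>(2) sets_branchM cylinders_def intro!: sigma_sets.Basic)
    then have "integrable (\<nu> \<xi>) (indicator (cyl n {q}) :: _ \<Rightarrow> real)" if "q \<in> dgrid n" for q
      using that by (intro integrable_real_indicator) (auto simp: emeasure_finite less_top[symmetric])
    moreover have "cyl n {q} \<inter> space (\<nu> \<xi>) = cyl n {q}" for q by (auto simp: cyl_def \<nu>(1))
    ultimately show ?thesis using c by (subst Bochner_Integration.integral_sum) (auto intro!: sum.cong)
  qed
  also have "\<dots> = (\<Sum>q\<in>dgrid n. f q * (outer \<xi> \<xi> \<bullet> B n q))"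
    by (intro sum.cong) (auto simp: measure_cyl)
  finally show ?thesis .
qed

text \<open>\<open>R\<close> need not assign \<open>B n q\<close> to the cell at \<open>q\<close>,
  since branches in a cell can converge to its upper faces. What survives is the limit of Riemann
  sums. It is computed on branches, where \<open>F (\<omega> n)\<close> tends to \<open>F\<close> at
  the limit of \<open>\<omega>\<close>, and periodicity absorbs \<open>wrap\<close>.\<close>

lemma matrix_integral_R_limit:
  fixes F :: "real ^ 'd \<Rightarrow> real ^ 'd ^ 'd"
  assumes F: "continuous_on UNIV F" and per: "\<And>x k. (\<And>i. k $ i \<in> \<int>) \<Longrightarrow> F (x + k) = F x"
  shows "(\<lambda>n. \<Sum>q\<in>dgrid n. F q \<bullet> B n q) \<longlonglongrightarrow> matrix_integral R F"
proof -
  have "compact (F ` cbox 0 1)" by (intro compact_continuous_image continuous_on_subset[OF F]) auto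
  then have "bounded (F ` cbox 0 1)" by (rule compact_imp_bounded)
  then obtain b where b: "\<And>x. x \<in> cbox 0 1 \<Longrightarrow> norm (F x) \<le> b"
    unfolding bounded_iff by blast
  have lim: "(\<lambda>n. \<integral>\<omega>. F (\<omega> n) $ i $ j \<partial>\<nu> \<xi>) \<longlonglongrightarrow> (\<integral>x. F x $ i $ j \<partial>quad_measure R \<xi>)" for i j \<xi>
  proof -
    interpret finite_measure "\<nu> \<xi>" by (rule finite_\<nu>)
    have m: "proj \<in> \<nu> \<xi> \<rightarrow>\<^sub>M cellB" "(\<lambda>\<omega>. \<omega> n) \<in> \<nu> \<xi> \<rightarrow>\<^sub>M borel" "branch_limit \<in> \<nu> \<xi> \<rightarrow>\<^sub>M borel" for n
      using measurable_proj measurable_coordinate[of n] measurable_branch_limit by (simp_all cong: measurable_cong_sets add: \<nu>(2))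
    have "continuous_on UNIV (\<lambda>x. F x $ i $ j)" using F by (intro continuous_intros)
    then have Fm: "(\<lambda>x. F x $ i $ j) \<in> borel_measurable borel" by (rule borel_measurable_continuous_onI)
    have "(\<integral>x. F x $ i $ j \<partial>quad_measure R \<xi>) = (\<integral>\<omega>. F (proj \<omega>) $ i $ j \<partial>\<nu> \<xi>)"
      unfolding quad_measure_R by (rule integral_distr[OF m(1) measurable_restrict_space1[OF Fm]])
    also have "\<dots> = (\<integral>\<omega>. F (branch_limit \<omega>) $ i $ j \<partial>\<nu> \<xi>)"
      by (simp add: proj_def wrap_periodic[of F, OF per])
    finally have eq: "(\<integral>x. F x $ i $ j \<partial>quad_measure R \<xi>) = (\<integral>\<omega>. F (branch_limit \<omega>) $ i $ j \<partial>\<nu> \<xi>)" .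
    show ?thesis unfolding eq
    proof (rule integral_dominated_convergence[where w = "\<lambda>_. b"])
      show "(\<lambda>\<omega>. F (branch_limit \<omega>) $ i $ j) \<in> borel_measurable (\<nu> \<xi>)" by (rule measurable_compose[OF m(3) Fm])
      show "(\<lambda>\<omega>. F (\<omega> n) $ i $ j) \<in> borel_measurable (\<nu> \<xi>)" for n by (rule measurable_compose[OF m(2) Fm])
      show "integrable (\<nu> \<xi>) (\<lambda>_. b)" by simp
      show "AE \<omega> in \<nu> \<xi>. (\<lambda>n. F (\<omega> n) $ i $ j) \<longlonglongrightarrow> F (branch_limit \<omega>) $ i $ j"
      proof (rule AE_I2)
        fix \<omega> assume "\<omega> \<in> space (\<nu> \<xi>)"
        then have "\<omega> \<longlonglongrightarrow> branch_limit \<omega>" by (simp add: \<nu>(1) branch_limit)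
        then have "(\<lambda>n. F (\<omega> n)) \<longlonglongrightarrow> F (branch_limit \<omega>)"
          using F by (intro isCont_tendsto_compose[of _ F]) (simp_all add: continuous_on_eq_continuous_at)
        then show "(\<lambda>n. F (\<omega> n) $ i $ j) \<longlonglongrightarrow> F (branch_limit \<omega>) $ i $ j" by (intro tendsto_vec_nth)
      qed
      show "AE \<omega> in \<nu> \<xi>. norm (F (\<omega> n) $ i $ j) \<le> b" for n
      proof (rule AE_I2)
        fix \<omega> assume "\<omega> \<in> space (\<nu> \<xi>)"
        then have "\<omega> n \<in> cbox 0 1" using dgrid_cell cell_subset_cbox by (auto simp: \<nu>(1) branches_def)
        then have "norm (F (\<omega> n)) \<le> b" by (rule b)
        then show "norm (F (\<omega> n) $ i $ j) \<le> b"
          using Finite_Cartesian_Product.norm_nth_le[of "F (\<omega> n)" i] Finite_Cartesian_Product.norm_nth_le[of "F (\<omega> n) $ i" j] by linarith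
      qed
    qed
  qed
  have eq: "(\<Sum>q\<in>dgrid n. F q \<bullet> B n q) = (\<Sum>i\<in>UNIV. \<Sum>j\<in>UNIV. (1/2) *
    ((\<integral>\<omega>. F (\<omega> n) $ i $ j \<partial>\<nu> (axis i 1 + axis j 1)) - (\<integral>\<omega>. F (\<omega> n) $ i $ j \<partial>\<nu> (axis i 1)) - (\<integral>\<omega>. F (\<omega> n) $ i $ j \<partial>\<nu> (axis j 1))))" for n
  proof -
    have "(1/2) * ((\<integral>\<omega>. F (\<omega> n) $ i $ j \<partial>\<nu> (axis i 1 + axis j 1)) - (\<integral>\<omega>. F (\<omega> n) $ i $ j \<partial>\<nu> (axis i 1)) - (\<integral>\<omega>. F (\<omega> n) $ i $ j \<partial>\<nu> (axis j 1)))
      = (\<Sum>q\<in>dgrid n. F q $ i $ j * B n q $ i $ j)" for i j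
    proof -
      have "(\<Sum>q\<in>dgrid n. F q $ i $ j * B n q $ i $ j) = (\<Sum>q\<in>dgrid n. F q $ i $ j * ((1/2) * (outer (axis i 1 + axis j 1) (axis i 1 + axis j 1) \<bullet> B n q
         - outer (axis i 1) (axis i 1) \<bullet> B n q - outer (axis j 1) (axis j 1) \<bullet> B n q)))"
        by (intro sum.cong refl) (metis polarization B_sym)
      then show ?thesis
        unfolding integral_coordinate[where f = "\<lambda>q. F q $ i $ j"]
        by (simp add: sum_subtractf[symmetric] sum_distrib_left algebra_simps)
    qed
    then have "(\<Sum>i\<in>UNIV. \<Sum>j\<in>UNIV. (1/2) *
      ((\<integral>\<omega>. F (\<omega> n) $ i $ j \<partial>\<nu> (axis i 1 + axis j 1)) - (\<integral>\<omega>. F (\<omega> n) $ i $ j \<partial>\<nu> (axis i 1)) - (\<integral>\<omega>. F (\<omega> n) $ i $ j \<partial>\<nu> (axis j 1))))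
      = (\<Sum>i\<in>UNIV. \<Sum>j\<in>UNIV. \<Sum>q\<in>dgrid n. F q $ i $ j * B n q $ i $ j)"
      by simp
    also have "\<dots> = (\<Sum>i\<in>UNIV. \<Sum>q\<in>dgrid n. \<Sum>j\<in>UNIV. F q $ i $ j * B n q $ i $ j)"
      by (subst sum.swap) simp
    also have "\<dots> = (\<Sum>q\<in>dgrid n. \<Sum>i\<in>UNIV. \<Sum>j\<in>UNIV. F q $ i $ j * B n q $ i $ j)"
      by (rule sum.swap)
    finally show ?thesis by (simp add: inner_vec_def)
  qed
  show ?thesis
    unfolding eq matrix_integral_def entry_integral_def by (intro tendsto_intros lim)
qed

end

section \<open>Consequences of the energy-variational inequality\<close>

lemma affine_nonpos_imp_slope_zero:
  fixes A X :: real
  assumes "\<And>lam. A - lam * X \<le> 0"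
  shows "X = 0"
proof (rule ccontr)
  assume "X \<noteq> 0"
  then show False using assms[of "(A - 1) / X"] by simp
qed

lemma affine_nonpos_imp_slope_nonneg:
  fixes A X :: real
  assumes "\<And>lam. 0 < lam \<Longrightarrow> A - lam * X \<le> 0"
  shows "0 \<le> X"
proof (rule ccontr)
  assume X: "\<not> 0 \<le> X"
  define lam where "lam = (\<bar>A\<bar> + 1) / (- X)"
  have "0 < lam" unfolding lam_def by (rule divide_pos_pos) (use X in linarith)+
  moreover have "lam * X = - (\<bar>A\<bar> + 1)" using X by (simp add: lam_def)
  ultimately show False using assms[of lam] by linarith
qed

context euler_fields
begin

lemma mass_pot_add_scaleR:
  assumes \<rho>: "C1_torus T \<rho>" "C1_torus T \<sigma>" and t: "t \<in> {0..T}" and hs: "integrable torus hs"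
  shows "(\<integral>x. hs x * (\<rho> t x + c *\<^sub>R \<sigma> t x) \<partial>torus) - tint T (flux (mass_test T (\<lambda>t x. \<rho> t x + c *\<^sub>R \<sigma> t x))) t
    = ((\<integral>x. hs x * \<rho> t x \<partial>torus) - tint T (flux (mass_test T \<rho>)) t)
      + c * ((\<integral>x. hs x * \<sigma> t x \<partial>torus) - tint T (flux (mass_test T \<sigma>)) t)"
proof -
  note k = continuous_on_mass_test[OF T \<rho>(1)] continuous_on_mass_test[OF T \<rho>(2)]
  have i: "integrable I (\<lambda>\<tau>. flux (mass_test T \<rho>) \<tau> + c * flux (mass_test T \<sigma>) \<tau>)"
    using integrable_flux[OF k(1)] integrable_flux[OF k(2)] by auto
  have "tint T (flux (mass_test T (\<lambda>t x. \<rho> t x + c *\<^sub>R \<sigma> t x))) t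
      = tint T (\<lambda>\<tau>. flux (mass_test T \<rho>) \<tau> + c * flux (mass_test T \<sigma>) \<tau>) t"
    by (intro tint_cong_AE i integrable_flux continuous_on_mass_test T C1_torus_add_scaleR(1) \<rho>
         AE_flux_add_scaleR[OF k] mass_test_add_scaleR[OF T \<rho>])
  also have "\<dots> = tint T (flux (mass_test T \<rho>)) t + c * tint T (flux (mass_test T \<sigma>)) t"
    by (rule tint_linear) (rule integrable_flux k)+
  finally show ?thesis
    using integrable_inner_continuous[OF hs continuous_on_section[OF C1_torus_continuous[OF \<rho>(1)] t]]
      integrable_inner_continuous[OF hs continuous_on_section[OF C1_torus_continuous[OF \<rho>(2)] t]]
    by (simp add: algebra_simps)
qed

lemma momentum_pot_add_scaleR:
  assumes \<rho>: "C1_torus T \<rho>" "C1_torus T \<sigma>" and t: "t \<in> {0..T}" and hs: "integrable torus hs"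
  shows "(\<integral>x. hs x \<bullet> (\<rho> t x + c *\<^sub>R \<sigma> t x) \<partial>torus) - tint T (flux (momentum_test T (\<lambda>t x. \<rho> t x + c *\<^sub>R \<sigma> t x))) t
    = ((\<integral>x. hs x \<bullet> \<rho> t x \<partial>torus) - tint T (flux (momentum_test T \<rho>)) t)
      + c * ((\<integral>x. hs x \<bullet> \<sigma> t x \<partial>torus) - tint T (flux (momentum_test T \<sigma>)) t)"
proof -
  note k = continuous_on_momentum_test[OF T \<rho>(1)] continuous_on_momentum_test[OF T \<rho>(2)]
  have i: "integrable I (\<lambda>\<tau>. flux (momentum_test T \<rho>) \<tau> + c * flux (momentum_test T \<sigma>) \<tau>)"
    using integrable_flux[OF k(1)] integrable_flux[OF k(2)] by auto
  have "tint T (flux (momentum_test T (\<lambda>t x. \<rho> t x + c *\<^sub>R \<sigma> t x))) t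
      = tint T (\<lambda>\<tau>. flux (momentum_test T \<rho>) \<tau> + c * flux (momentum_test T \<sigma>) \<tau>) t"
    by (intro tint_cong_AE i integrable_flux continuous_on_momentum_test T C1_torus_add_scaleR(1) \<rho>
         AE_flux_add_scaleR[OF k] momentum_test_add_scaleR[OF T \<rho>])
  also have "\<dots> = tint T (flux (momentum_test T \<rho>)) t + c * tint T (flux (momentum_test T \<sigma>)) t"
    by (rule tint_linear) (rule integrable_flux k)+
  finally show ?thesis
    using integrable_inner_continuous[OF hs continuous_on_section[OF C1_torus_continuous[OF \<rho>(1)] t]]
      integrable_inner_continuous[OF hs continuous_on_section[OF C1_torus_continuous[OF \<rho>(2)] t]]
    by (simp add: inner_add_right algebra_simps)
qed

lemma neg_norm_scaleR:
  assumes \<phi>: "C1_torus T \<phi>" and \<tau>: "\<tau> \<in> {0..T}" and c: "0 \<le> c"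
  shows "neg_norm (\<lambda>x. c *\<^sub>R \<phi> \<tau> x) = c * neg_norm (\<phi> \<tau>)"
proof -
  have le: "neg_norm (\<lambda>x. c *\<^sub>R \<phi> \<tau> x) \<le> c * neg_norm (\<phi> \<tau>)" if "0 \<le> c" "C1_torus T \<phi>" for c \<phi>
    using neg_norm_le[OF T C1_torus_scaleR(1)[OF T that(2), of c] \<tau>, of "c * neg_norm (\<phi> \<tau>)"]
      neg_norm_ge[OF T that(2) \<tau>] that(1)
    by (simp add: nabla_scaleR[OF T that(2) \<tau>] eneg_scaleR mult_left_mono)
  show ?thesis
  proof (cases "c = 0")
    case True
    then show ?thesis using le[OF c \<phi>] neg_norm_nonneg[OF T C1_torus_scaleR(1)[OF T \<phi>, of c] \<tau>] by simp
  next
    case False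
    have "neg_norm (\<phi> \<tau>) \<le> (1 / c) * neg_norm (\<lambda>x. c *\<^sub>R \<phi> \<tau> x)"
      using le[of "1 / c", OF _ C1_torus_scaleR(1)[OF T \<phi>, of c]] False c by simp
    then have "c * neg_norm (\<phi> \<tau>) \<le> neg_norm (\<lambda>x. c *\<^sub>R \<phi> \<tau> x)"
      using False c by (simp add: field_simps)
    then show ?thesis using le[OF c \<phi>] by simp
  qed
qed

lemma tint_defect_scaleR:
  assumes \<phi>: "C1_torus T \<phi>" and c: "0 \<le> c"
  shows "tint T (defect (\<lambda>t x. c *\<^sub>R \<phi> t x)) t = c * tint T (defect \<phi>) t"
proof -
  have "tint T (defect (\<lambda>t x. c *\<^sub>R \<phi> t x)) t = tint T (\<lambda>\<tau>. 0 + c * defect \<phi> \<tau>) t"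
  proof (rule tint_cong_AE)
    show "integrable I (\<lambda>\<tau>. 0 + c * defect \<phi> \<tau>)" using defect_integrable[OF \<phi>] by simp
    show "AE \<tau> in I. defect (\<lambda>t x. c *\<^sub>R \<phi> t x) \<tau> = 0 + c * defect \<phi> \<tau>"
      using AE_I_range by eventually_elim (simp add: defect_def neg_norm_scaleR[OF \<phi> _ c])
  qed (rule defect_integrable[OF C1_torus_scaleR(1)[OF T \<phi>]])
  also have "\<dots> = c * tint T (defect \<phi>) t"
    by (simp add: tint_def mult.left_commute)
  finally show ?thesis .
qed

end

section \<open>The momentum residual and its good times\<close>

locale ev_fields = euler_fields a \<gamma> T C h m E
  for a \<gamma> T C :: real and h :: "real \<Rightarrow> real ^ 'd \<Rightarrow> real" and m :: "real \<Rightarrow> real ^ 'd \<Rightarrow> real ^ 'd" and E +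
  fixes h0 :: "real ^ 'd \<Rightarrow> real" and m0 :: "real ^ 'd \<Rightarrow> real ^ 'd" and iv :: real
  assumes h0: "integrable torus h0" and m0: "integrable torus m0"
    and ev: "AE s in lebesgue_on {0<..<T}. AE t in lebesgue_on {s<..<T}.
        \<forall>\<rho> \<phi>. C1_torus T \<rho> \<and> C1_torus T \<phi> \<longrightarrow>
          ev_lhs a \<gamma> (\<gamma> - 1) T h m E (E s) (h s) (m s) s t \<rho> \<phi> \<le> 0"
    and ev0: "AE t in lebesgue_on {0<..<T}.
        \<forall>\<rho> \<phi>. C1_torus T \<rho> \<and> C1_torus T \<phi> \<longrightarrow>
          ev_lhs a \<gamma> (\<gamma> - 1) T h m E iv h0 m0 0 t \<rho> \<phi> \<le> 0"
begin

text \<open>The residual measured from the initial momentum. Its value at \<open>t = 0\<close> is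
  set by hand, because \<open>momentum_pot 0\<close> would refer to \<open>m 0\<close> instead of
  the initial datum.\<close>

definition L :: "real \<Rightarrow> (real \<Rightarrow> real ^ 'd \<Rightarrow> real ^ 'd) \<Rightarrow> real" where
  "L t \<phi> = (if t = 0 then 0 else momentum_pot t \<phi> - (\<integral>x. m0 x \<bullet> \<phi> 0 x \<partial>torus))"

text \<open>The energy increment is a fixed offset while the potentials scale with the test. The
  test \<open>\<rho>\<close> may carry any real factor, which yields an equation; the defect is only
  positively homogeneous, so \<open>\<phi>\<close> carries positive factors and yields one
  inequality.\<close>

lemma ev_consequences:
  assumes st: "s \<in> {0..T}" "t \<in> {0..T}" and Ut: "integrable torus (U t)"
    and hs: "integrable torus hs" and ms: "integrable torus ms"
    and ev: "\<And>\<rho> \<phi>. C1_torus T \<rho> \<Longrightarrow> C1_torus T \<phi> \<Longrightarrow> ev_lhs a \<gamma> (\<gamma> - 1) T h m E es hs ms s t \<rho> \<phi> \<le> 0"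
  shows ev_imp_mass: "C1_torus T \<rho> \<Longrightarrow> mass_balance T h m hs s t \<rho>"
    and ev_imp_momentum: "C1_torus T \<phi> \<Longrightarrow> - kap * (tint T (defect \<phi>) t - tint T (defect \<phi>) s) \<le>
      momentum_pot t \<phi> - ((\<integral>x. ms x \<bullet> \<phi> s x \<partial>torus) - tint T (flux (momentum_test T \<phi>)) s)"
proof -
  define X where "X = (\<lambda>\<rho>. mass_pot t \<rho> - ((\<integral>x. hs x * \<rho> s x \<partial>torus) - tint T (flux (mass_test T \<rho>)) s))"
  define Y where "Y = (\<lambda>\<phi>. momentum_pot t \<phi> - ((\<integral>x. ms x \<bullet> \<phi> s x \<partial>torus) - tint T (flux (momentum_test T \<phi>)) s))"
  define Z where "Z = (\<lambda>\<phi>. tint T (defect \<phi>) t - tint T (defect \<phi>) s)"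
  have main: "E t - es - X \<rho> - Y \<phi> - kap * Z \<phi> \<le> 0" if "C1_torus T \<rho>" "C1_torus T \<phi>" for \<rho> \<phi>
    using ev[OF that] unfolding ev_lhs_eq[OF that st Ut hs ms] X_def Y_def Z_def kap_def .
  have X: "X (\<lambda>t x. 0 + c *\<^sub>R \<rho> t x) = X (\<lambda>t x. 0) + c * X \<rho>" if "C1_torus T \<rho>" for c \<rho>
    unfolding X_def mass_pot_def
      mass_pot_add_scaleR[OF C1_torus_0 that st(2) integrable_hm(1)[OF Ut]] mass_pot_add_scaleR[OF C1_torus_0 that st(1) hs]
    by (simp add: algebra_simps)
  have Y: "Y (\<lambda>t x. 0 + c *\<^sub>R \<phi> t x) = Y (\<lambda>t x. 0) + c * Y \<phi>" if "C1_torus T \<phi>" for c \<phi>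
    unfolding Y_def momentum_pot_def
      momentum_pot_add_scaleR[OF C1_torus_0 that st(2) integrable_hm(2)[OF Ut]] momentum_pot_add_scaleR[OF C1_torus_0 that st(1) ms]
    by (simp add: algebra_simps)
  show "mass_balance T h m hs s t \<rho>" if \<rho>: "C1_torus T \<rho>"
  proof -
    have "X \<rho> = 0"
    proof (rule affine_nonpos_imp_slope_zero)
      fix c
      show "(E t - es - X (\<lambda>t x. 0) - Y (\<lambda>t x. 0) - kap * Z (\<lambda>t x. 0)) - c * X \<rho> \<le> 0"
        using main[OF C1_torus_add_scaleR(1)[OF T C1_torus_0 \<rho>, of c] C1_torus_0] X[OF \<rho>, of c] by simp
    qed
    then show ?thesis unfolding mass_balance_iff[OF \<rho> st] X_def by simp
  qed
  show "- kap * (tint T (defect \<phi>) t - tint T (defect \<phi>) s) \<le>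
      momentum_pot t \<phi> - ((\<integral>x. ms x \<bullet> \<phi> s x \<partial>torus) - tint T (flux (momentum_test T \<phi>)) s)" if \<phi>: "C1_torus T \<phi>"
  proof -
    have "0 \<le> Y \<phi> + kap * Z \<phi>"
    proof (rule affine_nonpos_imp_slope_nonneg)
      fix c :: real assume c: "0 < c"
      have "Z (\<lambda>t x. 0 + c *\<^sub>R \<phi> t x) = c * Z \<phi>"
        unfolding Z_def using tint_defect_scaleR[OF \<phi>, of c] c by (simp add: algebra_simps)
      then show "(E t - es - X (\<lambda>t x. 0) - Y (\<lambda>t x. 0)) - c * (Y \<phi> + kap * Z \<phi>) \<le> 0"
        using main[OF C1_torus_0 C1_torus_add_scaleR(1)[OF T C1_torus_0 \<phi>, of c]] Y[OF \<phi>, of c]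
        by (simp add: algebra_simps)
    qed
    then show ?thesis by (simp add: Y_def Z_def)
  qed
qed

text \<open>Times admissible against the initial data; a \<open>good\<close> time may in addition
  serve as the earlier time. For a fixed good \<open>s\<close> the inequality is available at almost
  every later time, not at each later good time, and \<open>L_increment_ge\<close> closes this
  gap.\<close>

definition good0 :: "real \<Rightarrow> bool" where
  "good0 t \<longleftrightarrow> t \<in> {0<..<T} \<and> integrable torus (U t) \<and> (\<forall>\<rho> \<phi>. C1_torus T \<rho> \<and> C1_torus T \<phi> \<longrightarrow>
          ev_lhs a \<gamma> (\<gamma> - 1) T h m E iv h0 m0 0 t \<rho> \<phi> \<le> 0)"

definition good :: "real \<Rightarrow> bool" where
  "good s \<longleftrightarrow> good0 s \<and> (AE t in lebesgue_on {s<..<T}.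
        \<forall>\<rho> \<phi>. C1_torus T \<rho> \<and> C1_torus T \<phi> \<longrightarrow>
          ev_lhs a \<gamma> (\<gamma> - 1) T h m E (E s) (h s) (m s) s t \<rho> \<phi> \<le> 0)"

lemma AE_good0: "AE t in I. good0 t"
  unfolding good0_def using ev0 AE_U AE_I_range by eventually_elim simp

lemma AE_good: "AE t in I. good t"
  unfolding good_def using ev AE_good0 by eventually_elim simp

lemma good0_mass: "good0 t \<Longrightarrow> C1_torus T \<rho> \<Longrightarrow> mass_balance T h m h0 0 t \<rho>"
  by (rule ev_imp_mass[OF _ _ _ h0 m0]) (auto simp: good0_def)

lemma good0_L: "good0 t \<Longrightarrow> C1_torus T \<phi> \<Longrightarrow> - kap * tint T (defect \<phi>) t \<le> L t \<phi>"
  using ev_imp_momentum[of 0 t h0 m0 iv \<phi>, OF _ _ _ h0 m0] by (auto simp: good0_def L_def)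

lemma L_add_scaleR:
  assumes t: "t = 0 \<or> good0 t" and \<phi>: "C1_torus T \<phi>" "C1_torus T \<psi>"
  shows "L t (\<lambda>t x. \<phi> t x + c *\<^sub>R \<psi> t x) = L t \<phi> + c * L t \<psi>"
proof (cases "t = 0")
  case False
  then have t': "t \<in> {0..T}" "integrable torus (U t)" using t by (auto simp: good0_def)
  have z: "0 \<in> {0..T}" using T by simp
  note i = integrable_inner_continuous[OF m0 continuous_on_section[OF C1_torus_continuous[OF \<phi>(1)] z]]
    integrable_inner_continuous[OF m0 continuous_on_section[OF C1_torus_continuous[OF \<phi>(2)] z]]
  show ?thesis
    using False i unfolding L_def momentum_pot_def momentum_pot_add_scaleR[OF \<phi> t'(1) integrable_hm(2)[OF t'(2)]]
    by (simp add: inner_add_right algebra_simps)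
qed (simp add: L_def)

lemma AE_after_good:
  assumes "good s"
  shows "AE t in lebesgue_on {s<..<T}. good0 t \<and> (\<forall>\<phi>. C1_torus T \<phi> \<longrightarrow>
    - kap * (tint T (defect \<phi>) t - tint T (defect \<phi>) s) \<le> L t \<phi> - L s \<phi>)"
proof -
  have s: "0 < s" "s < T" "integrable torus (U s)" using assms by (auto simp: good_def good0_def)
  have "AE t in lebesgue_on {s<..<T}. good0 t" using AE_lebesgue_on_Ioo_subset[OF AE_good0] s by simp
  moreover have "AE t in lebesgue_on {s<..<T}.
        \<forall>\<rho> \<phi>. C1_torus T \<rho> \<and> C1_torus T \<phi> \<longrightarrow>
          ev_lhs a \<gamma> (\<gamma> - 1) T h m E (E s) (h s) (m s) s t \<rho> \<phi> \<le> 0"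
    using assms by (simp add: good_def)
  ultimately show ?thesis
  proof eventually_elim
    case (elim t)
    then have t: "t \<in> {0<..<T}" "integrable torus (U t)" by (auto simp: good0_def)
    have "- kap * (tint T (defect \<phi>) t - tint T (defect \<phi>) s) \<le> L t \<phi> - L s \<phi>" if \<phi>: "C1_torus T \<phi>" for \<phi>
    proof -
      have "- kap * (tint T (defect \<phi>) t - tint T (defect \<phi>) s) \<le>
        momentum_pot t \<phi> - ((\<integral>x. m s x \<bullet> \<phi> s x \<partial>torus) - tint T (flux (momentum_test T \<phi>)) s)"
        by (rule ev_imp_momentum[OF _ _ t(2) integrable_hm[OF s(3)] _ \<phi>]) (use s t elim in auto)
      then show ?thesis using s t by (simp add: L_def momentum_pot_def)
    qed
    then show ?case using elim by blast
  qed
qed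

lemma defect_Lipschitz:
  assumes \<phi>: "C1_torus T \<phi>"
  obtains K where "0 \<le> K" "\<And>s t. s \<in> {0..T} \<Longrightarrow> t \<in> {0..T} \<Longrightarrow> \<bar>tint T (defect \<phi>) t - tint T (defect \<phi>) s\<bar> \<le> K * \<bar>t - s\<bar>"
proof -
  obtain B where B: "0 \<le> B" "\<And>t x. t \<in> {0..T} \<Longrightarrow> x \<in> cell \<Longrightarrow> norm (nabla (\<phi> t) x) \<le> B"
    using continuous_bounded_cell[OF C1_torus_continuous_nabla[OF T \<phi>]] by metis
  have "neg_norm (\<phi> t) \<le> B" if t: "t \<in> {0..T}" for t
    by (rule neg_norm_le[OF T \<phi> t]) (rule order_trans[OF eneg_le_norm B(2)[OF t]])
  then have AE: "AE \<tau> in I. \<bar>defect \<phi> \<tau>\<bar> \<le> B * C" by (rule AE_defect_le[OF \<phi>])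
  have le: "\<bar>tint T (defect \<phi>) t - tint T (defect \<phi>) s\<bar> \<le> (B * C) * (t - s)" if "0 \<le> s" "s \<le> t" "t \<le> T" for s t
    by (rule tint_diff_abs_le[OF defect_integrable[OF \<phi>] AE that])
  show ?thesis
  proof (rule that)
    show "0 \<le> B * C" using B(1) C_nonneg by simp
    fix s t assume st: "s \<in> {0..T}" "t \<in> {0..T}"
    show "\<bar>tint T (defect \<phi>) t - tint T (defect \<phi>) s\<bar> \<le> (B * C) * \<bar>t - s\<bar>"
      using le[of s t] le[of t s] st by (cases "s \<le> t") (auto simp: abs_minus_commute)
  qed
qed

text \<open>
  The inequality between two good times is obtained by passing through a later time that is good for
  both and letting it decrease to the second one.
\<close>

lemma L_increment_ge:
  assumes s: "s = 0 \<or> good s" and s': "good s'" and lt: "s < s'" and \<phi>: "C1_torus T \<phi>"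
  shows "- kap * (tint T (defect \<phi>) s' - tint T (defect \<phi>) s) \<le> L s' \<phi> - L s \<phi>"
proof (cases "s = 0")
  case True
  then show ?thesis using good0_L[OF _ \<phi>, of s'] s' by (simp add: L_def good_def)
next
  case False
  then have gs: "good s" using s by simp
  \<comment> \<open>The inequality for \<open>- \<phi>\<close> bounds the increment of the residual
    from above between \<open>s'\<close> and the auxiliary later time.\<close>
  define \<psi> where "\<psi> = (\<lambda>t x. 0 + (-1) *\<^sub>R \<phi> t x)"
  have \<psi>: "C1_torus T \<psi>" unfolding \<psi>_def by (rule C1_torus_add_scaleR(1)[OF T C1_torus_0 \<phi>])
  have L0: "L t (\<lambda>t x. 0) = 0" if "good0 t" for t
    using L_add_scaleR[of t "\<lambda>t x. 0" "\<lambda>t x. 0" 1] that by (simp add: C1_torus_0)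
  have L\<psi>: "L t \<psi> = - L t \<phi>" if "good0 t" for t
    unfolding \<psi>_def using L_add_scaleR[of t "\<lambda>t x. 0" \<phi> "-1"] L0[OF that] that \<phi> by (simp add: C1_torus_0)
  obtain K where K: "0 \<le> K" "\<And>s t. s \<in> {0..T} \<Longrightarrow> t \<in> {0..T} \<Longrightarrow> \<bar>tint T (defect \<phi>) t - tint T (defect \<phi>) s\<bar> \<le> K * \<bar>t - s\<bar>"
    using defect_Lipschitz[OF \<phi>] by metis
  obtain K' where K': "0 \<le> K'" "\<And>s t. s \<in> {0..T} \<Longrightarrow> t \<in> {0..T} \<Longrightarrow> \<bar>tint T (defect \<psi>) t - tint T (defect \<psi>) s\<bar> \<le> K' * \<bar>t - s\<bar>"
    using defect_Lipschitz[OF \<psi>] by metis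
  have r: "0 < s" "0 < s'" "s' < T" using gs s' by (auto simp: good_def good0_def)
  have G: "good0 s" "good0 s'" using gs s' by (auto simp: good_def)
  show ?thesis
  proof (rule field_le_epsilon)
    fix e :: real assume e: "0 < e"
    \<comment> \<open>Small enough that the accumulated defects of both tests between
      \<open>s'\<close> and \<open>t\<close> contribute at most \<open>e\<close>.\<close>
    define d where "d = e / (kap * (K + K') + 1)"
    have kK: "0 \<le> kap * (K + K')" using kap_pos K K' by simp
    have d: "0 < d" "kap * (K + K') * d \<le> e" using e kK by (auto simp: d_def field_simps)
    have lebesgue_Ioo: "{x<..<y :: real} \<inter> space lebesgue \<in> sets lebesgue" for x y by simp
    have "AE t in lebesgue_on {s'<..<T}. (\<forall>\<phi>. C1_torus T \<phi> \<longrightarrow> - kap * (tint T (defect \<phi>) t - tint T (defect \<phi>) s') \<le> L t \<phi> - L s' \<phi>)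
      \<and> (\<forall>\<phi>. C1_torus T \<phi> \<longrightarrow> - kap * (tint T (defect \<phi>) t - tint T (defect \<phi>) s) \<le> L t \<phi> - L s \<phi>) \<and> good0 t"
    proof -
      have "AE t in lebesgue_on {s'<..<T}. good0 t \<and> (\<forall>\<phi>. C1_torus T \<phi> \<longrightarrow> - kap * (tint T (defect \<phi>) t - tint T (defect \<phi>) s) \<le> L t \<phi> - L s \<phi>)"
        using AE_after_good[OF gs] unfolding AE_restrict_space_iff[OF lebesgue_Ioo]
        by (rule eventually_mono) (use lt in auto)
      then show ?thesis using AE_after_good[OF s'] by eventually_elim blast
    qed
    then have "AE t in I. s' < t \<longrightarrow> ((\<forall>\<phi>. C1_torus T \<phi> \<longrightarrow> - kap * (tint T (defect \<phi>) t - tint T (defect \<phi>) s') \<le> L t \<phi> - L s' \<phi>)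
      \<and> (\<forall>\<phi>. C1_torus T \<phi> \<longrightarrow> - kap * (tint T (defect \<phi>) t - tint T (defect \<phi>) s) \<le> L t \<phi> - L s \<phi>) \<and> good0 t)"
      unfolding AE_restrict_space_iff[OF lebesgue_Ioo] by (rule eventually_mono) (use r in auto)
    from AE_ex_between[OF _ _ _ this, of s' "min T (s' + d)"] r d
    obtain t where t: "s' < t" "t < T" "t < s' + d" and
      1: "- kap * (tint T (defect \<psi>) t - tint T (defect \<psi>) s') \<le> L t \<psi> - L s' \<psi>" and
      2: "- kap * (tint T (defect \<phi>) t - tint T (defect \<phi>) s) \<le> L t \<phi> - L s \<phi>" and g: "good0 t"
      using \<phi> \<psi> by auto
    have "\<bar>tint T (defect \<phi>) t - tint T (defect \<phi>) s'\<bar> \<le> K * d"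
      using K(2)[of s' t] t r K(1) mult_left_mono[of "t - s'" d K] by auto
    then have 3: "kap * (tint T (defect \<phi>) t - tint T (defect \<phi>) s') \<le> kap * (K * d)"
      using kap_pos by (intro mult_left_mono) auto
    have "\<bar>tint T (defect \<psi>) t - tint T (defect \<psi>) s'\<bar> \<le> K' * d"
      using K'(2)[of s' t] t r K'(1) mult_left_mono[of "t - s'" d K'] by auto
    then have 4: "kap * (tint T (defect \<psi>) t - tint T (defect \<psi>) s') \<le> kap * (K' * d)"
      using kap_pos by (intro mult_left_mono) auto
    show "- kap * (tint T (defect \<phi>) s' - tint T (defect \<phi>) s) \<le> L s' \<phi> - L s \<phi> + e"
      using 1 2 3 4 d(2) unfolding L\<psi>[OF g] L\<psi>[OF G(2)] by (simp add: algebra_simps)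
  qed
qed

text \<open>The increment bound is applied to \<open>\<phi>\<close> and to its negative, which gives
  a constant built from the Lipschitz constants of both defects.\<close>

lemma L_Lipschitz:
  assumes \<phi>: "C1_torus T \<phi>"
  obtains K where "0 \<le> K" "\<And>s t. s = 0 \<or> good s \<Longrightarrow> t = 0 \<or> good t \<Longrightarrow> \<bar>L s \<phi> - L t \<phi>\<bar> \<le> K * \<bar>s - t\<bar>"
proof -
  define \<psi> where "\<psi> = (\<lambda>t x. 0 + (-1) *\<^sub>R \<phi> t x)"
  have \<psi>: "C1_torus T \<psi>" unfolding \<psi>_def by (rule C1_torus_add_scaleR(1)[OF T C1_torus_0 \<phi>])
  have L0: "L t (\<lambda>t x. 0) = 0" if "t = 0 \<or> good0 t" for t
    using L_add_scaleR[OF that C1_torus_0 C1_torus_0, of 1] by simp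
  have L\<psi>: "L t \<psi> = - L t \<phi>" if "t = 0 \<or> good0 t" for t
    unfolding \<psi>_def using L_add_scaleR[OF that C1_torus_0 \<phi>, of "-1"] L0[OF that] by simp
  obtain K where K: "0 \<le> K" "\<And>s t. s \<in> {0..T} \<Longrightarrow> t \<in> {0..T} \<Longrightarrow> \<bar>tint T (defect \<phi>) t - tint T (defect \<phi>) s\<bar> \<le> K * \<bar>t - s\<bar>"
    using defect_Lipschitz[OF \<phi>] by metis
  obtain K' where K': "0 \<le> K'" "\<And>s t. s \<in> {0..T} \<Longrightarrow> t \<in> {0..T} \<Longrightarrow> \<bar>tint T (defect \<psi>) t - tint T (defect \<psi>) s\<bar> \<le> K' * \<bar>t - s\<bar>"
    using defect_Lipschitz[OF \<psi>] by metis
  define M where "M = kap * (K + K')"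
  have M: "0 \<le> M" "kap * K \<le> M" "kap * K' \<le> M" using kap_pos K(1) K'(1) by (auto simp: M_def distrib_left)
  have le: "\<bar>L t \<phi> - L s \<phi>\<bar> \<le> M * (t - s)" if s: "s = 0 \<or> good s" and t: "good t" and lt: "s < t" for s t
  proof -
    have r: "s \<in> {0..T}" "t \<in> {0..T}" using s t T by (auto simp: good_def good0_def)
    have g: "s = 0 \<or> good0 s" "t = 0 \<or> good0 t" using s t by (auto simp: good_def)
    have "kap * (tint T (defect \<phi>) t - tint T (defect \<phi>) s) \<le> kap * (K * (t - s))"
      using K(2)[OF r] lt kap_pos by (intro mult_left_mono) auto
    also have "\<dots> \<le> M * (t - s)" using M(2) lt mult_right_mono[OF M(2), of "t - s"] by (simp add: mult.assoc)
    finally have 1: "- (M * (t - s)) \<le> L t \<phi> - L s \<phi>" using L_increment_ge[OF s t lt \<phi>] by linarith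
    have "kap * (tint T (defect \<psi>) t - tint T (defect \<psi>) s) \<le> kap * (K' * (t - s))"
      using K'(2)[OF r] lt kap_pos by (intro mult_left_mono) auto
    also have "\<dots> \<le> M * (t - s)" using M(3) lt mult_right_mono[OF M(3), of "t - s"] by (simp add: mult.assoc)
    finally have 2: "- (M * (t - s)) \<le> L t \<psi> - L s \<psi>" using L_increment_ge[OF s t lt \<psi>] by linarith
    show ?thesis using 1 2 L\<psi>[OF g(1)] L\<psi>[OF g(2)] by (simp add: abs_le_iff)
  qed
  show ?thesis
  proof (rule that[OF M(1)])
    fix s t assume st: "s = 0 \<or> good s" "t = 0 \<or> good t"
    then have nn: "0 \<le> s" "0 \<le> t" by (auto simp: good_def good0_def)
    consider "s < t" | "t < s" | "s = t" by linarith
    then show "\<bar>L s \<phi> - L t \<phi>\<bar> \<le> M * \<bar>s - t\<bar>"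
    proof cases
      case 1
      then have "good t" using st nn by auto
      then show ?thesis using le[OF st(1) _ 1] 1 by (simp add: abs_minus_commute)
    next
      case 2
      then have "good s" using st nn by auto
      then show ?thesis using le[OF st(2) _ 2] 2 by simp
    qed simp
  qed
qed

lemma L_density:
  assumes \<phi>: "C1_torus T \<phi>"
  shows "\<exists>g. integrable I g \<and> (\<forall>t. t = 0 \<or> good t \<longrightarrow> tint T g t = L t \<phi>) \<and>
    (\<exists>K\<ge>0. \<forall>s\<in>{0..T}. \<forall>t\<in>{0..T}. \<bar>tint T g t - tint T g s\<bar> \<le> K * \<bar>t - s\<bar>)"
proof -
  obtain K where K: "0 \<le> K" "\<And>s t. s = 0 \<or> good s \<Longrightarrow> t = 0 \<or> good t \<Longrightarrow> \<bar>L s \<phi> - L t \<phi>\<bar> \<le> K * \<bar>s - t\<bar>"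
    using L_Lipschitz[OF \<phi>] by metis
  have "\<exists>g. integrable (lebesgue_on {0<..<T}) g \<and> (\<forall>t\<in>{t. t = 0 \<or> good t}. tint T g t = L t \<phi>) \<and>
    (\<forall>s\<in>{0..T}. \<forall>t\<in>{0..T}. \<bar>tint T g t - tint T g s\<bar> \<le> K * \<bar>t - s\<bar>)"
    by (rule Lipschitz_on_good_times_density[OF T _ K(1)])
       (use T K(2) in \<open>auto simp: good_def good0_def L_def\<close>)
  then show ?thesis using K(1) by blast
qed

end

section \<open>Matrix-valued measures from dominated functionals\<close>

definition dyadic_points :: "(real ^ 'd) set" where
  "dyadic_points = (\<Union>n. dgrid n)"

definition step_indices :: "(nat \<times> (real ^ 'd) \<times> 'd \<times> 'd) set" where
  "step_indices = {(n, q, i, l). q \<in> dgrid n}"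

definition step_code :: "nat \<times> (real ^ 'd) \<times> 'd \<times> 'd \<Rightarrow> nat" where
  "step_code z = 2 * to_nat_on step_indices z + 1"

definition step :: "nat \<times> (real ^ 'd) \<times> 'd \<times> 'd \<Rightarrow> real ^ 'd \<Rightarrow> real ^ 'd ^ 'd" where
  "step = (\<lambda>(n, q, i, l) x. if dyadic n x = q then outer (axis i 1) (axis l 1) else 0)"

text \<open>Even indices carry the given family, odd indices all matrix units on dyadic cells.\<close>

definition gen :: "(nat \<Rightarrow> real ^ 'd \<Rightarrow> real ^ 'd ^ 'd) \<Rightarrow> nat \<Rightarrow> real ^ 'd \<Rightarrow> real ^ 'd ^ 'd" where
  "gen F j = (if even j then F (j div 2) else step (from_nat_into step_indices (j div 2)))"

definition comb :: "(nat \<Rightarrow> real ^ 'd \<Rightarrow> real ^ 'd ^ 'd) \<Rightarrow> (nat \<Rightarrow> real) \<Rightarrow> real ^ 'd \<Rightarrow> real ^ 'd ^ 'd" where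
  "comb F c x = (\<Sum>j | c j \<noteq> 0. c j *\<^sub>R gen F j x)"

text \<open>The supremum runs over countably many points and so stays measurable in time. These
  points are dense and meet every dyadic cell, so continuous fields lose nothing and every step is
  seen.\<close>

definition neg_gauge :: "(nat \<Rightarrow> real ^ 'd \<Rightarrow> real ^ 'd ^ 'd) \<Rightarrow> (nat \<Rightarrow> real) \<Rightarrow> real" where
  "neg_gauge F c = (SUP x\<in>dyadic_points. eneg (comb F c x))"

text \<open>Translates a combination written with fields \<open>F k\<close> and steps
  \<open>z\<close> into a coefficient sequence over the merged index set.\<close>

definition coefficients ::
    "nat set \<Rightarrow> (nat \<times> (real ^ 'd) \<times> 'd \<times> 'd) set \<Rightarrow> (nat \<Rightarrow> real) \<Rightarrow> (nat \<times> (real ^ 'd) \<times> 'd \<times> 'd \<Rightarrow> real) \<Rightarrow> nat \<Rightarrow> real" where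
  "coefficients K Z u v j = (if even j then (if j div 2 \<in> K then u (j div 2) else 0)
     else (if j \<in> step_code ` Z then v (from_nat_into step_indices (j div 2)) else 0))"

lemma dyadic_points_cell: "x \<in> dyadic_points \<Longrightarrow> x \<in> cell"
  using dgrid_cell by (auto simp: dyadic_points_def)

lemma countable_dyadic_points: "countable dyadic_points"
  unfolding dyadic_points_def by (auto intro: countable_finite finite_dgrid)

lemma zero_in_dyadic_points: "0 \<in> dyadic_points"
proof -
  have "dyadic 0 (0 :: real ^ 'd) = 0" by (simp add: dyadic_def vec_eq_iff)
  moreover have "(0 :: real ^ 'd) \<in> cell" by (simp add: cell_def)
  ultimately have "(0 :: real ^ 'd) \<in> dgrid 0" by (metis dyadic_in_dgrid)
  then show ?thesis by (auto simp: dyadic_points_def)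
qed

lemma countable_step_indices: "countable step_indices"
proof (rule countable_subset)
  show "step_indices \<subseteq> UNIV \<times> dyadic_points \<times> UNIV \<times> UNIV" by (auto simp: step_indices_def dyadic_points_def)
  show "countable ((UNIV :: nat set) \<times> (dyadic_points :: (real ^ 'd) set) \<times> (UNIV :: 'd set) \<times> (UNIV :: 'd set))"
    by (intro countable_SIGMA countable_dyadic_points) (auto intro: countable_finite)
qed

lemma from_nat_into_step_code: "z \<in> step_indices \<Longrightarrow> from_nat_into step_indices (step_code z div 2) = z"
  using from_nat_into_to_nat_on[OF countable_step_indices] by (simp add: step_code_def)

lemma inj_on_step_code: "Z \<subseteq> step_indices \<Longrightarrow> inj_on step_code Z"
  by (rule inj_on_inverseI[of _ "\<lambda>j. from_nat_into step_indices (j div 2)"]) (auto intro: from_nat_into_step_code)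

lemma gen_even: "gen F (2 * k) = F k"
  by (simp add: gen_def)

lemma gen_step_code: "z \<in> step_indices \<Longrightarrow> gen F (step_code z) = step z"
  using from_nat_into_step_code[of z] by (simp add: gen_def step_code_def)

context
  fixes K :: "nat set" and Z :: "(nat \<times> (real ^ 'd) \<times> 'd \<times> 'd) set"
    and u :: "nat \<Rightarrow> real" and v :: "nat \<times> (real ^ 'd) \<times> 'd \<times> 'd \<Rightarrow> real"
  assumes fin: "finite K" "finite Z" and Z: "Z \<subseteq> step_indices"
begin

lemma coefficients_support: "{j. coefficients K Z u v j \<noteq> 0} \<subseteq> (\<lambda>k. 2 * k) ` K \<union> step_code ` Z"
  by (auto simp: coefficients_def elim!: evenE split: if_splits)

lemma coefficients_finsupp: "coefficients K Z u v \<in> finsupp UNIV"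
  using finite_subset[OF coefficients_support] fin by (auto simp: finsupp_def)

lemma sum_coefficients:
  fixes H :: "nat \<Rightarrow> 'v::real_vector"
  shows "(\<Sum>j | coefficients K Z u v j \<noteq> 0. coefficients K Z u v j *\<^sub>R H j)
    = (\<Sum>k\<in>K. u k *\<^sub>R H (2 * k)) + (\<Sum>z\<in>Z. v z *\<^sub>R H (step_code z))"
proof -
  let ?c = "coefficients K Z u v"
  have "(\<Sum>j | ?c j \<noteq> 0. ?c j *\<^sub>R H j) = (\<Sum>j\<in>(\<lambda>k. 2 * k) ` K \<union> step_code ` Z. ?c j *\<^sub>R H j)"
    using fin coefficients_support by (intro sum.mono_neutral_left) auto
  also have "\<dots> = (\<Sum>j\<in>(\<lambda>k. 2 * k) ` K. ?c j *\<^sub>R H j) + (\<Sum>j\<in>step_code ` Z. ?c j *\<^sub>R H j)"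
  proof (rule sum.union_disjoint)
    show "(\<lambda>k. 2 * k) ` K \<inter> step_code ` Z = {}"
    proof -
      have "2 * k \<noteq> step_code z" for k and z :: "nat \<times> (real ^ 'd) \<times> 'd \<times> 'd"
        unfolding step_code_def by presburger
      then show ?thesis by auto
    qed
  qed (use fin in auto)
  also have "(\<Sum>j\<in>(\<lambda>k. 2 * k) ` K. ?c j *\<^sub>R H j) = (\<Sum>k\<in>K. u k *\<^sub>R H (2 * k))"
    by (subst sum.reindex) (auto simp: inj_on_def coefficients_def intro!: sum.cong)
  also have "(\<Sum>j\<in>step_code ` Z. ?c j *\<^sub>R H j) = (\<Sum>z\<in>Z. ?c (step_code z) *\<^sub>R H (step_code z))"
    by (subst sum.reindex[OF inj_on_step_code[OF Z]]) simp
  also have "\<dots> = (\<Sum>z\<in>Z. v z *\<^sub>R H (step_code z))"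
  proof (rule sum.cong[OF refl])
    fix z assume z: "z \<in> Z"
    have "odd (step_code z)" by (simp add: step_code_def)
    then have "?c (step_code z) = v (from_nat_into step_indices (step_code z div 2))"
      using z by (simp add: coefficients_def)
    then show "?c (step_code z) *\<^sub>R H (step_code z) = v z *\<^sub>R H (step_code z)"
      using from_nat_into_step_code[of z] z Z by auto
  qed
  finally show ?thesis .
qed

lemma comb_coefficients: "comb F (coefficients K Z u v) x = (\<Sum>k\<in>K. u k *\<^sub>R F k x) + (\<Sum>z\<in>Z. v z *\<^sub>R step z x)"
proof -
  have "(\<Sum>z\<in>Z. v z *\<^sub>R gen F (step_code z) x) = (\<Sum>z\<in>Z. v z *\<^sub>R step z x)"
    using Z by (intro sum.cong) (auto simp: gen_step_code)
  then show ?thesis unfolding comb_def sum_coefficients[of "\<lambda>j. gen F j x"] gen_even by simp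
qed

lemma pairing_coefficients:
  "pairing (coefficients K Z u v) \<beta> = (\<Sum>k\<in>K. u k * \<beta> (2 * k)) + (\<Sum>z\<in>Z. v z * \<beta> (step_code z))"
  unfolding pairing_def using sum_coefficients[of \<beta>] by simp

end

lemma comb_superset:
  assumes "finite S" "{k. c k \<noteq> 0} \<subseteq> S"
  shows "comb F c x = (\<Sum>j\<in>S. c j *\<^sub>R gen F j x)"
  unfolding comb_def using assms by (intro sum.mono_neutral_left) auto

lemma comb_add:
  assumes "c \<in> finsupp A" "d \<in> finsupp A"
  shows "comb F (\<lambda>k. c k + d k) x = comb F c x + comb F d x"
proof -
  define S where "S = {k. c k \<noteq> 0} \<union> {k. d k \<noteq> 0}"
  have S: "finite S" "{k. c k \<noteq> 0} \<subseteq> S" "{k. d k \<noteq> 0} \<subseteq> S" "{k. c k + d k \<noteq> 0} \<subseteq> S"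
    using assms by (auto simp: finsupp_def S_def)
  show ?thesis
    unfolding comb_superset[OF S(1,2)] comb_superset[OF S(1,3)] comb_superset[OF S(1,4)]
    by (simp add: scaleR_add_left sum.distrib)
qed

lemma comb_scale:
  assumes "c \<in> finsupp A"
  shows "comb F (\<lambda>k. r * c k) x = r *\<^sub>R comb F c x"
proof -
  have S: "finite {k. c k \<noteq> 0}" "{k. c k \<noteq> 0} \<subseteq> {k. c k \<noteq> 0}" "{k. r * c k \<noteq> 0} \<subseteq> {k. c k \<noteq> 0}"
    using assms by (auto simp: finsupp_def)
  show ?thesis
    unfolding comb_superset[OF S(1,2)] comb_superset[OF S(1,3)] by (simp add: scaleR_right.sum)
qed

lemma norm_step_le: "norm (step z x) \<le> (\<Sum>i\<in>UNIV. \<Sum>l\<in>UNIV. norm (outer (axis i 1) (axis l 1) :: real ^ 'd ^ 'd))"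
  for z :: "nat \<times> (real ^ 'd) \<times> 'd \<times> 'd"
proof -
  obtain n q i l where z: "z = (n, q, i, l)" by (cases z)
  have "norm (step z x) \<le> norm (outer (axis i 1) (axis l 1) :: real ^ 'd ^ 'd)"
    by (simp add: z step_def)
  also have "\<dots> \<le> (\<Sum>l\<in>UNIV. norm (outer (axis i 1) (axis l 1) :: real ^ 'd ^ 'd))"
    by (rule member_le_sum) auto
  also have "\<dots> \<le> (\<Sum>i\<in>UNIV. \<Sum>l\<in>UNIV. norm (outer (axis i 1) (axis l 1) :: real ^ 'd ^ 'd))"
    by (rule member_le_sum[where f = "\<lambda>i. \<Sum>l\<in>UNIV. norm (outer (axis i 1) (axis l 1) :: real ^ 'd ^ 'd)"]) (auto intro: sum_nonneg)
  finally show ?thesis .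
qed

context
  fixes F :: "nat \<Rightarrow> real ^ 'd \<Rightarrow> real ^ 'd ^ 'd"
  assumes F_bdd: "\<exists>b. \<forall>x\<in>cell. norm (F k x) \<le> b"
begin

lemma bdd_above_eneg_comb: "bdd_above ((\<lambda>x. eneg (comb F c x)) ` dyadic_points)"
proof -
  have "\<exists>b. \<forall>x\<in>cell. norm (gen F j x) \<le> b" for j
  proof (cases "even j")
    case False
    then show ?thesis unfolding gen_def using norm_step_le[of "from_nat_into step_indices (j div 2)"] by auto
  qed (use F_bdd in \<open>simp add: gen_def\<close>)
  then obtain b where b: "\<And>j x. x \<in> cell \<Longrightarrow> norm (gen F j x) \<le> b j" by metis
  show ?thesis
  proof (rule bdd_aboveI2)
    fix x :: "real ^ 'd" assume "x \<in> dyadic_points"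
    then have x: "x \<in> cell" by (rule dyadic_points_cell)
    have "eneg (comb F c x) \<le> norm (comb F c x)" by (rule eneg_le_norm)
    also have "\<dots> \<le> (\<Sum>j | c j \<noteq> 0. norm (c j *\<^sub>R gen F j x))" unfolding comb_def by (rule norm_sum)
    also have "\<dots> \<le> (\<Sum>j | c j \<noteq> 0. \<bar>c j\<bar> * b j)" by (intro sum_mono) (simp add: b[OF x] mult_left_mono)
    finally show "eneg (comb F c x) \<le> (\<Sum>j | c j \<noteq> 0. \<bar>c j\<bar> * b j)" .
  qed
qed

lemma eneg_le_neg_gauge: "x \<in> dyadic_points \<Longrightarrow> eneg (comb F c x) \<le> neg_gauge F c"
  unfolding neg_gauge_def by (rule cSUP_upper[OF _ bdd_above_eneg_comb])

lemma neg_gauge_nonneg: "0 \<le> neg_gauge F c"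
  using eneg_le_neg_gauge[OF zero_in_dyadic_points] eneg_nonneg order_trans by blast

lemma neg_gauge_add:
  assumes "c \<in> finsupp A" "d \<in> finsupp A"
  shows "neg_gauge F (\<lambda>k. c k + d k) \<le> neg_gauge F c + neg_gauge F d"
  unfolding neg_gauge_def[of F "\<lambda>k. c k + d k"]
proof (rule cSUP_least)
  fix x :: "real ^ 'd" assume x: "x \<in> dyadic_points"
  show "eneg (comb F (\<lambda>k. c k + d k) x) \<le> neg_gauge F c + neg_gauge F d"
    unfolding comb_add[OF assms] by (rule order_trans[OF eneg_add_le add_mono]) (rule eneg_le_neg_gauge[OF x])+
qed (use zero_in_dyadic_points in blast)

lemma neg_gauge_scale:
  assumes "c \<in> finsupp A" "0 \<le> r"
  shows "neg_gauge F (\<lambda>k. r * c k) = r * neg_gauge F c"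
proof -
  have le: "neg_gauge F (\<lambda>k. r * c k) \<le> r * neg_gauge F c" if "c \<in> finsupp A" "0 \<le> r" for c r
    unfolding neg_gauge_def[of F "\<lambda>k. r * c k"]
  proof (rule cSUP_least)
    fix x :: "real ^ 'd" assume x: "x \<in> dyadic_points"
    show "eneg (comb F (\<lambda>k. r * c k) x) \<le> r * neg_gauge F c"
      unfolding comb_scale[OF that(1)] eneg_scaleR[OF that(2)] by (rule mult_left_mono[OF eneg_le_neg_gauge[OF x] that(2)])
  qed (use zero_in_dyadic_points in blast)
  show ?thesis
  proof (cases "r = 0")
    case True
    then show ?thesis using le[OF assms] neg_gauge_nonneg[of "\<lambda>k. r * c k"] by simp
  next
    case False
    have c: "(\<lambda>k. r * c k) \<in> finsupp A" using assms(1) False by (simp add: finsupp_def)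
    have "(\<lambda>k. 1 / r * (r * c k)) = c" using False by auto
    then have "neg_gauge F c \<le> 1 / r * neg_gauge F (\<lambda>k. r * c k)" using le[OF c, of "1 / r"] assms(2) by simp
    then have "r * neg_gauge F c \<le> neg_gauge F (\<lambda>k. r * c k)" using False assms(2) by (simp add: field_simps)
    then show ?thesis using le[OF assms] by simp
  qed
qed

end

lemma neg_gauge_le: "(\<And>x. x \<in> cell \<Longrightarrow> eneg (comb F c x) \<le> r) \<Longrightarrow> neg_gauge F c \<le> r"
  unfolding neg_gauge_def using zero_in_dyadic_points dyadic_points_cell by (intro cSUP_least) auto

lemma matrix_eq_sum_outer: "(\<Sum>p\<in>UNIV. A $ fst p $ snd p *\<^sub>R outer (axis (fst p) 1) (axis (snd p) 1)) = (A :: real ^ 'd ^ 'd)"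
proof -
  have "(\<Sum>p\<in>UNIV. A $ fst p $ snd p *\<^sub>R outer (axis (fst p) 1) (axis (snd p) 1))
    = (\<Sum>i\<in>UNIV. \<Sum>l\<in>UNIV. A $ i $ l *\<^sub>R outer (axis i 1) (axis l 1))"
    by (simp add: sum.cartesian_product UNIV_Times_UNIV case_prod_unfold)
  also have "\<dots> = A"
    by (simp add: vec_eq_iff sum_component outer_def axis_def if_distrib[of "\<lambda>x. _ * x"] cong: if_cong)
  finally show ?thesis .
qed

lemma eneg_nonpos: "(\<And>v. 0 \<le> v \<bullet> (A *v v)) \<Longrightarrow> eneg A \<le> 0"
  by (subst eneg_le_iff) auto

text \<open>The situation at one fixed time: \<open>\<beta>\<close> holds the values of the extended
  functional on all generators, and \<open>w\<close> will bound the trace.\<close>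

locale dominated_generators =
  fixes F :: "nat \<Rightarrow> real ^ 'd \<Rightarrow> real ^ 'd ^ 'd" and \<beta> :: "nat \<Rightarrow> real" and w :: real
  assumes w: "0 \<le> w"
    and F_cont: "\<And>k. continuous_on UNIV (F k)"
    and F_periodic: "\<And>k x z. (\<And>i. z $ i \<in> \<int>) \<Longrightarrow> F k (x + z) = F k x"
    and dom: "\<And>c. c \<in> finsupp UNIV \<Longrightarrow> pairing c \<beta> \<le> w * neg_gauge F c"
begin

text \<open>The minus sign is due to the dominated functional being the negative of the density;
  \<open>B n q\<close> collects what \<open>- \<beta>\<close> assigns to the matrix units on the
  cell of \<open>q\<close>.\<close>

definition B :: "nat \<Rightarrow> real ^ 'd \<Rightarrow> real ^ 'd ^ 'd" where
  "B n q = (\<chi> i l. - \<beta> (step_code (n, q, i, l)))"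

lemma step_function_le:
  fixes A :: "nat \<times> (real ^ 'd) \<Rightarrow> real ^ 'd ^ 'd"
  assumes fin: "finite K" "finite D" and D: "\<And>n q. (n, q) \<in> D \<Longrightarrow> q \<in> dgrid n"
    and le: "\<And>x. x \<in> cell \<Longrightarrow> eneg ((\<Sum>k\<in>K. u k *\<^sub>R F k x) + (\<Sum>e\<in>D. if dyadic (fst e) x = snd e then A e else 0)) \<le> r"
  shows "(\<Sum>k\<in>K. u k * \<beta> (2 * k)) - (\<Sum>e\<in>D. A e \<bullet> B (fst e) (snd e)) \<le> w * r"
proof -
  define j where "j = (\<lambda>(e :: nat \<times> (real ^ 'd), p :: 'd \<times> 'd). (fst e, snd e, fst p, snd p))"
  define Z where "Z = j ` (D \<times> UNIV)"
  define v where "v = (\<lambda>(n, q, i, l). A (n, q) $ i $ l)"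
  have inj: "inj_on j (D \<times> UNIV)" by (auto simp: inj_on_def j_def prod_eq_iff)
  have Z: "finite Z" "Z \<subseteq> step_indices" using fin D by (auto simp: Z_def j_def step_indices_def)
  note c = coefficients_finsupp[OF fin(1) Z] comb_coefficients[OF fin(1) Z] pairing_coefficients[OF fin(1) Z]
  have sumZ: "(\<Sum>z\<in>Z. f z) = (\<Sum>e\<in>D. \<Sum>p\<in>UNIV. f (fst e, snd e, fst p, snd p))" for f :: "_ \<Rightarrow> 'z::comm_monoid_add"
    unfolding Z_def sum.reindex[OF inj] sum.cartesian_product by (intro sum.cong) (auto simp: j_def)
  have step: "(\<Sum>z\<in>Z. v z *\<^sub>R step z x) = (\<Sum>e\<in>D. if dyadic (fst e) x = snd e then A e else 0)" for x
    unfolding sumZ by (intro sum.cong refl) (simp add: v_def step_def case_prod_unfold matrix_eq_sum_outer)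
  have "(\<Sum>z\<in>Z. v z * \<beta> (step_code z)) = (\<Sum>e\<in>D. \<Sum>p\<in>UNIV. - (A e $ fst p $ snd p * B (fst e) (snd e) $ fst p $ snd p))"
    unfolding sumZ by (intro sum.cong refl) (simp add: v_def B_def case_prod_unfold)
  also have "\<dots> = (\<Sum>e\<in>D. - (A e \<bullet> B (fst e) (snd e)))"
  proof (rule sum.cong[OF refl])
    fix e
    have "(\<Sum>i\<in>UNIV. \<Sum>l\<in>UNIV. A e $ i $ l * B (fst e) (snd e) $ i $ l)
      = (\<Sum>p\<in>UNIV. A e $ fst p $ snd p * B (fst e) (snd e) $ fst p $ snd p)"
      by (simp add: sum.cartesian_product UNIV_Times_UNIV case_prod_unfold)
    then show "(\<Sum>p\<in>UNIV. - (A e $ fst p $ snd p * B (fst e) (snd e) $ fst p $ snd p)) = - (A e \<bullet> B (fst e) (snd e))"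
      by (simp add: inner_vec_def sum_negf)
  qed
  finally have "(\<Sum>k\<in>K. u k * \<beta> (2 * k)) - (\<Sum>e\<in>D. A e \<bullet> B (fst e) (snd e)) = pairing (coefficients K Z u v) \<beta>"
    unfolding c(3) by (simp add: sum_negf)
  also have "\<dots> \<le> w * neg_gauge F (coefficients K Z u v)" by (rule dom[OF c(1)])
  also have "\<dots> \<le> w * r"
    by (rule mult_left_mono[OF neg_gauge_le w]) (use le in \<open>simp add: c(2) step\<close>)
  finally show ?thesis .
qed

lemma single_step_le:
  assumes q: "q \<in> dgrid n" and A: "\<And>v. 0 \<le> v \<bullet> (A *v v)"
  shows "0 \<le> A \<bullet> B n q"
proof -
  have "(\<Sum>k\<in>{}. 0 * \<beta> (2 * k)) - (\<Sum>e\<in>{(n, q)}. A \<bullet> B (fst e) (snd e)) \<le> w * 0"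
    by (rule step_function_le) (use q eneg_nonpos[OF A] in auto)
  then show ?thesis by simp
qed

lemma B_symmetric:
  assumes q: "q \<in> dgrid n"
  shows "transpose (B n q) = B n q"
proof -
  have le: "B n q $ l $ i \<le> B n q $ i $ l" for i l
  proof -
    have c: "outer (axis i 1) (axis l 1) \<bullet> B n q = B n q $ i $ l" for i l
      by (simp add: outer_inner inner_axis' matrix_vector_mult_basis column_def)
    \<comment> \<open>The antisymmetric combination of matrix units has zero quadratic form, so it
      is an admissible test; exchanging \<open>i\<close> and \<open>l\<close> gives the opposite
      inequality.\<close>
    have "0 \<le> (outer (axis i 1) (axis l 1) - outer (axis l 1) (axis i 1)) \<bullet> B n q"
    proof (rule single_step_le[OF q])
      fix v :: "real ^ 'd"
      have o: "v \<bullet> (outer (axis i 1) (axis l 1) *v v) = v $ i * v $ l" for i l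
        unfolding inner_outer[symmetric] outer_inner[symmetric]
        by (simp add: inner_commute[of "outer v v"] outer_inner inner_axis')
           (simp add: outer_def matrix_vector_mult_basis column_def)
      show "0 \<le> v \<bullet> ((outer (axis i 1) (axis l 1) - outer (axis l 1) (axis i 1)) *v v)"
        by (simp add: matrix_vector_mult_diff_rdistrib inner_diff_right o)
    qed
    then show ?thesis by (simp add: inner_diff_left c)
  qed
  then show ?thesis by (simp add: transpose_def vec_eq_iff order_antisym)
qed

lemma B_psd:
  assumes q: "q \<in> dgrid n"
  shows "0 \<le> outer \<xi> \<xi> \<bullet> B n q"
proof (rule single_step_le[OF q])
  fix v
  have "v \<bullet> (outer \<xi> \<xi> *v v) = (v \<bullet> \<xi>)\<^sup>2"
    unfolding outer_inner[symmetric]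
    by (simp add: outer_def inner_vec_def sum_product power2_eq_square mult_ac)
  then show "0 \<le> v \<bullet> (outer \<xi> \<xi> *v v)" by simp
qed

text \<open>The step with value \<open>M\<close> on a cell minus the steps on its children vanishes
  at every point of the unit cell. Its gauge is zero, and the same holds for
  \<open>- M\<close>.\<close>

lemma B_additive:
  assumes q: "q \<in> dgrid n"
  shows "B n q = (\<Sum>q' | q' \<in> dgrid (Suc n) \<and> dyadic n q' = q. B (Suc n) q')"
proof -
  define S where "S = {q'. q' \<in> dgrid (Suc n) \<and> dyadic n q' = q}"
  have S: "finite S" "S \<subseteq> dgrid (Suc n)" using finite_dgrid[of "Suc n"] by (auto simp: S_def)
  have le: "M \<bullet> (\<Sum>q'\<in>S. B (Suc n) q') \<le> M \<bullet> B n q" for M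
  proof -
    define D where "D = insert (n, q) (Pair (Suc n) ` S)"
    define A where "A = (\<lambda>e :: nat \<times> (real ^ 'd). if fst e = n then M else - M)"
    have sumD: "(\<Sum>e\<in>D. f e) = f (n, q) + (\<Sum>q'\<in>S. f (Suc n, q'))" for f :: "_ \<Rightarrow> 'z::comm_monoid_add"
    proof -
      have "(n, q) \<notin> Pair (Suc n) ` S" by auto
      moreover have "(\<Sum>e\<in>Pair (Suc n) ` S. f e) = (\<Sum>q'\<in>S. f (Suc n, q'))"
        by (subst sum.reindex) (auto simp: inj_on_def)
      ultimately show ?thesis unfolding D_def using S(1) by simp
    qed
    have "(\<Sum>k\<in>{}. 0 * \<beta> (2 * k)) - (\<Sum>e\<in>D. A e \<bullet> B (fst e) (snd e)) \<le> w * 0"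
    proof (rule step_function_le)
      show "finite D" using S by (simp add: D_def)
      show "q' \<in> dgrid k" if "(k, q') \<in> D" for k q' using that q S by (auto simp: D_def)
      fix x :: "real ^ 'd" assume x: "x \<in> cell"
      have "(\<Sum>q'\<in>S. if dyadic (Suc n) x = q' then - M else 0) = (if dyadic (Suc n) x \<in> S then - M else 0)"
        using S by (simp add: sum.delta)
      moreover have "dyadic (Suc n) x \<in> S \<longleftrightarrow> dyadic n x = q"
        using x by (simp add: S_def dyadic_in_dgrid dyadic_dyadic)
      ultimately show "eneg ((\<Sum>k\<in>{}. 0 *\<^sub>R F k x) + (\<Sum>e\<in>D. if dyadic (fst e) x = snd e then A e else 0)) \<le> 0"
        by (simp add: sumD A_def cong: if_cong)
    qed simp
    then show ?thesis by (simp add: sumD A_def inner_sum_right sum_negf)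
  qed
  have "M \<bullet> (B n q - (\<Sum>q'\<in>S. B (Suc n) q')) = 0" for M
    using le[of M] le[of "- M"] by (simp add: inner_diff_right)
  \<comment> \<open>Taking for \<open>M\<close> the difference itself makes its squared norm
    vanish.\<close>
  from this[of "B n q - (\<Sum>q'\<in>S. B (Suc n) q')"] show ?thesis by (simp add: S_def)
qed

sublocale psd_content B
  by unfold_locales (fact B_symmetric B_psd B_additive)+

lemma psd_content_B: "psd_content B" by (rule psd_content_axioms)

lemma sum_single_level:
  fixes A :: "nat \<times> (real ^ 'd) \<Rightarrow> 'z::comm_monoid_add"
  assumes "x \<in> cell"
  shows "(\<Sum>e\<in>Pair n ` dgrid n. if dyadic (fst e) x = snd e then A e else 0) = A (n, dyadic n x)"
proof -
  have "(\<Sum>e\<in>Pair n ` dgrid n. if dyadic (fst e) x = snd e then A e else 0)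
    = (\<Sum>q\<in>dgrid n. if dyadic n x = q then A (n, q) else 0)"
    by (subst sum.reindex) (auto simp: inj_on_def)
  also have "\<dots> = A (n, dyadic n x)" by (simp add: sum.delta finite_dgrid dyadic_in_dgrid[OF assms])
  finally show ?thesis .
qed

text \<open>The test is minus the identity on all cells of level zero, whose negative part has norm
  at most one.\<close>

lemma trace_R_le: "trace (R cell) \<le> w"
proof -
  have "(\<Sum>k\<in>{}. 0 * \<beta> (2 * k)) - (\<Sum>e\<in>Pair 0 ` dgrid 0. (- mat 1) \<bullet> B (fst e) (snd e)) \<le> w * 1"
  proof (rule step_function_le)
    fix x :: "real ^ 'd" assume x: "x \<in> cell"
    have "(- mat 1 :: real ^ 'd ^ 'd) *v v = - v" for v
      by (simp add: vec_eq_iff matrix_vector_mult_def mat_def sum_negf if_distrib[of "\<lambda>x. x * _"] cong: if_cong)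
    then have "eneg (- mat 1 :: real ^ 'd ^ 'd) \<le> 1" by (subst eneg_le_iff) simp_all
    then show "eneg ((\<Sum>k\<in>{}. 0 *\<^sub>R F k x) + (\<Sum>e\<in>Pair 0 ` dgrid 0. if dyadic (fst e) x = snd e then - mat 1 else 0)) \<le> 1"
      unfolding sum_single_level[OF x] by simp
  qed (auto simp: finite_dgrid)
  also have "(\<Sum>e\<in>Pair 0 ` dgrid 0. (- mat 1) \<bullet> B (fst e) (snd e)) = - (\<Sum>q\<in>dgrid 0. trace (B 0 q))"
  proof -
    have "mat 1 \<bullet> A = trace A" for A :: "real ^ 'd ^ 'd"
      by (simp add: mat_def inner_vec_def trace_def if_distrib[of "\<lambda>x. x * _"] cong: if_cong)
    then show ?thesis by (subst sum.reindex) (auto simp: inj_on_def sum_negf)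
  qed
  finally show ?thesis unfolding trace_R[of 0] by simp
qed

text \<open>On fine levels \<open>F k\<close> differs from its dyadic step function by at most
  \<open>r\<close>, so the functional separates the two by at most \<open>w * r\<close>. The Riemann
  sums thus tend to \<open>- \<beta> (2 * k)\<close>, and by \<open>matrix_integral_R_limit\<close>
  also to the integral.\<close>

lemma matrix_integral_R_F: "matrix_integral R (F k) = - \<beta> (2 * k)"
proof -
  have lim: "(\<lambda>n. \<Sum>q\<in>dgrid n. F k q \<bullet> B n q) \<longlonglongrightarrow> - \<beta> (2 * k)"
  proof (rule LIMSEQ_I)
    fix e :: real assume e: "0 < e"
    \<comment> \<open>Chosen so that \<open>w * r < e\<close>; the summand \<open>1\<close> keeps
      the denominator positive when \<open>w = 0\<close>.\<close>
    define r where "r = e / (2 * (w + 1))"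
    have r: "0 < r" using e w by (auto simp: r_def intro!: divide_pos_pos)
    have "0 < w * r + 2 * r" by (rule add_nonneg_pos[OF mult_nonneg_nonneg[OF w less_imp_le[OF r]]]) (use r in simp)
    then have "w * r < w * r + (w * r + 2 * r)" by (simp only: less_add_same_cancel1)
    also have "\<dots> = (w + 1) * (2 * r)" by (simp add: algebra_simps)
    also have "\<dots> = e"
    proof -
      have "w + 1 \<noteq> 0" "2 * w + 2 \<noteq> 0" using w by auto
      then show ?thesis unfolding r_def by (simp add: field_simps)
    qed
    finally have wr: "w * r < e" .
    have "uniformly_continuous_on (cbox 0 1) (F k)"
      by (intro compact_uniformly_continuous continuous_on_subset[OF F_cont]) auto
    then obtain d where d: "0 < d" "\<And>x y. x \<in> cbox 0 1 \<Longrightarrow> y \<in> cbox 0 1 \<Longrightarrow> dist x y < d \<Longrightarrow> dist (F k x) (F k y) < r"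
      using r unfolding uniformly_continuous_on_def by metis
    \<comment> \<open>Fine enough for the modulus \<open>d\<close>: the distance of a point to its
      corner is at most the sum of \<open>CARD('d)\<close> coordinate errors, each at most
      \<open>1 / 2 ^ n\<close>.\<close>
    obtain N where N: "real CARD('d) / d < 2 ^ N" using real_arch_pow[of 2 "real CARD('d) / d"] by auto
    show "\<exists>no. \<forall>n\<ge>no. norm ((\<Sum>q\<in>dgrid n. F k q \<bullet> B n q) - - \<beta> (2 * k)) < e"
    proof (intro exI[of _ N] allI impI)
      fix n assume n: "N \<le> n"
      have close: "norm (F k x - F k (dyadic n x)) \<le> r" if x: "x \<in> cell" for x
      proof -
        have "norm (x - dyadic n x) \<le> (\<Sum>i\<in>UNIV. \<bar>(x - dyadic n x) $ i\<bar>)" by (rule norm_le_l1_cart)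
        also have "\<dots> \<le> (\<Sum>i\<in>(UNIV :: 'd set). 1 / 2 ^ n)"
        proof (rule sum_mono)
          fix i show "\<bar>(x - dyadic n x) $ i\<bar> \<le> 1 / 2 ^ n"
            using dyadic_le[of n x i] dyadic_ge[of x i n] by simp
        qed
        also have "\<dots> = real CARD('d) / 2 ^ n" by simp
        also have "\<dots> \<le> real CARD('d) / 2 ^ N" using n by (intro divide_left_mono) auto
        also have "\<dots> < d" using N d(1) by (simp add: field_simps)
        finally have "dist x (dyadic n x) < d" by (simp add: dist_norm)
        then have "dist (F k x) (F k (dyadic n x)) < r"
          using x dyadic_cell[OF x, of n] cell_subset_cbox by (intro d(2)) auto
        then show ?thesis by (simp add: dist_norm)
      qed
      have main: "u * \<beta> (2 * k) + u * (\<Sum>q\<in>dgrid n. F k q \<bullet> B n q) \<le> w * r" if u: "\<bar>u\<bar> = 1" for u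
      proof -
        have "(\<Sum>k\<in>{k}. u * \<beta> (2 * k)) - (\<Sum>e\<in>Pair n ` dgrid n. (- u *\<^sub>R F k (snd e)) \<bullet> B (fst e) (snd e)) \<le> w * r"
        proof (rule step_function_le)
          fix x :: "real ^ 'd" assume x: "x \<in> cell"
          have "eneg (u *\<^sub>R F k x - u *\<^sub>R F k (dyadic n x)) \<le> norm (u *\<^sub>R F k x - u *\<^sub>R F k (dyadic n x))" by (rule eneg_le_norm)
          also have "\<dots> = norm (F k x - F k (dyadic n x))" using u by (simp add: scaleR_diff_right[symmetric])
          also have "\<dots> \<le> r" by (rule close[OF x])
          finally show "eneg ((\<Sum>k\<in>{k}. u *\<^sub>R F k x) + (\<Sum>e\<in>Pair n ` dgrid n. if dyadic (fst e) x = snd e then - u *\<^sub>R F k (snd e) else 0)) \<le> r"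
            unfolding sum_single_level[OF x, where A = "\<lambda>e. - u *\<^sub>R F k (snd e)"] by simp
        qed (auto simp: finite_dgrid)
        moreover have "(\<Sum>e\<in>Pair n ` dgrid n. (- u *\<^sub>R F k (snd e)) \<bullet> B (fst e) (snd e)) = - u * (\<Sum>q\<in>dgrid n. F k q \<bullet> B n q)"
          by (subst sum.reindex) (auto simp: inj_on_def sum_distrib_left sum_negf)
        ultimately show ?thesis by simp
      qed
      show "norm ((\<Sum>q\<in>dgrid n. F k q \<bullet> B n q) - - \<beta> (2 * k)) < e"
        using main[of 1] main[of "- 1"] wr by (simp add: abs_less_iff)
    qed
  qed
  show ?thesis
    using LIMSEQ_unique[OF matrix_integral_R_limit[OF F_cont F_periodic] lim] by simp
qed

end

section \<open>Energy-variational solutions are dissipative\<close>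

context psd_matrix_measure
begin

text \<open>Clear for dyadic step functions, where the integral is a finite sum; the limit carries
  it over to continuous fields.\<close>

lemma matrix_integral_diff:
  assumes F: "continuous_on UNIV F" and G: "continuous_on UNIV G"
  shows "matrix_integral \<mu> (\<lambda>x. F x - G x) = matrix_integral \<mu> F - matrix_integral \<mu> G"
proof (rule LIMSEQ_unique)
  show "(\<lambda>n. matrix_integral \<mu> (\<lambda>x. F (dyadic n x) - G (dyadic n x))) \<longlonglongrightarrow> matrix_integral \<mu> (\<lambda>x. F x - G x)"
    using F G by (intro matrix_integral_dyadic_tendsto[of "\<lambda>x. F x - G x"] continuous_intros)
  have "matrix_integral \<mu> (\<lambda>x. F (dyadic n x) - G (dyadic n x))
      = matrix_integral \<mu> (\<lambda>x. F (dyadic n x)) - matrix_integral \<mu> (\<lambda>x. G (dyadic n x))" for n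
    unfolding matrix_integral_dyadic[of F] matrix_integral_dyadic[of G] matrix_integral_dyadic[of "\<lambda>x. F x - G x"]
    by (simp add: inner_diff_left sum_subtractf)
  then show "(\<lambda>n. matrix_integral \<mu> (\<lambda>x. F (dyadic n x) - G (dyadic n x))) \<longlonglongrightarrow> matrix_integral \<mu> F - matrix_integral \<mu> G"
    using tendsto_diff[OF matrix_integral_dyadic_tendsto[OF F] matrix_integral_dyadic_tendsto[OF G]] by simp
qed

lemma matrix_integral_0: "matrix_integral \<mu> (\<lambda>x. 0) = 0"
  using matrix_integral_diff[of "\<lambda>x. 0" "\<lambda>x. 0", OF continuous_on_const continuous_on_const] by simp

lemma matrix_integral_abs_le:
  assumes F: "continuous_on UNIV F" and r: "\<And>x. x \<in> cell \<Longrightarrow> eneg (F x) \<le> r" "\<And>x. x \<in> cell \<Longrightarrow> eneg (- F x) \<le> r"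
  shows "\<bar>matrix_integral \<mu> F\<bar> \<le> r * trace (\<mu> cell)"
proof -
  have "- r * trace (\<mu> cell) \<le> matrix_integral \<mu> (\<lambda>x. 0 - F x)"
    by (rule matrix_integral_lower) (use F r(2) in \<open>auto intro!: continuous_intros\<close>)
  then show ?thesis
    using matrix_integral_lower[OF F r(1)] matrix_integral_diff[of "\<lambda>x. 0" F] F matrix_integral_0
    by (simp add: abs_le_iff)
qed

lemma matrix_integral_close:
  assumes F: "continuous_on UNIV F" and G: "continuous_on UNIV G" and e: "\<And>x. x \<in> cell \<Longrightarrow> norm (F x - G x) \<le> e"
  shows "\<bar>matrix_integral \<mu> F - matrix_integral \<mu> G\<bar> \<le> e * trace (\<mu> cell)"
  unfolding matrix_integral_diff[OF F G, symmetric]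
proof (rule matrix_integral_abs_le)
  show "continuous_on UNIV (\<lambda>x. F x - G x)" using F G by (intro continuous_intros)
  show "eneg (F x - G x) \<le> e" "eneg (- (F x - G x)) \<le> e" if "x \<in> cell" for x
    using eneg_le_norm[of "F x - G x"] eneg_le_norm[of "- (F x - G x)"] e[OF that] by (simp_all add: norm_minus_commute)
qed

end

context ev_fields
begin

lemma L_0:
  assumes "t = 0 \<or> good0 t"
  shows "L t (\<lambda>t x. 0) = 0"
  using L_add_scaleR[OF assms C1_torus_0 C1_torus_0, of 1] by simp

lemma L_sum:
  assumes t: "t = 0 \<or> good0 t" and S: "finite S" and \<phi>: "\<And>k. k \<in> S \<Longrightarrow> C1_torus T (\<phi> k)"
  shows "L t (\<lambda>t x. \<Sum>k\<in>S. c k *\<^sub>R \<phi> k t x) = (\<Sum>k\<in>S. c k * L t (\<phi> k))"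
  using S \<phi>
proof (induction S)
  case empty
  then show ?case using L_0[OF t] by simp
next
  case (insert j S)
  have 1: "C1_torus T (\<lambda>t x. \<Sum>k\<in>S. c k *\<^sub>R \<phi> k t x)"
    using C1_torus_sum[OF T insert(1), of \<phi> c] insert.prems by blast
  have "(\<lambda>t x. \<Sum>k\<in>insert j S. c k *\<^sub>R \<phi> k t x) = (\<lambda>t x. (\<Sum>k\<in>S. c k *\<^sub>R \<phi> k t x) + c j *\<^sub>R \<phi> j t x)"
    using insert(1,2) by (simp add: fun_eq_iff add.commute)
  then show ?case using L_add_scaleR[OF t 1, of "\<phi> j" "c j"] insert by simp
qed

text \<open>At good times the primitive of the displayed function equals
  \<open>L t \<Phi> + kap * tint T (defect \<Phi>) t\<close>, which increases there by
  \<open>L_increment_ge\<close>. The exceptional null set depends on the coefficients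
  \<open>c\<close>.\<close>

lemma AE_combined_density_nonneg:
  fixes \<phi> :: "nat \<Rightarrow> real \<Rightarrow> real ^ 'd \<Rightarrow> real ^ 'd"
  assumes \<phi>: "\<And>k. C1_torus T (\<phi> k)" and gi: "\<And>k. integrable I (g k)"
    and gL: "\<And>k t. t = 0 \<or> good t \<Longrightarrow> tint T (g k) t = L t (\<phi> k)"
    and Lip: "\<And>k. \<exists>K\<ge>0. \<forall>s\<in>{0..T}. \<forall>t\<in>{0..T}. \<bar>tint T (g k) t - tint T (g k) s\<bar> \<le> K * \<bar>t - s\<bar>"
    and S: "finite S"
  shows "AE \<tau> in I. 0 \<le> (\<Sum>k\<in>S. c k * g k \<tau>) + kap * defect (\<lambda>t x. \<Sum>k\<in>S. c k *\<^sub>R \<phi> k t x) \<tau>"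
proof -
  define \<Phi> where "\<Phi> = (\<lambda>t x. \<Sum>k\<in>S. c k *\<^sub>R \<phi> k t x)"
  have \<Phi>: "C1_torus T \<Phi>" unfolding \<Phi>_def using C1_torus_sum[OF T S, of \<phi> c] \<phi> by blast
  define f where "f = (\<lambda>\<tau>. (\<Sum>k\<in>S. c k * g k \<tau>) + kap * defect \<Phi> \<tau>)"
  have si: "integrable I (\<lambda>\<tau>. \<Sum>k\<in>S. c k * g k \<tau>)" using gi by auto
  have fi: "integrable I f" unfolding f_def using si defect_integrable[OF \<Phi>] by auto
  have tf: "tint T f t = (\<Sum>k\<in>S. c k * tint T (g k) t) + kap * tint T (defect \<Phi>) t" for t
    unfolding f_def tint_linear[OF si defect_integrable[OF \<Phi>]] using tint_sum[where K = S and f = g and c = c] gi by simp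
  obtain K where K: "\<And>k. 0 \<le> K k" "\<And>k s t. s \<in> {0..T} \<Longrightarrow> t \<in> {0..T} \<Longrightarrow> \<bar>tint T (g k) t - tint T (g k) s\<bar> \<le> K k * \<bar>t - s\<bar>"
    using Lip by metis
  obtain Kd where Kd: "0 \<le> Kd" "\<And>s t. s \<in> {0..T} \<Longrightarrow> t \<in> {0..T} \<Longrightarrow> \<bar>tint T (defect \<Phi>) t - tint T (defect \<Phi>) s\<bar> \<le> Kd * \<bar>t - s\<bar>"
    using defect_Lipschitz[OF \<Phi>] by metis
  define M where "M = (\<Sum>k\<in>S. \<bar>c k\<bar> * K k) + kap * Kd"
  have Lf: "\<bar>tint T f t - tint T f s\<bar> \<le> M * \<bar>t - s\<bar>" if st: "s \<in> {0..T}" "t \<in> {0..T}" for s t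
  proof -
    have eq: "tint T f t - tint T f s = (\<Sum>k\<in>S. c k * (tint T (g k) t - tint T (g k) s)) + kap * (tint T (defect \<Phi>) t - tint T (defect \<Phi>) s)"
      by (simp add: tf right_diff_distrib sum_subtractf)
    have "\<bar>tint T f t - tint T f s\<bar> \<le> \<bar>\<Sum>k\<in>S. c k * (tint T (g k) t - tint T (g k) s)\<bar> + \<bar>kap * (tint T (defect \<Phi>) t - tint T (defect \<Phi>) s)\<bar>"
      unfolding eq by (rule abs_triangle_ineq)
    also have "\<dots> \<le> (\<Sum>k\<in>S. \<bar>c k\<bar> * (K k * \<bar>t - s\<bar>)) + kap * (Kd * \<bar>t - s\<bar>)"
    proof (rule add_mono)
      have "\<bar>\<Sum>k\<in>S. c k * (tint T (g k) t - tint T (g k) s)\<bar> \<le> (\<Sum>k\<in>S. \<bar>c k * (tint T (g k) t - tint T (g k) s)\<bar>)" by (rule sum_abs)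
      also have "\<dots> \<le> (\<Sum>k\<in>S. \<bar>c k\<bar> * (K k * \<bar>t - s\<bar>))"
        by (intro sum_mono) (simp add: abs_mult mult_left_mono K(2)[OF st])
      finally show "\<bar>\<Sum>k\<in>S. c k * (tint T (g k) t - tint T (g k) s)\<bar> \<le> (\<Sum>k\<in>S. \<bar>c k\<bar> * (K k * \<bar>t - s\<bar>))" .
      show "\<bar>kap * (tint T (defect \<Phi>) t - tint T (defect \<Phi>) s)\<bar> \<le> kap * (Kd * \<bar>t - s\<bar>)"
        using kap_pos Kd(2)[OF st] by (simp add: abs_mult mult_left_mono)
    qed
    also have "\<dots> = M * \<bar>t - s\<bar>" by (simp add: M_def distrib_right sum_distrib_right mult.assoc)
    finally show ?thesis .
  qed
  have mono: "tint T f s \<le> tint T f t" if "good s" "good t" "s < t" for s t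
  proof -
    have eq: "tint T f t = L t \<Phi> + kap * tint T (defect \<Phi>) t" if "good t" for t
      unfolding tf \<Phi>_def using L_sum[OF _ S, of t \<phi> c] \<phi> gL[of t] that by (simp add: good_def)
    show ?thesis unfolding eq[OF that(1)] eq[OF that(2)]
      using L_increment_ge[OF _ that(2,3) \<Phi>] that(1) by (simp add: algebra_simps)
  qed
  have inc: "tint T f s \<le> tint T f t" if "0 \<le> s" "s \<le> t" "t \<le> T" for s t
    by (rule tint_increasing_from_dense[OF T _ Lf, of "{t. good t}" s t]) (use AE_good mono that in auto)
  have "AE \<tau> in I. 0 \<le> f \<tau>"
  proof (rule tint_increasing_imp_AE_nonneg[OF T fi _ inc])
    fix s t assume "0 \<le> s" "s \<le> t" "t \<le> T"
    then show "tint T f t - tint T f s \<le> M * (t - s)" using Lf[of s t] by auto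
  qed
  then show ?thesis by (simp add: f_def \<Phi>_def)
qed

text \<open>Construction of \<open>R\<close> from a sequence of tests. The measurability clause
  admits all continuous periodic fields, also time-dependent ones, because both
  \<open>nabla (\<phi> \<tau>)\<close> and the fixed symmetric fields of
  \<open>Linf_weakstar_psd\<close> are integrated later.\<close>

lemma ex_defect_measure:
  fixes \<phi> :: "nat \<Rightarrow> real \<Rightarrow> real ^ 'd \<Rightarrow> real ^ 'd"
  assumes \<phi>: "\<And>k. C1_torus T (\<phi> k)"
  shows "\<exists>R. (\<forall>\<tau>\<in>{0<..<T}. psd_measure (R \<tau>) \<and> trace (R \<tau> cell) \<le> kap * max 0 (E \<tau> - en \<tau>)) \<and>
    (\<forall>F. continuous_on ({0..T} \<times> UNIV) (\<lambda>(t, x). F t x) \<and> (\<forall>t\<in>{0..T}. \<forall>x k. (\<forall>i. k $ i \<in> \<int>) \<longrightarrow> F t (x + k) = F t x)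
       \<longrightarrow> (\<lambda>\<tau>. matrix_integral (R \<tau>) (F \<tau>)) \<in> borel_measurable I) \<and>
    (\<forall>k. \<exists>g. integrable I g \<and> (\<forall>t. t = 0 \<or> good t \<longrightarrow> tint T g t = L t (\<phi> k)) \<and>
       (AE \<tau> in I. matrix_integral (R \<tau>) (nabla (\<phi> k \<tau>)) = g \<tau>))"
proof -
  have "\<forall>k. \<exists>g. integrable I g \<and> (\<forall>t. t = 0 \<or> good t \<longrightarrow> tint T g t = L t (\<phi> k)) \<and>
    (\<exists>K\<ge>0. \<forall>s\<in>{0..T}. \<forall>t\<in>{0..T}. \<bar>tint T g t - tint T g s\<bar> \<le> K * \<bar>t - s\<bar>)"
    using L_density[OF \<phi>] by blast
  then obtain g where g: "\<And>k. integrable I (g k)" "\<And>k t. t = 0 \<or> good t \<Longrightarrow> tint T (g k) t = L t (\<phi> k)"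
    "\<And>k. \<exists>K\<ge>0. \<forall>s\<in>{0..T}. \<forall>t\<in>{0..T}. \<bar>tint T (g k) t - tint T (g k) s\<bar> \<le> K * \<bar>t - s\<bar>"
    by metis
  define \<Phi> where "\<Phi> = (\<lambda>c :: nat \<Rightarrow> real. \<lambda>t x. \<Sum>k | c k \<noteq> 0. c k *\<^sub>R \<phi> k t x)"
  have AE: "AE \<tau> in I. \<forall>c\<in>ratsupp UNIV. 0 \<le> (\<Sum>k | c k \<noteq> 0. c k * g k \<tau>) + kap * defect (\<Phi> c) \<tau>"
    unfolding \<Phi>_def
    by (intro AE_ball_countable[OF countable_ratsupp, THEN iffD2] ballI AE_combined_density_nonneg \<phi> g)
       (auto simp: ratsupp_def finsupp_def)
  define Q where "Q = (\<lambda>\<tau>. (\<forall>c\<in>ratsupp UNIV. 0 \<le> (\<Sum>k | c k \<noteq> 0. c k * g k \<tau>) + kap * defect (\<Phi> c) \<tau>) \<and> 0 \<le> E \<tau> - en \<tau>)"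
  have "AE \<tau> in I. Q \<tau>"
    unfolding Q_def using AE AE_gap by eventually_elim simp
  from AE_E3[OF this] obtain N where N: "\<And>\<tau>. \<tau> \<in> space I - N \<Longrightarrow> Q \<tau>" "N \<in> null_sets I"
    by blast
  \<comment> \<open>The truncation makes the weight nonnegative at every time and not only outside a
    null set, as a sublinear gauge is required at all times.\<close>
  define w where "w = (\<lambda>\<tau>. kap * max 0 (E \<tau> - en \<tau>))"
  define F where "F = (\<lambda>\<tau> k. nabla (\<phi> k \<tau>))"
  define p where "p = (\<lambda>\<tau> c. w \<tau> * neg_gauge (F \<tau>) c)"
  \<comment> \<open>The prescribed values on even indices are \<open>- g\<close>; on the null set
    \<open>N\<close> they are replaced by zero, which is dominated trivially.\<close>
  define a' where "a' = (\<lambda>j \<tau>. if \<tau> \<in> N then 0 else - g (j div 2) \<tau>)"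
  have sp: "\<tau> \<in> space I \<longleftrightarrow> \<tau> \<in> {0<..<T}" for \<tau> by (simp add: space_restrict_space)
  have w: "0 \<le> w \<tau>" for \<tau> using kap_pos by (simp add: w_def)
  have Fc: "continuous_on UNIV (F \<tau> k)" if "\<tau> \<in> {0..T}" for \<tau> k
    unfolding F_def by (rule continuous_on_section[OF C1_torus_continuous_nabla[OF T \<phi>] that])
  have Fb: "\<exists>b. \<forall>x\<in>cell. norm (F \<tau> k x) \<le> b" if "\<tau> \<in> {0..T}" for \<tau> k
    using continuous_bounded_cell[OF C1_torus_continuous_nabla[OF T \<phi>[of k]]] that unfolding F_def by metis
  interpret H: sublinear_family I p
  proof
    fix \<tau> c d r assume \<tau>: "\<tau> \<in> space I" and c: "c \<in> finsupp UNIV"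
    then have \<tau>': "\<tau> \<in> {0..T}" by (simp add: sp)
    show "p \<tau> (\<lambda>k. c k + d k) \<le> p \<tau> c + p \<tau> d" if "d \<in> finsupp UNIV"
      unfolding p_def distrib_left[symmetric] by (rule mult_left_mono[OF neg_gauge_add[OF Fb[OF \<tau>'] c that] w])
    show "p \<tau> (\<lambda>k. r * c k) = r * p \<tau> c" if "0 \<le> r"
      unfolding p_def by (simp add: neg_gauge_scale[OF Fb[OF \<tau>'] c that])
    show "0 \<le> p \<tau> c" unfolding p_def by (rule mult_nonneg_nonneg[OF w neg_gauge_nonneg[OF Fb[OF \<tau>']]])
  next
    fix c :: "nat \<Rightarrow> real"
    \<comment> \<open>The given fields are continuous in time at each point, and the steps do not
      depend on time.\<close>
    have cont: "continuous_on {0<..<T} (\<lambda>\<tau>. eneg (comb (F \<tau>) c x))" for x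
    proof -
      have "continuous_on {0<..<T} (\<lambda>\<tau>. gen (F \<tau>) j x)" for j
      proof (cases "even j")
        case True
        have "continuous_on {0<..<T} (\<lambda>\<tau>. (\<lambda>(t, x). nabla (\<phi> (j div 2) t) x) (\<tau>, x))"
          by (rule continuous_on_compose2[OF C1_torus_continuous_nabla[OF T \<phi>]]) (auto intro!: continuous_intros)
        then show ?thesis using True by (simp add: gen_def F_def)
      qed (simp add: gen_def)
      then have "continuous_on {0<..<T} (\<lambda>\<tau>. comb (F \<tau>) c x)" unfolding comb_def by (intro continuous_intros)
      then show ?thesis by (rule continuous_on_compose2[OF continuous_on_eneg[of UNIV]]) simp
    qed
    have "(\<lambda>\<tau>. neg_gauge (F \<tau>) c) \<in> borel_measurable I"
      unfolding neg_gauge_def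
    proof (rule borel_measurable_cSUP[OF countable_dyadic_points])
      show "(\<lambda>\<tau>. eneg (comb (F \<tau>) c x)) \<in> borel_measurable I" for x
        by (rule continuous_imp_measurable_on_sets_lebesgue[OF cont]) simp
      show "bdd_above ((\<lambda>x. eneg (comb (F \<tau>) c x)) ` dyadic_points)" if "\<tau> \<in> space I" for \<tau>
        by (rule bdd_above_eneg_comb[OF Fb]) (use that in \<open>simp add: sp\<close>)
    qed
    then show "(\<lambda>\<tau>. p \<tau> c) \<in> borel_measurable I"
      using gap_measurable unfolding p_def w_def by measurable
  qed
  have "H.dominated {j. even j} a'"
    unfolding H.dominated_def
  proof (intro conjI ballI)
    fix j
    have [measurable]: "N \<in> sets I" "g (j div 2) \<in> borel_measurable I" using N(2) g(1) by (auto simp: null_sets_def)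
    show "a' j \<in> borel_measurable I" unfolding a'_def by measurable
  next
    fix \<tau> c assume \<tau>: "\<tau> \<in> space I" and c: "c \<in> ratsupp {j :: nat. even j}"
    have \<tau>': "\<tau> \<in> {0..T}" using \<tau> by (simp add: sp)
    show "pairing c (\<lambda>k. a' k \<tau>) \<le> p \<tau> c"
    proof (cases "\<tau> \<in> N")
      case True
      then show ?thesis using mult_nonneg_nonneg[OF w neg_gauge_nonneg[OF Fb[OF \<tau>']]] by (simp add: pairing_def a'_def p_def)
    next
      case False
      define c' where "c' = (\<lambda>k. c (2 * k))"
      have ev: "even j" if "c j \<noteq> 0" for j using c that by (auto simp: ratsupp_def finsupp_def)
      have supp: "{j. c j \<noteq> 0} = (\<lambda>k. 2 * k) ` {k. c' k \<noteq> 0}"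
        using ev by (auto simp: c'_def elim!: evenE)
      have inj: "inj_on (\<lambda>k :: nat. 2 * k) X" for X by (simp add: inj_on_def)
      have "finite {k. c' k \<noteq> 0}"
        using c finite_imageD[OF _ inj, of "{k. c' k \<noteq> 0}"] by (simp add: supp[symmetric] ratsupp_def finsupp_def)
      then have c': "c' \<in> ratsupp UNIV" "finite {k. c' k \<noteq> 0}" using c by (auto simp: ratsupp_def finsupp_def c'_def)
      have C1: "C1_torus T (\<Phi> c')" and nab: "\<And>x. nabla (\<Phi> c' \<tau>) x = (\<Sum>k | c' k \<noteq> 0. c' k *\<^sub>R nabla (\<phi> k \<tau>) x)"
        unfolding \<Phi>_def using C1_torus_sum[OF T c'(2), of \<phi> c'] \<phi> \<tau>' by auto
      have pr: "pairing c (\<lambda>k. a' k \<tau>) = - (\<Sum>k | c' k \<noteq> 0. c' k * g k \<tau>)"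
        unfolding pairing_def supp sum.reindex[OF inj] using False by (simp add: a'_def c'_def sum_negf)
      have cb: "comb (F \<tau>) c x = nabla (\<Phi> c' \<tau>) x" for x
        unfolding comb_def supp sum.reindex[OF inj] nab by (simp add: gen_even F_def c'_def)
      \<comment> \<open>A supremum over dyadic points bounds the norm on the whole cell, since every
        point is the limit of its dyadic corners and \<open>nabla\<close> is continuous.\<close>
      have nn: "neg_norm (\<Phi> c' \<tau>) \<le> neg_gauge (F \<tau>) c"
      proof (rule neg_norm_le[OF T C1 \<tau>'])
        fix x :: "real ^ 'd" assume x: "x \<in> cell"
        have ct: "continuous_on UNIV (\<lambda>x. eneg (nabla (\<Phi> c' \<tau>) x))"
          by (rule continuous_on_compose2[OF continuous_on_eneg[of UNIV] continuous_on_section[OF C1_torus_continuous_nabla[OF T C1] \<tau>']]) simp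
        have "(\<lambda>n. eneg (nabla (\<Phi> c' \<tau>) (dyadic n x))) \<longlonglongrightarrow> eneg (nabla (\<Phi> c' \<tau>) x)"
          by (rule continuous_on_tendsto_compose[OF ct dyadic_tendsto]) auto
        then show "eneg (nabla (\<Phi> c' \<tau>) x) \<le> neg_gauge (F \<tau>) c"
        proof (rule LIMSEQ_le_const2, intro exI allI impI)
          fix n
          have "dyadic n x \<in> dyadic_points" using dyadic_in_dgrid[OF x] by (auto simp: dyadic_points_def)
          then show "eneg (nabla (\<Phi> c' \<tau>) (dyadic n x)) \<le> neg_gauge (F \<tau>) c"
            using eneg_le_neg_gauge[where F = "F \<tau>", OF Fb[OF \<tau>'], where x = "dyadic n x" and c = c] by (simp add: cb)
        qed
      qed
      have "- (\<Sum>k | c' k \<noteq> 0. c' k * g k \<tau>) \<le> kap * defect (\<Phi> c') \<tau>"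
        using N(1)[OF DiffI[OF \<tau> False]] c'(1) unfolding Q_def by fastforce
      also have "\<dots> = w \<tau> * neg_norm (\<Phi> c' \<tau>)"
        using N(1)[OF DiffI[OF \<tau> False]] by (simp add: Q_def defect_def w_def)
      also have "\<dots> \<le> p \<tau> c" unfolding p_def by (rule mult_left_mono[OF nn w])
      finally show ?thesis unfolding pr .
    qed
  qed
  from H.measurable_Hahn_Banach[OF this] obtain b where b: "\<And>k. b k \<in> borel_measurable I" "\<And>k. even k \<Longrightarrow> b k = a' k"
    "\<And>\<tau> c. \<tau> \<in> space I \<Longrightarrow> c \<in> finsupp UNIV \<Longrightarrow> pairing c (\<lambda>k. b k \<tau>) \<le> p \<tau> c"
    by blast
  define B :: "real \<Rightarrow> nat \<Rightarrow> real ^ 'd \<Rightarrow> real ^ 'd ^ 'd" where "B = (\<lambda>\<tau>. dominated_generators.B (\<lambda>k. b k \<tau>))"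
  have G: "dominated_generators (F \<tau>) (\<lambda>k. b k \<tau>) (w \<tau>)" if "\<tau> \<in> {0<..<T}" for \<tau>
  proof
    have \<tau>: "\<tau> \<in> {0..T}" using that by simp
    show "0 \<le> w \<tau>" by (rule w)
    show "continuous_on UNIV (F \<tau> k)" for k by (rule Fc[OF \<tau>])
    show "F \<tau> k (x + z) = F \<tau> k x" if "\<And>i. z $ i \<in> \<int>" for k x z
      unfolding F_def by (rule C1_torus_nabla_periodic[OF T \<phi> \<tau> that])
    show "pairing c (\<lambda>k. b k \<tau>) \<le> w \<tau> * neg_gauge (F \<tau>) c" if "c \<in> finsupp UNIV" for c
      using b(3)[OF _ that, of \<tau>] \<open>\<tau> \<in> {0<..<T}\<close> by (simp add: sp p_def)
  qed
  have P: "psd_content (B \<tau>)" if "\<tau> \<in> {0<..<T}" for \<tau>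
    unfolding B_def by (rule dominated_generators.psd_content_B[OF G[OF that]])
  show ?thesis
  proof (intro exI[of _ "\<lambda>\<tau>. psd_content.R (B \<tau>)"] conjI ballI allI impI)
    fix \<tau> assume \<tau>: "\<tau> \<in> {0<..<T}"
    show "psd_measure (psd_content.R (B \<tau>))" by (rule psd_content.psd_measure_R[OF P[OF \<tau>]])
    show "trace (psd_content.R (B \<tau>) cell) \<le> kap * max 0 (E \<tau> - en \<tau>)"
      using dominated_generators.trace_R_le[OF G[OF \<tau>]] by (simp add: B_def w_def)
  next
    fix F' :: "real \<Rightarrow> real ^ 'd \<Rightarrow> real ^ 'd ^ 'd"
    assume F': "continuous_on ({0..T} \<times> UNIV) (\<lambda>(t, x). F' t x) \<and> (\<forall>t\<in>{0..T}. \<forall>x k. (\<forall>i. k $ i \<in> \<int>) \<longrightarrow> F' t (x + k) = F' t x)"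
    \<comment> \<open>The integral is a limit of Riemann sums whose coefficients are values of the
      extension \<open>b\<close>; this is where the measurable choice of \<open>b\<close>
      enters.\<close>
    show "(\<lambda>\<tau>. matrix_integral (psd_content.R (B \<tau>)) (F' \<tau>)) \<in> borel_measurable I"
    proof (rule borel_measurable_LIMSEQ_real)
      fix \<tau> assume "\<tau> \<in> space I"
      then have \<tau>: "\<tau> \<in> {0<..<T}" by (simp add: sp)
      show "(\<lambda>n. \<Sum>q\<in>dgrid n. F' \<tau> q \<bullet> B \<tau> n q) \<longlonglongrightarrow> matrix_integral (psd_content.R (B \<tau>)) (F' \<tau>)"
        by (rule psd_content.matrix_integral_R_limit[OF P[OF \<tau>] continuous_on_section[of "{0..T}"]]) (use F' \<tau> in auto)
    next
      fix n
      have Fm: "(\<lambda>\<tau>. F' \<tau> q $ i $ j) \<in> borel_measurable I" for q i j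
      proof (rule continuous_imp_measurable_on_sets_lebesgue)
        have "continuous_on {0<..<T} (\<lambda>\<tau>. (\<lambda>(t, x). F' t x) (\<tau>, q))"
          by (rule continuous_on_compose2[OF conjunct1[OF F']]) (auto intro!: continuous_intros)
        then show "continuous_on {0<..<T} (\<lambda>\<tau>. F' \<tau> q $ i $ j)" by (auto intro!: continuous_intros)
      qed simp
      have Bm: "(\<lambda>\<tau>. B \<tau> n q $ i $ j) \<in> borel_measurable I" for q i j
      proof -
        have "(\<lambda>\<tau>. B \<tau> n q $ i $ j) \<in> borel_measurable I \<longleftrightarrow> (\<lambda>\<tau>. - b (step_code (n, q, i, j)) \<tau>) \<in> borel_measurable I"
          by (rule measurable_cong) (simp add: sp B_def dominated_generators.B_def[OF G])
        then show ?thesis using b(1) by simp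
      qed
      show "(\<lambda>\<tau>. \<Sum>q\<in>dgrid n. F' \<tau> q \<bullet> B \<tau> n q) \<in> borel_measurable I"
        unfolding inner_vec_def inner_real_def by (intro borel_measurable_sum borel_measurable_times Fm Bm)
    qed
  next
    fix k
    show "\<exists>g. integrable I g \<and> (\<forall>t. t = 0 \<or> good t \<longrightarrow> tint T g t = L t (\<phi> k)) \<and>
       (AE \<tau> in I. matrix_integral (psd_content.R (B \<tau>)) (nabla (\<phi> k \<tau>)) = g \<tau>)"
    proof (intro exI[of _ "g k"] conjI allI impI g)
      have "AE \<tau> in I. \<tau> \<notin> N" using N(2) by (rule AE_not_in)
      then show "AE \<tau> in I. matrix_integral (psd_content.R (B \<tau>)) (nabla (\<phi> k \<tau>)) = g k \<tau>"
        using AE_I_range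
      proof eventually_elim
        case (elim \<tau>)
        then have "matrix_integral (psd_content.R (B \<tau>)) (F \<tau> k) = - b (2 * k) \<tau>"
          unfolding B_def by (intro dominated_generators.matrix_integral_R_F[OF G]) auto
        then show ?case using elim by (simp add: b(2) a'_def F_def)
      qed
    qed
  qed
qed

end

text \<open>The monotone representative is the essential supremum of \<open>E\<close> over later
  times. It lies below \<open>E\<close> almost everywhere by hypothesis, and above \<open>E\<close>
  almost everywhere on its set of continuity points, which omits only countably many times.\<close>

lemma AE_AE_nonincreasing:
  assumes T: "0 < T" and C: "AE t in lebesgue_on {0<..<T}. \<bar>E t\<bar> \<le> C"
    and mono: "AE s in lebesgue_on {0<..<T}. AE t in lebesgue_on {s<..<T}. E t \<le> E s"
  shows "nonincreasing T E"
proof -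
  let ?I = "lebesgue_on {0<..<T}"
  define N where "N = (\<lambda>q t. AE s in ?I. t < s \<longrightarrow> E s \<le> q)"
  define F where "F = (\<lambda>t. Inf {q. N q t})"
  have range: "AE t in ?I. t \<in> {0<..<T}" using AE_space[of ?I] by (simp add: space_restrict_space)
  have ne: "C \<in> {q. N q t}" for t
    unfolding N_def using C by (auto elim!: eventually_mono)
  have lower: "- C \<le> q" if "N q t" and t: "t \<in> {0<..<T}" for q t
  proof -
    have "AE s in ?I. (t < s \<longrightarrow> E s \<le> q) \<and> \<bar>E s\<bar> \<le> C"
      using that(1) C unfolding N_def by eventually_elim simp
    from AE_ex_between[OF _ _ _ this, of t T] t show ?thesis by auto
  qed
  have bdd: "bdd_below {q. N q t}" if "t \<in> {0<..<T}" for t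
    using lower that by (intro bdd_belowI[of _ "- C"]) auto
  have anti: "F t' \<le> F t" if t: "t \<in> {0<..<T}" "t' \<in> {0<..<T}" "t \<le> t'" for t t'
    unfolding F_def
  proof (rule cInf_superset_mono)
    show "{q. N q t} \<subseteq> {q. N q t'}"
      unfolding N_def using t(3) by (auto elim!: eventually_mono)
  qed (use ne bdd[OF t(2)] in auto)
  have above: "AE t in ?I. F t \<le> E t"
    using mono range
  proof eventually_elim
    case (elim t)
    have "AE s in lebesgue. s \<in> {t<..<T} \<longrightarrow> E s \<le> E t"
      using elim(1) by (subst (asm) AE_restrict_space_iff) auto
    then have "N (E t) t"
      unfolding N_def by (subst AE_restrict_space_iff) (auto elim!: eventually_mono)
    then show ?case unfolding F_def by (intro cInf_lower bdd elim(2)) simp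
  qed
  have attained: "N (F t) t" for t
  proof -
    have "AE s in ?I. \<forall>n. t < s \<longrightarrow> E s \<le> F t + 1 / real (Suc n)"
    proof (intro AE_all_countable[THEN iffD2] allI)
      fix n
      obtain q where q: "N q t" "q < F t + 1 / real (Suc n)"
        using cInf_lessD[of "{q. N q t}" "F t + 1 / real (Suc n)"] ne[of t] by (auto simp: F_def)
      show "AE s in ?I. t < s \<longrightarrow> E s \<le> F t + 1 / real (Suc n)"
        using q(1) unfolding N_def by (rule eventually_mono) (use q(2) in auto)
    qed
    then show ?thesis unfolding N_def
    proof (rule eventually_mono, intro impI)
      fix s assume s: "\<forall>n. t < s \<longrightarrow> E s \<le> F t + 1 / real (Suc n)" "t < s"
      show "E s \<le> F t"
      proof (rule field_le_epsilon)
        fix e :: real assume "0 < e"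
        then obtain n where "1 / real (Suc n) < e" using nat_approx_posE by blast
        then show "E s \<le> F t + e" using s spec[OF s(1), of n] by linarith
      qed
    qed
  qed
  \<comment> \<open>Bounds from rational earlier times: countability leaves a single null set for
    all \<open>q\<close>, and continuity of \<open>F\<close> lets \<open>q\<close> approach the time
    in question.\<close>
  have "AE s in ?I. \<forall>q\<in>\<rat>. q < s \<longrightarrow> E s \<le> F q"
    using attained by (intro AE_ball_countable[OF countable_rat, THEN iffD2] ballI) (simp add: N_def)
  moreover have "AE s in ?I. isCont (\<lambda>t. - F t) s"
  proof -
    have "mono_on {0<..<T} (\<lambda>t. - F t)" by (rule mono_onI) (use anti in auto)
    then have "countable {a \<in> {0<..<T}. \<not> isCont (\<lambda>t. - F t) a}"
      by (intro mono_on_ctble_discont_open) auto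
    then have "{a \<in> {0<..<T}. \<not> isCont (\<lambda>t. - F t) a} \<in> null_sets lborel" by (rule countable_imp_null_set_lborel)
    then have "AE a in lborel. a \<notin> {a \<in> {0<..<T}. \<not> isCont (\<lambda>t. - F t) a}" by (rule AE_not_in)
    then have "AE a in lebesgue. a \<notin> {a \<in> {0<..<T}. \<not> isCont (\<lambda>t. - F t) a}" by (rule AE_completion)
    then show ?thesis by (subst AE_restrict_space_iff) (auto elim!: eventually_mono)
  qed
  ultimately have "AE t in ?I. E t = F t"
    using above range
  proof eventually_elim
    case (elim t)
    have "E t \<le> F t"
    proof (rule field_le_epsilon)
      fix e :: real assume e: "0 < e"
      obtain d where d: "0 < d" "\<And>s. dist s t < d \<Longrightarrow> dist (- F s) (- F t) < e"
        using elim(2) e unfolding continuous_at_eps_delta by metis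
      obtain q where q: "q \<in> \<rat>" "max 0 (t - d) < q" "q < t"
        using Rats_dense_in_real[of "max 0 (t - d)" t] d(1) elim(4) by auto
      have "dist (- F q) (- F t) < e" by (rule d(2)) (use q in \<open>auto simp: dist_real_def\<close>)
      then have "F q < F t + e" by (auto simp: dist_real_def)
      moreover have "E t \<le> F q" using elim(1) q by blast
      ultimately show "E t \<le> F t + e" by simp
    qed
    then show ?case using elim(3) by simp
  qed
  moreover have "antimono_on {0<..<T} F" by (rule monotone_onI) (use anti in auto)
  ultimately show ?thesis unfolding nonincreasing_def by blast
qed

lemma ev_lhs_0:
  assumes T: "0 < T" and st: "s \<in> {0..T}" "t \<in> {0..T}"
  shows "ev_lhs a \<gamma> \<alpha> T h m E es hs ms s t (\<lambda>t x. 0) (\<lambda>t x. 0) = E t - es"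
proof -
  have zero: "(LINT \<tau>=s..t|lebesgue. f \<tau>) = 0" if "\<And>\<tau>. \<tau> \<in> {0<..<T} \<Longrightarrow> f \<tau> = 0" for f :: "real \<Rightarrow> real"
  proof -
    have i0: "integrable (lebesgue_on {0<..<T}) (\<lambda>_. 0 :: real)" by simp
    have i: "integrable (lebesgue_on {0<..<T}) f"
      using i0 by (rule Bochner_Integration.integrable_cong[THEN iffD1, rotated -1]) (simp_all add: that space_restrict_space)
    have ae: "AE \<tau> in lebesgue_on {0<..<T}. f \<tau> = 0" by (rule AE_I2) (simp add: that space_restrict_space)
    have "tint T f r = 0" for r using tint_cong_AE[OF i i0 ae, of r] by (simp add: tint_def)
    then show ?thesis using interval_integral_eq_tint[OF i st] by simp
  qed
  have K: "K_weight \<alpha> (\<lambda>x :: real ^ 'd. 0) = 0"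
  proof -
    have z: "0 \<in> {0..T}" using T by simp
    have "neg_norm (\<lambda>x :: real ^ 'd. 0) \<le> 0"
      by (rule neg_norm_le[where \<phi> = "\<lambda>t x. 0", OF T C1_torus_0 z]) (simp add: nabla_0)
    moreover have "0 \<le> neg_norm (\<lambda>x :: real ^ 'd. 0)"
      by (rule neg_norm_nonneg[where \<phi> = "\<lambda>t x. 0", OF T C1_torus_0 z])
    ultimately have "neg_norm (\<lambda>x :: real ^ 'd. 0) = 0" by (rule order_antisym)
    then show ?thesis by (simp add: K_weight_def neg_norm_def)
  qed
  show ?thesis
    unfolding ev_lhs_def by (subst (1 2) zero) (simp_all add: K dt_0[OF T] grad_0 nabla_0)
qed

context ev_fields
begin

lemma L_close:
  assumes t: "t = 0 \<or> good0 t" and \<phi>: "C1_torus T \<phi>" and \<psi>: "C1_torus T \<psi>" and e: "momentum_close T e \<phi> \<psi>" "0 \<le> e"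
  shows "\<bar>L t \<phi> - L t \<psi>\<bar> \<le> (((\<integral>x. norm (m t x) \<partial>torus) + CU * T) + ((\<integral>x. norm (m0 x) \<partial>torus) + CU * T)) * e"
proof (cases "t = 0")
  case True
  have "0 \<le> ((\<integral>x. norm (m t x) \<partial>torus) + CU * T) + ((\<integral>x. norm (m0 x) \<partial>torus) + CU * T)"
    using CU(1) T by (intro add_nonneg_nonneg mult_nonneg_nonneg Bochner_Integration.integral_nonneg) auto
  then show ?thesis using True e(2) by (simp add: L_def)
next
  case False
  then have t': "t \<in> {0..T}" "integrable torus (U t)" using t by (auto simp: good0_def)
  have z: "0 \<in> {0..T}" using T by simp
  show ?thesis
    using momentum_pot_close[OF \<phi> \<psi> e(1) t'(1) integrable_hm(2)[OF t'(2)]] momentum_pot_close[OF \<phi> \<psi> e(1) z m0] False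
    unfolding L_def momentum_pot_def tint_0 by (simp add: algebra_simps abs_le_iff)
qed

text \<open>The measure is built from a dense sequence of tests. Both \<open>L\<close> and the
  measure term are continuous for the \<open>C1\<close> distance, the latter by the trace bound, so
  the representation passes to all tests.\<close>

theorem ex_dissipative_measure:
  "\<exists>R. Linf_weakstar_psd T R \<and>
     (\<forall>\<phi>. C1_torus T \<phi> \<longrightarrow> (AE s in I. AE t in I. momentum_balance a \<gamma> T h m R (m s) s t \<phi>) \<and>
        (AE t in I. momentum_balance a \<gamma> T h m R m0 0 t \<phi>)) \<and>
     (AE t in I. energy a \<gamma> (h t) (m t) + ereal (1 / kap * trace (R t cell)) \<le> ereal (E t))"
proof -
  obtain J :: "(real \<Rightarrow> real ^ 'd \<Rightarrow> real ^ 'd) set" where J: "countable J" "\<forall>\<phi>\<in>J. C1_torus T \<phi>"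
    "\<forall>\<phi>. C1_torus T \<phi> \<longrightarrow> (\<forall>e>0. \<exists>\<psi>\<in>J. momentum_close T e \<phi> \<psi>)"
    using countable_dense_momentum_tests[OF T] by blast
  have "J \<noteq> {}" using J(3) C1_torus_0[of T] zero_less_one by blast
  define \<Phi> where "\<Phi> = from_nat_into J"
  have \<Phi>: "C1_torus T (\<Phi> k)" for k
    using J(2) from_nat_into[OF \<open>J \<noteq> {}\<close>] by (simp add: \<Phi>_def)
  have dense: "\<exists>k. momentum_close T e \<phi> (\<Phi> k)" if "C1_torus T \<phi>" "0 < e" for \<phi> e
    using J(3) that from_nat_into_surj[OF J(1)] unfolding \<Phi>_def by metis
  from ex_defect_measure[where \<phi> = \<Phi>, OF \<Phi>] obtain R where R_all:
    "(\<forall>\<tau>\<in>{0<..<T}. psd_measure (R \<tau>) \<and> trace (R \<tau> cell) \<le> kap * max 0 (E \<tau> - en \<tau>)) \<and>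
    (\<forall>F. continuous_on ({0..T} \<times> UNIV) (\<lambda>(t, x). F t x) \<and> (\<forall>t\<in>{0..T}. \<forall>x k. (\<forall>i. k $ i \<in> \<int>) \<longrightarrow> F t (x + k) = F t x)
       \<longrightarrow> (\<lambda>\<tau>. matrix_integral (R \<tau>) (F \<tau>)) \<in> borel_measurable I) \<and>
    (\<forall>k. \<exists>g. integrable I g \<and> (\<forall>t. t = 0 \<or> good t \<longrightarrow> tint T g t = L t (\<Phi> k)) \<and>
       (AE \<tau> in I. matrix_integral (R \<tau>) (nabla (\<Phi> k \<tau>)) = g \<tau>))"
    by (rule exE)
  have R: "psd_measure (R \<tau>)" "trace (R \<tau> cell) \<le> kap * max 0 (E \<tau> - en \<tau>)" if "\<tau> \<in> {0<..<T}" for \<tau>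
    using conjunct1[OF R_all] that by blast+
  have meas: "(\<lambda>\<tau>. matrix_integral (R \<tau>) (F \<tau>)) \<in> borel_measurable I"
    if "continuous_on ({0..T} \<times> UNIV) (\<lambda>(t, x). F t x)" "\<forall>t\<in>{0..T}. \<forall>x k. (\<forall>i. k $ i \<in> \<int>) \<longrightarrow> F t (x + k) = F t x" for F
    by (rule mp[OF spec[OF conjunct1[OF conjunct2[OF R_all]]] conjI]) (fact that)+
  note rep = spec[OF conjunct2[OF conjunct2[OF R_all]]]
  have pm: "psd_matrix_measure (R \<tau>)" if "\<tau> \<in> {0<..<T}" for \<tau> by (rule psd_matrix_measure.intro[OF R(1)[OF that]])
  have tr: "AE \<tau> in I. \<tau> \<in> {0<..<T} \<and> 0 \<le> trace (R \<tau> cell) \<and> trace (R \<tau> cell) \<le> kap * (E \<tau> - en \<tau>) \<and> trace (R \<tau> cell) \<le> kap * C"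
    using AE_I_range AE_gap
  proof eventually_elim
    case (elim \<tau>)
    have "kap * (E \<tau> - en \<tau>) \<le> kap * C" using elim(2) kap_pos by (intro mult_left_mono) auto
    then show ?case using R(2)[OF elim(1)] psd_matrix_measure.trace_nonneg[OF pm[OF elim(1)]] elim by (simp add: max_def)
  qed
  define mi where "mi = (\<lambda>\<phi> \<tau>. matrix_integral (R \<tau>) (nabla (\<phi> \<tau>)))"
  have nc: "continuous_on UNIV (nabla (\<phi> \<tau>))" if "C1_torus T \<phi>" "\<tau> \<in> {0<..<T}" for \<phi> :: "real \<Rightarrow> real ^ 'd \<Rightarrow> real ^ 'd" and \<tau>
    by (rule continuous_on_section[OF C1_torus_continuous_nabla[OF T that(1)]]) (use that(2) in simp)
  have mi: "integrable I (mi \<phi>)" if \<phi>: "C1_torus T \<phi>" for \<phi>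
  proof -
    obtain b where b: "0 \<le> b" "\<And>t x. t \<in> {0..T} \<Longrightarrow> x \<in> cell \<Longrightarrow> norm (nabla (\<phi> t) x) \<le> b"
      using continuous_bounded_cell[OF C1_torus_continuous_nabla[OF T \<phi>]] by metis
    show ?thesis
    proof (rule integrable_bounded_I)
      show "mi \<phi> \<in> borel_measurable I" unfolding mi_def
        by (rule meas[OF C1_torus_continuous_nabla[OF T \<phi>]]) (use C1_torus_nabla_periodic[OF T \<phi>] in blast)
      show "AE \<tau> in I. \<bar>mi \<phi> \<tau>\<bar> \<le> b * (kap * C)"
        using tr
      proof eventually_elim
        case (elim \<tau>)
        have "\<bar>mi \<phi> \<tau>\<bar> \<le> b * trace (R \<tau> cell)"
          unfolding mi_def
        proof (rule psd_matrix_measure.matrix_integral_abs_le[OF pm nc[OF \<phi>]])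
          fix x :: "real ^ 'd" assume "x \<in> cell"
          then have "norm (nabla (\<phi> \<tau>) x) \<le> b" using b(2) elim by simp
          then show "eneg (nabla (\<phi> \<tau>) x) \<le> b" "eneg (- nabla (\<phi> \<tau>) x) \<le> b"
            using eneg_le_norm[of "nabla (\<phi> \<tau>) x"] eneg_le_norm[of "- nabla (\<phi> \<tau>) x"] by simp_all
        qed (use elim in simp_all)
        also have "\<dots> \<le> b * (kap * C)" using elim b(1) by (intro mult_left_mono) auto
        finally show ?case .
      qed
    qed
  qed
  \<comment> \<open>An identity from time zero to a single good time; the balance between two good
    times is a difference of two such identities.\<close>
  have main: "L t \<phi> = tint T (mi \<phi>) t" if t: "t = 0 \<or> good t" and \<phi>: "C1_torus T \<phi>" for t \<phi>
  proof -
    have tT: "t \<in> {0..T}" and t0: "t = 0 \<or> good0 t" using t T by (auto simp: good_def good0_def)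
    \<comment> \<open>Sum of the constants from \<open>L_close\<close> and from the comparison of
      the measure terms.\<close>
    define M where "M = (((\<integral>x. norm (m t x) \<partial>torus) + CU * T) + ((\<integral>x. norm (m0 x) \<partial>torus) + CU * T)) + kap * C * T"
    have M: "0 \<le> M" unfolding M_def
      using CU(1) T kap_pos C_nonneg by (intro add_nonneg_nonneg mult_nonneg_nonneg Bochner_Integration.integral_nonneg) auto
    have close: "\<bar>L t \<phi> - tint T (mi \<phi>) t\<bar> \<le> M * e" if e: "0 < e" for e
    proof -
      obtain k where k: "momentum_close T e \<phi> (\<Phi> k)" using dense[OF \<phi> e] by blast
      obtain g where g: "integrable I g" "\<And>t. t = 0 \<or> good t \<Longrightarrow> tint T g t = L t (\<Phi> k)" "AE \<tau> in I. mi (\<Phi> k) \<tau> = g \<tau>"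
        using rep[of k] unfolding mi_def by blast
      have d: "AE \<tau> in I. \<bar>mi \<phi> \<tau> + (- 1) * g \<tau>\<bar> \<le> e * (kap * C)"
        using tr g(3)
      proof eventually_elim
        case (elim \<tau>)
        have "\<bar>mi \<phi> \<tau> - mi (\<Phi> k) \<tau>\<bar> \<le> e * trace (R \<tau> cell)"
          unfolding mi_def
          by (rule psd_matrix_measure.matrix_integral_close[OF pm nc[OF \<phi>] nc[OF \<Phi>] momentum_close_nabla[OF k]])
             (use elim in simp_all)
        also have "\<dots> \<le> e * (kap * C)" using elim e by (intro mult_left_mono) auto
        finally show ?case using elim by simp
      qed
      have i: "integrable I (\<lambda>\<tau>. mi \<phi> \<tau> + (- 1) * g \<tau>)" using mi[OF \<phi>] g(1) by auto
      have "\<bar>tint T (\<lambda>\<tau>. mi \<phi> \<tau> + (- 1) * g \<tau>) t - tint T (\<lambda>\<tau>. mi \<phi> \<tau> + (- 1) * g \<tau>) 0\<bar> \<le> e * (kap * C) * (t - 0)"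
        by (rule tint_diff_abs_le[OF i d]) (use tT in auto)
      also have "\<dots> \<le> e * (kap * C) * T" using tT e kap_pos C_nonneg by (intro mult_left_mono) auto
      finally have "\<bar>tint T (mi \<phi>) t - L t (\<Phi> k)\<bar> \<le> e * (kap * C) * T"
        unfolding tint_linear[OF mi[OF \<phi>] g(1)] using g(2)[OF t] by simp
      then show ?thesis
        using L_close[OF t0 \<phi> \<Phi> k less_imp_le[OF e]] unfolding M_def by (simp add: algebra_simps)
    qed
    have "\<bar>L t \<phi> - tint T (mi \<phi>) t\<bar> \<le> 0"
    proof (rule field_le_epsilon)
      fix e :: real assume e: "0 < e"
      have "\<bar>L t \<phi> - tint T (mi \<phi>) t\<bar> \<le> M * (e / (M + 1))" using M e by (intro close divide_pos_pos) auto
      also have "\<dots> \<le> e" using M e by (simp add: field_simps)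
      finally show "\<bar>L t \<phi> - tint T (mi \<phi>) t\<bar> \<le> 0 + e" by simp
    qed
    then show ?thesis by simp
  qed
  have "Linf_weakstar_psd T R"
    unfolding Linf_weakstar_psd_def
  proof (intro conjI ballI allI impI exI)
    show "psd_measure (R t)" if "t \<in> {0<..<T}" for t by (rule R(1)[OF that])
    fix F :: "real ^ 'd \<Rightarrow> real ^ 'd ^ 'd" assume F: "C_sym F"
    show "(\<lambda>t. matrix_integral (R t) F) \<in> borel_measurable I"
    proof (rule meas)
      have "continuous_on ({0..T} \<times> UNIV) (\<lambda>z. F (snd z))"
        by (rule continuous_on_compose2[of UNIV F]) (use F in \<open>auto simp: C_sym_def intro!: continuous_intros\<close>)
      then show "continuous_on ({0..T} \<times> UNIV) (\<lambda>(t, x). F x)" by (simp add: case_prod_unfold)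
      show "\<forall>t\<in>{0..T}. \<forall>x k. (\<forall>i. k $ i \<in> \<int>) \<longrightarrow> F (x + k) = F x" using F by (simp add: C_sym_def periodic_def)
    qed
  next
    show "AE t in I. \<forall>F. C_sym F \<and> (\<forall>x. spectral_norm (F x) \<le> 1) \<longrightarrow> \<bar>matrix_integral (R t) F\<bar> \<le> kap * C"
      using tr
    proof eventually_elim
      case (elim t)
      show ?case
      proof (intro allI impI)
        fix F :: "real ^ 'd \<Rightarrow> real ^ 'd ^ 'd" assume F: "C_sym F \<and> (\<forall>x. spectral_norm (F x) \<le> 1)"
        have "\<bar>matrix_integral (R t) F\<bar> \<le> 1 * trace (R t cell)"
          by (rule psd_matrix_measure.matrix_integral_abs_le[OF pm])
             (use elim F eneg_uminus_sym_le_spectral_norm[of "F _"] in \<open>auto simp: C_sym_def\<close>)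
        then show "\<bar>matrix_integral (R t) F\<bar> \<le> kap * C" using elim by simp
      qed
    qed
  qed
  moreover have "AE s in I. AE t in I. momentum_balance a \<gamma> T h m R (m s) s t \<phi>" "AE t in I. momentum_balance a \<gamma> T h m R m0 0 t \<phi>"
    if \<phi>: "C1_torus T \<phi>" for \<phi>
  proof -
    have LINT: "(LINT \<tau>=s..t|lebesgue. matrix_integral (R \<tau>) (nabla (\<phi> \<tau>))) = tint T (mi \<phi>) t - tint T (mi \<phi>) s"
      if "s \<in> {0..T}" "t \<in> {0..T}" for s t
      using interval_integral_eq_tint[OF mi[OF \<phi>] that] by (simp add: mi_def)
    have r: "t \<in> {0..T} \<and> t \<noteq> 0" if "good t" for t using that by (auto simp: good_def good0_def)
    have z: "0 \<in> {0..T}" using T by simp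
    have 1: "momentum_balance a \<gamma> T h m R (m s) s t \<phi>" if st: "good s" "good t" for s t
      unfolding momentum_balance_iff[OF \<phi> conjunct1[OF r[OF st(1)]] conjunct1[OF r[OF st(2)]]]
        LINT[OF conjunct1[OF r[OF st(1)]] conjunct1[OF r[OF st(2)]]]
      using main[of s, OF _ \<phi>] main[of t, OF _ \<phi>] st r[OF st(1)] r[OF st(2)] by (simp add: L_def momentum_pot_def)
    have 2: "momentum_balance a \<gamma> T h m R m0 0 t \<phi>" if t: "good t" for t
      unfolding momentum_balance_iff[OF \<phi> z conjunct1[OF r[OF t]]] LINT[OF z conjunct1[OF r[OF t]]]
      using main[of t, OF _ \<phi>] t r[OF t] by (simp add: L_def)
    show "AE s in I. AE t in I. momentum_balance a \<gamma> T h m R (m s) s t \<phi>"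
      using AE_good by (rule eventually_mono) (use AE_good 1 in \<open>auto elim: eventually_mono\<close>)
    show "AE t in I. momentum_balance a \<gamma> T h m R m0 0 t \<phi>"
      using AE_good by (rule eventually_mono) (rule 2)
  qed
  moreover have "AE t in I. energy a \<gamma> (h t) (m t) + ereal (1 / kap * trace (R t cell)) \<le> ereal (E t)"
    using tr AE_en
  proof eventually_elim
    case (elim t)
    then have "1 / kap * trace (R t cell) \<le> 1 / kap * (kap * (E t - en t))"
      using kap_pos by (intro mult_left_mono) auto
    then have "en t + 1 / kap * trace (R t cell) \<le> E t" using kap_pos by simp
    then show ?case using elim by simp
  qed
  ultimately show ?thesis by blast
qed

text \<open>Each time is compared with the initial data, and the balance between two times is the
  difference.\<close>

lemma AE_mass_balance:
  assumes \<rho>: "C1_torus T \<rho>"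
  shows "AE s in I. AE t in I. mass_balance T h m (h s) s t \<rho>" "AE t in I. mass_balance T h m h0 0 t \<rho>"
proof -
  have z: "0 \<in> {0..T}" using T by simp
  have r: "t \<in> {0..T}" if "good0 t" for t using that by (auto simp: good0_def)
  have 1: "mass_balance T h m (h s) s t \<rho>" if "good0 s" "good0 t" for s t
    using good0_mass[OF that(1) \<rho>] good0_mass[OF that(2) \<rho>]
    unfolding mass_balance_iff[OF \<rho> z r[OF that(1)]] mass_balance_iff[OF \<rho> z r[OF that(2)]] mass_balance_iff[OF \<rho> r[OF that(1)] r[OF that(2)]]
    by (simp add: mass_pot_def)
  show "AE s in I. AE t in I. mass_balance T h m (h s) s t \<rho>"
    using AE_good0 by (rule eventually_mono) (use AE_good0 1 in \<open>auto elim: eventually_mono\<close>)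
  show "AE t in I. mass_balance T h m h0 0 t \<rho>"
    using AE_good0 by (rule eventually_mono) (rule good0_mass[OF _ \<rho>])
qed

end

theorem energy_variational_imp_dissipative:
  fixes h0 :: "real ^ 'd \<Rightarrow> real" and m0 :: "real ^ 'd \<Rightarrow> real ^ 'd"
  assumes T: "0 < T" and a: "0 < a" and \<gamma>: "1 < \<gamma>"
    and h0: "integrable torus h0" and m0: "integrable torus m0"
    and h: "Linf_Lp T \<gamma> h" and m: "Linf_Lp T (2 * \<gamma> / (1 + \<gamma>)) m" and BV: "BV T E"
    and V: "energy_variational_solution a \<gamma> (\<gamma> - 1) T h0 m0 h m E"
    and iv: "ereal (initial_value T E) = energy a \<gamma> h0 m0"
  shows "dissipative_weak_solution a \<gamma> (min (1/2) (1 / (real CARD('d) * (\<gamma> - 1)))) T h0 m0 h m E"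
proof -
  let ?I = "lebesgue_on {0<..<T}"
  obtain C where C: "AE t in ?I. \<bar>E t\<bar> \<le> C" using BV_bounded[OF T BV] by blast
  have ev: "AE s in ?I. AE t in lebesgue_on {s<..<T}. \<forall>\<rho> \<phi>. C1_torus T \<rho> \<and> C1_torus T \<phi> \<longrightarrow>
          ev_lhs a \<gamma> (\<gamma> - 1) T h m E (E s) (h s) (m s) s t \<rho> \<phi> \<le> 0"
    and ev0: "AE t in ?I. \<forall>\<rho> \<phi>. C1_torus T \<rho> \<and> C1_torus T \<phi> \<longrightarrow>
          ev_lhs a \<gamma> (\<gamma> - 1) T h m E (initial_value T E) h0 m0 0 t \<rho> \<phi> \<le> 0"
    and le: "AE t in ?I. energy a \<gamma> (h t) (m t) \<le> ereal (E t)"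
    using V unfolding energy_variational_solution_def by blast+
  \<comment> \<open>Testing with zero reduces the variational inequality to
    \<open>E t \<le> E s\<close>.\<close>
  have "AE s in ?I. AE t in lebesgue_on {s<..<T}. E t \<le> E s"
    using ev AE_space[of ?I]
  proof eventually_elim
    case (elim s)
    then have s: "s \<in> {0<..<T}" by (simp add: space_restrict_space)
    show ?case
      using elim(1) AE_space[of "lebesgue_on {s<..<T}"]
    proof eventually_elim
      case (elim t)
      then have "s \<in> {0..T}" "t \<in> {0..T}" using s by (auto simp: space_restrict_space)
      from ev_lhs_0[OF T this] elim(1) C1_torus_0 show ?case by (metis diff_le_0_iff_le)
    qed
  qed
  \<comment> \<open>Monotonicity precedes the interpretation of the locale because it supplies the
    measurability of \<open>E\<close>.\<close>
  then have ni: "nonincreasing T E" by (rule AE_AE_nonincreasing[OF T C])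
  interpret ev_fields a \<gamma> T C h m E h0 m0 "initial_value T E"
    by unfold_locales (fact T a \<gamma> h m nonincreasing_measurable[OF ni] C le h0 m0 ev ev0)+
  have c: "min (1/2) (1 / (real CARD('d) * (\<gamma> - 1))) = 1 / kap"
    unfolding kap_def by (rule min_eq_inverse_max) (use \<gamma> in auto)
  obtain R where R: "Linf_weakstar_psd T R"
     "\<forall>\<phi>. C1_torus T \<phi> \<longrightarrow> (AE s in I. AE t in I. momentum_balance a \<gamma> T h m R (m s) s t \<phi>) \<and>
        (AE t in I. momentum_balance a \<gamma> T h m R m0 0 t \<phi>)"
     "AE t in I. energy a \<gamma> (h t) (m t) + ereal (1 / kap * trace (R t cell)) \<le> ereal (E t)"
    using ex_dissipative_measure by blast
  show ?thesis
    unfolding dissipative_weak_solution_def c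
    using h m BV R AE_mass_balance ni iv by (intro conjI exI[of _ R]) auto
qed

theorem theorem5p12:
  fixes a \<gamma> T :: real
    and h0 :: "real ^ 'd \<Rightarrow> real" and m0 :: "real ^ 'd \<Rightarrow> real ^ 'd"
    and h :: "real \<Rightarrow> real ^ 'd \<Rightarrow> real" and m :: "real \<Rightarrow> real ^ 'd \<Rightarrow> real ^ 'd"
    and E :: "real \<Rightarrow> real"
  assumes "0 < T" and "0 < a" and "1 < \<gamma>"
    and "integrable torus h0" and "integrable torus m0"
    and "energy a \<gamma> h0 m0 < \<infinity>"
    and "Linf_Lp T \<gamma> h" and "Linf_Lp T (2 * \<gamma> / (1 + \<gamma>)) m" and "BV T E"
  shows "energy_variational_solution a \<gamma> (\<gamma> - 1) T h0 m0 h m E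
           \<and> ereal (initial_value T E) = energy a \<gamma> h0 m0
         \<longleftrightarrow> dissipative_weak_solution a \<gamma> (min (1/2) (1 / (real CARD('d) * (\<gamma> - 1)))) T h0 m0 h m E"
  using energy_variational_imp_dissipative[of T a \<gamma> h0 m0 h m E]
    dissipative_imp_energy_variational[of T a \<gamma> h0 m0 h m E] assms by blast

end
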